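(* Let $\hat{\mathbf{A}}_1$ be the matrix with entries $\hat A_h((0,\phi_l^\Gamma),(0,\phi_m^\Gamma))$, $m,l\in I^\Gamma$. For $\mathbf{D}_1:=\mathrm{diag}(\hat{\mathbf{A}}_1)$ the uniform spectral equivalence $$\mathbf{D}_1\sim\hat{\mathbf{A}}_1$$ holds, i.e. $\mathbf{x}_1^T\mathbf{D}_1\mathbf{x}_1\sim\mathbf{x}_1^T\hat{\mathbf{A}}_1\mathbf{x}_1$ for all coefficient vectors $\mathbf{x}_1=(x_{1,j})_{j\in I^\Gamma}$.
   Context: Geometry and mesh. $d\in\{2,3\}$, $k\ge 1$; $\Omega\subset\mathbb{R}^d$ is a bounded connected polygonal domain with a non-overlapping partitioning into $\Omega_1,\Omega_2$, and $\Gamma=\overline{\Omega}_1\cap\overline{\Omega}_2$ is the (smooth) interface with unit normal $\mathbf{n}_\Gamma$ pointing from $\Omega_1$ into $\Omega_2$. $\{\mathcal{T}_h\}_{h>0}$ is a family of shape regular (not necessarily quasi-uniform) simplicial triangulations of $\Omega$, not fitted to $\Gamma$; $h_T$ is the diameter of $T\in\mathcal{T}_h$. $V_h$ is the space of continuous piecewise polynomials of degree $\le k$ on $\mathcal{T}_h$ vanishing on $\partial\Omega$. $\mathcal{T}_h^\Gamma$ is the set of simplices cut by $\Gamma$ and $\Omega_h^\Gamma$ is the domain they form; $\Omega_{i,h}^{\rm ex}$ is the domain formed by all simplices with nonzero intersection with $\Omega_i$. $V_{i,h}=\{(v_h)_{|\Omega_{i,h}^{\rm ex}}: v_h\in V_h\}$.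 Norms. $\|\cdot\|_\omega$ is the $L^2$ norm on $\omega$ and $(\cdot,\cdot)_\omega$ the $L^2$ scalar product. Scalings with $h$ are element-wise: $(h^{-1}u,v)_\Gamma=\sum_{T\in\mathcal{T}_h^\Gamma}h_T^{-1}(u,v)_{T\cap\Gamma}$, $\|h^{-1/2}v\|_\Gamma^2=(h^{-1}v,v)_\Gamma$. $A\sim B$ means $c_1B\le A\le c_2B$ with constants $c_1,c_2>0$ independent of $h$ and of the location of $\Gamma$ in the triangulation (they may depend on shape regularity, $d$, $k$, the smoothness of $\Gamma$, $\alpha_1,\alpha_2$, $\gamma$, $\beta$). Spaces. $\phi_j$, $j\in I_0$, are the nodal basis functions of $V_h$. $I^\Gamma\subset I_0$ are the labels of nodes in $\Omega_h^\Gamma$, $I_i^\Gamma=\{j\in I^\Gamma:\text{node } j\text{ is not in }\Omega_i\}$, $i=1,2$. It is assumed that no nodes lie on $\Gamma$; then $I^\Gamma=I_1^\Gamma\cup I_2^\Gamma$ is a disjoint partition. Cut basis functions: $\phi_j^\Gamma=\phi_j|_{\Omega_h^\Gamma}$, $j\in I^\Gamma$. $V_i^\Gamma=\mathrm{span}\{\phi_j^\Gamma: j\in I_i^\Gamma\}$ and $V_h^\Gamma=V_1^\Gamma\oplus V_2^\Gamma$; $Q_i:V_h^\Gamma\to V_i^\Gamma$, $Q_i\big(\sum_{j\in I^\Gamma}\beta_j\phi_j^\Gamma\big)=\sum_{j\in I_i^\Gamma}\beta_j\phi_j^\Gamma$. Functions in $V_i^\Gamma$ are extended by zero to $\Omega_{i,h}^{\rm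 ex}$. The isomorphism $L:V_h\times V_h^\Gamma\to V_{1,h}\times V_{2,h}$ is $L(u_0,u^\Gamma)=(u_{1,h},u_{2,h})$ with $u_{i,h}={u_0}_{|\Omega_{i,h}^{\rm ex}}+Q_iu^\Gamma$. Bilinear forms. $\alpha_1,\alpha_2>0$ are the diffusion coefficients, $\gamma,\beta>0$ fixed parameters, $[\![\cdot]\!]$ the jump across $\Gamma$ (resp. across a face), $[\![u_h]\!]=(u_{1,h}-u_{2,h})_{|\Gamma}$, $\{\!\!\{\cdot\}\!\!\}$ a weighted averaging operator across $\Gamma$, $\bar\alpha$ a corresponding average of $\alpha_1,\alpha_2$, and $\mathcal{F}_{g,i}$ a suitable subset of faces in $\Omega_h^\Gamma$ with face diameters $h_F$. For $u_h,v_h\in V_{1,h}\times V_{2,h}$: $$A_h(u_h,v_h)=\sum_{i=1}^2(\alpha_i\nabla u_{i,h},\nabla v_{i,h})_{\Omega_i}+N_h^c(u_h,v_h)+N_h^c(v_h,u_h)+\bar\alpha\gamma(h^{-1}[\![u_h]\!],[\![v_h]\!])_\Gamma+G_h(u_h,v_h),$$ $$N_h^c(u_h,v_h)=(\{\!\!\{-\alpha\nabla v_h\}\!\!\}\cdot\mathbf{n}_\Gamma,[\![u_h]\!])_\Gamma,\quad G_h(u_h,v_h)=\beta\sum_{i=1}^2\sum_{\ell=1}^k\sum_{F\in\mathcal{F}_{g,i}}h_F^{2\ell-1}([\![\partial_n^\ell u_{i,h}]\!],[\![\partial_n^\ell v_{i,h}]\!])_F .$$ Set $\hat A_h(\hat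 u_h,\hat v_h)=A_h(L\hat u_h,L\hat v_h)$ on $V_h\times V_h^\Gamma$. The averaging, $\gamma$, $\beta$ and $\mathcal{F}_{g,i}$ are such that the following norm equivalence, known from the CutFEM literature, holds: $\hat A_h(\hat u_h,\hat u_h)\sim\sum_{i=1}^2\|\nabla u_{i,h}\|_{\Omega_{i,h}^{\rm ex}}^2+\|h^{-1/2}(u_{1,h}-u_{2,h})\|_\Gamma^2$ for all $\hat u_h\in V_h\times V_h^\Gamma$. *)

theory Defs
  imports "HOL-Analysis.Analysis"
begin

section \<open>Hausdorff measure\<close>

text \<open>
  The surface measure on the interface and on mesh faces is the Hausdorff measure of dimension
  \<open>d - 1\<close>. The factor \<^const>\<open>unit_ball_vol\<close> normalises it so that it is the
  usual area on flat pieces. Only \<open>m \<ge> 1\<close> is used.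
\<close>

definition hausdorff_gauge :: "nat \<Rightarrow> real \<Rightarrow> 'a::metric_space set \<Rightarrow> ennreal" where
  "hausdorff_gauge m \<delta> A =
     (if bounded A \<and> diameter A \<le> \<delta> then ennreal (unit_ball_vol (real m) * (diameter A / 2) ^ m)
      else top)"

definition hausdorff_outer :: "nat \<Rightarrow> 'a::metric_space set \<Rightarrow> ennreal" where
  "hausdorff_outer m A = (SUP \<delta>\<in>{0<..}. outer_measure UNIV (hausdorff_gauge m \<delta>) A)"

definition hausdorff_measure :: "nat \<Rightarrow> 'a::metric_space measure" where
  "hausdorff_measure m = measure_of UNIV (sets borel) (hausdorff_outer m)"

text \<open>
  \<^const>\<open>measure_of\<close> is the null measure unless its argument is countably additive on the given
  sets, so the definition needs Caratheodory's criterion for metric outer measures.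
\<close>

lemma hausdorff_gauge_mono:
  assumes "A \<subseteq> B" shows "hausdorff_gauge m \<delta> A \<le> hausdorff_gauge m \<delta> B"
proof (cases "bounded B \<and> diameter B \<le> \<delta>")
  case True
  then have "diameter A \<le> diameter B" "bounded A"
    using assms diameter_subset bounded_subset by blast+
  moreover have "0 \<le> diameter A" using \<open>bounded A\<close> by (rule diameter_ge_0)
  ultimately show ?thesis
    using True by (auto simp: hausdorff_gauge_def intro!: ennreal_leI mult_left_mono power_mono)
qed (auto simp: hausdorff_gauge_def)

lemma hausdorff_gauge_empty: "m \<ge> 1 \<Longrightarrow> \<delta> > 0 \<Longrightarrow> hausdorff_gauge m \<delta> {} = 0"
  by (simp add: hausdorff_gauge_def)

lemma outer_measure_space_hausdorff_pre:
  fixes \<delta> :: real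
  assumes "m \<ge> 1" "\<delta> > 0"
  shows "outer_measure_space UNIV
           (outer_measure UNIV (hausdorff_gauge m \<delta>) :: 'a::metric_space set \<Rightarrow> ennreal)"
proof -
  interpret sigma_algebra "UNIV :: 'a set" UNIV
    using sigma_algebra_Pow[of "UNIV :: 'a set"] by simp
  have "outer_measure_space (Pow (UNIV :: 'a set)) (outer_measure UNIV (hausdorff_gauge m \<delta>))"
    using assms by (intro outer_measure_space_outer_measure)
      (auto simp: positive_def increasing_def hausdorff_gauge_empty hausdorff_gauge_mono)
  then show ?thesis by simp
qed

lemma outer_measure_space_hausdorff:
  assumes "m \<ge> 1"
  shows "outer_measure_space UNIV (hausdorff_outer m :: 'a::metric_space set \<Rightarrow> ennreal)"
proof -
  let ?O = "\<lambda>\<delta>. outer_measure UNIV (hausdorff_gauge m \<delta>) :: 'a set \<Rightarrow> ennreal"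
  have O: "?O \<delta> {} = 0" "A \<subseteq> B \<Longrightarrow> ?O \<delta> A \<le> ?O \<delta> B"
    "?O \<delta> (\<Union>i. C i) \<le> (\<Sum>i. ?O \<delta> (C i))" if "\<delta> > 0" for \<delta> A B and C :: "nat \<Rightarrow> 'a set"
  proof -
    note oms = outer_measure_space_hausdorff_pre[OF assms that, where 'a='a]
    show "?O \<delta> {} = 0" "A \<subseteq> B \<Longrightarrow> ?O \<delta> A \<le> ?O \<delta> B"
      using oms by (auto simp: outer_measure_space_def positive_def increasing_def)
    interpret ring_of_sets "UNIV :: 'a set" UNIV
      using sigma_algebra_Pow[of "UNIV :: 'a set"] by (simp add: sigma_algebra_def algebra_def)
    show "?O \<delta> (\<Union>i. C i) \<le> (\<Sum>i. ?O \<delta> (C i))"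
    proof -
      have sub: "subadditive UNIV (?O \<delta>)"
        using countably_subadditive_subadditive oms unfolding outer_measure_space_def by blast
      have "(\<Union>i. C i) = (\<Union>i. disjointed C i)" by (simp add: UN_disjointed_eq)
      then have "?O \<delta> (\<Union>i. C i) = ?O \<delta> (\<Union>i. disjointed C i)" by simp
      also have "\<dots> \<le> (\<Sum>i. ?O \<delta> (disjointed C i))"
        using oms disjoint_family_disjointed[of C]
        by (auto simp: outer_measure_space_def countably_subadditive_def)
      also have "\<dots> \<le> (\<Sum>i. ?O \<delta> (C i))"
        using oms disjointed_subset[of C]
        by (intro suminf_le) (auto simp: outer_measure_space_def increasing_def)
      finally show ?thesis .
    qed
  qed
  have "hausdorff_outer m ({} :: 'a set) = 0"
    unfolding hausdorff_outer_def using O(1) by (auto intro!: antisym SUP_least)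
  moreover have "hausdorff_outer m A \<le> hausdorff_outer m B" if "A \<subseteq> B" for A B :: "'a set"
    unfolding hausdorff_outer_def using O(2) that by (intro SUP_mono) auto
  moreover have "hausdorff_outer m (\<Union>i. C i) \<le> (\<Sum>i. hausdorff_outer m (C i))"
    for C :: "nat \<Rightarrow> 'a set"
  proof (subst (1) hausdorff_outer_def, rule SUP_least)
    fix \<delta> :: real assume "\<delta> \<in> {0<..}"
    then have "?O \<delta> (\<Union>i. C i) \<le> (\<Sum>i. ?O \<delta> (C i))" by (intro O(3)) auto
    also have "\<dots> \<le> (\<Sum>i. hausdorff_outer m (C i))"
      unfolding hausdorff_outer_def using \<open>\<delta> \<in> _\<close> by (intro suminf_le SUP_upper) auto
    finally show "?O \<delta> (\<Union>i. C i) \<le> (\<Sum>i. hausdorff_outer m (C i))" .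
  qed
  ultimately show ?thesis
    by (auto simp: outer_measure_space_def positive_def increasing_def countably_subadditive_def)
qed

lemma hausdorff_outer_mono:
  "m \<ge> 1 \<Longrightarrow> A \<subseteq> B \<Longrightarrow> hausdorff_outer m A \<le> hausdorff_outer m (B :: 'a::metric_space set)"
  using outer_measure_space_hausdorff[of m, where 'a='a]
  by (auto simp: outer_measure_space_def increasing_def)

lemma hausdorff_pre_metric:
  fixes A B :: "'a::metric_space set"
  assumes "m \<ge> 1" "\<delta> > 0" "\<And>x y. x \<in> A \<Longrightarrow> y \<in> B \<Longrightarrow> dist x y > \<delta>"
  shows "outer_measure UNIV (hausdorff_gauge m \<delta>) A + outer_measure UNIV (hausdorff_gauge m \<delta>) B
         \<le> outer_measure UNIV (hausdorff_gauge m \<delta>) (A \<union> B)"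
proof -
  let ?g = "hausdorff_gauge m \<delta> :: 'a set \<Rightarrow> ennreal"
  interpret ring_of_sets "UNIV :: 'a set" UNIV
    using sigma_algebra_Pow[of "UNIV :: 'a set"] by (simp add: sigma_algebra_def algebra_def)
  have pos: "positive UNIV ?g" and inc: "increasing UNIV ?g"
    using assms by (auto simp: positive_def increasing_def hausdorff_gauge_empty hausdorff_gauge_mono)
  have split: "?g (C \<inter> A) + ?g (C \<inter> B) \<le> ?g C" for C
  proof (cases "bounded C \<and> diameter C \<le> \<delta>")
    case True
    have "C \<inter> A = {} \<or> C \<inter> B = {}"
    proof (rule ccontr)
      assume "\<not> ?thesis"
      then obtain x y where "x \<in> C" "x \<in> A" "y \<in> C" "y \<in> B" by blast
      then have "dist x y \<le> \<delta>" "dist x y > \<delta>"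
        using True diameter_bounded_bound[of C x y] assms(3) by auto
      then show False by simp
    qed
    then show ?thesis
      using hausdorff_gauge_empty[OF assms(1,2), where 'a='a] hausdorff_gauge_mono[of "C \<inter> A" C m \<delta>]
        hausdorff_gauge_mono[of "C \<inter> B" C m \<delta>] by auto
  qed (auto simp: hausdorff_gauge_def)
  show ?thesis
    unfolding outer_measure_def[of _ _ "A \<union> B"]
  proof (rule INF_greatest)
    fix C :: "nat \<Rightarrow> 'a set"
    assume "C \<in> {C. range C \<subseteq> UNIV \<and> disjoint_family C \<and> A \<union> B \<subseteq> \<Union> (range C)}"
    then have C: "A \<union> B \<subseteq> (\<Union>i. C i)" by simp
    have "outer_measure UNIV ?g A \<le> (\<Sum>i. ?g (C i \<inter> A))"
      using C by (intro outer_measure_le pos inc) auto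
    moreover have "outer_measure UNIV ?g B \<le> (\<Sum>i. ?g (C i \<inter> B))"
      using C by (intro outer_measure_le pos inc) auto
    ultimately have "outer_measure UNIV ?g A + outer_measure UNIV ?g B
        \<le> (\<Sum>i. ?g (C i \<inter> A)) + (\<Sum>i. ?g (C i \<inter> B))" by (rule add_mono)
    also have "\<dots> = (\<Sum>i. ?g (C i \<inter> A) + ?g (C i \<inter> B))" by (intro suminf_add) auto
    also have "\<dots> \<le> (\<Sum>i. ?g (C i))" by (intro suminf_le split) auto
    finally show "outer_measure UNIV ?g A + outer_measure UNIV ?g B \<le> (\<Sum>i. ?g (C i))" .
  qed
qed

lemma hausdorff_outer_metric:
  fixes A B :: "'a::metric_space set"
  assumes m: "m \<ge> 1" and r: "r > 0" and d: "\<And>x y. x \<in> A \<Longrightarrow> y \<in> B \<Longrightarrow> dist x y \<ge> r"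
  shows "hausdorff_outer m A + hausdorff_outer m B \<le> hausdorff_outer m (A \<union> B)"
proof -
  let ?O = "\<lambda>\<delta>. outer_measure UNIV (hausdorff_gauge m \<delta>) :: 'a set \<Rightarrow> ennreal"
  have anti: "?O \<delta> X \<le> ?O \<delta>' X" if "\<delta>' \<le> \<delta>" for \<delta> \<delta>' X
    unfolding outer_measure_def
    by (intro INF_mono bexI suminf_le) (use that in \<open>auto simp: hausdorff_gauge_def\<close>)
  have *: "?O a A + ?O b B \<le> hausdorff_outer m (A \<union> B)" if "a > 0" "b > 0" for a b
  proof -
    define \<delta> where "\<delta> = min (min a b) (r / 2)"
    have "\<delta> > 0" using that r by (auto simp: \<delta>_def)
    have "\<delta> < r" using r by (auto simp: \<delta>_def)
    have "?O a A + ?O b B \<le> ?O \<delta> A + ?O \<delta> B" by (intro add_mono anti) (auto simp: \<delta>_def)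
    also have "\<dots> \<le> ?O \<delta> (A \<union> B)"
      using d \<open>\<delta> > 0\<close> \<open>\<delta> < r\<close> m by (intro hausdorff_pre_metric) (auto intro: less_le_trans)
    also have "\<dots> \<le> hausdorff_outer m (A \<union> B)"
      unfolding hausdorff_outer_def using \<open>\<delta> > 0\<close> by (intro SUP_upper) auto
    finally show ?thesis .
  qed
  have ne: "{0<..} \<noteq> ({} :: real set)" by simp
  have "hausdorff_outer m A + hausdorff_outer m B = (SUP a\<in>{0<..}. SUP b\<in>{0<..}. ?O a A + ?O b B)"
    unfolding hausdorff_outer_def
    by (simp only: ennreal_SUP_add_left[OF ne, symmetric] ennreal_SUP_add_right[OF ne, symmetric])
  also have "\<dots> \<le> hausdorff_outer m (A \<union> B)"
    using * by (intro SUP_least) auto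
  finally show ?thesis .
qed

lemma closed_lambda_system_hausdorff:
  fixes C :: "'a::metric_space set"
  assumes m: "m \<ge> 1" and C: "closed C"
  shows "C \<in> lambda_system UNIV UNIV (hausdorff_outer m)"
proof -
  let ?H = "hausdorff_outer m :: 'a set \<Rightarrow> ennreal"
  have oms: "outer_measure_space UNIV ?H" by (rule outer_measure_space_hausdorff[OF m])
  interpret ring_of_sets "UNIV :: 'a set" UNIV
    using sigma_algebra_Pow[of "UNIV :: 'a set"] by (simp add: sigma_algebra_def algebra_def)
  have H0: "?H {} = 0" using oms by (simp add: outer_measure_space_def positive_def)
  have mono: "X \<subseteq> Y \<Longrightarrow> ?H X \<le> ?H Y" for X Y using hausdorff_outer_mono[OF m] .
  have sub: "?H (X \<union> Y) \<le> ?H X + ?H Y" if "X \<inter> Y = {}" for X Y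
    using countably_subadditive_subadditive[of ?H] oms that
    by (auto simp: outer_measure_space_def subadditive_def)
  have le: "?H (A \<inter> C) + ?H (A - C) \<le> ?H A" for A
  proof (cases "C = {} \<or> ?H A = top")
    case True then show ?thesis by (auto simp: H0)
  next
    case False
    then have "C \<noteq> {}" and fin: "?H A < top" by (auto simp: less_top)
    define q where "q n = 1 / real (Suc n)" for n
    have q_pos: "q n > 0" and q_dec: "q (Suc n) < q n" for n
      by (auto simp: q_def field_simps)
    define D where "D n = {x \<in> A. infdist x C \<ge> q n}" for n
    define R where "R n = {x \<in> A. q (Suc n) \<le> infdist x C \<and> infdist x C < q n}" for n
    have gap: "infdist x C - infdist y C \<le> dist x y" for x y
      using infdist_triangle[of x C y] by simp
    have step1: "?H (A \<inter> C) + ?H (D n) \<le> ?H A" for n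
    proof -
      have "?H (A \<inter> C) + ?H (D n) \<le> ?H ((A \<inter> C) \<union> D n)"
      proof (rule hausdorff_outer_metric[OF m q_pos[of n]])
        fix x y assume "x \<in> A \<inter> C" "y \<in> D n"
        then show "dist x y \<ge> q n"
          using gap[of y x] infdist_zero[of x C] by (auto simp: D_def dist_commute)
      qed
      also have "\<dots> \<le> ?H A" by (intro mono) (auto simp: D_def)
      finally show ?thesis .
    qed
    have sums: "(\<Sum>j<k. ?H (R (2 * j + e))) \<le> ?H (\<Union>j<k. R (2 * j + e))" for k e
    proof (induction k)
      case (Suc k)
      have "(\<Sum>j<Suc k. ?H (R (2 * j + e))) \<le> ?H (\<Union>j<k. R (2 * j + e)) + ?H (R (2 * k + e))"
        using Suc by (auto intro: add_right_mono)
      also have "\<dots> \<le> ?H ((\<Union>j<k. R (2 * j + e)) \<union> R (2 * k + e))"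
      proof (cases k)
        case 0 then show ?thesis by (simp add: H0)
      next
        case (Suc k')
        have qmono: "a \<le> b \<Longrightarrow> q b \<le> q a" for a b by (auto simp: q_def field_simps)
        show ?thesis
        proof (rule hausdorff_outer_metric[OF m, of "q (2*k+e-1) - q (2*k+e)"])
          show "q (2*k+e-1) - q (2*k+e) > 0"
            using q_dec[of "2*k+e-1"] Suc by simp
          fix x y assume "x \<in> (\<Union>j<k. R (2 * j + e))" "y \<in> R (2 * k + e)"
          then obtain j where j: "j < k" "x \<in> R (2*j+e)" by auto
          have "q (2*k+e-1) \<le> infdist x C"
          proof -
            have "Suc (2*j+e) \<le> 2*k+e-1" using j by linarith
            then have "q (2*k+e-1) \<le> q (Suc (2*j+e))" by (rule qmono)
            then show ?thesis using j by (auto simp: R_def)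
          qed
          moreover have "infdist y C < q (2*k+e)" using \<open>y \<in> _\<close> by (auto simp: R_def)
          ultimately show "q (2*k+e-1) - q (2*k+e) \<le> dist x y" using gap[of x y] by linarith
        qed
      qed
      also have "\<dots> = ?H (\<Union>j<Suc k. R (2 * j + e))" by (simp add: lessThan_Suc Un_commute)
      finally show ?case .
    qed (simp add: H0)
    have evod: "(\<Sum>n<2*k. h n) = (\<Sum>j<k. h (2*j+0)) + (\<Sum>j<k. h (2*j+1))"
      for k and h :: "nat \<Rightarrow> ennreal" by (induction k) (auto simp: algebra_simps)
    have "(\<Sum>n<k. ?H (R n)) \<le> 2 * ?H A" for k
    proof -
      have "(\<Sum>n<k. ?H (R n)) \<le> (\<Sum>n<2*k. ?H (R n))" by (intro sum_mono2) auto
      also have "\<dots> \<le> ?H A + ?H A"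
        unfolding evod
        by (intro add_mono order_trans[OF sums] mono) (auto simp: R_def)
      finally show ?thesis by (simp add: mult_2)
    qed
    then have "(\<Sum>n. ?H (R n)) \<le> 2 * ?H A"
      by (intro suminf_le_const) auto
    then have finsum: "(\<Sum>n. ?H (R n)) < top"
      using fin by (metis ennreal_mult_less_top ennreal_numeral ennreal_less_top order_le_less_trans)
    have tail: "(\<lambda>N. \<Sum>n. ?H (R (n + N))) \<longlonglongrightarrow> 0"
    proof -
      define f where "f n = enn2real (?H (R n))" for n
      have fR: "?H (R n) = ennreal (f n)" for n
      proof -
        have "?H (R n) \<le> ?H A" by (intro mono) (auto simp: R_def)
        then show ?thesis unfolding f_def using fin by (simp add: order_le_less_trans)
      qed
      have f0: "f n \<ge> 0" for n by (simp add: f_def)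
      have "summable f"
        using finsum unfolding fR by (intro summable_suminf_not_top) (auto simp: f0)
      then have "(\<Sum>n. ?H (R (n + N))) = ennreal (\<Sum>n. f (n + N))" for N
        unfolding fR by (intro suminf_ennreal2) (auto simp: f0 summable_iff_shift)
      moreover have "(\<lambda>N. \<Sum>n. f (n + N)) \<longlonglongrightarrow> 0"
        using suminf_exist_split2[OF \<open>summable f\<close>] .
      ultimately show ?thesis using tendsto_ennrealI by fastforce
    qed
    have bound: "?H (A \<inter> C) + ?H (A - C) \<le> ?H A + (\<Sum>n. ?H (R (n + N)))" for N
    proof -
      have sub2: "A - C \<subseteq> D N \<union> (\<Union>n. R (n + N))"
      proof
        fix x assume x: "x \<in> A - C"
        then have pos: "infdist x C > 0"
          using C \<open>C \<noteq> {}\<close> by (simp add: infdist_pos_not_in_closed)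
        show "x \<in> D N \<union> (\<Union>n. R (n + N))"
        proof (cases "infdist x C \<ge> q N")
          case True then show ?thesis using x by (auto simp: D_def)
        next
          case False
          obtain k where "q k < infdist x C"
            using pos nat_approx_posE[of "infdist x C"] unfolding q_def by blast
          define p where "p = (LEAST k. q k \<le> infdist x C)"
          have p: "q p \<le> infdist x C"
            unfolding p_def by (rule LeastI[of _ k]) (use \<open>q k < _\<close> in simp)
          have np: "infdist x C < q j" if "j < p" for j
            using not_less_Least[of j "\<lambda>k. q k \<le> infdist x C"] that unfolding p_def by simp
          have "p > N"
          proof (rule ccontr)
            assume "\<not> p > N"
            then have "q N \<le> q p" by (auto simp: q_def field_simps)
            then show False using p False by simp
          qed
          then obtain j where "p = Suc (j + N)"
            by (metis add.commute less_imp_Suc_add)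
          then have "x \<in> R (j + N)" using x p np[of "j + N"] by (auto simp: R_def)
          then show ?thesis by blast
        qed
      qed
      have disjR: "disjoint_family (\<lambda>n. R (n + N))"
      proof -
        have qmono: "a \<le> b \<Longrightarrow> q b \<le> q a" for a b by (auto simp: q_def field_simps)
        have "R a \<inter> R b = {}" if "a < b" for a b
          using qmono[of "Suc a" b] that by (force simp: R_def)
        then show ?thesis
          unfolding disjoint_family_on_def by (metis Int_commute add_right_cancel linorder_neqE_nat)
      qed
      have "?H (A - C) \<le> ?H (D N \<union> (\<Union>n. R (n + N)))" by (rule mono[OF sub2])
      also have "\<dots> \<le> ?H (D N) + ?H (\<Union>n. R (n + N))"
      proof (rule sub)
        have "q (n + N) \<le> q N" for n by (auto simp: q_def field_simps)
        then show "D N \<inter> (\<Union>n. R (n + N)) = {}"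
          by (fastforce simp: D_def R_def dest: order_le_less_trans)
      qed
      also have "\<dots> \<le> ?H (D N) + (\<Sum>n. ?H (R (n + N)))"
        using oms disjR
        by (intro add_left_mono) (auto simp: outer_measure_space_def countably_subadditive_def)
      finally have "?H (A \<inter> C) + ?H (A - C) \<le> ?H (A \<inter> C) + (?H (D N) + (\<Sum>n. ?H (R (n + N))))"
        by (rule add_left_mono)
      also have "\<dots> \<le> ?H A + (\<Sum>n. ?H (R (n + N)))"
        using step1[of N] by (simp add: add.assoc[symmetric] add_right_mono)
      finally show ?thesis .
    qed
    have "(\<lambda>N. ?H A + (\<Sum>n. ?H (R (n + N)))) \<longlonglongrightarrow> ?H A + 0"
      by (intro tendsto_add tendsto_const tail)
    then show ?thesis
      using bound by (intro LIMSEQ_le_const[where X="\<lambda>N. ?H A + (\<Sum>n. ?H (R (n + N)))"]) auto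
  qed
  have "?H (C \<inter> A) + ?H ((UNIV - C) \<inter> A) = ?H A" for A
  proof -
    have "C \<inter> A = A \<inter> C" "(UNIV - C) \<inter> A = A - C" by auto
    moreover have "?H A \<le> ?H (A \<inter> C) + ?H (A - C)"
      using sub[of "A \<inter> C" "A - C"] by (simp add: Int_Diff_disjoint Int_Diff_Un)
    ultimately show ?thesis using le[of A] by simp
  qed
  then show ?thesis by (auto simp: lambda_system_def)
qed

theorem measure_space_hausdorff:
  assumes "m \<ge> 1"
  shows "measure_space UNIV (sets borel) (hausdorff_outer m :: 'a::metric_space set \<Rightarrow> ennreal)"
proof -
  interpret U: sigma_algebra "UNIV :: 'a set" UNIV
    using sigma_algebra_Pow[of "UNIV :: 'a set"] by simp
  let ?L = "lambda_system UNIV UNIV (hausdorff_outer m :: 'a set \<Rightarrow> ennreal)"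
  have L: "measure_space UNIV ?L (hausdorff_outer m)"
    by (rule U.caratheodory_lemma[OF outer_measure_space_hausdorff[OF assms]])
  then interpret sigma_algebra UNIV ?L by (simp add: measure_space_def)
  have "sets (borel :: 'a measure) = sigma_sets UNIV (Collect closed)"
    by (simp add: borel_eq_closed)
  also have "\<dots> \<subseteq> ?L"
    using closed_lambda_system_hausdorff[OF assms] by (intro sigma_sets_subset) auto
  finally show ?thesis
    using measure_down[OF L] sets.sigma_algebra_axioms[of borel] by (metis space_borel)
qed

corollary emeasure_hausdorff_measure:
  assumes "m \<ge> 1" "A \<in> sets borel"
  shows "emeasure (hausdorff_measure m) A = hausdorff_outer m (A :: 'a::metric_space set)"
  unfolding hausdorff_measure_def
  using measure_space_hausdorff[OF assms(1), where 'a='a] assms(2)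
  by (intro emeasure_measure_of_sigma) (auto simp: measure_space_def)

abbreviation surface_measure :: "'a::euclidean_space measure" where
  "surface_measure \<equiv> hausdorff_measure (DIM('a) - 1)"


section \<open>Polynomials and derivatives\<close>

definition multi_indices :: "nat \<Rightarrow> ('a::euclidean_space \<Rightarrow> nat) set" where
  "multi_indices k = {e. (\<forall>b. b \<notin> Basis \<longrightarrow> e b = 0) \<and> (\<Sum>b\<in>Basis. e b) \<le> k}"

definition polys :: "nat \<Rightarrow> ('a::euclidean_space \<Rightarrow> real) set" where
  "polys k = {p. \<exists>c. p = (\<lambda>x. \<Sum>e\<in>multi_indices k. c e * (\<Prod>b\<in>Basis. (x \<bullet> b) ^ e b))}"

definition grad :: "('a::euclidean_space \<Rightarrow> real) \<Rightarrow> 'a \<Rightarrow> 'a" where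
  "grad f x = (\<Sum>b\<in>Basis. frechet_derivative f (at x) b *\<^sub>R b)"

primrec Ck_on :: "nat \<Rightarrow> 'a::euclidean_space set \<Rightarrow> ('a \<Rightarrow> real) \<Rightarrow> bool" where
  "Ck_on 0 U f \<longleftrightarrow> continuous_on U f"
| "Ck_on (Suc m) U f \<longleftrightarrow> (\<forall>x\<in>U. f differentiable at x) \<and>
     (\<forall>b\<in>Basis. Ck_on m U (\<lambda>x. frechet_derivative f (at x) b))"

definition smooth_on :: "'a::euclidean_space set \<Rightarrow> ('a \<Rightarrow> real) \<Rightarrow> bool" where
  "smooth_on U f \<longleftrightarrow> (\<forall>m. Ck_on m U f)"


section \<open>Domain, interface and mesh\<close>

text \<open>
  The subdomains are \<open>Om 1\<close> and \<open>Om 2\<close>; other arguments of \<open>Om\<close> (and of every other family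
  indexed by the subdomain number) are never used.
\<close>

definition simplicial_mesh :: "'a::euclidean_space set \<Rightarrow> 'a set set \<Rightarrow> bool" where
  "simplicial_mesh \<Omega> \<T> \<longleftrightarrow>
     triangulation \<T> \<and> (\<forall>T\<in>\<T>. int DIM('a) simplex T) \<and> \<Union>\<T> = closure \<Omega>"

definition polygonal_domain :: "'a::euclidean_space set \<Rightarrow> bool" where
  "polygonal_domain \<Omega> \<longleftrightarrow>
     open \<Omega> \<and> bounded \<Omega> \<and> connected \<Omega> \<and> \<Omega> \<noteq> {} \<and> interior (closure \<Omega>) = \<Omega> \<and>
     (\<exists>\<T>. simplicial_mesh \<Omega> \<T>)"

definition iface :: "(nat \<Rightarrow> 'a::euclidean_space set) \<Rightarrow> 'a set" where
  "iface Om = closure (Om 1) \<inter> closure (Om 2)"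

definition partitioned :: "'a::euclidean_space set \<Rightarrow> (nat \<Rightarrow> 'a set) \<Rightarrow> bool" where
  "partitioned \<Omega> Om \<longleftrightarrow>
     (\<forall>i\<in>{1, 2}. open (Om i) \<and> Om i \<noteq> {}) \<and> Om 1 \<inter> Om 2 = {} \<and> Om 1 \<union> Om 2 = \<Omega> - iface Om"

text \<open>
  The interface is locally the zero set of a smooth function with non-vanishing gradient that is
  negative on \<open>Om 1\<close> and positive on \<open>Om 2\<close>; \<open>n\<close> is the unit normal from \<open>Om 1\<close> into \<open>Om 2\<close>.
  The interface may be closed or may meet the boundary of the domain.
\<close>

definition smooth_iface ::
  "'a::euclidean_space set \<Rightarrow> (nat \<Rightarrow> 'a set) \<Rightarrow> ('a \<Rightarrow> 'a) \<Rightarrow> bool" where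
  "smooth_iface \<Omega> Om n \<longleftrightarrow>
     (\<forall>x\<in>iface Om. \<exists>U \<psi>. open U \<and> x \<in> U \<and> smooth_on U \<psi> \<and> (\<forall>y\<in>U. grad \<psi> y \<noteq> 0) \<and>
        Om 1 \<inter> U = {y \<in> \<Omega> \<inter> U. \<psi> y < 0} \<and> Om 2 \<inter> U = {y \<in> \<Omega> \<inter> U. \<psi> y > 0} \<and>
        (\<forall>y\<in>iface Om \<inter> U. n y = grad \<psi> y /\<^sub>R norm (grad \<psi> y)))"

definition inball_diameter :: "'a::euclidean_space set \<Rightarrow> real" where
  "inball_diameter T = Sup {2 * r | r. 0 \<le> r \<and> (\<exists>x. cball x r \<subseteq> T)}"

definition shape_regular :: "real \<Rightarrow> 'a::euclidean_space set set \<Rightarrow> bool" where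
  "shape_regular \<sigma> \<T> \<longleftrightarrow> (\<forall>T\<in>\<T>. diameter T \<le> \<sigma> * inball_diameter T)"

text \<open>
  A simplex is cut if the interface meets its interior, equivalently if it contains points of both
  subdomains.
\<close>

definition cut_simplices :: "(nat \<Rightarrow> 'a::euclidean_space set) \<Rightarrow> 'a set set \<Rightarrow> 'a set set" where
  "cut_simplices Om \<T> = {T \<in> \<T>. interior T \<inter> iface Om \<noteq> {}}"

definition cut_region :: "(nat \<Rightarrow> 'a::euclidean_space set) \<Rightarrow> 'a set set \<Rightarrow> 'a set" where
  "cut_region Om \<T> = \<Union>(cut_simplices Om \<T>)"

definition ex_simplices :: "(nat \<Rightarrow> 'a::euclidean_space set) \<Rightarrow> 'a set set \<Rightarrow> nat \<Rightarrow> 'a set set" where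
  "ex_simplices Om \<T> i = {T \<in> \<T>. T \<inter> Om i \<noteq> {}}"

definition ex_region :: "(nat \<Rightarrow> 'a::euclidean_space set) \<Rightarrow> 'a set set \<Rightarrow> nat \<Rightarrow> 'a set" where
  "ex_region Om \<T> i = \<Union>(ex_simplices Om \<T> i)"


section \<open>Finite element spaces\<close>

text \<open>
  A function on a subset of the space is represented by its extension by zero to the whole space.
\<close>

definition restr :: "'a set \<Rightarrow> ('a \<Rightarrow> real) \<Rightarrow> 'a \<Rightarrow> real" where
  "restr S f = (\<lambda>x. if x \<in> S then f x else 0)"

definition fe_space :: "'a::euclidean_space set \<Rightarrow> nat \<Rightarrow> 'a set set \<Rightarrow> ('a \<Rightarrow> real) set" where
  "fe_space \<Omega> k \<T> =
     {v. continuous_on (closure \<Omega>) v \<and> (\<forall>T\<in>\<T>. \<exists>p\<in>polys k. \<forall>x\<in>T. v x = p x) \<and>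
         (\<forall>x\<in>frontier \<Omega>. v x = 0) \<and> (\<forall>x. x \<notin> closure \<Omega> \<longrightarrow> v x = 0)}"

text \<open>Principal lattice of order \<open>k\<close> of a simplex.\<close>

definition lagrange_points :: "nat \<Rightarrow> 'a::euclidean_space set \<Rightarrow> 'a set" where
  "lagrange_points k T =
     {(\<Sum>v\<in>{v. v extreme_point_of T}. (real (m v) / real k) *\<^sub>R v) | m.
        (\<Sum>v\<in>{v. v extreme_point_of T}. m v) = k}"

text \<open>
  Nodes serve as their own labels. Nodes on the boundary of the domain carry no basis function.
\<close>

definition nodes :: "'a::euclidean_space set \<Rightarrow> nat \<Rightarrow> 'a set set \<Rightarrow> 'a set" where
  "nodes \<Omega> k \<T> = (\<Union>T\<in>\<T>. lagrange_points k T) \<inter> \<Omega>"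

definition nodal_basis :: "'a::euclidean_space set \<Rightarrow> nat \<Rightarrow> 'a set set \<Rightarrow> 'a \<Rightarrow> 'a \<Rightarrow> real" where
  "nodal_basis \<Omega> k \<T> j =
     (THE v. v \<in> fe_space \<Omega> k \<T> \<and> (\<forall>l\<in>nodes \<Omega> k \<T>. v l = (if l = j then 1 else 0)))"

definition cut_nodes ::
  "'a::euclidean_space set \<Rightarrow> (nat \<Rightarrow> 'a set) \<Rightarrow> nat \<Rightarrow> 'a set set \<Rightarrow> 'a set" where
  "cut_nodes \<Omega> Om k \<T> = nodes \<Omega> k \<T> \<inter> cut_region Om \<T>"

definition cut_nodes_of ::
  "'a::euclidean_space set \<Rightarrow> (nat \<Rightarrow> 'a set) \<Rightarrow> nat \<Rightarrow> 'a set set \<Rightarrow> nat \<Rightarrow> 'a set" where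
  "cut_nodes_of \<Omega> Om k \<T> i = {j \<in> cut_nodes \<Omega> Om k \<T>. j \<notin> Om i}"

definition cut_basis ::
  "'a::euclidean_space set \<Rightarrow> (nat \<Rightarrow> 'a set) \<Rightarrow> nat \<Rightarrow> 'a set set \<Rightarrow> 'a \<Rightarrow> 'a \<Rightarrow> real" where
  "cut_basis \<Omega> Om k \<T> j = restr (cut_region Om \<T>) (nodal_basis \<Omega> k \<T> j)"

definition cut_space_of ::
  "'a::euclidean_space set \<Rightarrow> (nat \<Rightarrow> 'a set) \<Rightarrow> nat \<Rightarrow> 'a set set \<Rightarrow> nat \<Rightarrow> ('a \<Rightarrow> real) set" where
  "cut_space_of \<Omega> Om k \<T> i =
     {v. \<exists>c. v = (\<lambda>x. \<Sum>j\<in>cut_nodes_of \<Omega> Om k \<T> i. c j * cut_basis \<Omega> Om k \<T> j x)}"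

definition cut_space ::
  "'a::euclidean_space set \<Rightarrow> (nat \<Rightarrow> 'a set) \<Rightarrow> nat \<Rightarrow> 'a set set \<Rightarrow> ('a \<Rightarrow> real) set" where
  "cut_space \<Omega> Om k \<T> =
     {(\<lambda>x. v x + w x) | v w. v \<in> cut_space_of \<Omega> Om k \<T> 1 \<and> w \<in> cut_space_of \<Omega> Om k \<T> 2}"

definition cut_proj ::
  "'a::euclidean_space set \<Rightarrow> (nat \<Rightarrow> 'a set) \<Rightarrow> nat \<Rightarrow> 'a set set \<Rightarrow> nat \<Rightarrow> ('a \<Rightarrow> real) \<Rightarrow> 'a \<Rightarrow> real"
where
  "cut_proj \<Omega> Om k \<T> i u =
     (THE w. \<exists>c. u = (\<lambda>x. \<Sum>j\<in>cut_nodes \<Omega> Om k \<T>. c j * cut_basis \<Omega> Om k \<T> j x) \<and>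
                 w = (\<lambda>x. \<Sum>j\<in>cut_nodes_of \<Omega> Om k \<T> i. c j * cut_basis \<Omega> Om k \<T> j x))"

text \<open>The isomorphism \<open>L\<close>; the result maps the subdomain number to the component.\<close>

definition split_map ::
  "'a::euclidean_space set \<Rightarrow> (nat \<Rightarrow> 'a set) \<Rightarrow> nat \<Rightarrow> 'a set set \<Rightarrow>
   ('a \<Rightarrow> real) \<times> ('a \<Rightarrow> real) \<Rightarrow> nat \<Rightarrow> 'a \<Rightarrow> real" where
  "split_map \<Omega> Om k \<T> = (\<lambda>(u0, uc) i x. restr (ex_region Om \<T> i) u0 x + cut_proj \<Omega> Om k \<T> i uc x)"


section \<open>Bilinear forms\<close>

text \<open>
  All derivatives are taken elementwise: \<open>elt_poly k T u\<close> is the polynomial that coincides with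
  \<open>u\<close> on the simplex \<open>T\<close>. Integrals of derivatives over a subdomain or over the interface are
  sums over the simplices, so that traces of gradients on the interface are meaningful without
  assumptions on how the interface meets the mesh skeleton.
\<close>

definition elt_poly :: "nat \<Rightarrow> 'a::euclidean_space set \<Rightarrow> ('a \<Rightarrow> real) \<Rightarrow> 'a \<Rightarrow> real" where
  "elt_poly k T u = (THE p. p \<in> polys k \<and> (\<forall>x\<in>T. p x = u x))"

definition elt_grad :: "nat \<Rightarrow> 'a::euclidean_space set \<Rightarrow> ('a \<Rightarrow> real) \<Rightarrow> 'a \<Rightarrow> 'a" where
  "elt_grad k T u = grad (elt_poly k T u)"

definition jump :: "(nat \<Rightarrow> 'a \<Rightarrow> real) \<Rightarrow> 'a \<Rightarrow> real" where
  "jump u x = u 1 x - u 2 x"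

text \<open>
  Weighted average with weight \<open>\<kappa> \<in> [0, 1]\<close> for the first and \<open>1 - \<kappa>\<close> for the second component.
\<close>

definition average :: "real \<Rightarrow> (nat \<Rightarrow> 'b::real_vector) \<Rightarrow> 'b" where
  "average \<kappa> w = \<kappa> *\<^sub>R w 1 + (1 - \<kappa>) *\<^sub>R w 2"

definition diffusion_form ::
  "(nat \<Rightarrow> 'a::euclidean_space set) \<Rightarrow> nat \<Rightarrow> 'a set set \<Rightarrow> (nat \<Rightarrow> real) \<Rightarrow>
   (nat \<Rightarrow> 'a \<Rightarrow> real) \<Rightarrow> (nat \<Rightarrow> 'a \<Rightarrow> real) \<Rightarrow> real" where
  "diffusion_form Om k \<T> \<alpha> u v =
     (\<Sum>i\<in>{1, 2}. \<Sum>T\<in>ex_simplices Om \<T> i.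
        set_lebesgue_integral lborel (T \<inter> Om i)
          (\<lambda>x. \<alpha> i * (elt_grad k T (u i) x \<bullet> elt_grad k T (v i) x)))"

definition consistency_form ::
  "(nat \<Rightarrow> 'a::euclidean_space set) \<Rightarrow> ('a \<Rightarrow> 'a) \<Rightarrow> nat \<Rightarrow> 'a set set \<Rightarrow> (nat \<Rightarrow> real) \<Rightarrow>
   ('a set \<Rightarrow> real) \<Rightarrow> (nat \<Rightarrow> 'a \<Rightarrow> real) \<Rightarrow> (nat \<Rightarrow> 'a \<Rightarrow> real) \<Rightarrow> real" where
  "consistency_form Om n k \<T> \<alpha> \<kappa> u v =
     (\<Sum>T\<in>cut_simplices Om \<T>.
        set_lebesgue_integral surface_measure (T \<inter> iface Om)
          (\<lambda>x. (average (\<kappa> T) (\<lambda>i. - \<alpha> i *\<^sub>R elt_grad k T (v i) x) \<bullet> n x) * jump u x))"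

definition scaled_jump_form ::
  "(nat \<Rightarrow> 'a::euclidean_space set) \<Rightarrow> 'a set set \<Rightarrow>
   (nat \<Rightarrow> 'a \<Rightarrow> real) \<Rightarrow> (nat \<Rightarrow> 'a \<Rightarrow> real) \<Rightarrow> real" where
  "scaled_jump_form Om \<T> u v =
     (\<Sum>T\<in>cut_simplices Om \<T>. (1 / diameter T) *
        set_lebesgue_integral surface_measure (T \<inter> iface Om) (\<lambda>x. jump u x * jump v x))"

text \<open>Interior faces in the cut region across which component \<open>i\<close> is two-sided.\<close>

definition ghost_faces :: "(nat \<Rightarrow> 'a::euclidean_space set) \<Rightarrow> 'a set set \<Rightarrow> nat \<Rightarrow> 'a set set" where
  "ghost_faces Om \<T> i =
     {F. F \<subseteq> cut_region Om \<T> \<and>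
         (\<exists>T\<in>ex_simplices Om \<T> i. \<exists>T'\<in>ex_simplices Om \<T> i. T \<noteq> T' \<and> F = T \<inter> T' \<and> F facet_of T)}"

text \<open>
  The two choices below are unique up to the order of the simplices and the sign of the normal;
  products of two jumps of the same order do not depend on them.
\<close>

definition face_sides :: "'a set set \<Rightarrow> 'a set \<Rightarrow> 'a set \<times> 'a set" where
  "face_sides \<T> F = (SOME (T, T'). T \<in> \<T> \<and> T' \<in> \<T> \<and> T \<noteq> T' \<and> F = T \<inter> T')"

definition face_normal :: "'a::euclidean_space set \<Rightarrow> 'a" where
  "face_normal F = (SOME \<nu>. norm \<nu> = 1 \<and> (\<forall>x\<in>F. \<forall>y\<in>F. \<nu> \<bullet> (x - y) = 0))"

definition dir_deriv :: "nat \<Rightarrow> 'a::euclidean_space \<Rightarrow> ('a \<Rightarrow> real) \<Rightarrow> 'a \<Rightarrow> real" where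
  "dir_deriv l \<nu> f x = (deriv ^^ l) (\<lambda>t. f (x + t *\<^sub>R \<nu>)) 0"

definition face_jump ::
  "nat \<Rightarrow> 'a::euclidean_space set set \<Rightarrow> nat \<Rightarrow> 'a set \<Rightarrow> ('a \<Rightarrow> real) \<Rightarrow> 'a \<Rightarrow> real" where
  "face_jump k \<T> l F u x =
     (let (T, T') = face_sides \<T> F; \<nu> = face_normal F
      in dir_deriv l \<nu> (elt_poly k T u) x - dir_deriv l \<nu> (elt_poly k T' u) x)"

definition ghost_form ::
  "nat \<Rightarrow> 'a::euclidean_space set set \<Rightarrow> real \<Rightarrow> (nat \<Rightarrow> 'a set set) \<Rightarrow>
   (nat \<Rightarrow> 'a \<Rightarrow> real) \<Rightarrow> (nat \<Rightarrow> 'a \<Rightarrow> real) \<Rightarrow> real" where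
  "ghost_form k \<T> \<beta> \<F> u v =
     \<beta> * (\<Sum>i\<in>{1, 2}. \<Sum>l\<in>{1..k}. \<Sum>F\<in>\<F> i. diameter F ^ (2 * l - 1) *
        set_lebesgue_integral surface_measure F
          (\<lambda>x. face_jump k \<T> l F (u i) x * face_jump k \<T> l F (v i) x))"

definition cutfem_form ::
  "(nat \<Rightarrow> 'a::euclidean_space set) \<Rightarrow> ('a \<Rightarrow> 'a) \<Rightarrow> nat \<Rightarrow> 'a set set \<Rightarrow> (nat \<Rightarrow> real) \<Rightarrow> real \<Rightarrow> real \<Rightarrow>
   ('a set \<Rightarrow> real) \<Rightarrow> real \<Rightarrow> (nat \<Rightarrow> 'a set set) \<Rightarrow>
   (nat \<Rightarrow> 'a \<Rightarrow> real) \<Rightarrow> (nat \<Rightarrow> 'a \<Rightarrow> real) \<Rightarrow> real" where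
  "cutfem_form Om n k \<T> \<alpha> \<gamma> \<beta> \<kappa> \<alpha>bar \<F> u v =
     diffusion_form Om k \<T> \<alpha> u v +
     consistency_form Om n k \<T> \<alpha> \<kappa> u v + consistency_form Om n k \<T> \<alpha> \<kappa> v u +
     \<alpha>bar * \<gamma> * scaled_jump_form Om \<T> u v +
     ghost_form k \<T> \<beta> \<F> u v"

definition split_form ::
  "'a::euclidean_space set \<Rightarrow> (nat \<Rightarrow> 'a set) \<Rightarrow> ('a \<Rightarrow> 'a) \<Rightarrow> nat \<Rightarrow> 'a set set \<Rightarrow>
   (nat \<Rightarrow> real) \<Rightarrow> real \<Rightarrow> real \<Rightarrow> ('a set \<Rightarrow> real) \<Rightarrow> real \<Rightarrow> (nat \<Rightarrow> 'a set set) \<Rightarrow>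
   ('a \<Rightarrow> real) \<times> ('a \<Rightarrow> real) \<Rightarrow> ('a \<Rightarrow> real) \<times> ('a \<Rightarrow> real) \<Rightarrow> real" where
  "split_form \<Omega> Om n k \<T> \<alpha> \<gamma> \<beta> \<kappa> \<alpha>bar \<F> u v =
     cutfem_form Om n k \<T> \<alpha> \<gamma> \<beta> \<kappa> \<alpha>bar \<F> (split_map \<Omega> Om k \<T> u) (split_map \<Omega> Om k \<T> v)"

definition energy ::
  "(nat \<Rightarrow> 'a::euclidean_space set) \<Rightarrow> nat \<Rightarrow> 'a set set \<Rightarrow> (nat \<Rightarrow> 'a \<Rightarrow> real) \<Rightarrow> real" where
  "energy Om k \<T> u =
     (\<Sum>i\<in>{1, 2}. \<Sum>T\<in>ex_simplices Om \<T> i.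
        set_lebesgue_integral lborel T (\<lambda>x. (norm (elt_grad k T (u i) x))\<^sup>2)) +
     scaled_jump_form Om \<T> u u"

definition norm_equivalence ::
  "real \<Rightarrow> real \<Rightarrow> 'a::euclidean_space set \<Rightarrow> (nat \<Rightarrow> 'a set) \<Rightarrow> ('a \<Rightarrow> 'a) \<Rightarrow> nat \<Rightarrow> 'a set set \<Rightarrow>
   (nat \<Rightarrow> real) \<Rightarrow> real \<Rightarrow> real \<Rightarrow> ('a set \<Rightarrow> real) \<Rightarrow> real \<Rightarrow> (nat \<Rightarrow> 'a set set) \<Rightarrow> bool" where
  "norm_equivalence c1 c2 \<Omega> Om n k \<T> \<alpha> \<gamma> \<beta> \<kappa> \<alpha>bar \<F> \<longleftrightarrow>
     (\<forall>u\<in>fe_space \<Omega> k \<T> \<times> cut_space \<Omega> Om k \<T>.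
        let E = energy Om k \<T> (split_map \<Omega> Om k \<T> u);
            A = split_form \<Omega> Om n k \<T> \<alpha> \<gamma> \<beta> \<kappa> \<alpha>bar \<F> u u
        in c1 * E \<le> A \<and> A \<le> c2 * E)"


section \<open>Matrices\<close>

definition cut_matrix ::
  "'a::euclidean_space set \<Rightarrow> (nat \<Rightarrow> 'a set) \<Rightarrow> ('a \<Rightarrow> 'a) \<Rightarrow> nat \<Rightarrow> 'a set set \<Rightarrow>
   (nat \<Rightarrow> real) \<Rightarrow> real \<Rightarrow> real \<Rightarrow> ('a set \<Rightarrow> real) \<Rightarrow> real \<Rightarrow> (nat \<Rightarrow> 'a set set) \<Rightarrow>
   'a \<Rightarrow> 'a \<Rightarrow> real" where
  "cut_matrix \<Omega> Om n k \<T> \<alpha> \<gamma> \<beta> \<kappa> \<alpha>bar \<F> m l =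
     split_form \<Omega> Om n k \<T> \<alpha> \<gamma> \<beta> \<kappa> \<alpha>bar \<F>
       (\<lambda>_. 0, cut_basis \<Omega> Om k \<T> l) (\<lambda>_. 0, cut_basis \<Omega> Om k \<T> m)"

definition diag_part :: "('b \<Rightarrow> 'b \<Rightarrow> real) \<Rightarrow> 'b \<Rightarrow> 'b \<Rightarrow> real" where
  "diag_part A m l = (if m = l then A m l else 0)"

definition quad_form :: "'b set \<Rightarrow> ('b \<Rightarrow> 'b \<Rightarrow> real) \<Rightarrow> ('b \<Rightarrow> real) \<Rightarrow> real" where
  "quad_form I A x = (\<Sum>m\<in>I. \<Sum>l\<in>I. x m * A m l * x l)"

end

theory Submission
  imports Defs
begin

text \<open>
  On a cut simplex \<open>T\<close> let \<open>M\<^sub>T x = h\<^sub>T ^ (d - 2) * (\<Sum>j\<in>T. (x j)\<^sup>2)\<close>, a diagonal form. The energy norm is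
  bounded above by \<open>\<Sum>T. M\<^sub>T\<close> through inverse estimates and \<open>|T \<inter> \<Gamma>| \<lesssim> h\<^sub>T ^ (d - 1)\<close>. For the converse
  bound consider the component \<open>u\<^sub>i\<close> on \<open>T\<close>. If it vanishes at a node of \<open>T\<close>, its gradient controls it.
  Otherwise all nodes of \<open>T\<close> lie on the other side of \<open>\<Gamma>\<close>; close to some vertex \<open>v\<close> of \<open>T\<close> the interface has
  area at least of order \<open>h\<^sub>T ^ (d - 1)\<close> and is contained in the cut simplices of the star of \<open>v\<close>, so one of
  these, \<open>S\<close>, carries a fair share of it. On \<open>S\<close> either \<open>u\<^sub>i\<close> vanishes at a node or the other component
  vanishes identically and the jump term controls \<open>u\<^sub>i\<close>; the bound is passed back to \<open>T\<close> through \<open>u\<^sub>i v\<close>.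
  Energy and diagonal form are therefore equivalent, and both the matrix and its diagonal are equivalent
  to the latter.
\<close>


section \<open>Polynomials\<close>

text \<open>The interface may cut an arbitrarily thin sliver from T, so no bound that uses T alone
  is uniform in its position; hence the search for a neighbour S with a definite share of interface
  area. The search needs an interior vertex, and one is available exactly when it is needed: if a
  component has no zero node on T, every lattice point of T carries a basis function and so lies in
  \<Omega>. Some vertex v has a hat function that is positive on a ball of radius comparable to h_T
  around an interface point of T; positivity forces every element met there into the star of v. The
  star has boundedly many elements by a packing argument, and their sizes are comparable because a
  punctured ball is connected for d >= 2. Coarse meshes are covered as well: the radius is \<rho>
  h_T, with \<rho> so small in terms of the diameter of \<Omega> that it stays below the scale
  \<open>r0\<close> of the interface charts. Reference estimates are taken on a cube inside an
  inscribed ball and extrapolated to the element, so shape regularity enters only through the ratio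
  \<open>K\<close> of diameter to ball radius.\<close>

lemma finite_multi_indices: "finite (multi_indices k :: ('a::euclidean_space \<Rightarrow> nat) set)"
proof (rule finite_subset)
  show "multi_indices k \<subseteq> {e :: 'a \<Rightarrow> nat. \<forall>b. (b \<in> Basis \<longrightarrow> e b \<in> {..k}) \<and> (b \<notin> Basis \<longrightarrow> e b = 0)}"
  proof
    fix e :: "'a \<Rightarrow> nat" assume e: "e \<in> multi_indices k"
    have "e b \<le> k" if "b \<in> Basis" for b
      using e member_le_sum[OF that, of e] by (auto simp: multi_indices_def)
    then show "e \<in> {e. \<forall>b. (b \<in> Basis \<longrightarrow> e b \<in> {..k}) \<and> (b \<notin> Basis \<longrightarrow> e b = 0)}"
      using e by (auto simp: multi_indices_def)
  qed
qed (rule finite_set_of_finite_funs; simp)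

lemma polys_monom:
  assumes "e \<in> multi_indices k" shows "(\<lambda>x. \<Prod>b\<in>Basis. (x \<bullet> b) ^ e b) \<in> polys k"
proof -
  have "(\<Sum>e'\<in>multi_indices k. (if e' = e then 1 else 0) * (\<Prod>b\<in>Basis. (x \<bullet> b) ^ e' b))
      = (\<Prod>b\<in>Basis. (x \<bullet> b) ^ e b)" for x :: 'a
    using sum.delta[OF finite_multi_indices, where a=e and b="\<lambda>e'. \<Prod>b\<in>Basis. (x \<bullet> b) ^ e' b"] assms
    by (simp add: if_distrib[of "\<lambda>a. a * _"] cong: if_cong)
  then show ?thesis
    unfolding polys_def by (intro CollectI exI[of _ "\<lambda>e'. if e' = e then 1 else 0"]) simp
qed

lemma polys_zero: "(\<lambda>x. 0) \<in> polys k"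
  unfolding polys_def by (auto intro!: exI[of _ "\<lambda>_. 0"])

lemma polys_add: "p \<in> polys k \<Longrightarrow> q \<in> polys k \<Longrightarrow> (\<lambda>x. p x + q x) \<in> polys k"
proof -
  assume "p \<in> polys k" "q \<in> polys k"
  then obtain c c' where "p = (\<lambda>x. \<Sum>e\<in>multi_indices k. c e * (\<Prod>b\<in>Basis. (x \<bullet> b) ^ e b))"
    "q = (\<lambda>x. \<Sum>e\<in>multi_indices k. c' e * (\<Prod>b\<in>Basis. (x \<bullet> b) ^ e b))"
    unfolding polys_def by auto
  then show ?thesis unfolding polys_def
    by (auto intro!: exI[of _ "\<lambda>e. c e + c' e"] simp: algebra_simps sum.distrib)
qed

lemma polys_scale: "p \<in> polys k \<Longrightarrow> (\<lambda>x. a * p x) \<in> polys k"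
proof -
  assume "p \<in> polys k"
  then obtain c where "p = (\<lambda>x. \<Sum>e\<in>multi_indices k. c e * (\<Prod>b\<in>Basis. (x \<bullet> b) ^ e b))"
    unfolding polys_def by auto
  then show ?thesis unfolding polys_def
    by (auto intro!: exI[of _ "\<lambda>e. a * c e"] simp: algebra_simps sum_distrib_left)
qed

lemma polys_sum: "(\<And>i. i \<in> I \<Longrightarrow> f i \<in> polys k) \<Longrightarrow> (\<lambda>x. \<Sum>i\<in>I. f i x) \<in> polys k"
  by (induction I rule: infinite_finite_induct) (auto intro: polys_zero polys_add)

lemma polys_const: "(\<lambda>x. a) \<in> polys k"
  using polys_scale[OF polys_monom[of "\<lambda>_. 0" k], of a] by (simp add: multi_indices_def)

lemma multi_indices_mono: "j \<le> k \<Longrightarrow> multi_indices j \<subseteq> multi_indices k"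
  by (auto simp: multi_indices_def)

lemma polys_mono: "j \<le> k \<Longrightarrow> p \<in> polys j \<Longrightarrow> p \<in> polys k"
  by (auto simp: polys_def[of j]
      intro!: polys_sum polys_scale polys_monom dest: multi_indices_mono[THEN subsetD])

lemma polys_mult:
  assumes "p \<in> polys i" "q \<in> polys j" shows "(\<lambda>x. p x * q x) \<in> polys (i + j)"
proof -
  obtain c c' where pq: "p = (\<lambda>x. \<Sum>e\<in>multi_indices i. c e * (\<Prod>b\<in>Basis. (x \<bullet> b) ^ e b))"
    "q = (\<lambda>x. \<Sum>e\<in>multi_indices j. c' e * (\<Prod>b\<in>Basis. (x \<bullet> b) ^ e b))"
    using assms unfolding polys_def by auto
  have "(\<lambda>x. (c e * (\<Prod>b\<in>Basis. (x \<bullet> b) ^ e b)) * (c' e' * (\<Prod>b\<in>Basis. (x \<bullet> b) ^ e' b))) \<in> polys (i + j)"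
    if "e \<in> multi_indices i" "e' \<in> multi_indices j" for e e'
  proof -
    have "(\<lambda>b. e b + e' b) \<in> multi_indices (i + j)"
      using that by (auto simp: multi_indices_def sum.distrib)
    from polys_scale[OF polys_monom[OF this], of "c e * c' e'"] show ?thesis
      by (simp add: power_add prod.distrib algebra_simps)
  qed
  then show ?thesis
    unfolding pq sum_product by (intro polys_sum)
qed

lemma polys_affine: "(\<lambda>x. c + a \<bullet> x) \<in> polys 1"
proof -
  have "(\<lambda>x::'a. x \<bullet> b) \<in> polys 1" if b: "b \<in> Basis" for b
  proof -
    have "(\<lambda>b'. if b' = b then 1 else 0) \<in> multi_indices 1"
      using b by (auto simp: multi_indices_def)
    moreover have "(\<Prod>b'\<in>Basis. (x \<bullet> b') ^ (if b' = b then 1 else 0)) = x \<bullet> b" for x :: 'a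
      using b by (subst prod.remove[OF finite_Basis b]) auto
    ultimately show ?thesis using polys_monom[of "\<lambda>b'. if b' = b then 1 else 0" 1] by simp
  qed
  then have "(\<lambda>x. c + (\<Sum>b\<in>Basis. (a \<bullet> b) * (x \<bullet> b))) \<in> polys 1"
    by (intro polys_add polys_const polys_sum polys_scale)
  then show ?thesis by (subst euclidean_inner)
qed

lemma polys_prod:
  "(\<And>i. i \<in> I \<Longrightarrow> f i \<in> polys (e i)) \<Longrightarrow> (\<lambda>x. \<Prod>i\<in>I. f i x) \<in> polys (sum e I)"
  by (induction I rule: infinite_finite_induct) (auto intro: polys_const polys_mult)

lemma polys_power: "p \<in> polys j \<Longrightarrow> (\<lambda>x. p x ^ n) \<in> polys (n * j)"
  by (induction n) (auto intro: polys_const polys_mult)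

lemma polys_prod_power:
  assumes "\<And>i. i \<in> I \<Longrightarrow> f i \<in> polys 1" "sum e I \<le> k"
  shows "(\<lambda>x. \<Prod>i\<in>I. f i x ^ e i) \<in> polys k"
proof -
  have "(\<lambda>x. f i x ^ e i) \<in> polys (e i)" if "i \<in> I" for i
    using polys_power[OF assms(1)[OF that], of "e i"] by simp
  then show ?thesis
    using polys_mono[OF assms(2)] polys_prod[of I "\<lambda>i x. f i x ^ e i" e] by auto
qed

lemma polys_compose:
  fixes p :: "'a::euclidean_space \<Rightarrow> real"
  assumes "p \<in> polys k" shows "(\<lambda>x. p (z + r *\<^sub>R x)) \<in> polys k"
proof -
  obtain c where p: "p = (\<lambda>x. \<Sum>e\<in>multi_indices k. c e * (\<Prod>b\<in>Basis. (x \<bullet> b) ^ e b))"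
    using assms unfolding polys_def by auto
  have "(\<lambda>x. \<Prod>b\<in>Basis. ((z + r *\<^sub>R x) \<bullet> b) ^ e b) \<in> polys k" if e: "e \<in> multi_indices k" for e :: "'a \<Rightarrow> nat"
  proof (rule polys_prod_power)
    fix b :: 'a
    show "(\<lambda>x. (z + r *\<^sub>R x) \<bullet> b) \<in> polys 1"
      using polys_affine[of "z \<bullet> b" "r *\<^sub>R b"] by (simp add: inner_add_left inner_commute[of _ b] inner_add_right)
  next
    show "sum e Basis \<le> k" using e by (simp add: multi_indices_def)
  qed
  then show ?thesis unfolding p by (intro polys_sum polys_scale)
qed

text \<open>The derivative is carried as the inner product with a continuous field, because the
  product rule for the next factor needs value and continuity of the gradient of the remaining
  product.\<close>

lemma has_gradient_prod:
  fixes f :: "'b \<Rightarrow> 'a::euclidean_space \<Rightarrow> real"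
  assumes "finite I"
    and "\<And>i. i \<in> I \<Longrightarrow> \<exists>g. continuous_on UNIV g \<and> (\<forall>x. (f i has_derivative (\<lambda>h. g x \<bullet> h)) (at x))"
  shows "\<exists>g. continuous_on UNIV g \<and> (\<forall>x. ((\<lambda>x. \<Prod>i\<in>I. f i x) has_derivative (\<lambda>h. g x \<bullet> h)) (at x))"
  using assms
proof (induction I rule: finite_induct)
  case (insert i I)
  obtain g where g: "continuous_on UNIV g" "\<And>x. (f i has_derivative (\<lambda>h. g x \<bullet> h)) (at x)"
    using insert.prems by auto
  obtain g' where g': "continuous_on UNIV g'"
    "\<And>x. ((\<lambda>x. \<Prod>i\<in>I. f i x) has_derivative (\<lambda>h. g' x \<bullet> h)) (at x)"
    using insert by auto
  have "continuous_on UNIV (f i)" "continuous_on UNIV (\<lambda>x. \<Prod>i\<in>I. f i x)"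
    by (intro continuous_at_imp_continuous_on ballI has_derivative_continuous[OF g(2)]
        has_derivative_continuous[OF g'(2)])+
  then have "continuous_on UNIV (\<lambda>x. f i x *\<^sub>R g' x + (\<Prod>i\<in>I. f i x) *\<^sub>R g x)"
    using g(1) g'(1) by (intro continuous_on_add continuous_on_scaleR)
  moreover have "((\<lambda>x. f i x * (\<Prod>i\<in>I. f i x)) has_derivative
      (\<lambda>h. (f i x *\<^sub>R g' x + (\<Prod>i\<in>I. f i x) *\<^sub>R g x) \<bullet> h)) (at x)" for x
    using has_derivative_mult[OF g(2)[of x] g'(2)[of x]]
    by (simp add: inner_add_left algebra_simps)
  ultimately show ?case
    using insert.hyps by (intro exI[of _ "\<lambda>x. f i x *\<^sub>R g' x + (\<Prod>i\<in>I. f i x) *\<^sub>R g x"]) simp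
next
  case empty
  show ?case by (intro exI[of _ "\<lambda>_. 0"] conjI allI continuous_on_const)
    (simp only: inner_zero_left has_derivative_const prod.empty)
qed

lemma polys_has_gradient:
  fixes p :: "'a::euclidean_space \<Rightarrow> real"
  assumes "p \<in> polys k"
  shows "\<exists>g. continuous_on UNIV g \<and> (\<forall>x. (p has_derivative (\<lambda>h. g x \<bullet> h)) (at x))"
proof -
  obtain c where p: "p = (\<lambda>x. \<Sum>e\<in>multi_indices k. c e * (\<Prod>b\<in>Basis. (x \<bullet> b) ^ e b))"
    using assms unfolding polys_def by auto
  have "\<exists>g. continuous_on UNIV g \<and>
      (\<forall>x::'a. ((\<lambda>x. \<Prod>b\<in>Basis. (x \<bullet> b) ^ e b) has_derivative (\<lambda>h. g x \<bullet> h)) (at x))" for e :: "'a \<Rightarrow> nat"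
  proof (rule has_gradient_prod[OF finite_Basis])
    fix b :: 'a
    show "\<exists>g. continuous_on UNIV g \<and>
        (\<forall>x. ((\<lambda>x. (x \<bullet> b) ^ e b) has_derivative (\<lambda>h. g x \<bullet> h)) (at x))"
    proof (intro exI conjI allI)
      show "continuous_on UNIV (\<lambda>x. (real (e b) * (x \<bullet> b) ^ (e b - 1)) *\<^sub>R b)"
        by (intro continuous_intros)
      fix x :: 'a
      have "((\<lambda>x. x \<bullet> b) has_derivative (\<lambda>h. h \<bullet> b)) (at x)"
        by (intro has_derivative_inner_left has_derivative_ident)
      from has_derivative_power[OF this, of "e b"]
      show "((\<lambda>x. (x \<bullet> b) ^ e b) has_derivative
          (\<lambda>h. ((real (e b) * (x \<bullet> b) ^ (e b - 1)) *\<^sub>R b) \<bullet> h)) (at x)"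
        by (simp only: inner_scaleR_left inner_commute[of _ b] mult.commute mult.left_commute mult.assoc)
    qed
  qed
  then have "\<forall>e. \<exists>g. continuous_on UNIV g \<and>
      (\<forall>x::'a. ((\<lambda>x. \<Prod>b\<in>Basis. (x \<bullet> b) ^ e b) has_derivative (\<lambda>h. g x \<bullet> h)) (at x))" ..
  from choice[OF this] obtain g :: "('a \<Rightarrow> nat) \<Rightarrow> 'a \<Rightarrow> 'a" where g: "\<And>e. continuous_on UNIV (g e)"
    "\<And>e x. ((\<lambda>x. \<Prod>b\<in>Basis. (x \<bullet> b) ^ e b) has_derivative (\<lambda>h. g e x \<bullet> h)) (at x)"
    by auto
  have "((\<lambda>x. \<Sum>e\<in>multi_indices k. c e * (\<Prod>b\<in>Basis. (x \<bullet> b) ^ e b)) has_derivative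
      (\<lambda>h. (\<Sum>e\<in>multi_indices k. c e *\<^sub>R g e x) \<bullet> h)) (at x)" for x
    unfolding inner_sum_left inner_scaleR_left
    by (intro has_derivative_sum has_derivative_mult_right g)
  moreover have "continuous_on UNIV (\<lambda>x. \<Sum>e\<in>multi_indices k. c e *\<^sub>R g e x)"
    by (intro continuous_intros g)
  ultimately show ?thesis unfolding p by blast
qed

lemma grad_eqI: "(p has_derivative (\<lambda>h. g \<bullet> h)) (at x) \<Longrightarrow> grad p x = g"
  using frechet_derivative_at[of p "\<lambda>h. g \<bullet> h" x, symmetric]
  by (simp add: grad_def euclidean_representation)

lemma
  assumes "p \<in> polys k"
  shows polys_has_derivative: "(p has_derivative (\<lambda>h. grad p x \<bullet> h)) (at x)"
    and continuous_grad: "continuous_on UNIV (grad p)"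
    and continuous_polys: "continuous_on S p"
proof -
  obtain g where g: "continuous_on UNIV g" "\<And>x. (p has_derivative (\<lambda>h. g x \<bullet> h)) (at x)"
    using polys_has_gradient[OF assms] by auto
  then have "grad p = g" by (auto intro: grad_eqI)
  with g show "(p has_derivative (\<lambda>h. grad p x \<bullet> h)) (at x)" "continuous_on UNIV (grad p)" by auto
  show "continuous_on S p"
    by (intro continuous_at_imp_continuous_on ballI has_derivative_continuous[OF g(2)])
qed

lemma grad_add:
  assumes "p \<in> polys k" "q \<in> polys k" shows "grad (\<lambda>x. p x + q x) x = grad p x + grad q x"
  using has_derivative_add[OF polys_has_derivative[OF assms(1), of x] polys_has_derivative[OF assms(2), of x]]
  by (intro grad_eqI) (simp add: inner_add_left)

lemma grad_scale:
  assumes "p \<in> polys k" shows "grad (\<lambda>x. a * p x) x = a *\<^sub>R grad p x"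
  using has_derivative_mult_right[OF polys_has_derivative[OF assms(1), of x], of a]
  by (intro grad_eqI) simp

lemma grad_sum:
  assumes "\<And>i. i \<in> I \<Longrightarrow> f i \<in> polys k"
  shows "grad (\<lambda>x. \<Sum>i\<in>I. f i x) x = (\<Sum>i\<in>I. grad (f i) x)"
  using assms
proof (induction I rule: infinite_finite_induct)
  case (insert i I)
  then show ?case
    by (simp add: grad_add[of _ k] polys_sum)
qed (auto intro!: grad_eqI)

text \<open>
  Along a line a polynomial is a univariate polynomial with continuous coefficients; iterated
  directional derivatives are its Taylor coefficients.
\<close>

lemma polys_along_line:
  fixes p :: "'a::euclidean_space \<Rightarrow> real"
  assumes "p \<in> polys k"
  shows "\<exists>P. (\<forall>i. continuous_on UNIV (\<lambda>x. poly.coeff (P x) i)) \<and>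
             (\<forall>x t. p (x + t *\<^sub>R \<nu>) = poly (P x) t)"
proof -
  define good where "good p P \<longleftrightarrow> (\<forall>i. continuous_on UNIV (\<lambda>x. poly.coeff (P x) i)) \<and>
             (\<forall>x t. p (x + t *\<^sub>R \<nu>) = poly (P x) t)" for p :: "'a \<Rightarrow> real" and P :: "'a \<Rightarrow> real poly"
  have mult: "good (\<lambda>x. p x * q x) (\<lambda>x. P x * Q x)" if "good p P" "good q Q" for p q P Q
    using that unfolding good_def coeff_mult by (simp add: continuous_on_sum continuous_on_mult)
  have add: "good (\<lambda>x. p x + q x) (\<lambda>x. P x + Q x)" if "good p P" "good q Q" for p q P Q
    using that unfolding good_def by (simp add: continuous_on_add)
  have const: "good (\<lambda>x. c) (\<lambda>x. [:c:])" for c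
    unfolding good_def by simp
  have constE: "\<exists>P. good (\<lambda>x. c) P" for c
    by (rule exI[where x="\<lambda>x. [:c:]"]) (rule const)
  have inner: "good (\<lambda>x. x \<bullet> b) (\<lambda>x. [:x \<bullet> b, \<nu> \<bullet> b:])" for b
    unfolding good_def
  proof (intro conjI allI)
    fix i
    show "continuous_on UNIV (\<lambda>x. poly.coeff [:x \<bullet> b, \<nu> \<bullet> b:] i)"
    proof (cases i)
      case (Suc j)
      then show ?thesis by (cases j) simp_all
    qed (simp add: continuous_on_inner continuous_on_id)
  next
    fix x t show "(x + t *\<^sub>R \<nu>) \<bullet> b = poly [:x \<bullet> b, \<nu> \<bullet> b:] t"
      by (simp add: inner_add_left)
  qed
  have power: "\<exists>P. good (\<lambda>x. (x \<bullet> b) ^ n) P" for b n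
  proof (induction n)
    case 0 show ?case unfolding power_0 by (rule constE)
  next
    case (Suc n)
    obtain P where "good (\<lambda>x. (x \<bullet> b) ^ n) P" using Suc ..
    from mult[OF inner[of b] this] show ?case unfolding power_Suc
      by (rule exI[where x="\<lambda>x. [:x \<bullet> b, \<nu> \<bullet> b:] * P x"])
  qed
  have prod: "\<exists>P. good (\<lambda>x. \<Prod>b\<in>B. (x \<bullet> b) ^ e b) P" for B :: "'a set" and e
  proof (induction B rule: infinite_finite_induct)
    case (insert b B)
    obtain P where P: "good (\<lambda>x. \<Prod>b\<in>B. (x \<bullet> b) ^ e b) P" using insert.IH ..
    obtain Q where "good (\<lambda>x. (x \<bullet> b) ^ e b) Q" using power ..
    from mult[OF this P] show ?case unfolding prod.insert[OF insert.hyps]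
      by (rule exI[where x="\<lambda>x. Q x * P x"])
  qed (simp_all add: constE)
  have sum: "\<exists>P. good (\<lambda>x. \<Sum>e\<in>E. c e * (\<Prod>b\<in>Basis. (x \<bullet> b) ^ e b)) P" for E c
  proof (induction E rule: infinite_finite_induct)
    case (insert e E)
    obtain P where P: "good (\<lambda>x. \<Sum>e\<in>E. c e * (\<Prod>b\<in>Basis. (x \<bullet> b) ^ e b)) P"
      using insert.IH ..
    obtain Q where "good (\<lambda>x. \<Prod>b\<in>Basis. (x \<bullet> b) ^ e b) Q" using prod ..
    from add[OF mult[OF const this] P, of "c e"] show ?case
      unfolding sum.insert[OF insert.hyps]
      by (rule exI[where x="\<lambda>x. [:c e:] * Q x + P x"])
  qed (simp_all add: constE)
  obtain c where "p = (\<lambda>x. \<Sum>e\<in>multi_indices k. c e * (\<Prod>b\<in>Basis. (x \<bullet> b) ^ e b))"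
    using assms unfolding polys_def by auto
  then have "\<exists>P. good p P" using sum[of c "multi_indices k"] by simp
  then show ?thesis unfolding good_def .
qed

lemma dir_deriv_poly:
  assumes "\<And>t. p (x + t *\<^sub>R \<nu>) = poly P t"
  shows "dir_deriv l \<nu> p x = poly.coeff ((pderiv ^^ l) P) 0"
proof -
  have "(deriv ^^ l) (poly P) = poly ((pderiv ^^ l) P)"
  proof (induction l)
    case (Suc l)
    have "deriv (poly Q) = poly (pderiv Q)" for Q :: "real poly"
      by (rule ext, rule DERIV_imp_deriv, rule poly_DERIV)
    then show ?case using Suc by simp
  qed simp
  then show ?thesis unfolding dir_deriv_def assms by (simp add: poly_0_coeff_0)
qed

text \<open>Makes jumps of normal derivatives continuous on faces, hence the ghost penalty
  integrands integrable.\<close>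

lemma continuous_dir_deriv:
  assumes "p \<in> polys k" shows "continuous_on S (dir_deriv l \<nu> p)"
proof -
  obtain P where P: "\<And>i. continuous_on UNIV (\<lambda>x. poly.coeff (P x) i)"
    "\<And>x t. p (x + t *\<^sub>R \<nu>) = poly (P x) t"
    using polys_along_line[OF assms, of \<nu>] by auto
  have "continuous_on UNIV (\<lambda>x. poly.coeff ((pderiv ^^ l) (P x)) i)" for i
    by (induction l arbitrary: i) (simp_all add: P coeff_pderiv continuous_on_mult)
  moreover have "dir_deriv l \<nu> p = (\<lambda>x. poly.coeff ((pderiv ^^ l) (P x)) 0)"
    by (intro ext dir_deriv_poly P)
  ultimately show ?thesis by (auto intro: continuous_on_subset)
qed

lemma pderiv_iter_add: "(pderiv ^^ l) (P + Q) = (pderiv ^^ l) P + (pderiv ^^ l) Q"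
  by (induction l) (auto simp: pderiv_add)

lemma pderiv_iter_smult: "(pderiv ^^ l) (smult a P) = smult a ((pderiv ^^ l) P)"
  by (induction l) (auto simp: pderiv_smult)

lemma dir_deriv_add:
  assumes "p \<in> polys k" "q \<in> polys k"
  shows "dir_deriv l \<nu> (\<lambda>x. p x + q x) x = dir_deriv l \<nu> p x + dir_deriv l \<nu> q x"
proof -
  obtain P Q where P: "\<And>t. p (x + t *\<^sub>R \<nu>) = poly P t" and Q: "\<And>t. q (x + t *\<^sub>R \<nu>) = poly Q t"
    using polys_along_line[OF assms(1), of \<nu>] polys_along_line[OF assms(2), of \<nu>] by metis
  show ?thesis
    using dir_deriv_poly[of "\<lambda>x. p x + q x" x \<nu> "P + Q" l]
    by (simp add: P Q dir_deriv_poly[of _ _ _ P] dir_deriv_poly[of _ _ _ Q] pderiv_iter_add)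
qed

lemma dir_deriv_scale:
  assumes "p \<in> polys k"
  shows "dir_deriv l \<nu> (\<lambda>x. a * p x) x = a * dir_deriv l \<nu> p x"
proof -
  obtain P where P: "\<And>t. p (x + t *\<^sub>R \<nu>) = poly P t"
    using polys_along_line[OF assms(1), of \<nu>] by metis
  show ?thesis
    using dir_deriv_poly[of "\<lambda>x. a * p x" x \<nu> "smult a P" l]
    by (simp add: P dir_deriv_poly[of _ _ _ P] pderiv_iter_smult)
qed

section \<open>Barycentric coordinates\<close>

definition affine_frame :: "'a::euclidean_space set \<Rightarrow> bool" where
  "affine_frame C \<longleftrightarrow> \<not> affine_dependent C \<and> card C = Suc DIM('a)"

text \<open>The choice leaves the values off \<open>C\<close> arbitrary; on an affine frame those on
  \<open>C\<close> are determined (\<open>bary_unique\<close>). The point need not lie in the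
  simplex, and some coordinate is negative outside it.\<close>

definition bary :: "'a::euclidean_space set \<Rightarrow> 'a \<Rightarrow> 'a \<Rightarrow> real" where
  "bary C x = (SOME u. sum u C = 1 \<and> (\<Sum>v\<in>C. u v *\<^sub>R v) = x)"

lemma affine_frame_finite: "affine_frame C \<Longrightarrow> finite C"
  by (auto simp: affine_frame_def aff_independent_finite)

lemma affine_frame_hull:
  fixes C :: "'a::euclidean_space set"
  assumes "affine_frame C" shows "affine hull C = UNIV"
  using assms aff_dim_affine_independent[of C] aff_dim_eq_full[of C]
  by (auto simp: affine_frame_def)

lemma
  fixes C :: "'a::euclidean_space set"
  assumes "affine_frame C"
  shows bary_sum: "sum (bary C x) C = 1" and bary_comb: "(\<Sum>v\<in>C. bary C x v *\<^sub>R v) = x"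
proof -
  have "x \<in> affine hull C" using affine_frame_hull[OF assms] by simp
  then have "\<exists>u. sum u C = 1 \<and> (\<Sum>v\<in>C. u v *\<^sub>R v) = x"
    using affine_hull_finite[OF affine_frame_finite[OF assms]] by simp
  from someI_ex[OF this] show "sum (bary C x) C = 1" "(\<Sum>v\<in>C. bary C x v *\<^sub>R v) = x"
    unfolding bary_def by simp_all
qed

lemma bary_unique:
  fixes C :: "'a::euclidean_space set"
  assumes "affine_frame C" "sum u C = 1" "(\<Sum>v\<in>C. u v *\<^sub>R v) = x" "v \<in> C"
  shows "bary C x v = u v"
proof (rule ccontr)
  assume ne: "bary C x v \<noteq> u v"
  let ?U = "\<lambda>v. bary C x v - u v"
  have "sum ?U C = 0" "(\<Sum>v\<in>C. ?U v *\<^sub>R v) = 0"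
    using assms bary_sum[OF assms(1), of x] bary_comb[OF assms(1), of x]
    by (simp_all add: sum_subtractf scaleR_left_diff_distrib)
  then have "affine_dependent C"
    unfolding affine_dependent_explicit_finite[OF affine_frame_finite[OF assms(1)]]
    using ne assms(4) by (intro exI[of _ ?U]) auto
  then show False using assms(1) by (simp add: affine_frame_def)
qed

text \<open>Exhibits the coordinate as an explicit affine function whose slope is read off at the
  unit vectors; behaviour under combinations, continuity and polynomial degree follow from this
  form. The right-hand sides sum to one and reproduce \<open>x\<close>, so uniqueness
  applies.\<close>

lemma bary_expand:
  fixes C :: "'a::euclidean_space set"
  assumes C: "affine_frame C" and "v \<in> C"
  shows "bary C x v = bary C 0 v + (\<Sum>b\<in>Basis. (bary C b v - bary C 0 v) *\<^sub>R b) \<bullet> x"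
proof -
  let ?u = "\<lambda>v. bary C 0 v + (\<Sum>b\<in>Basis. (x \<bullet> b) * (bary C b v - bary C 0 v))"
  have "sum ?u C = 1 + (\<Sum>b\<in>Basis. (x \<bullet> b) * (\<Sum>v\<in>C. bary C b v - bary C 0 v))"
    using bary_sum[OF C, of 0] by (simp add: sum.distrib sum_distrib_left sum.swap[of _ _ C])
  also have "\<dots> = 1" by (simp add: sum_subtractf bary_sum[OF C])
  finally have 1: "sum ?u C = 1" .
  have "(\<Sum>v\<in>C. ?u v *\<^sub>R v) = (\<Sum>v\<in>C. bary C 0 v *\<^sub>R v) +
      (\<Sum>v\<in>C. \<Sum>b\<in>Basis. ((x \<bullet> b) * (bary C b v - bary C 0 v)) *\<^sub>R v)"
    by (simp add: scaleR_left_distrib sum.distrib scaleR_sum_left)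
  also have "(\<Sum>v\<in>C. \<Sum>b\<in>Basis. ((x \<bullet> b) * (bary C b v - bary C 0 v)) *\<^sub>R v) =
      (\<Sum>b\<in>Basis. (x \<bullet> b) *\<^sub>R (\<Sum>v\<in>C. (bary C b v - bary C 0 v) *\<^sub>R v))"
    by (subst sum.swap) (simp add: scaleR_sum_right)
  also have "\<dots> = x"
    by (simp add: scaleR_left_diff_distrib sum_subtractf bary_comb[OF C] euclidean_representation)
  finally have 2: "(\<Sum>v\<in>C. ?u v *\<^sub>R v) = x" by (simp add: bary_comb[OF C])
  show ?thesis using bary_unique[OF C 1 2 assms(2)]
    by (simp add: inner_sum_left inner_commute[of x] ac_simps)
qed

lemma bary_combine:
  assumes C: "affine_frame C" and "v \<in> C" and "sum w I = 1"
  shows "bary C (\<Sum>i\<in>I. w i *\<^sub>R f i) v = (\<Sum>i\<in>I. w i * bary C (f i) v)"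
  by (subst (1 2) bary_expand[OF C assms(2)])
    (simp add: inner_sum_right distrib_left sum.distrib assms(3) flip: sum_distrib_right)

lemma bary_line:
  assumes C: "affine_frame C" and "v \<in> C"
  shows "bary C ((1 - t) *\<^sub>R x + t *\<^sub>R y) v = (1 - t) * bary C x v + t * bary C y v"
  by (subst (1 2 3) bary_expand[OF C assms(2)]) (simp add: inner_add_right algebra_simps)

lemma bary_vertex:
  assumes C: "affine_frame C" and "v \<in> C" "w \<in> C"
  shows "bary C w v = (if v = w then 1 else 0)"
proof (rule bary_unique[OF C])
  have fin: "finite C" by (rule affine_frame_finite[OF C])
  show "(\<Sum>v\<in>C. if v = w then 1 else 0) = (1::real)" using assms fin by simp
  have "(\<Sum>v\<in>C. (if v = w then 1 else 0) *\<^sub>R v) = (\<Sum>v\<in>C. if v = w then v else 0)"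
    by (intro sum.cong) auto
  also have "\<dots> = w" using assms fin by simp
  finally show "(\<Sum>v\<in>C. (if v = w then 1 else 0) *\<^sub>R v) = w" .
qed (use assms in auto)

lemma bary_polys:
  assumes "affine_frame C" "v \<in> C" shows "(\<lambda>x. bary C x v) \<in> polys 1"
  by (subst bary_expand[OF assms]) (rule polys_affine)

lemma continuous_bary:
  assumes "affine_frame C" "v \<in> C" shows "continuous_on S (\<lambda>x. bary C x v)"
  using bary_polys[OF assms] by (rule continuous_polys)

lemma in_convex_hull_bary:
  fixes C :: "'a::euclidean_space set"
  assumes C: "affine_frame C" and W: "W \<subseteq> C"
  shows "x \<in> convex hull W \<longleftrightarrow> (\<forall>v\<in>C. bary C x v \<ge> 0) \<and> (\<forall>v\<in>C - W. bary C x v = 0)"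
proof
  have fin: "finite C" "finite W" using affine_frame_finite[OF C] W finite_subset by auto
  assume "x \<in> convex hull W"
  then obtain u where u: "\<forall>v\<in>W. 0 \<le> u v" "sum u W = 1" "(\<Sum>v\<in>W. u v *\<^sub>R v) = x"
    using convex_hull_finite[OF fin(2)] by auto
  let ?u = "\<lambda>v. if v \<in> W then u v else 0"
  have "(\<Sum>v\<in>C. ?u v *\<^sub>R v) = (\<Sum>v\<in>C. if v \<in> W then u v *\<^sub>R v else 0)"
    by (intro sum.cong) auto
  then have "sum ?u C = 1" "(\<Sum>v\<in>C. ?u v *\<^sub>R v) = x"
    using u(2,3) fin W by (simp_all add: sum.If_cases Int_absorb1)
  then have "bary C x v = ?u v" if "v \<in> C" for v
    using bary_unique[OF C] that by blast
  then show "(\<forall>v\<in>C. bary C x v \<ge> 0) \<and> (\<forall>v\<in>C - W. bary C x v = 0)"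
    using u(1) by auto
next
  have fin: "finite C" "finite W" using affine_frame_finite[OF C] W finite_subset by auto
  assume a: "(\<forall>v\<in>C. bary C x v \<ge> 0) \<and> (\<forall>v\<in>C - W. bary C x v = 0)"
  have "sum (bary C x) W = 1" "(\<Sum>v\<in>W. bary C x v *\<^sub>R v) = x"
    using sum.mono_neutral_left[OF fin(1) W, of "bary C x"]
      sum.mono_neutral_left[OF fin(1) W, of "\<lambda>v. bary C x v *\<^sub>R v"] a
      bary_sum[OF C, of x] bary_comb[OF C, of x] by auto
  then show "x \<in> convex hull W"
    unfolding convex_hull_finite[OF fin(2)] using a W by auto
qed

lemma in_simplex_bary:
  assumes "affine_frame C"
  shows "x \<in> convex hull C \<longleftrightarrow> (\<forall>v\<in>C. bary C x v \<ge> 0)"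
  using in_convex_hull_bary[OF assms, of C x] by simp

lemma bary_le_1:
  assumes "affine_frame C" "x \<in> convex hull C" "v \<in> C" shows "bary C x v \<le> 1"
  using member_le_sum[of v C "bary C x"] assms bary_sum[OF assms(1), of x]
    affine_frame_finite[OF assms(1)] in_simplex_bary[OF assms(1)] by auto

lemma open_bary_pos:
  assumes "affine_frame C" "W \<subseteq> C" shows "open {x. \<forall>v\<in>W. bary C x v > 0}"
proof -
  have "finite W" using assms affine_frame_finite finite_subset by blast
  then have "open (\<Inter>v\<in>W. {x. bary C x v > 0})"
    by (intro open_INT ballI open_Collect_less continuous_intros continuous_bary assms(1))
      (use assms in auto)
  moreover have "(\<Inter>v\<in>W. {x. bary C x v > 0}) = {x. \<forall>v\<in>W. bary C x v > 0}" by auto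
  ultimately show ?thesis by simp
qed

lemma interior_simplex_nonempty:
  fixes C :: "'a::euclidean_space set"
  assumes C: "affine_frame C" shows "interior (convex hull C) \<noteq> {}"
proof -
  have fin: "finite C" "C \<noteq> {}" using C affine_frame_finite by (auto simp: affine_frame_def)
  define x where "x = (\<Sum>v\<in>C. (1 / card C) *\<^sub>R v)"
  have "bary C x v = 1 / card C" if "v \<in> C" for v
    by (rule bary_unique[OF C]) (use that fin in \<open>auto simp: x_def\<close>)
  then have "x \<in> {x. \<forall>v\<in>C. bary C x v > 0}" using fin by (auto simp: card_gt_0_iff)
  moreover have "{x. \<forall>v\<in>C. bary C x v > 0} \<subseteq> convex hull C"
    using in_simplex_bary[OF C] by (auto intro: less_imp_le)
  ultimately show ?thesis
    using interior_maximal[OF _ open_bary_pos[OF C order_refl]] by blast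
qed

text \<open>On the inscribed ball the affine coordinate stays in [0, 1], so it changes by at most
  one along a diameter of length 2 r. Its slope in every direction is therefore at most 1 / (2
  r).\<close>

lemma bary_lipschitz:
  fixes C :: "'a::euclidean_space set"
  assumes C: "affine_frame C" and v: "v \<in> C" and r: "r > 0" "cball z r \<subseteq> convex hull C"
  shows "\<bar>bary C x v - bary C y v\<bar> \<le> norm (x - y) / (2 * r)"
proof (cases "x = y")
  case False
  define a where "a = (\<Sum>b\<in>Basis. (bary C b v - bary C 0 v) *\<^sub>R b)"
  have e: "bary C x v - bary C y v = a \<bullet> (x - y)" for x y
    using bary_expand[OF C v, of x] bary_expand[OF C v, of y] by (simp add: a_def inner_diff_right)
  define h where "h = (r / norm (x - y)) *\<^sub>R (x - y)"
  have "norm h = r" using False r by (simp add: h_def)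
  then have "z + h \<in> convex hull C" "z - h \<in> convex hull C"
    using r by (auto simp: dist_norm intro!: subsetD[OF r(2)])
  then have "0 \<le> bary C (z + h) v" "0 \<le> bary C (z - h) v" "bary C (z + h) v \<le> 1" "bary C (z - h) v \<le> 1"
    using in_simplex_bary[OF C] bary_le_1[OF C _ v] v by auto
  then have "\<bar>bary C (z + h) v - bary C (z - h) v\<bar> \<le> 1" by linarith
  then have "\<bar>2 * (a \<bullet> h)\<bar> \<le> 1" unfolding e by (simp add: inner_add_right)
  moreover have "2 * (a \<bullet> h) = (2 * r / norm (x - y)) * (a \<bullet> (x - y))" by (simp add: h_def)
  ultimately have "(2 * r / norm (x - y)) * \<bar>a \<bullet> (x - y)\<bar> \<le> 1"
    using r by (simp only: abs_mult) simp
  then have "2 * r * \<bar>a \<bullet> (x - y)\<bar> \<le> norm (x - y)"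
    using False by (simp add: field_simps)
  then show ?thesis using r unfolding e by (simp add: field_simps)
qed simp

text \<open>The coordinates with respect to \<open>C'\<close>, kept on \<open>W\<close> and
  continued by zero, are admissible weights for \<open>C\<close>. This agreement on common faces is
  what lets element-wise functions be glued.\<close>

lemma bary_restrict:
  assumes C: "affine_frame C" "affine_frame C'" and W: "W \<subseteq> C" "W \<subseteq> C'"
    and x: "x \<in> convex hull W" and v: "v \<in> W"
  shows "bary C x v = bary C' x v"
proof -
  have fin: "finite C" "finite C'" "finite W"
    using affine_frame_finite[OF C(1)] affine_frame_finite[OF C(2)] W finite_subset by auto
  let ?u = "\<lambda>v. if v \<in> W then bary C' x v else 0"
  have "bary C' x v = 0" if "v \<in> C' - W" for v
    using x in_convex_hull_bary[OF C(2) W(2)] that by blast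
  then have s: "sum (bary C' x) W = 1" "(\<Sum>v\<in>W. bary C' x v *\<^sub>R v) = x"
    using sum.mono_neutral_left[OF fin(2) W(2), of "bary C' x"]
      sum.mono_neutral_left[OF fin(2) W(2), of "\<lambda>v. bary C' x v *\<^sub>R v"]
      bary_sum[OF C(2), of x] bary_comb[OF C(2), of x] by auto
  have "(\<Sum>v\<in>C. ?u v *\<^sub>R v) = (\<Sum>v\<in>C. if v \<in> W then bary C' x v *\<^sub>R v else 0)"
    by (intro sum.cong) auto
  then have "sum ?u C = 1" "(\<Sum>v\<in>C. ?u v *\<^sub>R v) = x"
    using s fin W by (simp_all add: sum.If_cases Int_absorb1)
  from bary_unique[OF C(1) this, of v] show ?thesis using v W by auto
qed


section \<open>Lagrange interpolation on a simplex\<close>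

definition lag_idx :: "'a set \<Rightarrow> nat \<Rightarrow> ('a \<Rightarrow> nat) set" where
  "lag_idx C k = {m. (\<forall>v. v \<notin> C \<longrightarrow> m v = 0) \<and> sum m C = k}"

definition lag_pt :: "'a::euclidean_space set \<Rightarrow> nat \<Rightarrow> ('a \<Rightarrow> nat) \<Rightarrow> 'a" where
  "lag_pt C k m = (\<Sum>v\<in>C. (real (m v) / real k) *\<^sub>R v)"

text \<open>Up to normalisation the Silvester polynomial of the principal lattice: the factor with
  index \<open>i\<close> vanishes where the coordinate of \<open>v\<close> equals i / k.\<close>

definition newton :: "'a::euclidean_space set \<Rightarrow> nat \<Rightarrow> ('a \<Rightarrow> nat) \<Rightarrow> 'a \<Rightarrow> real" where
  "newton C k m x = (\<Prod>v\<in>C. \<Prod>i<m v. real k * bary C x v - real i)"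

definition lagb :: "'a::euclidean_space set \<Rightarrow> nat \<Rightarrow> ('a \<Rightarrow> nat) \<Rightarrow> 'a \<Rightarrow> real" where
  "lagb C k m x = newton C k m x / newton C k m (lag_pt C k m)"

definition interp :: "'a::euclidean_space set \<Rightarrow> nat \<Rightarrow> ('a \<Rightarrow> real) \<Rightarrow> 'a \<Rightarrow> real" where
  "interp C k g x = (\<Sum>m\<in>lag_idx C k. g (lag_pt C k m) * lagb C k m x)"

lemma finite_lag_idx: "finite C \<Longrightarrow> finite (lag_idx C k)"
proof (rule finite_subset)
  assume C: "finite C"
  show "lag_idx C k \<subseteq> {e. \<forall>b. (b \<in> C \<longrightarrow> e b \<in> {..k}) \<and> (b \<notin> C \<longrightarrow> e b = 0)}"
  proof
    fix e assume e: "e \<in> lag_idx C k"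
    have "e b \<le> k" if "b \<in> C" for b
      using e member_le_sum[OF that, of e] C by (auto simp: lag_idx_def)
    then show "e \<in> {e. \<forall>b. (b \<in> C \<longrightarrow> e b \<in> {..k}) \<and> (b \<notin> C \<longrightarrow> e b = 0)}"
      using e by (auto simp: lag_idx_def)
  qed
  show "finite {e. \<forall>b. (b \<in> C \<longrightarrow> e b \<in> {..k}) \<and> (b \<notin> C \<longrightarrow> e b = 0)}"
    using C by (intro finite_set_of_finite_funs) auto
qed

lemma bary_lag_pt:
  assumes C: "affine_frame C" and m: "m \<in> lag_idx C k" and k: "k \<ge> 1" and v: "v \<in> C"
  shows "bary C (lag_pt C k m) v = real (m v) / real k"
proof (rule bary_unique[OF C _ _ v])
  have "(\<Sum>v\<in>C. real (m v)) = real k" using m by (simp add: lag_idx_def flip: of_nat_sum)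
  then show "(\<Sum>v\<in>C. real (m v) / real k) = 1" using k by (simp flip: sum_divide_distrib)
qed (simp add: lag_pt_def)

lemma lag_pt_in:
  assumes C: "affine_frame C" and W: "W \<subseteq> C" and m: "m \<in> lag_idx C k" and k: "k \<ge> 1"
    and "\<And>v. v \<in> C - W \<Longrightarrow> m v = 0"
  shows "lag_pt C k m \<in> convex hull W"
  unfolding in_convex_hull_bary[OF C W] using bary_lag_pt[OF C m k] assms(5) by auto

lemma lagrange_points_simplex:
  assumes C: "affine_frame C"
  shows "lagrange_points k (convex hull C) = lag_pt C k ` lag_idx C k"
proof -
  have ext: "{v. v extreme_point_of (convex hull C)} = C"
    using C extreme_point_of_convex_hull_affine_independent by (auto simp: affine_frame_def)
  show ?thesis unfolding lagrange_points_def ext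
  proof (intro set_eqI iffI)
    fix x assume "x \<in> {\<Sum>v\<in>C. (real (m v) / real k) *\<^sub>R v |m. sum m C = k}"
    then obtain m where m: "sum m C = k" "x = (\<Sum>v\<in>C. (real (m v) / real k) *\<^sub>R v)" by auto
    let ?m = "\<lambda>v. if v \<in> C then m v else 0"
    have "?m \<in> lag_idx C k" using m by (auto simp: lag_idx_def)
    moreover have "x = lag_pt C k ?m" unfolding lag_pt_def m by (intro sum.cong) auto
    ultimately show "x \<in> lag_pt C k ` lag_idx C k" by blast
  qed (auto simp: lag_pt_def lag_idx_def)
qed

text \<open>Two different indices of equal sum have a vertex at which \<open>m'\<close> is the
  smaller one; the factor with i = \<open>m' v\<close> vanishes at the lattice point of
  \<open>m'\<close>.\<close>

lemma newton_at_pt: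
  assumes C: "affine_frame C" and m: "m \<in> lag_idx C k" and m': "m' \<in> lag_idx C k" and k: "k \<ge> 1"
    and "m \<noteq> m'"
  shows "newton C k m (lag_pt C k m') = 0"
proof -
  have fin: "finite C" using C by (rule affine_frame_finite)
  have "\<exists>v\<in>C. m' v < m v"
  proof (rule ccontr)
    assume "\<not> ?thesis"
    then have le: "m v \<le> m' v" if "v \<in> C" for v using that by force
    have "m v = m' v" for v
    proof (cases "v \<in> C")
      case True
      have "sum m C = sum m' C" using m m' by (simp add: lag_idx_def)
      then show ?thesis using sum_mono_inv[of m C m' v] le True fin by auto
    qed (use m m' in \<open>auto simp: lag_idx_def\<close>)
    then show False using assms(5) by auto
  qed
  then obtain v where v: "v \<in> C" "m' v < m v" by auto
  have "(\<Prod>i<m v. real k * bary C (lag_pt C k m') v - real i) = 0"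
    using v k by (intro prod_zero bexI[of _ "m' v"]) (auto simp: bary_lag_pt[OF C m' k])
  then show ?thesis unfolding newton_def using v fin by (intro prod_zero) auto
qed

lemma newton_at_own_pt:
  assumes C: "affine_frame C" and m: "m \<in> lag_idx C k" and k: "k \<ge> 1"
  shows "newton C k m (lag_pt C k m) \<ge> 1"
  unfolding newton_def
proof (intro prod_ge_1)
  fix v i assume "v \<in> C" "i \<in> {..<m v}"
  then show "1 \<le> real k * bary C (lag_pt C k m) v - real i"
    using k by (simp add: bary_lag_pt[OF C m k])
qed

lemma lagb_at_pt:
  assumes C: "affine_frame C" and "m \<in> lag_idx C k" "m' \<in> lag_idx C k" "k \<ge> 1"
  shows "lagb C k m (lag_pt C k m') = (if m = m' then 1 else 0)"
  using newton_at_pt[OF assms] newton_at_own_pt[OF assms(1,2,4)] by (auto simp: lagb_def)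

lemma lagb_polys:
  assumes C: "affine_frame C" and m: "m \<in> lag_idx C k" shows "lagb C k m \<in> polys k"
proof -
  have "(\<lambda>x. real k * bary C x v - real i) \<in> polys 1" if "v \<in> C" for v i
    using polys_add[OF polys_scale[OF bary_polys[OF C that], of "real k"] polys_const[of "- real i"]] by simp
  then have "(\<lambda>x. \<Prod>v\<in>C. \<Prod>i<m v. real k * bary C x v - real i) \<in> polys (\<Sum>v\<in>C. \<Sum>i<m v. 1)"
    by (intro polys_prod)
  then have "newton C k m \<in> polys k"
    using m by (simp add: newton_def[abs_def] lag_idx_def)
  from polys_scale[OF this, of "inverse (newton C k m (lag_pt C k m))"]
  show ?thesis by (simp add: lagb_def[abs_def] field_simps)
qed

lemma interp_polys: "affine_frame C \<Longrightarrow> interp C k g \<in> polys k"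
  unfolding interp_def[abs_def] by (intro polys_sum polys_scale lagb_polys)

lemma interp_at_pt:
  assumes C: "affine_frame C" and m: "m \<in> lag_idx C k" and k: "k \<ge> 1"
  shows "interp C k g (lag_pt C k m) = g (lag_pt C k m)"
proof -
  have "interp C k g (lag_pt C k m) = (\<Sum>m'\<in>lag_idx C k. if m' = m then g (lag_pt C k m) else 0)"
    unfolding interp_def by (intro sum.cong) (auto simp: lagb_at_pt[OF C _ m k])
  then show ?thesis using m finite_lag_idx[OF affine_frame_finite[OF C]] by simp
qed

text \<open>There are k factors, each of modulus at most k on the simplex, and the normalising value
  is at least one. The bound is independent of the shape of the simplex.\<close>

lemma abs_lagb_le:
  assumes C: "affine_frame C" and m: "m \<in> lag_idx C k" and k: "k \<ge> 1" and x: "x \<in> convex hull C"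
  shows "\<bar>lagb C k m x\<bar> \<le> real k ^ k"
proof -
  have fin: "finite C" using C by (rule affine_frame_finite)
  have "\<bar>real k * bary C x v - real i\<bar> \<le> real k" if v: "v \<in> C" and i: "i < m v" for v i
  proof -
    have "m v \<le> k" using m member_le_sum[OF v, of m] fin by (auto simp: lag_idx_def)
    moreover have "0 \<le> bary C x v" "bary C x v \<le> 1"
      using x v in_simplex_bary[OF C] bary_le_1[OF C] by auto
    moreover from this have "0 \<le> real k * bary C x v" "real k * bary C x v \<le> real k"
      by (auto simp: mult_left_le)
    moreover have "real i \<le> real k" using i \<open>m v \<le> k\<close> by simp
    ultimately show ?thesis by linarith
  qed
  then have "\<bar>newton C k m x\<bar> \<le> (\<Prod>v\<in>C. \<Prod>i<m v. real k)"
    unfolding newton_def abs_prod by (intro prod_mono conjI prod_nonneg) auto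
  also have "\<dots> = real k ^ k"
    using m by (simp add: lag_idx_def flip: power_sum)
  finally show ?thesis
    using newton_at_own_pt[OF C m k] mult_left_mono[of 1 "newton C k m (lag_pt C k m)" "real k ^ k"]
    by (simp add: lagb_def divide_le_eq)
qed

text \<open>
  Unisolvence: \<open>k bary\<^sub>w N\<^sub>m = N\<^bsub>m + e\<^sub>w\<^esub> + m\<^sub>w N\<^sub>m\<close> and, since barycentric coordinates sum to one,
  \<open>(k - |m|) N\<^sub>m = (\<Sum>w. N\<^bsub>m + e\<^sub>w\<^esub>)\<close>, so products of at most \<open>k\<close> affine functions are
  combinations of the \<open>N\<^sub>m\<close> with \<open>|m| = k\<close>.
\<close>

definition newton_span :: "'a::euclidean_space set \<Rightarrow> nat \<Rightarrow> nat \<Rightarrow> ('a \<Rightarrow> real) set" where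
  "newton_span C k j = {f. \<exists>c. f = (\<lambda>x. \<Sum>m\<in>lag_idx C j. c m * newton C k m x)}"

lemma newton_span_zero: "(\<lambda>x. 0) \<in> newton_span C k j"
  unfolding newton_span_def by (auto intro!: exI[of _ "\<lambda>_. 0"])

lemma newton_span_add:
  assumes "f \<in> newton_span C k j" "g \<in> newton_span C k j"
  shows "(\<lambda>x. f x + g x) \<in> newton_span C k j"
proof -
  obtain c c' where "f = (\<lambda>x. \<Sum>m\<in>lag_idx C j. c m * newton C k m x)"
    "g = (\<lambda>x. \<Sum>m\<in>lag_idx C j. c' m * newton C k m x)"
    using assms unfolding newton_span_def by auto
  then show ?thesis unfolding newton_span_def
    by (auto intro!: exI[of _ "\<lambda>m. c m + c' m"] simp: distrib_right sum.distrib)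
qed

lemma newton_span_scale:
  assumes "f \<in> newton_span C k j" shows "(\<lambda>x. a * f x) \<in> newton_span C k j"
proof -
  obtain c where "f = (\<lambda>x. \<Sum>m\<in>lag_idx C j. c m * newton C k m x)"
    using assms unfolding newton_span_def by auto
  then show ?thesis unfolding newton_span_def
    by (auto intro!: exI[of _ "\<lambda>m. a * c m"] simp: mult.assoc sum_distrib_left)
qed

lemma newton_span_sum:
  "(\<And>i. i \<in> I \<Longrightarrow> f i \<in> newton_span C k j) \<Longrightarrow> (\<lambda>x. \<Sum>i\<in>I. f i x) \<in> newton_span C k j"
  by (induction I rule: infinite_finite_induct) (auto intro: newton_span_zero newton_span_add)

lemma newton_in_span:
  assumes "finite C" "m \<in> lag_idx C j" shows "newton C k m \<in> newton_span C k j"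
proof -
  have "(\<Sum>m'\<in>lag_idx C j. (if m' = m then 1 else 0) * newton C k m' x) =
      (\<Sum>m'\<in>lag_idx C j. if m' = m then newton C k m' x else 0)" for x
    by (intro sum.cong) auto
  moreover have "(\<Sum>m'\<in>lag_idx C j. if m' = m then newton C k m' x else 0) = newton C k m x" for x
    using sum.delta[OF finite_lag_idx[OF assms(1)], where a=m and b="\<lambda>m'. newton C k m' x"] assms(2)
    by simp
  ultimately show ?thesis unfolding newton_span_def
    by (intro CollectI exI[of _ "\<lambda>m'. if m' = m then 1 else 0"] ext) simp
qed

lemma lag_idx_Suc:
  assumes "finite C" "w \<in> C" "m \<in> lag_idx C j" shows "m(w := Suc (m w)) \<in> lag_idx C (Suc j)"
  using assms sum.remove[OF assms(1,2), of m] sum.remove[OF assms(1,2), of "m(w := Suc (m w))"]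
  by (auto simp: lag_idx_def)

lemma newton_Suc:
  assumes "finite C" "w \<in> C"
  shows "newton C k (m(w := Suc (m w))) x = newton C k m x * (real k * bary C x w - real (m w))"
proof -
  have "(\<Prod>v\<in>C - {w}. \<Prod>i<(m(w := Suc (m w))) v. real k * bary C x v - real i) =
      (\<Prod>v\<in>C - {w}. \<Prod>i<m v. real k * bary C x v - real i)"
    by (intro prod.cong) auto
  then show ?thesis
    unfolding newton_def by (subst (1 2) prod.remove[OF assms]) (simp add: lessThan_Suc)
qed

lemma newton_span_Suc:
  assumes C: "affine_frame C" and f: "f \<in> newton_span C k j" and j: "j < k"
  shows "f \<in> newton_span C k (Suc j)"
proof -
  have fin: "finite C" using C by (rule affine_frame_finite)
  have N: "newton C k m \<in> newton_span C k (Suc j)" if m: "m \<in> lag_idx C j" for m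
  proof -
    have "(\<Sum>w\<in>C. newton C k (m(w := Suc (m w))) x) = (real k - real j) * newton C k m x" for x
    proof -
      have "(\<Sum>w\<in>C. newton C k (m(w := Suc (m w))) x) =
          (\<Sum>w\<in>C. newton C k m x * (real k * bary C x w - real (m w)))"
        by (intro sum.cong refl newton_Suc fin)
      also have "\<dots> = newton C k m x * (real k * (\<Sum>w\<in>C. bary C x w) - real (\<Sum>w\<in>C. m w))"
        by (simp add: sum_distrib_left sum_subtractf right_diff_distrib)
      moreover have "(\<Sum>w\<in>C. m w) = j" using m by (simp add: lag_idx_def)
      ultimately show ?thesis by (simp only: bary_sum[OF C]) simp
    qed
    then have "newton C k m = (\<lambda>x. inverse (real k - real j) * (\<Sum>w\<in>C. newton C k (m(w := Suc (m w))) x))"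
      using j by (auto simp: fun_eq_iff field_simps)
    moreover have "\<dots> \<in> newton_span C k (Suc j)"
      by (intro newton_span_scale newton_span_sum newton_in_span fin lag_idx_Suc m)
    ultimately show ?thesis by simp
  qed
  obtain c where "f = (\<lambda>x. \<Sum>m\<in>lag_idx C j. c m * newton C k m x)"
    using f unfolding newton_span_def by auto
  then show ?thesis by (auto intro!: newton_span_sum newton_span_scale N)
qed

lemma newton_span_inner:
  assumes C: "affine_frame C" and f: "f \<in> newton_span C k j" and j: "j < k"
  shows "(\<lambda>x. (x \<bullet> b) * f x) \<in> newton_span C k (Suc j)"
proof -
  have fin: "finite C" using C by (rule affine_frame_finite)
  have N: "(\<lambda>x. bary C x w * newton C k m x) \<in> newton_span C k (Suc j)"
    if m: "m \<in> lag_idx C j" and w: "w \<in> C" for m w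
  proof -
    have "(\<lambda>x. bary C x w * newton C k m x) =
        (\<lambda>x. inverse (real k) * (newton C k (m(w := Suc (m w))) x + real (m w) * newton C k m x))"
      using j by (auto simp: fun_eq_iff newton_Suc[OF fin w] field_simps)
    moreover have "\<dots> \<in> newton_span C k (Suc j)"
      by (intro newton_span_scale newton_span_add newton_in_span fin lag_idx_Suc m w
          newton_span_Suc[OF C newton_in_span[OF fin m] j])
    ultimately show ?thesis by simp
  qed
  obtain c where c: "f = (\<lambda>x. \<Sum>m\<in>lag_idx C j. c m * newton C k m x)"
    using f unfolding newton_span_def by auto
  have "(\<lambda>x. bary C x w * f x) = (\<lambda>x. \<Sum>m\<in>lag_idx C j. c m * (bary C x w * newton C k m x))" for w
    unfolding c by (simp add: sum_distrib_left mult.left_commute)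
  then have *: "(\<lambda>x. bary C x w * f x) \<in> newton_span C k (Suc j)" if "w \<in> C" for w
    by (auto intro!: newton_span_sum newton_span_scale N that)
  have coord: "x \<bullet> b = (\<Sum>w\<in>C. (w \<bullet> b) * bary C x w)" for x
    using arg_cong[OF bary_comb[OF C, of x], of "\<lambda>y. y \<bullet> b"] by (simp add: inner_sum_left mult.commute)
  have "(\<lambda>x. (x \<bullet> b) * f x) = (\<lambda>x. \<Sum>w\<in>C. (w \<bullet> b) * (bary C x w * f x))"
    by (intro ext) (subst (1) coord, simp add: sum_distrib_right mult.assoc)
  then show ?thesis by (auto intro!: newton_span_sum newton_span_scale *)
qed

lemma newton_span_power:
  assumes "affine_frame C" "f \<in> newton_span C k j" "j + n \<le> k"
  shows "(\<lambda>x. (x \<bullet> b) ^ n * f x) \<in> newton_span C k (j + n)"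
  using assms(3)
proof (induction n)
  case (Suc n)
  then have "(\<lambda>x. (x \<bullet> b) * ((x \<bullet> b) ^ n * f x)) \<in> newton_span C k (Suc (j + n))"
    by (intro newton_span_inner[OF assms(1)]) auto
  then show ?case by (simp add: mult.assoc)
qed (use assms(2) in simp)

lemma polys_newton_span:
  assumes C: "affine_frame C" and p: "p \<in> polys k" shows "p \<in> newton_span C k k"
proof -
  have fin: "finite C" using C by (rule affine_frame_finite)
  have "newton C k (\<lambda>_. 0) \<in> newton_span C k 0" by (intro newton_in_span fin) (auto simp: lag_idx_def)
  then have one: "(\<lambda>x. 1) \<in> newton_span C k 0" by (simp add: newton_def[abs_def])
  have prod: "(\<lambda>x. \<Prod>b\<in>B. (x \<bullet> b) ^ e b) \<in> newton_span C k (sum e B)"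
    if "finite B" "sum e B \<le> k" for B and e :: "'a \<Rightarrow> nat"
    using that
  proof (induction B rule: finite_induct)
    case (insert b B)
    then have "(\<lambda>x. (x \<bullet> b) ^ e b * (\<Prod>b\<in>B. (x \<bullet> b) ^ e b)) \<in> newton_span C k (sum e B + e b)"
      by (intro newton_span_power[OF C]) auto
    then show ?case using insert.hyps by (simp add: add.commute)
  qed (use one in simp)
  have lift: "f \<in> newton_span C k (j + i)" if "f \<in> newton_span C k j" "j + i \<le> k" for f j i
    using that(2)
  proof (induction i)
    case (Suc i)
    then show ?case using newton_span_Suc[OF C, of f k "j + i"] by simp
  qed (use that in simp)
  obtain c where pe: "p = (\<lambda>x. \<Sum>e\<in>multi_indices k. c e * (\<Prod>b\<in>Basis. (x \<bullet> b) ^ e b))"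
    using p unfolding polys_def by auto
  have "(\<lambda>x. \<Prod>b\<in>Basis. (x \<bullet> b) ^ e b) \<in> newton_span C k k"
    if "e \<in> multi_indices k" for e :: "'a \<Rightarrow> nat"
    using lift[OF prod[OF finite_Basis], of e "k - sum e Basis"] that by (simp add: multi_indices_def)
  then show ?thesis unfolding pe by (intro newton_span_sum newton_span_scale)
qed

text \<open>After expansion in Newton products of full degree the coefficients are read off at the
  lattice points, because each product vanishes at all of them but its own.\<close>

theorem interp_eq:
  assumes C: "affine_frame C" and p: "p \<in> polys k" and k: "k \<ge> 1"
  shows "p x = interp C k p x"
proof -
  have fin: "finite C" using C by (rule affine_frame_finite)
  obtain c where c: "p = (\<lambda>x. \<Sum>m\<in>lag_idx C k. c m * newton C k m x)"
    using polys_newton_span[OF C p] unfolding newton_span_def by auto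
  have "p (lag_pt C k m) = c m * newton C k m (lag_pt C k m)" if m: "m \<in> lag_idx C k" for m
  proof -
    have "p (lag_pt C k m) = (\<Sum>m'\<in>lag_idx C k. if m' = m then c m * newton C k m (lag_pt C k m) else 0)"
      unfolding c by (intro sum.cong) (auto simp: newton_at_pt[OF C _ m k])
    then show ?thesis using m finite_lag_idx[OF fin] by simp
  qed
  then have "interp C k p x = (\<Sum>m\<in>lag_idx C k. c m * newton C k m x)"
    unfolding interp_def lagb_def using newton_at_own_pt[OF C _ k] by (intro sum.cong) force+
  then show ?thesis unfolding c by simp
qed

corollary polys_eqI:
  assumes "affine_frame C" "k \<ge> 1" "p \<in> polys k" "q \<in> polys k"
    and "\<And>l. l \<in> lagrange_points k (convex hull C) \<Longrightarrow> p l = q l"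
  shows "p = q"
proof
  fix x
  have "interp C k p x = interp C k q x"
    unfolding interp_def by (intro sum.cong) (auto simp: assms(5) lagrange_points_simplex[OF assms(1)])
  then show "p x = q x"
    using interp_eq[OF assms(1,3,2)] interp_eq[OF assms(1,4,2)] by simp
qed

lemma lagrange_points_subset:
  assumes "affine_frame C" "k \<ge> 1"
  shows "lagrange_points k (convex hull C) \<subseteq> convex hull C"
  using lag_pt_in[OF assms(1) order_refl _ assms(2)] by (auto simp: lagrange_points_simplex[OF assms(1)])

corollary polys_eq_on_simplex:
  assumes "affine_frame C" "k \<ge> 1" "p \<in> polys k" "q \<in> polys k"
    and "\<And>x. x \<in> convex hull C \<Longrightarrow> p x = q x"
  shows "p = q"
  using assms lagrange_points_subset[OF assms(1,2)] by (intro polys_eqI[OF assms(1-4)]) auto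

text \<open>An index that charges a vertex outside \<open>W\<close> contributes the factor with i =
  0, which is k times a vanishing coordinate. The surviving terms involve only lattice points and
  coordinates of the face, so the interpolants of neighbouring elements agree there.\<close>

lemma interp_restrict:
  assumes C: "affine_frame C" "affine_frame C'" and W: "W \<subseteq> C" "W \<subseteq> C'" and k: "k \<ge> 1"
    and x: "x \<in> convex hull W"
  shows "interp C k g x = interp C' k g x"
proof -
  have face: "interp D k g x = (\<Sum>m\<in>lag_idx W k. g (lag_pt W k m) *
      ((\<Prod>v\<in>W. \<Prod>i<m v. real k * bary D x v - real i) /
       (\<Prod>v\<in>W. \<Prod>i<m v. real (m v) - real i)))"
    if D: "affine_frame D" and WD: "W \<subseteq> D" for D
  proof -
    have fin: "finite D" using D by (rule affine_frame_finite)
    have sub: "lag_idx W k \<subseteq> lag_idx D k"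
    proof
      fix m assume m: "m \<in> lag_idx W k"
      then have "sum m D = sum m W"
        by (intro sum.mono_neutral_right fin WD) (auto simp: lag_idx_def)
      then show "m \<in> lag_idx D k" using m WD by (auto simp: lag_idx_def)
    qed
    have 0: "newton D k m x = 0" if "m \<in> lag_idx D k - lag_idx W k" for m
    proof -
      have "\<exists>v\<in>D - W. m v \<noteq> 0"
      proof (rule ccontr)
        assume a: "\<not> ?thesis"
        then have "sum m D = sum m W" by (intro sum.mono_neutral_right fin WD) auto
        moreover have "m v = 0" if "v \<notin> W" for v
          using that a \<open>m \<in> lag_idx D k - lag_idx W k\<close> by (cases "v \<in> D") (auto simp: lag_idx_def)
        ultimately have "m \<in> lag_idx W k"
          using \<open>m \<in> lag_idx D k - lag_idx W k\<close> by (simp add: lag_idx_def)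
        then show False using \<open>m \<in> lag_idx D k - lag_idx W k\<close> by simp
      qed
      then obtain v where v: "v \<in> D" "v \<notin> W" "m v > 0" by auto
      then have "bary D x v = 0" using x in_convex_hull_bary[OF D WD] by blast
      then have "(\<Prod>i<m v. real k * bary D x v - real i) = 0"
        using v by (intro prod_zero bexI[of _ 0]) auto
      then show ?thesis unfolding newton_def using v fin by (intro prod_zero) auto
    qed
    have "interp D k g x = (\<Sum>m\<in>lag_idx W k. g (lag_pt D k m) * lagb D k m x)"
      unfolding interp_def using 0
      by (intro sum.mono_neutral_right finite_lag_idx fin sub) (auto simp: lagb_def)
    also have "\<dots> = (\<Sum>m\<in>lag_idx W k. g (lag_pt W k m) *
      ((\<Prod>v\<in>W. \<Prod>i<m v. real k * bary D x v - real i) /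
       (\<Prod>v\<in>W. \<Prod>i<m v. real (m v) - real i)))"
    proof (intro sum.cong refl)
      fix m assume m: "m \<in> lag_idx W k"
      then have z: "m v = 0" if "v \<in> D - W" for v using that by (auto simp: lag_idx_def)
      have "lag_pt D k m = lag_pt W k m"
        unfolding lag_pt_def using z by (intro sum.mono_neutral_right fin WD) auto
      moreover have "newton D k m y = (\<Prod>v\<in>W. \<Prod>i<m v. real k * bary D y v - real i)" for y
        unfolding newton_def using z by (intro prod.mono_neutral_right fin WD) auto
      moreover have "(\<Prod>v\<in>W. \<Prod>i<m v. real k * bary D (lag_pt D k m) v - real i) =
          (\<Prod>v\<in>W. \<Prod>i<m v. real (m v) - real i)"
        using k bary_lag_pt[OF D subsetD[OF sub m] k] subsetD[OF WD] by (intro prod.cong refl) simp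
      ultimately show "g (lag_pt D k m) * lagb D k m x = g (lag_pt W k m) *
        ((\<Prod>v\<in>W. \<Prod>i<m v. real k * bary D x v - real i) /
         (\<Prod>v\<in>W. \<Prod>i<m v. real (m v) - real i))"
        unfolding lagb_def by simp
    qed
    finally show ?thesis .
  qed
  show ?thesis unfolding face[OF C(1) W(1)] face[OF C(2) W(2)]
    using bary_restrict[OF C W x] by (intro sum.cong refl) (simp cong: prod.cong)
qed

section \<open>Scaled polynomial estimates\<close>

text \<open>Induction by completing the square: eliminating one variable leaves the Schur complement
  \<open>B'\<close>, which is again positive definite. It serves as norm equivalence in finite
  dimension.\<close>

lemma posdef_form_bound:
  fixes B :: "'b \<Rightarrow> 'b \<Rightarrow> real"
  assumes "finite I" and "\<And>i j. i \<in> I \<Longrightarrow> j \<in> I \<Longrightarrow> B i j = B j i"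
    and "\<And>c. (\<exists>i\<in>I. c i \<noteq> 0) \<Longrightarrow> (\<Sum>i\<in>I. \<Sum>j\<in>I. c i * c j * B i j) > 0"
  shows "\<exists>\<delta>>0. \<forall>c. \<delta> * (\<Sum>i\<in>I. (c i)\<^sup>2) \<le> (\<Sum>i\<in>I. \<Sum>j\<in>I. c i * c j * B i j)"
  using assms
proof (induction I arbitrary: B rule: finite_induct)
  case empty
  show ?case by (intro exI[of _ 1]) simp
next
  case (insert a I)
  define Q where "Q c = (\<Sum>i\<in>insert a I. \<Sum>j\<in>insert a I. c i * c j * B i j)" for c
  have "Q (\<lambda>i. if i = a then 1 else 0) > 0"
    unfolding Q_def by (rule insert.prems(2)) auto
  moreover have "Q (\<lambda>i. if i = a then 1 else 0) = B a a"
    unfolding Q_def using insert.hyps by (simp add: sum.neutral)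
  ultimately have Baa: "B a a > 0" by simp
  define \<beta> where "\<beta> i = B a i / B a a" for i
  define B' where "B' i j = B i j - B a a * \<beta> i * \<beta> j" for i j
  define s where "s c = (\<Sum>i\<in>I. \<beta> i * c i)" for c
  have Q: "Q c = B a a * (c a + s c)\<^sup>2 + (\<Sum>i\<in>I. \<Sum>j\<in>I. c i * c j * B' i j)" for c
  proof -
    have "Q c = c a * c a * B a a + (\<Sum>j\<in>I. c a * c j * B a j) + (\<Sum>i\<in>I. c i * c a * B i a)
        + (\<Sum>i\<in>I. \<Sum>j\<in>I. c i * c j * B i j)"
      unfolding Q_def using insert.hyps by (simp add: sum.distrib)
    also have "(\<Sum>i\<in>I. c i * c a * B i a) = (\<Sum>j\<in>I. c a * c j * B a j)"
      using insert.prems(1) by (intro sum.cong) auto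
    also have "(\<Sum>j\<in>I. c a * c j * B a j) = c a * B a a * s c"
      unfolding s_def \<beta>_def sum_distrib_left using Baa by (intro sum.cong) auto
    also have "(\<Sum>i\<in>I. \<Sum>j\<in>I. c i * c j * B i j) =
        (\<Sum>i\<in>I. \<Sum>j\<in>I. c i * c j * B' i j) + (\<Sum>i\<in>I. \<Sum>j\<in>I. B a a * ((\<beta> i * c i) * (\<beta> j * c j)))"
      unfolding sum.distrib[symmetric] by (intro sum.cong refl) (simp add: B'_def algebra_simps)
    also have "(\<Sum>i\<in>I. \<Sum>j\<in>I. B a a * ((\<beta> i * c i) * (\<beta> j * c j))) = B a a * (s c)\<^sup>2"
      unfolding s_def power2_eq_square sum_product by (simp add: sum_distrib_left)
    finally show ?thesis by (simp add: power2_eq_square algebra_simps)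
  qed
  have "\<exists>\<delta>>0. \<forall>c. \<delta> * (\<Sum>i\<in>I. (c i)\<^sup>2) \<le> (\<Sum>i\<in>I. \<Sum>j\<in>I. c i * c j * B' i j)"
  proof (rule insert.IH)
    show "B' i j = B' j i" if "i \<in> I" "j \<in> I" for i j
      using that insert.prems(1) by (simp add: B'_def)
    fix c :: "'b \<Rightarrow> real" assume nz: "\<exists>i\<in>I. c i \<noteq> 0"
    \<comment> \<open>The value of the eliminated variable that makes the square vanish, so that the
      full form at \<open>c'\<close> equals the Schur complement at \<open>c\<close>.\<close>
    define c' where "c' = c(a := - s c)"
    have eq: "c' i = c i" if "i \<in> I" for i using that insert.hyps by (auto simp: c'_def)
    have "s c' = s c" unfolding s_def by (intro sum.cong) (auto simp: eq)
    then have "Q c' = (\<Sum>i\<in>I. \<Sum>j\<in>I. c i * c j * B' i j)"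
      unfolding Q by (simp add: eq) (simp add: c'_def)
    moreover have "Q c' > 0" unfolding Q_def
      by (rule insert.prems(2)) (use nz eq in auto)
    ultimately show "(\<Sum>i\<in>I. \<Sum>j\<in>I. c i * c j * B' i j) > 0" by simp
  qed
  then obtain \<delta> where \<delta>: "\<delta> > 0"
    "\<And>c. \<delta> * (\<Sum>i\<in>I. (c i)\<^sup>2) \<le> (\<Sum>i\<in>I. \<Sum>j\<in>I. c i * c j * B' i j)" by auto
  define M where "M = (\<Sum>i\<in>I. (\<beta> i)\<^sup>2)"
  have M: "M \<ge> 0" by (simp add: M_def sum_nonneg)
  \<comment> \<open>From (c a)^2 <= 2 (c a + s)^2 + 2 s^2, s^2 <= M S and S <= R / \<delta>: the
    first summand pays for the square, the second for the Schur complement part.\<close>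
  define K where "K = 2 / B a a + (2 * M + 1) / \<delta>"
  have K: "K > 0" using Baa \<delta>(1) M by (simp add: K_def add_pos_pos)
  have "(\<Sum>i\<in>insert a I. (c i)\<^sup>2) \<le> K * Q c" for c
  proof -
    define S where "S = (\<Sum>i\<in>I. (c i)\<^sup>2)"
    have S: "S \<ge> 0" by (simp add: S_def sum_nonneg)
    define R where "R = (\<Sum>i\<in>I. \<Sum>j\<in>I. c i * c j * B' i j)"
    have R: "\<delta> * S \<le> R" using \<delta>(2) by (simp add: R_def S_def)
    have "(s c)\<^sup>2 \<le> M * S"
      unfolding s_def M_def S_def by (rule Cauchy_Schwarz_ineq_sum)
    moreover have "(c a)\<^sup>2 \<le> 2 * (c a + s c)\<^sup>2 + 2 * (s c)\<^sup>2"
      using zero_le_power2[of "c a + 2 * s c"] by (simp add: power2_eq_square algebra_simps)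
    ultimately have "(c a)\<^sup>2 + S \<le> 2 * (c a + s c)\<^sup>2 + (2 * M + 1) * S"
      by (simp add: algebra_simps)
    also have "S \<le> R / \<delta>" using R \<delta>(1) by (simp add: field_simps)
    then have "(2 * M + 1) * S \<le> (2 * M + 1) * (R / \<delta>)" using M by (intro mult_left_mono) auto
    finally have 1: "(c a)\<^sup>2 + S \<le> 2 * (c a + s c)\<^sup>2 + (2 * M + 1) / \<delta> * R" by simp
    have "0 \<le> \<delta> * S" using S \<delta>(1) by simp
    then have "R \<ge> 0" using R by linarith
    then have "0 \<le> 2 / B a a * R" "0 \<le> (2 * M + 1) / \<delta> * (B a a * (c a + s c)\<^sup>2)"
      using Baa M \<delta>(1) by simp_all
    moreover have "2 / B a a * (B a a * (c a + s c)\<^sup>2) = 2 * (c a + s c)\<^sup>2"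
      using Baa by simp
    ultimately have "2 * (c a + s c)\<^sup>2 + (2 * M + 1) / \<delta> * R \<le> K * (B a a * (c a + s c)\<^sup>2 + R)"
      unfolding K_def distrib_right distrib_left by linarith
    then show ?thesis using 1 insert.hyps unfolding Q[of c] R_def S_def by simp
  qed
  then have "1 / K * (\<Sum>i\<in>insert a I. (c i)\<^sup>2) \<le> Q c" for c
    using K by (simp add: field_simps)
  then show ?case unfolding Q_def using K by (intro exI[of _ "1 / K"]) simp
qed

lemma set_integrable_bounded:
  fixes f :: "'a::euclidean_space \<Rightarrow> real"
  assumes M: "sets M = sets borel" and S: "S \<in> sets borel" "emeasure M S < \<infinity>"
    and f: "continuous_on S f" "bounded (f ` S)"
  shows "set_integrable M S f"
proof -
  obtain B where B: "\<And>x. x \<in> S \<Longrightarrow> norm (f x) \<le> B" using f(2) by (auto simp: bounded_iff)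
  have "(\<lambda>x. indicator S x *\<^sub>R f x) \<in> borel_measurable M"
    using borel_measurable_continuous_on_indicator[OF S(1) f(1)] measurable_cong_sets[OF M refl] by blast
  then show ?thesis
    unfolding set_integrable_def
    by (intro integrableI_bounded_set[where A=S and B=B])
      (use S B M in \<open>auto simp: indicator_def\<close>)
qed

lemma set_integrable_compact:
  fixes f :: "'a::euclidean_space \<Rightarrow> real"
  assumes "sets M = sets borel" "compact S" "emeasure M S < \<infinity>" "continuous_on S f"
  shows "set_integrable M S f"
  using assms by (intro set_integrable_bounded compact_imp_bounded[OF compact_continuous_image])
    (simp_all add: borel_compact)

lemma lborel_integral_scale:
  fixes f :: "'a::euclidean_space \<Rightarrow> real"
  assumes "r > 0" "f \<in> borel_measurable borel"
  shows "(\<integral>x. f x \<partial>lborel) = r ^ DIM('a) * (\<integral>y. f (z + r *\<^sub>R y) \<partial>lborel)"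
proof -
  have "(\<integral>x. f x \<partial>lborel) =
      (\<integral>x. f x \<partial>density (distr lborel borel (\<lambda>x. z + r *\<^sub>R x)) (\<lambda>_. \<bar>r\<bar> ^ DIM('a)))"
    using lborel_affine[of r z] assms(1) by simp
  also have "\<dots> = (\<integral>x. r ^ DIM('a) *\<^sub>R f x \<partial>distr lborel borel (\<lambda>x. z + r *\<^sub>R x))"
    using assms by (subst integral_density) auto
  also have "\<dots> = (\<integral>x. r ^ DIM('a) *\<^sub>R f (z + r *\<^sub>R x) \<partial>lborel)"
    using assms by (subst integral_distr) auto
  finally show ?thesis by simp
qed

lemma affine_frame_Basis: "affine_frame (insert 0 Basis :: 'a::euclidean_space set)"
proof -
  have "\<not> affine_dependent (insert 0 Basis :: 'a set)"
    using affine_dependent_iff_dependent[of 0 "Basis :: 'a set"] independent_Basis nonzero_Basis by auto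
  then show ?thesis using nonzero_Basis by (auto simp: affine_frame_def)
qed

text \<open>A cube rather than the reference simplex: it contains the lattice points of the latter
  and, scaled by r / d, fits into any ball of radius r. Elements thus need no affine map onto a
  reference element.\<close>

abbreviation ref_cube :: "'a::euclidean_space set" where
  "ref_cube \<equiv> cbox (- One) One"

lemma ref_simplex_in_cube: "convex hull (insert 0 Basis) \<subseteq> (ref_cube :: 'a::euclidean_space set)"
proof (rule hull_minimal)
  show "insert 0 Basis \<subseteq> (ref_cube :: 'a set)"
    by (auto simp: mem_box inner_Basis)
qed (rule convex_box)

lemma norm_le_ref_cube: "y \<in> (ref_cube :: 'a::euclidean_space set) \<Longrightarrow> norm y \<le> real DIM('a)"
proof -
  assume y: "y \<in> (ref_cube :: 'a set)"
  have "norm y \<le> (\<Sum>b\<in>Basis. \<bar>y \<bullet> b\<bar>)" by (rule norm_le_l1)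
  also have "\<dots> \<le> (\<Sum>b\<in>(Basis::'a set). 1)"
    using y by (intro sum_mono) (auto simp: mem_box abs_le_iff minus_le_iff)
  finally show ?thesis by simp
qed

text \<open>On polynomials that vanish at one fixed lattice point the gradient seminorm is a norm:
  zero gradient on the cube means constant, and the constant is the value at that point.\<close>

lemma ref_gradient_bound:
  assumes k: "k \<ge> 1"
  obtains \<delta> :: real and m0 where "\<delta> > 0" "m0 \<in> lag_idx (insert 0 Basis) k"
    "\<And>q :: 'a::euclidean_space \<Rightarrow> real. q \<in> polys k \<Longrightarrow> q (lag_pt (insert 0 Basis) k m0) = 0 \<Longrightarrow>
      \<delta> * (\<Sum>m\<in>lag_idx (insert 0 Basis) k. (q (lag_pt (insert 0 Basis) k m))\<^sup>2)
        \<le> set_lebesgue_integral lborel ref_cube (\<lambda>x. (norm (grad q x))\<^sup>2)"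
proof -
  let ?C = "insert 0 Basis :: 'a set"
  note C = affine_frame_Basis[where 'a='a]
  have fin: "finite (lag_idx ?C k)" by (intro finite_lag_idx) auto
  \<comment> \<open>The index of the vertex at the origin; leaving it out of \<open>I\<close>
    parametrises the polynomials that vanish there.\<close>
  define m0 :: "'a \<Rightarrow> nat" where "m0 = (\<lambda>v. if v = 0 then k else 0)"
  have m0: "m0 \<in> lag_idx ?C k"
    using nonzero_Basis by (auto simp: lag_idx_def m0_def intro!: sum.neutral)
  define I where "I = lag_idx ?C k - {m0}"
  have I: "finite I" using fin by (simp add: I_def)
  define G where "G m = grad (lagb ?C k m)" for m
  have contG: "continuous_on S (G m)" if "m \<in> I" for m S
    using continuous_grad[OF lagb_polys[OF C]] that unfolding G_def I_def
    by (auto intro: continuous_on_subset)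
  define B where "B i j = set_lebesgue_integral lborel ref_cube (\<lambda>x. G i x \<bullet> G j x)" for i j
  have cube: "emeasure lborel (ref_cube::'a set) < \<infinity>"
    using emeasure_bounded_finite[OF bounded_cbox] by (simp add: top.not_eq_extremum)
  have integrable: "set_integrable lborel ref_cube (\<lambda>x. G i x \<bullet> G j x)" if "i \<in> I" "j \<in> I" for i j
    using that cube by (intro set_integrable_compact continuous_on_inner contG) auto
  define P where "P c x = (\<Sum>m\<in>I. c m * lagb ?C k m x)" for c x
  have Pp: "P c \<in> polys k" for c
    unfolding P_def[abs_def] by (intro polys_sum polys_scale lagb_polys C) (auto simp: I_def)
  have gradP: "grad (P c) x = (\<Sum>m\<in>I. c m *\<^sub>R G m x)" for c x
  proof -
    have "grad (P c) x = (\<Sum>m\<in>I. grad (\<lambda>x. c m * lagb ?C k m x) x)"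
      unfolding P_def[abs_def]
      by (intro grad_sum[of _ _ k] polys_scale lagb_polys C) (auto simp: I_def)
    then show ?thesis unfolding G_def
      using grad_scale[OF lagb_polys[OF C]] by (auto simp: I_def intro!: sum.cong)
  qed
  have form: "set_lebesgue_integral lborel ref_cube (\<lambda>x. (norm (grad (P c) x))\<^sup>2) =
      (\<Sum>i\<in>I. \<Sum>j\<in>I. c i * c j * B i j)" for c
  proof -
    have int: "integrable lborel (\<lambda>x. c i * c j * (indicator ref_cube x *\<^sub>R (G i x \<bullet> G j x)))"
      if "i \<in> I" "j \<in> I" for i j
      by (rule integrable_mult_right) (rule integrable[OF that, unfolded set_integrable_def])
    have "(norm (grad (P c) x))\<^sup>2 = (\<Sum>i\<in>I. \<Sum>j\<in>I. c i * c j * (G i x \<bullet> G j x))" for x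
      unfolding gradP power2_norm_eq_inner
      by (subst inner_sum_left) (simp add: inner_sum_right ac_simps)
    then have "set_lebesgue_integral lborel ref_cube (\<lambda>x. (norm (grad (P c) x))\<^sup>2) =
        (\<integral>x. (\<Sum>i\<in>I. \<Sum>j\<in>I. c i * c j * (indicator ref_cube x *\<^sub>R (G i x \<bullet> G j x))) \<partial>lborel)"
      unfolding set_lebesgue_integral_def by (simp add: sum_distrib_left ac_simps)
    also have "\<dots> = (\<Sum>i\<in>I. \<integral>x. (\<Sum>j\<in>I. c i * c j * (indicator ref_cube x *\<^sub>R (G i x \<bullet> G j x))) \<partial>lborel)"
      by (rule Bochner_Integration.integral_sum) (intro Bochner_Integration.integrable_sum int)
    also have "\<dots> = (\<Sum>i\<in>I. \<Sum>j\<in>I. \<integral>x. c i * c j * (indicator ref_cube x *\<^sub>R (G i x \<bullet> G j x)) \<partial>lborel)"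
      by (intro sum.cong refl Bochner_Integration.integral_sum int)
    also have "\<dots> = (\<Sum>i\<in>I. \<Sum>j\<in>I. c i * c j * B i j)"
      unfolding B_def set_lebesgue_integral_def by (simp only: integral_mult_right_zero)
    finally show ?thesis .
  qed
  have "\<exists>\<delta>>0. \<forall>c. \<delta> * (\<Sum>i\<in>I. (c i)\<^sup>2) \<le> (\<Sum>i\<in>I. \<Sum>j\<in>I. c i * c j * B i j)"
  proof (rule posdef_form_bound[OF I])
    show "B i j = B j i" for i j by (simp add: B_def inner_commute)
    fix c :: "('a \<Rightarrow> nat) \<Rightarrow> real" assume nz: "\<exists>i\<in>I. c i \<noteq> 0"
    let ?f = "\<lambda>x. (norm (grad (P c) x))\<^sup>2"
    have cont: "continuous_on ref_cube ?f"
      using continuous_on_subset[OF continuous_grad[OF Pp]] by (intro continuous_intros) auto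
    have nn: "0 \<le> set_lebesgue_integral lborel ref_cube ?f"
      unfolding set_lebesgue_integral_def by (intro Bochner_Integration.integral_nonneg) simp
    have "set_lebesgue_integral lborel ref_cube ?f \<noteq> 0"
    proof
      assume 0: "set_lebesgue_integral lborel ref_cube ?f = 0"
      have "set_integrable lborel ref_cube ?f"
        using cube by (intro set_integrable_compact cont) auto
      then have "(?f has_integral 0) ref_cube"
        using has_integral_set_lebesgue[of ref_cube ?f] 0
        by (simp add: set_borel_integral_eq_integral has_integral_iff)
      then have "?f x = 0" if "x \<in> ref_cube" for x
        using has_integral_0_cbox_imp_0[OF cont _ _ _ that] by (simp add: box_ne_empty)
      then have g0: "grad (P c) x = 0" if "x \<in> ref_cube" for x using that by simp
      have "\<exists>a. \<forall>x\<in>ref_cube. P c x = a"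
      proof (rule has_derivative_zero_constant)
        fix x :: 'a assume "x \<in> ref_cube"
        then show "(P c has_derivative (\<lambda>h. 0)) (at x within ref_cube)"
          using polys_has_derivative[OF Pp, of c x] g0 by (auto intro: has_derivative_at_withinI)
      qed (rule convex_box)
      then obtain a where a: "\<And>x. x \<in> ref_cube \<Longrightarrow> P c x = a" by auto
      have pt: "P c (lag_pt ?C k m) = (if m \<in> I then c m else 0)" if m: "m \<in> lag_idx ?C k" for m
      proof -
        have "P c (lag_pt ?C k m) = (\<Sum>m'\<in>I. if m' = m then c m else 0)"
          unfolding P_def by (intro sum.cong) (auto simp: lagb_at_pt[OF C _ m k] I_def)
        then show ?thesis using I by simp
      qed
      have inc: "lag_pt ?C k m \<in> ref_cube" if "m \<in> lag_idx ?C k" for m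
        using lag_pt_in[OF C order_refl that k] ref_simplex_in_cube by auto
      have "a = 0" using pt[OF m0] a[OF inc[OF m0]] by (simp add: I_def)
      then have "c m = 0" if "m \<in> I" for m
        using pt[of m] a[OF inc, of m] that by (auto simp: I_def)
      then show False using nz by auto
    qed
    then show "(\<Sum>i\<in>I. \<Sum>j\<in>I. c i * c j * B i j) > 0" using nn unfolding form by simp
  qed
  then obtain \<delta> where \<delta>: "\<delta> > 0" "\<And>c. \<delta> * (\<Sum>i\<in>I. (c i)\<^sup>2) \<le> (\<Sum>i\<in>I. \<Sum>j\<in>I. c i * c j * B i j)"
    by auto
  show thesis
  proof (rule that[OF \<delta>(1) m0])
    fix q :: "'a \<Rightarrow> real" assume q: "q \<in> polys k" "q (lag_pt ?C k m0) = 0"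
    define c where "c m = q (lag_pt ?C k m)" for m
    have "q = P c"
    proof
      fix x
      have "q x = (\<Sum>m\<in>lag_idx ?C k. c m * lagb ?C k m x)"
        using interp_eq[OF C q(1) k, of x] by (simp add: interp_def c_def)
      also have "\<dots> = P c x"
        unfolding P_def I_def using m0 q(2) fin by (subst sum.remove[OF fin m0]) (auto simp: c_def)
      finally show "q x = P c x" .
    qed
    moreover have "(\<Sum>m\<in>lag_idx ?C k. (c m)\<^sup>2) = (\<Sum>m\<in>I. (c m)\<^sup>2)"
      unfolding I_def using q(2) by (subst sum.remove[OF fin m0]) (auto simp: c_def)
    ultimately show "\<delta> * (\<Sum>m\<in>lag_idx ?C k. (q (lag_pt ?C k m))\<^sup>2)
        \<le> set_lebesgue_integral lborel ref_cube (\<lambda>x. (norm (grad q x))\<^sup>2)"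
      using \<delta>(2)[of c] form[of c] by (simp add: c_def)
  qed
qed

lemma grad_compose:
  assumes "p \<in> polys k" shows "grad (\<lambda>y. p (z + r *\<^sub>R y)) y = r *\<^sub>R grad p (z + r *\<^sub>R y)"
proof (rule grad_eqI)
  have "((\<lambda>y. z + r *\<^sub>R y) has_derivative (\<lambda>h. r *\<^sub>R h)) (at y)"
    by (auto intro!: derivative_eq_intros)
  from has_derivative_compose[OF this polys_has_derivative[OF assms]]
  show "((\<lambda>y. p (z + r *\<^sub>R y)) has_derivative (\<lambda>h. (r *\<^sub>R grad p (z + r *\<^sub>R y)) \<bullet> h)) (at y)"
    by simp
qed

lemma continuous_sum_bound_cball:
  fixes f :: "'b \<Rightarrow> 'a::euclidean_space \<Rightarrow> real"
  assumes "\<And>m. m \<in> I \<Longrightarrow> continuous_on UNIV (f m)"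
  shows "\<exists>S>0. \<forall>y\<in>cball 0 R. (\<Sum>m\<in>I. f m y) \<le> S"
proof -
  have "compact ((\<lambda>y. \<Sum>m\<in>I. f m y) ` cball 0 R)"
    using assms by (intro compact_continuous_image continuous_on_sum) (auto intro: continuous_on_subset)
  then have "bounded ((\<lambda>y. \<Sum>m\<in>I. f m y) ` cball 0 R)" by (rule compact_imp_bounded)
  then obtain S where "S > 0" "\<And>y. y \<in> cball 0 R \<Longrightarrow> \<bar>\<Sum>m\<in>I. f m y\<bar> \<le> S"
    unfolding bounded_pos by auto
  then show ?thesis by (intro exI[of _ S]) (auto simp: abs_le_iff)
qed

text \<open>Poincare-type estimate by scaling: the squared gradient contributes two powers of the
  length scale and the volume element d of them, whence the exponent d - 2. The gradient is used
  only on a cube inside the ball; values on the rest of \<open>S\<close> are extrapolated at a price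
  depending on \<open>K\<close>, k and d.\<close>

lemma polys_oscillation:
  assumes k: "k \<ge> 1" and d: "DIM('a::euclidean_space) \<ge> 2"
  shows "\<exists>Cst>0. \<forall>(z::'a) r S p. r > 0 \<longrightarrow> cball z r \<subseteq> S \<longrightarrow> S \<subseteq> cball z (K * r) \<longrightarrow> compact S \<longrightarrow>
    p \<in> polys k \<longrightarrow> (\<forall>x\<in>S. \<forall>y\<in>S. r ^ (DIM('a) - 2) * (p x - p y)\<^sup>2 \<le>
      Cst * set_lebesgue_integral lborel S (\<lambda>x. (norm (grad p x))\<^sup>2))"
proof -
  let ?C = "insert 0 Basis :: 'a set" and ?d = "real DIM('a)"
  note C = affine_frame_Basis[where 'a='a]
  obtain \<delta> m0 where \<delta>: "\<delta> > 0" and m0: "m0 \<in> lag_idx ?C k" and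
    q: "\<And>q :: 'a \<Rightarrow> real. q \<in> polys k \<Longrightarrow> q (lag_pt ?C k m0) = 0 \<Longrightarrow>
      \<delta> * (\<Sum>m\<in>lag_idx ?C k. (q (lag_pt ?C k m))\<^sup>2)
        \<le> set_lebesgue_integral lborel ref_cube (\<lambda>x. (norm (grad q x))\<^sup>2)"
    using ref_gradient_bound[OF k, where 'a='a] by metis
  obtain S where S: "S > 0" "\<And>y. y \<in> cball 0 (K * ?d) \<Longrightarrow> (\<Sum>m\<in>lag_idx ?C k. (lagb ?C k m y)\<^sup>2) \<le> S"
    using continuous_sum_bound_cball[of "lag_idx ?C k" "\<lambda>m y. (lagb ?C k m y)\<^sup>2" "K * ?d"]
      continuous_on_power[OF continuous_polys[OF lagb_polys[OF C]]] by blast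
  have main: "r ^ (DIM('a) - 2) * (p x - p y)\<^sup>2 \<le>
      (4 * S / \<delta> * ?d ^ (DIM('a) - 2)) * set_lebesgue_integral lborel T (\<lambda>x. (norm (grad p x))\<^sup>2)"
    if r: "r > 0" and T: "cball z r \<subseteq> T" "T \<subseteq> cball z (K * r)" "compact T" and p: "p \<in> polys k"
      and xy: "x \<in> T" "y \<in> T" for z :: 'a and r T p x y
  proof -
    \<comment> \<open>Points of the cube have norm at most d, so the cube scaled by
      \<open>\<rho>\<close> fits into the ball of radius \<open>r\<close>.\<close>
    define \<rho> where "\<rho> = r / ?d"
    have \<rho>: "\<rho> > 0" using r by (simp add: \<rho>_def)
    have r\<rho>: "r = ?d * \<rho>" by (simp add: \<rho>_def)
    have rpow: "\<rho> ^ DIM('a) = \<rho> ^ (DIM('a) - 2) * \<rho>\<^sup>2"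
      using d by (metis le_add_diff_inverse2 power_add)
    define p0 where "p0 = p (z + \<rho> *\<^sub>R lag_pt ?C k m0)"
    define w where "w x = p (z + \<rho> *\<^sub>R x) - p0" for x
    have w: "w \<in> polys k"
      using polys_add[OF polys_compose[OF p, of z \<rho>] polys_const[of "- p0"]] by (simp add: w_def[abs_def])
    have gw: "grad w x = \<rho> *\<^sub>R grad p (z + \<rho> *\<^sub>R x)" for x
      using grad_add[OF polys_compose[OF p, of z \<rho>] polys_const[of "- p0"], of x]
        grad_compose[OF p, of z \<rho> x] grad_eqI[of "\<lambda>x::'a. - p0" 0 x] by (simp add: w_def[abs_def])
    define J where "J = set_lebesgue_integral lborel ref_cube (\<lambda>x. (norm (grad w x))\<^sup>2)"
    define W where "W = (\<Sum>m\<in>lag_idx ?C k. (w (lag_pt ?C k m))\<^sup>2)"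
    have W: "\<delta> * W \<le> J"
      unfolding W_def J_def by (rule q[OF w]) (simp add: w_def p0_def)
    \<comment> \<open>The rescaled point may lie outside the reference cube, but never outside the
      ball of radius K d, on which the Lagrange basis is bounded by \<open>S\<close>. This is where
      \<open>K\<close> enters.\<close>
    have bound: "(p x - p0)\<^sup>2 \<le> S * W" if "x \<in> T" for x
    proof -
      define v where "v = (1 / \<rho>) *\<^sub>R (x - z)"
      have "norm (x - z) \<le> K * r" using T(2) that by (auto simp: dist_norm norm_minus_commute)
      moreover have "norm v = norm (x - z) / \<rho>" using \<rho> by (simp only: v_def norm_scaleR) simp
      moreover have "norm (x - z) / \<rho> \<le> K * ?d"
        using \<open>norm (x - z) \<le> K * r\<close> \<rho> by (simp add: r\<rho> pos_divide_le_eq ac_simps)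
      ultimately have "v \<in> cball 0 (K * ?d)" by simp
      moreover have "p x - p0 = w v" using \<rho> by (simp add: v_def w_def)
      moreover have "w v = (\<Sum>m\<in>lag_idx ?C k. w (lag_pt ?C k m) * lagb ?C k m v)"
        using interp_eq[OF C w k, of v] by (simp add: interp_def)
      ultimately have "(p x - p0)\<^sup>2 \<le> W * (\<Sum>m\<in>lag_idx ?C k. (lagb ?C k m v)\<^sup>2)"
        unfolding W_def using Cauchy_Schwarz_ineq_sum[of "\<lambda>m. w (lag_pt ?C k m)" "\<lambda>m. lagb ?C k m v" "lag_idx ?C k"]
        by simp
      also have "\<dots> \<le> W * S"
        using S(2)[OF \<open>v \<in> _\<close>] by (intro mult_left_mono) (auto simp: W_def sum_nonneg)
      finally show ?thesis by (simp add: mult.commute)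
    qed
    have "(p x - p y)\<^sup>2 \<le> 2 * (p x - p0)\<^sup>2 + 2 * (p y - p0)\<^sup>2"
      using zero_le_power2[of "(p x - p0) + (p y - p0)"] by (simp add: power2_eq_square algebra_simps)
    also have "\<dots> \<le> 4 * S * W" using bound[OF xy(1)] bound[OF xy(2)] by linarith
    also have "\<dots> \<le> 4 * S / \<delta> * J"
      using mult_left_mono[OF W, of "4 * S / \<delta>"] S(1) \<delta> by simp
    finally have 1: "(p x - p y)\<^sup>2 \<le> 4 * S / \<delta> * J" .
    let ?f = "\<lambda>x. (norm (grad p x))\<^sup>2"
    have cf: "continuous_on A ?f" for A
      using continuous_on_subset[OF continuous_grad[OF p]] by (intro continuous_intros) auto
    have fT: "emeasure lborel T < \<infinity>"
      using emeasure_bounded_finite[OF compact_imp_bounded[OF T(3)]] by (simp add: top.not_eq_extremum)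
    have iT: "integrable lborel (\<lambda>x. indicator T x *\<^sub>R ?f x)"
      using set_integrable_compact[OF _ T(3) fT cf] by (simp add: set_integrable_def)
    have "J = \<rho>\<^sup>2 * (\<integral>y. indicator ref_cube y *\<^sub>R ?f (z + \<rho> *\<^sub>R y) \<partial>lborel)"
      unfolding J_def gw set_lebesgue_integral_def
      by (subst integral_mult_right_zero[symmetric], intro Bochner_Integration.integral_cong refl)
        (simp add: power_mult_distrib ac_simps)
    then have "\<rho> ^ DIM('a) * (J / \<rho>\<^sup>2) =
      \<rho> ^ DIM('a) * (\<integral>y. indicator ref_cube y *\<^sub>R ?f (z + \<rho> *\<^sub>R y) \<partial>lborel)"
      using \<rho> by simp
    also have "\<dots> \<le> \<rho> ^ DIM('a) * (\<integral>y. indicator T (z + \<rho> *\<^sub>R y) *\<^sub>R ?f (z + \<rho> *\<^sub>R y) \<partial>lborel)"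
    proof (intro mult_left_mono integral_mono')
      have m: "(\<lambda>x. indicator T x *\<^sub>R ?f x) \<in> borel_measurable borel"
        using iT by (auto dest: borel_measurable_integrable)
      have i: "integrable (density (distr lborel borel (\<lambda>x. z + \<rho> *\<^sub>R x)) (\<lambda>_. \<bar>\<rho>\<bar> ^ DIM('a))) (\<lambda>x. indicator T x *\<^sub>R ?f x)"
        using iT lborel_affine[of \<rho> z] \<rho> by simp
      have "integrable (distr lborel borel (\<lambda>x. z + \<rho> *\<^sub>R x)) (\<lambda>x. \<bar>\<rho>\<bar> ^ DIM('a) *\<^sub>R (indicator T x *\<^sub>R ?f x))"
        using i m by (subst (asm) integrable_density) auto
      then have "integrable lborel (\<lambda>x. \<bar>\<rho>\<bar> ^ DIM('a) *\<^sub>R (indicator T (z + \<rho> *\<^sub>R x) *\<^sub>R ?f (z + \<rho> *\<^sub>R x)))"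
        using m by (subst (asm) integrable_distr_eq) auto
      then show "integrable lborel (\<lambda>y. indicator T (z + \<rho> *\<^sub>R y) *\<^sub>R ?f (z + \<rho> *\<^sub>R y))"
        using \<rho> by simp
      fix y :: 'a
      have "z + \<rho> *\<^sub>R y \<in> T" if "y \<in> ref_cube"
      proof -
        have "norm (\<rho> *\<^sub>R y) \<le> r" using norm_le_ref_cube[OF that] \<rho> by (simp add: r\<rho> field_simps)
        then show ?thesis using T(1) by (auto simp: dist_norm)
      qed
      then show "indicator ref_cube y *\<^sub>R ?f (z + \<rho> *\<^sub>R y) \<le> indicator T (z + \<rho> *\<^sub>R y) *\<^sub>R ?f (z + \<rho> *\<^sub>R y)"
        by (auto simp: indicator_def)
    qed (use \<rho> in auto)
    also have "\<dots> = set_lebesgue_integral lborel T ?f"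
      unfolding set_lebesgue_integral_def using iT \<rho>
      by (subst lborel_integral_scale[of \<rho> _ z]) (auto dest: borel_measurable_integrable)
    finally have "\<rho> ^ (DIM('a) - 2) * J \<le> set_lebesgue_integral lborel T ?f"
      using \<rho> rpow by simp
    then have 2: "r ^ (DIM('a) - 2) * J \<le> ?d ^ (DIM('a) - 2) * set_lebesgue_integral lborel T ?f"
      unfolding r\<rho> power_mult_distrib mult.assoc by (intro mult_left_mono) auto
    have "r ^ (DIM('a) - 2) * (p x - p y)\<^sup>2 \<le> r ^ (DIM('a) - 2) * (4 * S / \<delta> * J)"
      using 1 r by (intro mult_left_mono) auto
    also have "\<dots> = 4 * S / \<delta> * (r ^ (DIM('a) - 2) * J)" by simp
    also have "\<dots> \<le> 4 * S / \<delta> * (?d ^ (DIM('a) - 2) * set_lebesgue_integral lborel T ?f)"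
      using S(1) \<delta> by (intro mult_left_mono[OF 2]) auto
    finally show ?thesis by simp
  qed
  show ?thesis
  proof (intro exI[of _ "4 * S / \<delta> * ?d ^ (DIM('a) - 2)"] conjI allI impI ballI)
    show "0 < 4 * S / \<delta> * ?d ^ (DIM('a) - 2)" using S(1) \<delta> by simp
  qed (rule main)
qed

text \<open>Inverse estimate by the same scaling: the rescaled interpolation nodes fall into the
  inscribed ball, where |p| <= M, and the gradients of the Lagrange basis are bounded on the ball of
  radius K d.\<close>

lemma polys_gradient_bound:
  assumes k: "k \<ge> 1"
  shows "\<exists>Cst>0. \<forall>(z::'a::euclidean_space) r S p M. r > 0 \<longrightarrow> cball z r \<subseteq> S \<longrightarrow> S \<subseteq> cball z (K * r) \<longrightarrow>
    p \<in> polys k \<longrightarrow> (\<forall>x\<in>S. \<bar>p x\<bar> \<le> M) \<longrightarrow> (\<forall>x\<in>S. norm (grad p x) \<le> Cst * M / r)"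
proof -
  let ?C = "insert 0 Basis :: 'a set" and ?d = "real DIM('a)"
  note C = affine_frame_Basis[where 'a='a]
  obtain S where S: "S > 0" "\<And>y. y \<in> cball 0 (K * ?d) \<Longrightarrow> (\<Sum>m\<in>lag_idx ?C k. norm (grad (lagb ?C k m) y)) \<le> S"
    using continuous_sum_bound_cball[of "lag_idx ?C k" "\<lambda>m y. norm (grad (lagb ?C k m) y)" "K * ?d"]
      continuous_on_norm[OF continuous_grad[OF lagb_polys[OF C]]] by blast
  have "norm (grad p x) \<le> (S * ?d) * M / r"
    if r: "r > 0" and T: "cball z r \<subseteq> T" "T \<subseteq> cball z (K * r)" and p: "p \<in> polys k"
      and M: "\<And>x. x \<in> T \<Longrightarrow> \<bar>p x\<bar> \<le> M" and x: "x \<in> T" for z :: 'a and r T p x M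
  proof -
    define \<rho> where "\<rho> = r / ?d"
    have \<rho>: "\<rho> > 0" using r by (simp add: \<rho>_def)
    have r\<rho>: "r = ?d * \<rho>" by (simp add: \<rho>_def)
    define w where "w x = p (z + \<rho> *\<^sub>R x)" for x
    have w: "w \<in> polys k" using polys_compose[OF p] by (simp add: w_def[abs_def])
    define v where "v = (1 / \<rho>) *\<^sub>R (x - z)"
    have "norm (x - z) \<le> K * r" using T(2) x by (auto simp: dist_norm norm_minus_commute)
    moreover have "norm v = norm (x - z) / \<rho>" using \<rho> by (simp only: v_def norm_scaleR) simp
    moreover have "norm (x - z) / \<rho> \<le> K * ?d"
      using \<open>norm (x - z) \<le> K * r\<close> \<rho> by (simp add: r\<rho> pos_divide_le_eq ac_simps)
    ultimately have v: "v \<in> cball 0 (K * ?d)" by simp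
    have "w = (\<lambda>x. \<Sum>m\<in>lag_idx ?C k. w (lag_pt ?C k m) * lagb ?C k m x)"
      by (rule ext) (rule interp_eq[OF C w k, unfolded interp_def])
    then have "grad w v = grad (\<lambda>x. \<Sum>m\<in>lag_idx ?C k. w (lag_pt ?C k m) * lagb ?C k m x) v"
      by (rule arg_cong)
    also have "\<dots> = (\<Sum>m\<in>lag_idx ?C k. grad (\<lambda>x. w (lag_pt ?C k m) * lagb ?C k m x) v)"
      by (intro grad_sum[of _ _ k] polys_scale lagb_polys C)
    also have "\<dots> = (\<Sum>m\<in>lag_idx ?C k. w (lag_pt ?C k m) *\<^sub>R grad (lagb ?C k m) v)"
      by (intro sum.cong refl grad_scale[of _ k] lagb_polys C)
    also have "norm \<dots> \<le> (\<Sum>m\<in>lag_idx ?C k. M * norm (grad (lagb ?C k m) v))"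
    proof (intro sum_norm_le)
      fix m assume m: "m \<in> lag_idx ?C k"
      have "lag_pt ?C k m \<in> ref_cube" using lag_pt_in[OF C order_refl m k] ref_simplex_in_cube by auto
      then have "norm (\<rho> *\<^sub>R lag_pt ?C k m) \<le> r"
        using norm_le_ref_cube[of "lag_pt ?C k m"] \<rho> by (simp add: r\<rho> field_simps)
      then have "\<bar>w (lag_pt ?C k m)\<bar> \<le> M"
        unfolding w_def by (intro M subsetD[OF T(1)]) (simp add: dist_norm)
      then show "norm (w (lag_pt ?C k m) *\<^sub>R grad (lagb ?C k m) v) \<le> M * norm (grad (lagb ?C k m) v)"
        by (simp add: mult_right_mono)
    qed
    also have "\<dots> = M * (\<Sum>m\<in>lag_idx ?C k. norm (grad (lagb ?C k m) v))" by (simp add: sum_distrib_left)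
    also have "\<dots> \<le> M * S" using S(2)[OF v] M[OF x] by (intro mult_left_mono) auto
    also have "grad w v = \<rho> *\<^sub>R grad p x"
      using grad_compose[OF p, of z \<rho> v] \<rho> by (simp add: w_def[abs_def] v_def)
    finally have "\<rho> * norm (grad p x) \<le> M * S" using \<rho> by simp
    then show ?thesis using \<rho> by (simp add: r\<rho> field_simps)
  qed
  then show ?thesis using S(1) by (intro exI[of _ "S * ?d"] conjI allI impI ballI) simp_all
qed

section \<open>Hausdorff measure of hypersurfaces\<close>

lemma sets_hausdorff_measure [simp, measurable_cong]: "sets (hausdorff_measure m) = sets borel"
  using sets.sigma_sets_eq[of borel] by (simp add: hausdorff_measure_def space_borel)

text \<open>The projection along \<open>b\<close> is divided into N ^ (d - 1) cells. By the graph
  condition the piece over a cell has diameter of order a / N, so the total is of order a ^ (d - 1)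
  for every N, in particular for N so large that the pieces are admissible at scale
  \<open>\<delta>\<close>.\<close>

lemma hausdorff_outer_graph_upper:
  fixes S :: "'a::euclidean_space set"
  assumes d: "DIM('a) \<ge> 2" and b: "b \<in> Basis" and L: "L > 0" and a: "a > 0"
    and lip: "\<And>y y'. y \<in> S \<Longrightarrow> y' \<in> S \<Longrightarrow> norm (y - y') \<le> L * (\<Sum>i\<in>Basis - {b}. \<bar>(y - y') \<bullet> i\<bar>)"
    and S: "S \<subseteq> cball x a"
  shows "hausdorff_outer (DIM('a) - 1) S \<le>
    ennreal (unit_ball_vol (real (DIM('a) - 1)) * (L * real (DIM('a) - 1) * a) ^ (DIM('a) - 1))"
proof -
  define m where "m = DIM('a) - 1"
  have m: "m \<ge> 1" "card (Basis - {b}) = m" using d b by (auto simp: m_def card_Diff_singleton)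
  define V where "V = unit_ball_vol (real m)"
  have V: "V \<ge> 0" by (simp add: V_def)
  have "outer_measure UNIV (hausdorff_gauge m \<delta>) S \<le> ennreal (V * (L * real m * a) ^ m)" if \<delta>: "\<delta> > 0" for \<delta>
  proof -
    obtain N where N0: "real N > L * real m * (2 * a) / \<delta>" using reals_Archimedean2 by blast
    moreover have "L * real m * (2 * a) / \<delta> \<ge> 0" using L a \<delta> by simp
    ultimately have N: "N > 0" by (cases N) auto
    define D where "D = L * real m * (2 * a / real N)"
    have D: "0 \<le> D" "D \<le> \<delta>" using N0 N L a \<delta> by (simp_all add: D_def field_simps)
    define J where "J = (Basis - {b}) \<rightarrow>\<^sub>E {..<N}"
    have J: "finite J" "card J = N ^ m" unfolding J_def by (auto simp: card_PiE m(2) intro: finite_PiE)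
    define cell where "cell j = {y \<in> S. \<forall>i\<in>Basis - {b}. real (j i) * (2 * a / real N) \<le> (y - x) \<bullet> i + a \<and>
        (y - x) \<bullet> i + a \<le> real (Suc (j i)) * (2 * a / real N)}" for j
    have gauge: "hausdorff_gauge m \<delta> (cell j) \<le> ennreal (V * (D / 2) ^ m)" for j
    proof -
      have "norm (y - y') \<le> D" if y: "y \<in> cell j" "y' \<in> cell j" for y y'
      proof -
        have "\<bar>(y - y') \<bullet> i\<bar> \<le> 2 * a / real N" if "i \<in> Basis - {b}" for i
        proof -
          have "real (j i) * (2 * a / real N) \<le> (y - x) \<bullet> i + a" "real (j i) * (2 * a / real N) \<le> (y' - x) \<bullet> i + a"
            "(y - x) \<bullet> i + a \<le> real (Suc (j i)) * (2 * a / real N)"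
            "(y' - x) \<bullet> i + a \<le> real (Suc (j i)) * (2 * a / real N)"
            using y that unfolding cell_def by auto
          moreover have "real (Suc (j i)) * (2 * a / real N) = real (j i) * (2 * a / real N) + 2 * a / real N"
            by (simp only: of_nat_Suc distrib_right mult_1)
          moreover have "(y - y') \<bullet> i = (y - x) \<bullet> i - (y' - x) \<bullet> i" by (simp add: inner_diff_left)
          ultimately show ?thesis by linarith
        qed
        then have "(\<Sum>i\<in>Basis - {b}. \<bar>(y - y') \<bullet> i\<bar>) \<le> (\<Sum>i\<in>Basis - {b}. 2 * a / real N)"
          by (intro sum_mono) auto
        also have "\<dots> = real m * (2 * a / real N)" using m by simp
        finally have "L * (\<Sum>i\<in>Basis - {b}. \<bar>(y - y') \<bullet> i\<bar>) \<le> L * (real m * (2 * a / real N))"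
          using L by (intro mult_left_mono) auto
        moreover have "norm (y - y') \<le> L * (\<Sum>i\<in>Basis - {b}. \<bar>(y - y') \<bullet> i\<bar>)"
          using y by (intro lip) (auto simp: cell_def)
        ultimately show ?thesis unfolding D_def by (simp only: mult.assoc)
      qed
      then have dia: "diameter (cell j) \<le> D" using D by (intro diameter_le) auto
      have "cell j \<subseteq> cball x a" using S by (auto simp: cell_def)
      then have bd: "bounded (cell j)" by (rule bounded_subset[OF bounded_cball])
      then have "(diameter (cell j) / 2) ^ m \<le> (D / 2) ^ m"
        using dia diameter_ge_0[OF bd] by (intro power_mono) auto
      then show ?thesis
        using dia D bd V unfolding hausdorff_gauge_def V_def[symmetric]
        by (auto intro!: ennreal_leI mult_left_mono)
    qed
    obtain e where e: "bij_betw e {..<card J} J" using ex_bij_betw_nat_finite[OF J(1)] by (auto simp: atLeast0LessThan)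
    define A where "A i = (if i < card J then cell (e i) else {})" for i
    have cover: "S \<subseteq> (\<Union>i. A i)"
    proof
      fix y assume y: "y \<in> S"
      have "\<exists>n<N. real n * (2 * a / real N) \<le> (y - x) \<bullet> i + a \<and> (y - x) \<bullet> i + a \<le> real (Suc n) * (2 * a / real N)"
        if "i \<in> Basis" for i
      proof -
        have "\<bar>(y - x) \<bullet> i\<bar> \<le> norm (y - x)" using that by (rule Basis_le_norm)
        also have "\<dots> \<le> a" using S y by (auto simp: dist_norm norm_minus_commute)
        finally have ab: "0 \<le> (y - x) \<bullet> i + a" "(y - x) \<bullet> i + a \<le> 2 * a" by auto
        define s where "s = ((y - x) \<bullet> i + a) / (2 * a / real N)"
        have q: "2 * a / real N > 0" using a N by simp
        have s: "0 \<le> s" "s \<le> real N"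
          unfolding s_def pos_divide_le_eq[OF q] using divide_nonneg_pos[OF ab(1) q] ab(2) N by simp_all
        have "w = w / q * q" if "q > 0" for w q :: real using that by simp
        from this[OF q, of "(y - x) \<bullet> i + a"] have s2: "(y - x) \<bullet> i + a = s * (2 * a / real N)"
          unfolding s_def .
        show ?thesis
        \<comment> \<open>At the right end the floor would select the cell with index N, which does
          not exist; the last cell contains its right end point.\<close>
        proof (cases "s = real N")
          case True
          have "real (N - 1) \<le> s" "s \<le> real (Suc (N - 1))" using True N by auto
          then show ?thesis unfolding s2 using q N
            by (intro exI[of _ "N - 1"] conjI mult_right_mono) auto
        next
          case False
          define n where "n = nat \<lfloor>s\<rfloor>"
          have "real n \<le> s" "s \<le> real (Suc n)" using s unfolding n_def by linarith+
          moreover have "n < N" using \<open>real n \<le> s\<close> s False by linarith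
          ultimately show ?thesis unfolding s2 using q
            by (intro exI[of _ n] conjI mult_right_mono) auto
        qed
      qed
      then obtain f where f: "\<And>i. i \<in> Basis \<Longrightarrow> f i < N \<and> real (f i) * (2 * a / real N) \<le> (y - x) \<bullet> i + a \<and>
          (y - x) \<bullet> i + a \<le> real (Suc (f i)) * (2 * a / real N)" by metis
      define j where "j = restrict f (Basis - {b})"
      have "j \<in> J" using f by (auto simp: j_def J_def)
      then have "j \<in> e ` {..<card J}" using e by (simp add: bij_betw_def)
      then obtain i where "i < card J" "e i = j" by auto
      moreover have "y \<in> cell j" using y f by (simp add: cell_def j_def)
      ultimately show "y \<in> (\<Union>i. A i)" by (auto simp: A_def)
    qed
    interpret ring_of_sets "UNIV :: 'a set" UNIV
      using sigma_algebra_Pow[of "UNIV :: 'a set"] by (simp add: sigma_algebra_def algebra_def)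
    have "outer_measure UNIV (hausdorff_gauge m \<delta>) S \<le> (\<Sum>i. hausdorff_gauge m \<delta> (A i))"
      using cover m \<delta>
      by (intro outer_measure_le)
        (auto simp: positive_def increasing_def hausdorff_gauge_empty hausdorff_gauge_mono)
    also have "\<dots> = (\<Sum>i<card J. hausdorff_gauge m \<delta> (A i))"
      using m \<delta> by (intro suminf_finite) (auto simp: A_def hausdorff_gauge_empty)
    also have "\<dots> \<le> (\<Sum>i<card J. ennreal (V * (D / 2) ^ m))"
      by (intro sum_mono) (auto simp: A_def gauge)
    also have "\<dots> = ennreal (real (N ^ m) * (V * (D / 2) ^ m))"
      using V D by (simp add: J(2) ennreal_of_nat_eq_real_of_nat flip: ennreal_mult)
    also have "real (N ^ m) * (V * (D / 2) ^ m) = V * (real N * (D / 2)) ^ m"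
      by (simp add: power_mult_distrib power_divide)
    also have "real N * (D / 2) = L * real m * a" using N by (simp add: D_def)
    finally show ?thesis .
  qed
  then show ?thesis
    unfolding hausdorff_outer_def m_def[symmetric] V_def[symmetric] by (intro SUP_least) auto
qed

text \<open>
  A cover of the graph by sets of diameter \<open>D\<^sub>i\<close> yields a cover of a box by the tubes over these
  sets in direction \<open>b\<close>, whose Lebesgue measure is proportional to \<open>D\<^sub>i ^ (d - 1)\<close>.
\<close>

lemma hausdorff_outer_graph_lower:
  fixes S :: "'a::euclidean_space set"
  assumes d: "DIM('a) \<ge> 2" and b: "b \<in> Basis" and a: "a > 0"
    and proj: "\<And>z. (\<And>i. i \<in> Basis - {b} \<Longrightarrow> \<bar>(z - x) \<bullet> i\<bar> \<le> a) \<Longrightarrow>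
      \<exists>y\<in>S. \<forall>i\<in>Basis - {b}. y \<bullet> i = z \<bullet> i"
  shows "ennreal (unit_ball_vol (real (DIM('a) - 1)) * (a / 2) ^ (DIM('a) - 1)) \<le>
    hausdorff_outer (DIM('a) - 1) S"
proof -
  define m where "m = DIM('a) - 1"
  have m: "m \<ge> 1" "card (Basis - {b}) = m" using d b by (auto simp: m_def card_Diff_singleton)
  define V where "V = unit_ball_vol (real m)"
  have V: "V > 0" by (simp add: V_def unit_ball_vol_pos)
  define tube where "tube y D = cbox (\<Sum>i\<in>Basis. (if i = b then - a else y \<bullet> i - D) *\<^sub>R i)
      (\<Sum>i\<in>Basis. (if i = b then a else y \<bullet> i + D) *\<^sub>R i)" for y :: 'a and D
  have in_tube: "p \<in> tube y D \<longleftrightarrow> \<bar>p \<bullet> b\<bar> \<le> a \<and> (\<forall>i\<in>Basis - {b}. \<bar>p \<bullet> i - y \<bullet> i\<bar> \<le> D)" for p y D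
    unfolding tube_def mem_box using b by (auto simp: inner_sum_left_Basis abs_le_iff algebra_simps)
  have vol: "emeasure lborel (tube y D) = ennreal (2 * a * (2 * D) ^ m)" if "D \<ge> 0" for y D
  proof -
    have "emeasure lborel (tube y D) = ennreal (\<Prod>i\<in>Basis. if i = b then 2 * a else 2 * D)"
      unfolding tube_def
      by (subst emeasure_lborel_cbox)
        (use a that in \<open>auto simp: inner_sum_left_Basis inner_diff_left intro!: arg_cong[where f=ennreal] prod.cong\<close>)
    also have "(\<Prod>i\<in>Basis. if i = b then 2 * a else 2 * D) = 2 * a * (2 * D) ^ m"
      using m by (subst prod.remove[OF finite_Basis b]) simp
    finally show ?thesis .
  qed
  \<comment> \<open>Scale one suffices: \<open>hausdorff_outer\<close> is a supremum over scales,
    and the tube argument does not use that the pieces are small.\<close>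
  have "ennreal (V * (a / 2) ^ m) \<le> outer_measure UNIV (hausdorff_gauge m 1) S"
    unfolding outer_measure_def
  proof (rule INF_greatest)
    fix A :: "nat \<Rightarrow> 'a set"
    assume "A \<in> {A. range A \<subseteq> UNIV \<and> disjoint_family A \<and> S \<subseteq> \<Union> (range A)}"
    then have A: "S \<subseteq> (\<Union>i. A i)" by simp
    show "ennreal (V * (a / 2) ^ m) \<le> (\<Sum>i. hausdorff_gauge m 1 (A i))"
    proof (cases "\<exists>i. hausdorff_gauge m 1 (A i) = top")
      case True
      then obtain i where "hausdorff_gauge m 1 (A i) = top" by auto
      then have "(\<Sum>i. hausdorff_gauge m 1 (A i)) = top"
        using sum_le_suminf[of "\<lambda>i. hausdorff_gauge m 1 (A i)" "{i}"] by (simp add: top_unique)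
      then show ?thesis by simp
    next
      case False
      define D where "D i = diameter (A i)" for i
      have bd: "bounded (A i)" and g: "hausdorff_gauge m 1 (A i) = ennreal (V * (D i / 2) ^ m)" for i
        using False[simplified, rule_format, of i] by (auto simp: hausdorff_gauge_def V_def D_def split: if_splits)
      have D: "D i \<ge> 0" for i unfolding D_def by (rule diameter_ge_0[OF bd])
      define y where "y i = (SOME y. y \<in> A i)" for i
      have "tube x a \<subseteq> (\<Union>i. tube (y i) (D i))"
      proof
        fix p assume p: "p \<in> tube x a"
        then have "\<bar>(p - x) \<bullet> i\<bar> \<le> a" if "i \<in> Basis - {b}" for i
          using that by (auto simp: in_tube inner_diff_left)
        then obtain q where q: "q \<in> S" "\<And>i. i \<in> Basis - {b} \<Longrightarrow> q \<bullet> i = p \<bullet> i" using proj by metis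
        obtain i where i: "q \<in> A i" using A q by auto
        then have yi: "y i \<in> A i" unfolding y_def by (rule someI)
        have "\<bar>p \<bullet> l - y i \<bullet> l\<bar> \<le> D i" if l: "l \<in> Basis - {b}" for l
        proof -
          have "\<bar>(q - y i) \<bullet> l\<bar> \<le> norm (q - y i)" using l by (intro Basis_le_norm) auto
          also have "\<dots> \<le> D i" using diameter_bounded_bound[OF bd i yi] by (simp add: D_def dist_norm)
          finally show ?thesis using q(2)[OF l] by (simp add: inner_diff_left)
        qed
        then have "p \<in> tube (y i) (D i)" using p by (auto simp: in_tube)
        then show "p \<in> (\<Union>i. tube (y i) (D i))" by auto
      qed
      then have "emeasure lborel (tube x a) \<le> emeasure lborel (\<Union>i. tube (y i) (D i))"
        by (intro emeasure_mono) (auto simp: tube_def)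
      also have "\<dots> \<le> (\<Sum>i. emeasure lborel (tube (y i) (D i)))"
        by (intro emeasure_subadditive_countably) (auto simp: tube_def)
      \<comment> \<open>A tube around a point of a piece of diameter D has edges 2 D where the gauge
        has D / 2; this is the factor 4 ^ m.\<close>
      also have "\<dots> = (\<Sum>i. ennreal (2 * a * 4 ^ m / V) * hausdorff_gauge m 1 (A i))"
      proof (intro arg_cong[where f=suminf] ext)
        fix i
        have p4: "(2 * D i) ^ m = 4 ^ m * (D i / 2) ^ m"
          by (subst power_mult_distrib[symmetric]) simp
        have "2 * a * (2 * D i) ^ m = (2 * a * 4 ^ m / V) * (V * (D i / 2) ^ m)"
          using V p4 by simp
        then show "emeasure lborel (tube (y i) (D i)) = ennreal (2 * a * 4 ^ m / V) * hausdorff_gauge m 1 (A i)"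
          using V a D[of i] by (simp add: vol g flip: ennreal_mult)
      qed
      also have "\<dots> = ennreal (2 * a * 4 ^ m / V) * (\<Sum>i. hausdorff_gauge m 1 (A i))"
        by (rule ennreal_suminf_cmult)
      finally have "ennreal (V / (2 * a * 4 ^ m)) * emeasure lborel (tube x a) \<le>
          ennreal (V / (2 * a * 4 ^ m)) * (ennreal (2 * a * 4 ^ m / V) * (\<Sum>i. hausdorff_gauge m 1 (A i)))"
        by (rule mult_left_mono) simp
      also have "\<dots> = (\<Sum>i. hausdorff_gauge m 1 (A i))"
        using V a by (simp add: mult.assoc[symmetric] flip: ennreal_mult)
      also have "ennreal (V / (2 * a * 4 ^ m)) * emeasure lborel (tube x a) = ennreal (V / (2 * a * 4 ^ m) * (2 * a * (2 * a) ^ m))"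
        using V a by (simp add: vol flip: ennreal_mult)
      also have "V / (2 * a * 4 ^ m) * (2 * a * (2 * a) ^ m) = V * ((2 * a) ^ m / 4 ^ m)" using a by simp
      also have "(2 * a) ^ m / 4 ^ m = (a / 2) ^ m"
        by (subst power_divide[symmetric]) simp
      finally show ?thesis .
    qed
  qed
  also have "\<dots> \<le> hausdorff_outer m S"
    unfolding hausdorff_outer_def by (intro SUP_upper) auto
  finally show ?thesis by (simp add: m_def V_def)
qed

text \<open>Supplies the graph direction: relative to the largest component of the normal all slopes
  are at most one.\<close>

lemma max_coordinate:
  fixes g :: "'a::euclidean_space"
  assumes "g \<noteq> 0"
  obtains b where "b \<in> Basis" "g \<bullet> b \<noteq> 0" "\<And>i. i \<in> Basis \<Longrightarrow> \<bar>g \<bullet> i\<bar> \<le> \<bar>g \<bullet> b\<bar>"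
proof -
  obtain b where b: "b \<in> Basis" "\<bar>g \<bullet> b\<bar> = Max ((\<lambda>i. \<bar>g \<bullet> i\<bar>) ` Basis)"
    using Max_in[of "(\<lambda>i. \<bar>g \<bullet> i\<bar>) ` Basis"] by fastforce
  then have le: "\<bar>g \<bullet> i\<bar> \<le> \<bar>g \<bullet> b\<bar>" if "i \<in> Basis" for i using that by simp
  moreover have "g \<bullet> b \<noteq> 0"
  proof
    assume gb: "g \<bullet> b = 0"
    have "g = 0"
    proof (rule euclidean_eqI)
      fix i :: 'a assume "i \<in> Basis"
      from le[OF this] gb show "g \<bullet> i = 0 \<bullet> i" by simp
    qed
    then show False using assms by simp
  qed
  ultimately show thesis by (intro that[OF b(1)])
qed

lemma abs_inner_le_coordinates:
  fixes g w :: "'a::euclidean_space"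
  assumes "b \<in> Basis" "\<And>i. i \<in> Basis \<Longrightarrow> \<bar>g \<bullet> i\<bar> \<le> G"
  shows "\<bar>g \<bullet> w - (g \<bullet> b) * (w \<bullet> b)\<bar> \<le> G * (\<Sum>i\<in>Basis - {b}. \<bar>w \<bullet> i\<bar>)"
proof -
  have "g \<bullet> w = (g \<bullet> b) * (w \<bullet> b) + (\<Sum>i\<in>Basis - {b}. (g \<bullet> i) * (w \<bullet> i))"
    unfolding euclidean_inner[of g w] by (rule sum.remove[OF finite_Basis assms(1)])
  then have "\<bar>g \<bullet> w - (g \<bullet> b) * (w \<bullet> b)\<bar> = \<bar>\<Sum>i\<in>Basis - {b}. (g \<bullet> i) * (w \<bullet> i)\<bar>" by simp
  also have "\<dots> \<le> (\<Sum>i\<in>Basis - {b}. \<bar>(g \<bullet> i) * (w \<bullet> i)\<bar>)" by (rule sum_abs)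
  also have "\<dots> \<le> (\<Sum>i\<in>Basis - {b}. G * \<bar>w \<bullet> i\<bar>)"
    unfolding abs_mult using assms by (intro sum_mono mult_right_mono) auto
  finally show ?thesis by (simp add: sum_distrib_left)
qed

lemma norm_le_l1_remove:
  fixes w :: "'a::euclidean_space"
  assumes "b \<in> Basis"
  shows "norm w \<le> \<bar>w \<bullet> b\<bar> + (\<Sum>i\<in>Basis - {b}. \<bar>w \<bullet> i\<bar>)"
  using norm_le_l1[of w] sum.remove[OF finite_Basis assms, of "\<lambda>i. \<bar>w \<bullet> i\<bar>"] by simp

text \<open>A hyperplane is a graph in the direction of the largest component of its normal. Needed
  for integrals over ghost faces.\<close>

lemma hausdorff_hyperplane_finite:
  fixes F :: "'a::euclidean_space set"
  assumes d: "DIM('a) \<ge> 2" and g: "g \<noteq> 0" and F: "F \<subseteq> {x. g \<bullet> x = c}" "compact F"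
  shows "emeasure surface_measure F < \<infinity>"
proof -
  obtain b where b: "b \<in> Basis" "g \<bullet> b \<noteq> 0" "\<And>i. i \<in> Basis \<Longrightarrow> \<bar>g \<bullet> i\<bar> \<le> \<bar>g \<bullet> b\<bar>"
    using max_coordinate[OF g] by metis
  obtain a where a: "a > 0" "\<And>x. x \<in> F \<Longrightarrow> norm x \<le> a"
    using compact_imp_bounded[OF F(2)] unfolding bounded_pos by blast
  then have Fa: "F \<subseteq> cball 0 a" by auto
  have "hausdorff_outer (DIM('a) - 1) F \<le>
    ennreal (unit_ball_vol (real (DIM('a) - 1)) * (2 * real (DIM('a) - 1) * a) ^ (DIM('a) - 1))"
  proof (rule hausdorff_outer_graph_upper[OF d b(1) _ a(1) _ Fa])
    fix y y' assume "y \<in> F" "y' \<in> F"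
    then have "g \<bullet> (y - y') = 0" using F by (auto simp: inner_diff_right)
    then have "\<bar>g \<bullet> b\<bar> * \<bar>(y - y') \<bullet> b\<bar> \<le> \<bar>g \<bullet> b\<bar> * (\<Sum>i\<in>Basis - {b}. \<bar>(y - y') \<bullet> i\<bar>)"
      using abs_inner_le_coordinates[OF b(1,3), of "y - y'"] by (simp add: abs_mult)
    then have "\<bar>(y - y') \<bullet> b\<bar> \<le> (\<Sum>i\<in>Basis - {b}. \<bar>(y - y') \<bullet> i\<bar>)" using b(2) by simp
    then show "norm (y - y') \<le> 2 * (\<Sum>i\<in>Basis - {b}. \<bar>(y - y') \<bullet> i\<bar>)"
      using norm_le_l1_remove[OF b(1), of "y - y'"] by linarith
  qed simp
  moreover have "emeasure surface_measure F = hausdorff_outer (DIM('a) - 1) F"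
    using d F(2) by (intro emeasure_hausdorff_measure) (auto simp: borel_compact)
  ultimately show ?thesis by (metis ennreal_less_top infinity_ennreal_def order_le_less_trans)
qed


section \<open>Local structure of the interface\<close>

lemma Ck_on_gradient:
  fixes \<psi> :: "'a::euclidean_space \<Rightarrow> real"
  assumes "smooth_on U \<psi>"
  shows "x \<in> U \<Longrightarrow> (\<psi> has_derivative (\<lambda>h. grad \<psi> x \<bullet> h)) (at x)" and "continuous_on U (grad \<psi>)"
proof -
  have C1: "Ck_on (Suc 0) U \<psi>" using assms by (simp add: smooth_on_def del: Ck_on.simps)
  show "(\<psi> has_derivative (\<lambda>h. grad \<psi> x \<bullet> h)) (at x)" if "x \<in> U"
  proof -
    have D: "(\<psi> has_derivative frechet_derivative \<psi> (at x)) (at x)"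
      using C1 that frechet_derivative_works by auto
    then interpret linear "frechet_derivative \<psi> (at x)" by (rule has_derivative_linear)
    have "frechet_derivative \<psi> (at x) h = grad \<psi> x \<bullet> h" for h
    proof -
      have "frechet_derivative \<psi> (at x) (\<Sum>b\<in>Basis. (h \<bullet> b) *\<^sub>R b) = grad \<psi> x \<bullet> h"
        by (simp add: sum scaleR grad_def inner_sum_left inner_commute[of h] mult.commute)
      then show ?thesis by (simp add: euclidean_representation)
    qed
    then have "frechet_derivative \<psi> (at x) = (\<lambda>h. grad \<psi> x \<bullet> h)" by (rule ext)
    then show ?thesis using D by (simp only:)
  qed
  show "continuous_on U (grad \<psi>)"
    using C1 unfolding grad_def[abs_def] by (intro continuous_intros) auto
qed

text \<open>
  A chart: \<open>\<theta>\<close> is a local level set function, scaled so that its derivative in the coordinate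
  direction \<open>b\<close> is one and the other partial derivatives are not larger.
\<close>

definition iface_chart ::
  "'a::euclidean_space set \<Rightarrow> (nat \<Rightarrow> 'a set) \<Rightarrow> 'a \<Rightarrow> real \<Rightarrow> 'a \<Rightarrow> ('a \<Rightarrow> real) \<Rightarrow> bool" where
  "iface_chart \<Omega> Om x0 \<rho> b \<theta> \<longleftrightarrow> \<rho> > 0 \<and> b \<in> Basis \<and> continuous_on (ball x0 \<rho>) \<theta> \<and>
     (\<forall>y\<in>ball x0 \<rho>. \<forall>y'\<in>ball x0 \<rho>. \<bar>\<theta> y - \<theta> y' - (y - y') \<bullet> b\<bar> \<le>
        \<bar>(y - y') \<bullet> b\<bar> / 2 + 3 / 2 * (\<Sum>i\<in>Basis - {b}. \<bar>(y - y') \<bullet> i\<bar>)) \<and>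
     (\<forall>y\<in>ball x0 \<rho>. y \<in> iface Om \<longrightarrow> \<theta> y = 0) \<and>
     (\<forall>y\<in>ball x0 \<rho>. y \<in> \<Omega> \<longrightarrow> \<theta> y = 0 \<longrightarrow> y \<in> iface Om)"

text \<open>On a ball where the gradient stays within |g . b| / 2 of its value \<open>g\<close> at
  \<open>x0\<close>, the level set function minus its linear part has Lipschitz constant |g . b| /
  2. Division by g . b turns this into the chart inequality.\<close>

lemma iface_chart_exists:
  fixes \<Omega> :: "'a::euclidean_space set"
  assumes \<Omega>: "open \<Omega>" and sm: "smooth_iface \<Omega> Om n" and x0: "x0 \<in> iface Om"
  shows "\<exists>\<rho> b \<theta>. iface_chart \<Omega> Om x0 \<rho> b \<theta>"
proof -
  obtain U \<psi> where U: "open U" "x0 \<in> U" and \<psi>: "smooth_on U \<psi>" "\<forall>y\<in>U. grad \<psi> y \<noteq> 0"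
    and Om: "Om 1 \<inter> U = {y \<in> \<Omega> \<inter> U. \<psi> y < 0}" "Om 2 \<inter> U = {y \<in> \<Omega> \<inter> U. \<psi> y > 0}"
    using sm x0 unfolding smooth_iface_def by meson
  define g where "g = grad \<psi> x0"
  obtain b where b: "b \<in> Basis" "g \<bullet> b \<noteq> 0" "\<And>i. i \<in> Basis \<Longrightarrow> \<bar>g \<bullet> i\<bar> \<le> \<bar>g \<bullet> b\<bar>"
    using max_coordinate[of g] \<psi>(2) U(2) unfolding g_def by metis
  have "isCont (grad \<psi>) x0"
    using Ck_on_gradient(2)[OF \<psi>(1)] U continuous_on_eq_continuous_at by blast
  moreover have "\<bar>g \<bullet> b\<bar> / 2 > 0" using b(2) by simp
  ultimately obtain \<rho>1 where \<rho>1: "\<rho>1 > 0" "\<And>y. dist y x0 < \<rho>1 \<Longrightarrow> dist (grad \<psi> y) g < \<bar>g \<bullet> b\<bar> / 2"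
    unfolding continuous_at_eps_delta g_def by blast
  obtain \<rho>2 where \<rho>2: "\<rho>2 > 0" "ball x0 \<rho>2 \<subseteq> U" using U open_contains_ball by blast
  define \<rho> where "\<rho> = min \<rho>1 \<rho>2"
  have \<rho>: "\<rho> > 0" "ball x0 \<rho> \<subseteq> U" using \<rho>1 \<rho>2 by (auto simp: \<rho>_def)
  have bound: "\<bar>\<psi> y - \<psi> y' - g \<bullet> (y - y')\<bar> \<le> \<bar>g \<bullet> b\<bar> / 2 * norm (y - y')"
    if "y \<in> ball x0 \<rho>" "y' \<in> ball x0 \<rho>" for y y'
  proof -
    have "norm ((\<psi> y - g \<bullet> y) - (\<psi> y' - g \<bullet> y')) \<le> \<bar>g \<bullet> b\<bar> / 2 * norm (y - y')"
    proof (rule differentiable_bound[OF convex_ball _ _ that])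
      fix z assume z: "z \<in> ball x0 \<rho>"
      show "((\<lambda>y. \<psi> y - g \<bullet> y) has_derivative (\<lambda>h. (grad \<psi> z - g) \<bullet> h)) (at z within ball x0 \<rho>)"
        unfolding inner_diff_left
        by (intro has_derivative_diff has_derivative_at_withinI[OF Ck_on_gradient(1)[OF \<psi>(1)]]
            has_derivative_inner_right has_derivative_ident)
          (use z \<rho> in auto)
      have "norm (grad \<psi> z - g) \<le> \<bar>g \<bullet> b\<bar> / 2"
        using \<rho>1(2)[of z] z by (simp add: \<rho>_def dist_norm norm_minus_commute less_imp_le)
      then show "onorm (\<lambda>h. (grad \<psi> z - g) \<bullet> h) \<le> \<bar>g \<bullet> b\<bar> / 2"
        by (intro onorm_le, unfold real_norm_def)
          (rule order_trans[OF Cauchy_Schwarz_ineq2 mult_right_mono], simp_all)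
    qed
    then show ?thesis by (simp add: inner_diff_right algebra_simps)
  qed
  define \<theta> where "\<theta> y = \<psi> y / (g \<bullet> b)" for y
  have \<theta>: "\<bar>\<theta> y - \<theta> y' - (y - y') \<bullet> b\<bar> \<le>
        \<bar>(y - y') \<bullet> b\<bar> / 2 + 3 / 2 * (\<Sum>i\<in>Basis - {b}. \<bar>(y - y') \<bullet> i\<bar>)"
    if y: "y \<in> ball x0 \<rho>" "y' \<in> ball x0 \<rho>" for y y'
  proof -
    let ?w = "y - y'" and ?S = "\<Sum>i\<in>Basis - {b}. \<bar>(y - y') \<bullet> i\<bar>"
    have "\<bar>g \<bullet> b\<bar> / 2 * norm ?w \<le> \<bar>g \<bullet> b\<bar> / 2 * (\<bar>?w \<bullet> b\<bar> + ?S)"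
      using norm_le_l1_remove[OF b(1)] by (intro mult_left_mono) auto
    moreover have "\<bar>g \<bullet> ?w - (g \<bullet> b) * (?w \<bullet> b)\<bar> \<le> \<bar>g \<bullet> b\<bar> * ?S"
      by (rule abs_inner_le_coordinates[OF b(1,3)])
    ultimately have "\<bar>\<psi> y - \<psi> y' - (g \<bullet> b) * (?w \<bullet> b)\<bar> \<le> \<bar>g \<bullet> b\<bar> / 2 * (\<bar>?w \<bullet> b\<bar> + ?S) + \<bar>g \<bullet> b\<bar> * ?S"
      using bound[OF y] by linarith
    also have "\<dots> = \<bar>g \<bullet> b\<bar> * (\<bar>?w \<bullet> b\<bar> / 2 + 3 / 2 * ?S)" by (simp add: algebra_simps)
    finally have "\<bar>\<psi> y - \<psi> y' - (g \<bullet> b) * (?w \<bullet> b)\<bar> / \<bar>g \<bullet> b\<bar> \<le> \<bar>?w \<bullet> b\<bar> / 2 + 3 / 2 * ?S"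
      using b(2) by (simp add: pos_divide_le_eq mult.commute)
    moreover have "\<theta> y - \<theta> y' - ?w \<bullet> b = (\<psi> y - \<psi> y' - (g \<bullet> b) * (?w \<bullet> b)) / (g \<bullet> b)"
      using b(2) by (simp add: \<theta>_def diff_divide_distrib)
    ultimately show ?thesis by (simp add: abs_divide)
  qed
  have cont\<psi>: "continuous_on U \<psi>"
    by (intro continuous_at_imp_continuous_on ballI has_derivative_continuous[OF Ck_on_gradient(1)[OF \<psi>(1)]])
  then have cont: "continuous_on (ball x0 \<rho>) \<theta>"
    unfolding \<theta>_def[abs_def] using \<rho>(2) b(2) by (intro continuous_intros) (auto intro: continuous_on_subset)
  \<comment> \<open>A positive value at an interface point would persist nearby, although points of
    \<open>Om 1\<close>, where the function is negative, accumulate there; symmetrically for a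
    negative value and \<open>Om 2\<close>.\<close>
  have zero: "\<theta> y = 0" if y: "y \<in> ball x0 \<rho>" "y \<in> iface Om" for y
  proof -
    have yU: "y \<in> U" using y \<rho> by auto
    have c: "isCont \<psi> y" using cont\<psi> yU U(1) continuous_on_eq_continuous_at by blast
    have "\<not> \<psi> y > 0"
    proof
      assume "\<psi> y > 0"
      then have "\<forall>\<^sub>F z in nhds y. \<psi> z > 0"
        using order_tendstoD(1)[of \<psi> "\<psi> y" "nhds y" 0] c by (simp add: continuous_at tendsto_nhds_iff)
      then have "\<forall>\<^sub>F z in nhds y. \<psi> z > 0 \<and> z \<in> U"
        using U(1) yU by (intro eventually_conj) (auto simp: eventually_nhds)
      then obtain W where "open W" "y \<in> W" "\<And>z. z \<in> W \<Longrightarrow> \<psi> z > 0 \<and> z \<in> U" by (auto simp: eventually_nhds)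
      moreover have "y \<in> closure (Om 1)" using y by (simp add: iface_def)
      ultimately have "W \<inter> Om 1 \<noteq> {}" using open_Int_closure_eq_empty[of W "Om 1"] by blast
      then obtain z where "z \<in> Om 1" "\<psi> z > 0" "z \<in> U" using \<open>\<And>z. z \<in> W \<Longrightarrow> \<psi> z > 0 \<and> z \<in> U\<close> by blast
      moreover from this have "z \<in> Om 1 \<inter> U" by blast
      ultimately show False unfolding Om by simp
    qed
    moreover have "\<not> \<psi> y < 0"
    proof
      assume "\<psi> y < 0"
      then have "\<forall>\<^sub>F z in nhds y. \<psi> z < 0"
        using order_tendstoD(2)[of \<psi> "\<psi> y" "nhds y" 0] c by (simp add: continuous_at tendsto_nhds_iff)
      then have "\<forall>\<^sub>F z in nhds y. \<psi> z < 0 \<and> z \<in> U"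
        using U(1) yU by (intro eventually_conj) (auto simp: eventually_nhds)
      then obtain W where "open W" "y \<in> W" "\<And>z. z \<in> W \<Longrightarrow> \<psi> z < 0 \<and> z \<in> U" by (auto simp: eventually_nhds)
      moreover have "y \<in> closure (Om 2)" using y by (simp add: iface_def)
      ultimately have "W \<inter> Om 2 \<noteq> {}" using open_Int_closure_eq_empty[of W "Om 2"] by blast
      then obtain z where "z \<in> Om 2" "\<psi> z < 0" "z \<in> U" using \<open>\<And>z. z \<in> W \<Longrightarrow> \<psi> z < 0 \<and> z \<in> U\<close> by blast
      moreover from this have "z \<in> Om 2 \<inter> U" by blast
      ultimately show False unfolding Om by simp
    qed
    ultimately show ?thesis by (simp add: \<theta>_def)
  qed
  \<comment> \<open>Along \<open>b\<close> the function changes sign at a zero: after a step of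
    signed length s t its value differs from s t by at most half of it. A zero inside \<Omega> is
    therefore approached from both subdomains.\<close>
  have conv: "y \<in> iface Om" if y: "y \<in> ball x0 \<rho>" "y \<in> \<Omega>" "\<theta> y = 0" for y
  proof -
    have raw: "\<exists>z\<in>\<Omega> \<inter> U. dist z y < \<epsilon> \<and> s * \<theta> z > 0" if "\<epsilon> > 0" "s = 1 \<or> s = -1" for \<epsilon> s :: real
    proof -
      obtain e where e: "e > 0" "ball y e \<subseteq> \<Omega> \<inter> ball x0 \<rho>"
        using \<Omega> y open_contains_ball[of "\<Omega> \<inter> ball x0 \<rho>"] by blast
      define t where "t = min e \<epsilon> / 2"
      have t: "0 < t" "t < e" "t < \<epsilon>" using e(1) \<open>\<epsilon> > 0\<close> by (auto simp: t_def)
      define z where "z = y + (s * t) *\<^sub>R b"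
      have "norm (z - y) = t" using that(2) t b(1) by (auto simp: z_def)
      then have z: "z \<in> ball y e" "dist z y < \<epsilon>" using t by (auto simp: dist_norm norm_minus_commute)
      have "(z - y) \<bullet> i = 0" if "i \<in> Basis - {b}" for i using that b(1) inner_not_same_Basis[of b i] by (auto simp: z_def)
      moreover have zb: "(z - y) \<bullet> b = s * t" using b(1) by (simp add: z_def)
      ultimately have "\<bar>\<theta> z - s * t\<bar> \<le> \<bar>s * t\<bar> / 2"
        using \<theta>[of z y] z(1) e(2) y by auto
      then have "s * \<theta> z > 0" using that(2) t(1)
        by (elim disjE) (simp_all add: abs_if split: if_splits)
      then show ?thesis using z e(2) \<rho>(2) by blast
    qed
    have near: "\<exists>z\<in>\<Omega> \<inter> U. dist z y < \<epsilon> \<and> s * \<psi> z > 0" if eps: "\<epsilon> > 0" and ss: "s = 1 \<or> s = -1" for \<epsilon> s :: real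
    proof -
      \<comment> \<open>A negative g . b exchanges the two sides between \<open>\<theta>\<close> and
        \<open>\<psi>\<close>, so the sign of the step is adapted.\<close>
      let ?s = "if g \<bullet> b > 0 then s else - s"
      have s1: "?s = 1 \<or> ?s = -1" using ss by auto
      obtain z where "z \<in> \<Omega> \<inter> U" "dist z y < \<epsilon>" "?s * \<theta> z > 0"
        using raw[OF eps s1] by blast
      moreover from this(3) have "s * \<psi> z > 0"
        using b(2) by (auto simp: \<theta>_def zero_less_mult_iff zero_less_divide_iff divide_less_0_iff split: if_splits)
      ultimately show ?thesis by blast
    qed
    have "y \<in> closure (Om 1)" unfolding closure_approachable
    proof safe
      fix \<epsilon> :: real assume "\<epsilon> > 0"
      from near[OF this, of "-1"] obtain z where "z \<in> \<Omega> \<inter> U" "dist z y < \<epsilon>" "\<psi> z < 0" by auto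
      then show "\<exists>z\<in>Om 1. dist z y < \<epsilon>" using Om(1) by blast
    qed
    moreover have "y \<in> closure (Om 2)" unfolding closure_approachable
    proof safe
      fix \<epsilon> :: real assume "\<epsilon> > 0"
      from near[OF this, of 1] obtain z where "z \<in> \<Omega> \<inter> U" "dist z y < \<epsilon>" "\<psi> z > 0" by auto
      then show "\<exists>z\<in>Om 2. dist z y < \<epsilon>" using Om(2) by blast
    qed
    ultimately show ?thesis by (simp add: iface_def)
  qed
  have "iface_chart \<Omega> Om x0 \<rho> b \<theta>"
    unfolding iface_chart_def using \<rho>(1) b(1) cont \<theta> zero conv by blast
  then show ?thesis by blast
qed

text \<open>With \<open>\<theta>\<close> zero at both points, half of the \<open>b\<close> component
  is absorbed on the left, which bounds it by three times the sum of the others; adding these gives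
  four.\<close>

lemma iface_chart_graph:
  fixes \<Omega> :: "'a::euclidean_space set"
  assumes ch: "iface_chart \<Omega> Om x0 \<rho> b \<theta>"
    and y: "y \<in> iface Om" "y \<in> ball x0 \<rho>" "y' \<in> iface Om" "y' \<in> ball x0 \<rho>"
  shows "norm (y - y') \<le> 4 * (\<Sum>i\<in>Basis - {b}. \<bar>(y - y') \<bullet> i\<bar>)"
proof -
  have "\<theta> y = 0" "\<theta> y' = 0" and b: "b \<in> Basis" using ch y unfolding iface_chart_def by blast+
  moreover have "\<bar>\<theta> y - \<theta> y' - (y - y') \<bullet> b\<bar> \<le>
        \<bar>(y - y') \<bullet> b\<bar> / 2 + 3 / 2 * (\<Sum>i\<in>Basis - {b}. \<bar>(y - y') \<bullet> i\<bar>)"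
    using ch y unfolding iface_chart_def by blast
  ultimately have "\<bar>(y - y') \<bullet> b\<bar> \<le> 3 * (\<Sum>i\<in>Basis - {b}. \<bar>(y - y') \<bullet> i\<bar>)" by simp
  then show ?thesis using norm_le_l1_remove[OF b, of "y - y'"] by linarith
qed

text \<open>On each line in direction \<open>b\<close> over a box around \<open>x\<close> the
  intermediate value theorem gives a zero of \<open>\<theta>\<close> inside the ball, and it is an
  interface point because the ball lies in \<Omega>. The projection of the interface thus covers the
  box.\<close>

lemma iface_chart_lower:
  fixes \<Omega> :: "'a::euclidean_space set"
  assumes d: "DIM('a) \<ge> 2" and ch: "iface_chart \<Omega> Om x0 \<rho> b \<theta>"
    and x: "x \<in> iface Om" "x \<in> ball x0 (\<rho> / 2)" and r: "0 < r" "r \<le> \<rho> / 2" "ball x r \<subseteq> \<Omega>"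
  shows "ennreal (unit_ball_vol (real (DIM('a) - 1)) * (r / (12 * real (DIM('a) - 1))) ^ (DIM('a) - 1)) \<le>
    hausdorff_outer (DIM('a) - 1) (iface Om \<inter> ball x r)"
proof -
  define m where "m = real (DIM('a) - 1)"
  have b: "b \<in> Basis" using ch unfolding iface_chart_def by blast
  have m: "m \<ge> 1" "real (card (Basis - {b})) = m" using d b by (auto simp: m_def card_Diff_singleton)
  \<comment> \<open>An offset of m a and a travel of 4 m a stay within r = 6 m a. This travel
    reaches both signs: at its ends the chart error is at most 2 m a + 3/2 m a, less than 4 m
    a.\<close>
  define a where "a = r / (6 * m)"
  have a: "a > 0" "r = 6 * (m * a)" "m * a > 0" using r m by (auto simp: a_def)
  have sub: "ball x r \<subseteq> ball x0 \<rho>"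
  proof
    fix y assume "y \<in> ball x r"
    then show "y \<in> ball x0 \<rho>" using x(2) r(2) dist_triangle[of x0 y x] by auto
  qed
  have xb: "x \<in> ball x r" using r by simp
  have \<theta>x: "\<theta> x = 0" using ch x(1) sub xb unfolding iface_chart_def by blast
  have "ennreal (unit_ball_vol (real (DIM('a) - 1)) * (a / 2) ^ (DIM('a) - 1)) \<le>
    hausdorff_outer (DIM('a) - 1) (iface Om \<inter> ball x r)"
  proof (rule hausdorff_outer_graph_lower[OF d b a(1), of x])
    fix z assume z: "\<And>i. i \<in> Basis - {b} \<Longrightarrow> \<bar>(z - x) \<bullet> i\<bar> \<le> a"
    define w where "w = (\<Sum>i\<in>Basis. (if i = b then 0 else (z - x) \<bullet> i) *\<^sub>R i)"
    have wi: "w \<bullet> i = (if i = b then 0 else (z - x) \<bullet> i)" if "i \<in> Basis" for i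
      unfolding w_def using that by (rule inner_sum_left_Basis)
    define P where "P t = x + (w + t *\<^sub>R b)" for t
    have Pi: "(P t - x) \<bullet> i = (if i = b then t else (z - x) \<bullet> i)" if "i \<in> Basis" for i t
      using that b inner_not_same_Basis[of b i] by (simp add: P_def inner_add_left wi)
    have S: "(\<Sum>i\<in>Basis - {b}. \<bar>(P t - x) \<bullet> i\<bar>) \<le> m * a" for t
    proof -
      have "(\<Sum>i\<in>Basis - {b}. \<bar>(P t - x) \<bullet> i\<bar>) \<le> (\<Sum>i\<in>Basis - {b}. a)"
        using z by (intro sum_mono) (auto simp: Pi)
      then show ?thesis using m by simp
    qed
    have inb: "P t \<in> ball x r" if "\<bar>t\<bar> \<le> 4 * (m * a)" for t
    proof -
      have "norm (P t - x) \<le> \<bar>t\<bar> + m * a"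
        using norm_le_l1_remove[OF b, of "P t - x"] S[of t] Pi[OF b, of t] by simp
      then have "norm (P t - x) < r" using that a by linarith
      then show ?thesis by (simp add: dist_norm norm_minus_commute)
    qed
    have est: "\<bar>\<theta> (P t) - t\<bar> \<le> \<bar>t\<bar> / 2 + 3 / 2 * (m * a)" if "\<bar>t\<bar> \<le> 4 * (m * a)" for t
    proof -
      have "\<bar>\<theta> (P t) - \<theta> x - (P t - x) \<bullet> b\<bar> \<le>
          \<bar>(P t - x) \<bullet> b\<bar> / 2 + 3 / 2 * (\<Sum>i\<in>Basis - {b}. \<bar>(P t - x) \<bullet> i\<bar>)"
        using ch inb[OF that] xb sub unfolding iface_chart_def by blast
      then show ?thesis using S[of t] Pi[OF b, of t] \<theta>x by simp
    qed
    have "continuous_on {- (4 * (m * a))..4 * (m * a)} (\<lambda>t. \<theta> (P t))"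
    proof (rule continuous_on_compose2[where g=\<theta> and f=P])
      show "continuous_on (ball x0 \<rho>) \<theta>" using ch unfolding iface_chart_def by blast
      show "continuous_on {- (4 * (m * a))..4 * (m * a)} P" unfolding P_def by (intro continuous_intros)
      show "P ` {- (4 * (m * a))..4 * (m * a)} \<subseteq> ball x0 \<rho>" using inb sub by (auto simp: abs_le_iff)
    qed
    moreover have "\<bar>\<theta> (P (- (4 * (m * a)))) - - (4 * (m * a))\<bar> \<le> \<bar>- (4 * (m * a))\<bar> / 2 + 3 / 2 * (m * a)"
      "\<bar>\<theta> (P (4 * (m * a))) - 4 * (m * a)\<bar> \<le> \<bar>4 * (m * a)\<bar> / 2 + 3 / 2 * (m * a)"
      using a(3) by (intro est; simp)+
    then have "\<theta> (P (- (4 * (m * a)))) \<le> 0" "0 \<le> \<theta> (P (4 * (m * a)))"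
      using a(3) by linarith+
    ultimately obtain t where t: "- (4 * (m * a)) \<le> t" "t \<le> 4 * (m * a)" "\<theta> (P t) = 0"
      using IVT'[of "\<lambda>t. \<theta> (P t)" "- (4 * (m * a))" 0 "4 * (m * a)"] a(3) by auto
    have "P t \<in> ball x r" using t by (intro inb) auto
    then have "P t \<in> iface Om \<inter> ball x r" using ch sub r(3) t(3) unfolding iface_chart_def by blast
    moreover have "P t \<bullet> i = z \<bullet> i" if "i \<in> Basis - {b}" for i
      using Pi[of i t] that by (simp add: inner_diff_left)
    ultimately show "\<exists>y\<in>iface Om \<inter> ball x r. \<forall>i\<in>Basis - {b}. y \<bullet> i = z \<bullet> i" by blast
  qed
  moreover have "a / 2 = r / (12 * m)" using m by (simp add: a_def)
  ultimately show ?thesis unfolding m_def by simp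
qed

lemma compact_iface:
  assumes "bounded \<Omega>" "partitioned \<Omega> Om" shows "compact (iface Om)"
proof -
  have "Om 1 \<subseteq> \<Omega>" using assms(2) unfolding partitioned_def by blast
  then have "bounded (closure (Om 1))" using assms(1) bounded_subset by blast
  then have "bounded (iface Om)" unfolding iface_def using bounded_subset by blast
  then show ?thesis by (simp add: compact_eq_bounded_closed iface_def closed_Int)
qed

text \<open>Compactness of the interface makes the chart bounds uniform. The lower bound asks for a
  ball inside \<Omega> because the interface may end on the boundary of the domain.\<close>

lemma iface_measure_bounds:
  fixes \<Omega> :: "'a::euclidean_space set"
  assumes d: "DIM('a) \<ge> 2" and \<Omega>: "open \<Omega>" "bounded \<Omega>" and part: "partitioned \<Omega> Om"
    and sm: "smooth_iface \<Omega> Om n"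
  obtains C c r0 :: real where "C > 0" "c > 0" "r0 > 0"
    "\<And>x a. a > 0 \<Longrightarrow> emeasure surface_measure (iface Om \<inter> cball x a) \<le> ennreal (C * a ^ (DIM('a) - 1))"
    "\<And>x r. x \<in> iface Om \<Longrightarrow> 0 < r \<Longrightarrow> r \<le> r0 \<Longrightarrow> ball x r \<subseteq> \<Omega> \<Longrightarrow>
      ennreal (c * r ^ (DIM('a) - 1)) \<le> emeasure surface_measure (iface Om \<inter> ball x r)"
proof -
  define m where "m = DIM('a) - 1"
  have m: "m \<ge> 1" using d by (simp add: m_def)
  define V where "V = unit_ball_vol (real m)"
  have V: "V > 0" by (simp add: V_def unit_ball_vol_pos)
  have cI: "compact (iface Om)" by (rule compact_iface[OF \<Omega>(2) part])
  have em: "emeasure surface_measure A = hausdorff_outer m A" if "A \<in> sets borel" for A :: "'a set"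
    unfolding m_def using d that by (intro emeasure_hausdorff_measure) auto
  have "\<forall>x0\<in>iface Om. \<exists>\<rho> b \<theta>. iface_chart \<Omega> Om x0 \<rho> b \<theta>"
    using iface_chart_exists[OF \<Omega>(1) sm] by blast
  then obtain \<rho> where "\<forall>x0\<in>iface Om. \<exists>b \<theta>. iface_chart \<Omega> Om x0 (\<rho> x0) b \<theta>"
    by (rule bchoice[THEN exE])
  then obtain bb where "\<forall>x0\<in>iface Om. \<exists>\<theta>. iface_chart \<Omega> Om x0 (\<rho> x0) (bb x0) \<theta>"
    by (rule bchoice[THEN exE])
  then obtain \<theta> where ch: "\<forall>x0\<in>iface Om. iface_chart \<Omega> Om x0 (\<rho> x0) (bb x0) (\<theta> x0)"
    by (rule bchoice[THEN exE])
  have \<rho>: "\<rho> x0 > 0" "bb x0 \<in> Basis" if "x0 \<in> iface Om" for x0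
    using ch that unfolding iface_chart_def by blast+
  obtain F where F: "F \<subseteq> iface Om" "finite F" "iface Om \<subseteq> (\<Union>x0\<in>F. ball x0 (\<rho> x0 / 2))"
    by (rule compactE_image[OF cI, of "iface Om" "\<lambda>x0. ball x0 (\<rho> x0 / 2)"]) (use \<rho> in force)+
  \<comment> \<open>A Lebesgue number: the half-sized chart balls cover the interface, so a ball of
    this radius about an interface point stays in one chart. The entry 1 keeps the minimum defined
    for an empty interface.\<close>
  define r0 where "r0 = Min (insert 1 (\<rho> ` F)) / 2"
  have "Min (insert 1 (\<rho> ` F)) > 0" using F \<rho> by (subst Min_gr_iff) auto
  then have r0: "r0 > 0" by (simp add: r0_def)
  have r0\<rho>: "r0 \<le> \<rho> x0 / 2" if "x0 \<in> F" for x0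
    using F(2) that by (simp add: r0_def)
  have V4: "emeasure surface_measure (iface Om \<inter> cball x a) \<le> ennreal (V * (4 * real m * a) ^ m)"
    if a: "a > 0" and x0: "x0 \<in> F" and sub: "iface Om \<inter> cball x a \<subseteq> ball x0 (\<rho> x0)" for x a x0
  proof -
    have x0': "x0 \<in> iface Om" using x0 F(1) by blast
    have "hausdorff_outer (DIM('a) - 1) (iface Om \<inter> cball x a) \<le> ennreal
        (unit_ball_vol (real (DIM('a) - 1)) * (4 * real (DIM('a) - 1) * a) ^ (DIM('a) - 1))"
    proof (rule hausdorff_outer_graph_upper[OF d \<rho>(2)[OF x0'] _ a])
      fix y y' assume "y \<in> iface Om \<inter> cball x a" "y' \<in> iface Om \<inter> cball x a"
      then show "norm (y - y') \<le> 4 * (\<Sum>i\<in>Basis - {bb x0}. \<bar>(y - y') \<bullet> i\<bar>)"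
        using sub by (intro iface_chart_graph[OF bspec[OF ch x0']]) auto
    qed auto
    moreover have bor: "iface Om \<inter> cball x a \<in> sets borel" by (simp add: borel_closed iface_def closed_Int)
    ultimately show ?thesis by (simp only: em[OF bor] V_def m_def)
  qed
  define M where "M = (\<Sum>x0\<in>F. V * (4 * real m * (\<rho> x0 / 2)) ^ m)"
  have M: "M \<ge> 0" unfolding M_def using V \<rho>(1) F(1)
    by (intro sum_nonneg mult_nonneg_nonneg zero_le_power) (auto intro: less_imp_le)
  have total: "emeasure surface_measure (iface Om) \<le> ennreal M"
  proof -
    have bor: "iface Om \<inter> cball x r \<in> sets surface_measure" for x r
      by (simp add: borel_closed iface_def closed_Int)
    have "iface Om \<subseteq> (\<Union>x0\<in>F. iface Om \<inter> cball x0 (\<rho> x0 / 2))"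
    proof
      fix y assume y: "y \<in> iface Om"
      then obtain x0 where "x0 \<in> F" "y \<in> ball x0 (\<rho> x0 / 2)" using F(3) by blast
      then show "y \<in> (\<Union>x0\<in>F. iface Om \<inter> cball x0 (\<rho> x0 / 2))"
        using y ball_subset_cball by blast
    qed
    then have "emeasure surface_measure (iface Om) \<le>
        emeasure surface_measure (\<Union>x0\<in>F. iface Om \<inter> cball x0 (\<rho> x0 / 2))"
      by (rule emeasure_mono) (intro sets.finite_UN F(2) bor)
    also have "\<dots> \<le> (\<Sum>x0\<in>F. emeasure surface_measure (iface Om \<inter> cball x0 (\<rho> x0 / 2)))"
      by (rule emeasure_subadditive_finite[OF F(2)]) (use bor in blast)
    also have "\<dots> \<le> (\<Sum>x0\<in>F. ennreal (V * (4 * real m * (\<rho> x0 / 2)) ^ m))"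
    proof (intro sum_mono V4)
      fix x0 assume x0: "x0 \<in> F"
      then have p: "\<rho> x0 > 0" using F(1) \<rho>(1) by blast
      then show "0 < \<rho> x0 / 2" by simp
      show "iface Om \<inter> cball x0 (\<rho> x0 / 2) \<subseteq> ball x0 (\<rho> x0)" using p by auto
      show "x0 \<in> F" by (rule x0)
    qed
    also have "\<dots> = ennreal M"
      unfolding M_def using V \<rho>(1) F(1)
      by (intro sum_ennreal mult_nonneg_nonneg zero_le_power) (auto intro: less_imp_le)
    finally show ?thesis .
  qed
  \<comment> \<open>The first summand serves balls that fit into one chart; the second serves larger
    radii, where (2 a / r0) ^ m >= 1 and the total area is enough.\<close>
  define C where "C = V * (4 * real m) ^ m + M * (2 / r0) ^ m"
  have "V * (4 * real m) ^ m > 0" using V m by simp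
  moreover have "M * (2 / r0) ^ m \<ge> 0" using M r0 by simp
  ultimately have C: "C > 0" "C \<ge> V * (4 * real m) ^ m" "C \<ge> M * (2 / r0) ^ m" unfolding C_def by linarith+
  have upper: "emeasure surface_measure (iface Om \<inter> cball x a) \<le> ennreal (C * a ^ m)" if a: "a > 0" for x a
  proof (cases "2 * a \<le> r0 \<and> iface Om \<inter> cball x a \<noteq> {}")
    case True
    then obtain p where p: "p \<in> iface Om" "p \<in> cball x a" by blast
    then obtain x0 where x0: "x0 \<in> F" "p \<in> ball x0 (\<rho> x0 / 2)" using F(3) by blast
    have "iface Om \<inter> cball x a \<subseteq> ball x0 (\<rho> x0)"
    proof
      fix y assume "y \<in> iface Om \<inter> cball x a"
      then have "dist p y \<le> 2 * a" using p dist_triangle3[of p y x] by auto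
      then show "y \<in> ball x0 (\<rho> x0)"
        using True r0\<rho>[OF x0(1)] x0(2) dist_triangle[of x0 y p] by auto
    qed
    from V4[OF a x0(1) this] have "emeasure surface_measure (iface Om \<inter> cball x a) \<le> ennreal (V * (4 * real m * a) ^ m)" .
    also have "V * (4 * real m * a) ^ m = V * (4 * real m) ^ m * a ^ m" by (simp add: power_mult_distrib)
    also have "ennreal \<dots> \<le> ennreal (C * a ^ m)"
      using C(2) a by (intro ennreal_leI mult_right_mono) auto
    finally show ?thesis .
  next
    case False
    show ?thesis
    proof (cases "iface Om \<inter> cball x a = {}")
      case False
      then have "1 \<le> 2 * a / r0" using \<open>\<not> (2 * a \<le> r0 \<and> _)\<close> r0 by simp
      then have "1 \<le> (2 * a / r0) ^ m" by (rule one_le_power)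
      then have "M * 1 \<le> M * (2 * a / r0) ^ m" using M by (intro mult_left_mono)
      also have "(2 * a / r0) ^ m = (2 / r0) ^ m * a ^ m" by (subst power_mult_distrib[symmetric]) simp
      also have "M * ((2 / r0) ^ m * a ^ m) \<le> C * a ^ m"
        unfolding mult.assoc[symmetric] using C(3) a by (intro mult_right_mono) auto
      finally have "ennreal M \<le> ennreal (C * a ^ m)" by (intro ennreal_leI) simp
      moreover have "emeasure surface_measure (iface Om \<inter> cball x a) \<le> emeasure surface_measure (iface Om)"
        by (intro emeasure_mono) (auto intro!: borel_closed simp: iface_def)
      ultimately show ?thesis using total by (meson order_trans)
    qed simp
  qed
  define c where "c = V * (1 / (12 * real m)) ^ m"
  have c: "c > 0" using V m by (simp add: c_def)
  have lower: "ennreal (c * r ^ m) \<le> emeasure surface_measure (iface Om \<inter> ball x r)"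
    if x: "x \<in> iface Om" and r: "0 < r" "r \<le> r0" "ball x r \<subseteq> \<Omega>" for x r
  proof -
    obtain x0 where x0: "x0 \<in> F" "x \<in> ball x0 (\<rho> x0 / 2)" using F(3) x by blast
    then have "x0 \<in> iface Om" using F(1) by blast
    from iface_chart_lower[OF d bspec[OF ch this] x x0(2) r(1) _ r(3)]
    have "ennreal (V * (r / (12 * real m)) ^ m) \<le> hausdorff_outer m (iface Om \<inter> ball x r)"
      using r0\<rho>[OF x0(1)] r(2) by (simp add: V_def m_def)
    moreover have "c * r ^ m = V * (r / (12 * real m)) ^ m"
      unfolding c_def mult.assoc power_mult_distrib[symmetric] by simp
    moreover have "iface Om \<inter> ball x r \<in> sets borel"
      by (intro sets.Int borel_closed borel_open) (auto simp: iface_def)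
    ultimately show ?thesis by (simp only: em)
  qed
  show thesis
    by (rule that[OF C(1) c r0]) (rule upper[unfolded m_def] lower[unfolded m_def]; assumption)+
qed

text \<open>Continuity is local, and near each point the normal is a normalised smooth gradient. It
  makes the consistency terms integrable.\<close>

lemma continuous_normal:
  fixes n :: "'a::euclidean_space \<Rightarrow> 'a"
  assumes sm: "smooth_iface \<Omega> Om n"
  shows "continuous_on (iface Om) n"
proof -
  have chart: "\<exists>U \<psi>. open U \<and> x \<in> U \<and> smooth_on U \<psi> \<and> (\<forall>y\<in>U. grad \<psi> y \<noteq> 0) \<and>
      (\<forall>y\<in>iface Om \<inter> U. n y = grad \<psi> y /\<^sub>R norm (grad \<psi> y))" if "x \<in> iface Om" for x
    using bspec[OF sm[unfolded smooth_iface_def] that] by (elim exE conjE) (intro exI conjI; assumption)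
  show "continuous_on (iface Om) n"
    unfolding continuous_on_eq_continuous_within
  proof
    fix x assume x: "x \<in> iface Om"
    obtain U \<psi> where U: "open U" "x \<in> U" "smooth_on U \<psi>" "\<forall>y\<in>U. grad \<psi> y \<noteq> 0"
      "\<forall>y\<in>iface Om \<inter> U. n y = grad \<psi> y /\<^sub>R norm (grad \<psi> y)"
      using chart[OF x] by blast
    have "continuous_on (iface Om \<inter> U) (\<lambda>y. grad \<psi> y /\<^sub>R norm (grad \<psi> y))"
      using continuous_on_subset[OF Ck_on_gradient(2)[OF U(3)], of "iface Om \<inter> U"] U(4)
      by (intro continuous_on_scaleR continuous_on_inverse continuous_on_norm) simp_all
    then have "continuous_on (iface Om \<inter> U) n"
      by (rule continuous_on_eq) (use U(5) in simp)
    then have "continuous (at x within (iface Om \<inter> U)) n"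
      using x U(2) by (simp add: continuous_on_eq_continuous_within)
    moreover have "at x within (iface Om \<inter> U) = at x within iface Om"
      using U(1,2) by (intro at_within_nhd[of _ U]) auto
    ultimately show "continuous (at x within iface Om) n" by simp
  qed
qed

section \<open>Shape regular meshes\<close>

definition verts :: "'a::euclidean_space set \<Rightarrow> 'a set" where
  "verts T = {v. v extreme_point_of T}"

abbreviation lam :: "'a::euclidean_space set \<Rightarrow> 'a \<Rightarrow> 'a \<Rightarrow> real" where
  "lam T v x \<equiv> bary (verts T) x v"

lemma segment_near:
  fixes a b :: "'a::real_normed_vector"
  assumes "e > 0"
  obtains s where "0 < s" "s < 1" "(1 - s) *\<^sub>R a + s *\<^sub>R b \<in> ball a e"
proof -
  define N where "N = 2 * (norm (b - a) + 1)"
  have N: "N > 0" "norm (b - a) < N" using norm_ge_zero[of "b - a"] by (simp_all add: N_def add_nonneg_pos)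
  define s where "s = min (1 / 2) (e / N)"
  have s: "0 < s" "s < 1" "s \<le> e / N" using assms N by (auto simp: s_def)
  have "(1 - s) *\<^sub>R a + s *\<^sub>R b - a = s *\<^sub>R (b - a)" by (simp add: algebra_simps)
  then have "norm ((1 - s) *\<^sub>R a + s *\<^sub>R b - a) = s * norm (b - a)" using s by simp
  also have "\<dots> \<le> e / N * norm (b - a)" using s by (intro mult_right_mono) auto
  also have "\<dots> < e"
    using mult_strict_left_mono[OF N(2) assms] N by (simp add: pos_divide_less_eq)
  finally show thesis using that[of s] s by (simp add: dist_norm norm_minus_commute)
qed

text \<open>Shape regularity enters through an actual ball in each element instead of the supremum
  in \<open>inball_diameter\<close>; \<open>K\<close> compares the diameter with the radius of that
  ball.\<close>

locale mesh =
  fixes \<Omega> :: "'a::euclidean_space set" and \<T> :: "'a set set" and K :: real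
  assumes dim: "DIM('a) \<ge> 2"
    and \<Omega>: "open \<Omega>" "bounded \<Omega>" "interior (closure \<Omega>) = \<Omega>"
    and mesh: "simplicial_mesh \<Omega> \<T>"
    and inball: "\<And>T. T \<in> \<T> \<Longrightarrow> \<exists>z r. 0 < r \<and> cball z r \<subseteq> T \<and> diameter T \<le> K * r"
begin

lemma finite_mesh: "finite \<T>" and mesh_cover: "\<Union>\<T> = closure \<Omega>"
  using mesh by (auto simp: simplicial_mesh_def triangulation_def)

lemma
  assumes "T \<in> \<T>"
  shows frame: "affine_frame (verts T)" and hull_verts: "convex hull (verts T) = T"
proof -
  obtain C where C: "\<not> affine_dependent C" "int (card C) = int DIM('a) + 1" "T = convex hull C"
    using mesh assms unfolding simplicial_mesh_def simplex_def by meson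
  then have "verts T = C"
    unfolding verts_def using extreme_point_of_convex_hull_affine_independent by auto
  then show "affine_frame (verts T)" "convex hull (verts T) = T" using C by (auto simp: affine_frame_def)
qed

lemma finite_verts: "T \<in> \<T> \<Longrightarrow> finite (verts T)"
  using frame affine_frame_finite by blast

lemma compact_elt: "T \<in> \<T> \<Longrightarrow> compact T"
  using hull_verts finite_verts finite_imp_compact_convex_hull by metis

lemma convex_elt: "T \<in> \<T> \<Longrightarrow> convex T"
  using hull_verts convex_convex_hull by metis

lemma closed_elt: "T \<in> \<T> \<Longrightarrow> closed T"
  using compact_elt compact_imp_closed by blast

lemma verts_subset: "T \<in> \<T> \<Longrightarrow> verts T \<subseteq> T"
  using hull_verts hull_subset by metis

lemma interior_elt_nonempty: "T \<in> \<T> \<Longrightarrow> interior T \<noteq> {}"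
  using interior_simplex_nonempty[OF frame] hull_verts by metis

lemma closure_interior_elt: "T \<in> \<T> \<Longrightarrow> closure (interior T) = T"
  using convex_closure_interior[OF convex_elt interior_elt_nonempty] closed_elt closure_closed by metis

lemma in_elt: "T \<in> \<T> \<Longrightarrow> x \<in> T \<longleftrightarrow> (\<forall>v\<in>verts T. lam T v x \<ge> 0)"
  using in_simplex_bary[OF frame] hull_verts by metis

lemma inter_faces: "T \<in> \<T> \<Longrightarrow> T' \<in> \<T> \<Longrightarrow> (T \<inter> T') face_of T"
  using mesh by (auto simp: simplicial_mesh_def triangulation_def)

text \<open>The intersection is a face of both elements and its extreme points are the common
  vertices; Krein-Milman recovers it from them.\<close>

lemma elt_inter:
  assumes "T \<in> \<T>" "T' \<in> \<T>"
  shows "T \<inter> T' = convex hull (verts T \<inter> verts T')"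
proof -
  have f: "(T \<inter> T') face_of T" "(T \<inter> T') face_of T'"
    using inter_faces[OF assms] inter_faces[OF assms(2,1)] by (auto simp: Int_commute)
  have "x extreme_point_of (T \<inter> T') \<longleftrightarrow> x \<in> verts T \<and> x \<in> verts T'" for x
    using extreme_point_of_face[OF f(1), of x] extreme_point_of_face[OF f(2), of x]
      verts_subset[OF assms(1)] verts_subset[OF assms(2)] unfolding verts_def by blast
  then have "{x. x extreme_point_of (T \<inter> T')} = verts T \<inter> verts T'" by blast
  moreover have "T \<inter> T' = convex hull {x. x extreme_point_of (T \<inter> T')}"
    by (rule Krein_Milman_Minkowski)
      (use assms compact_elt convex_elt in \<open>auto intro: compact_Int convex_Int\<close>)
  ultimately show ?thesis by simp
qed

text \<open>No hanging nodes: extremality passes from one element to their common face and from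
  there to the other element.\<close>

lemma vertex_of_elt:
  assumes "T0 \<in> \<T>" "v \<in> verts T0" "T \<in> \<T>" "v \<in> T"
  shows "v \<in> verts T"
proof -
  have f: "(T \<inter> T0) face_of T" "(T \<inter> T0) face_of T0"
    using inter_faces[OF assms(3,1)] inter_faces[OF assms(1,3)] by (auto simp: Int_commute)
  have "v \<in> T0" using verts_subset assms by blast
  then show ?thesis
    using assms extreme_point_of_face[OF f(1), of v] extreme_point_of_face[OF f(2), of v]
    by (auto simp: verts_def)
qed

lemma lam_share:
  assumes "T \<in> \<T>" "T' \<in> \<T>" "x \<in> T" "x \<in> T'" "v \<in> verts T"
  shows "lam T v x = (if v \<in> verts T' then lam T' v x else 0)"
proof -
  have x: "x \<in> convex hull (verts T \<inter> verts T')" using elt_inter[OF assms(1,2)] assms(3,4) by blast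
  then have "\<forall>u\<in>verts T - verts T \<inter> verts T'. lam T u x = 0"
    using in_convex_hull_bary[OF frame[OF assms(1)], of "verts T \<inter> verts T'"] by blast
  then show ?thesis
    using bary_restrict[OF frame[OF assms(1)] frame[OF assms(2)] _ _ x] assms(5) by auto
qed

section \<open>Topology of the mesh near points of the domain\<close>

lemma local_elts:
  obtains \<delta> where "\<delta> > 0" "\<And>T. T \<in> \<T> \<Longrightarrow> T \<inter> ball y \<delta> \<noteq> {} \<Longrightarrow> y \<in> T"
proof -
  have "closed (\<Union>{T \<in> \<T>. y \<notin> T})" using finite_mesh closed_elt by (intro closed_Union) auto
  then have "open (- \<Union>{T \<in> \<T>. y \<notin> T})" by (simp add: open_Compl)
  moreover have "y \<in> - \<Union>{T \<in> \<T>. y \<notin> T}" by auto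
  ultimately obtain \<delta> where "\<delta> > 0" "ball y \<delta> \<subseteq> - \<Union>{T \<in> \<T>. y \<notin> T}"
    using open_contains_ball by blast
  then show thesis using that[of \<delta>] by blast
qed

text \<open>
  The minimal face of an interior point \<open>v\<close> is open in the domain: a small neighbourhood of a point \<open>y\<close>
  with larger support is the image of a neighbourhood of a point near \<open>v\<close> under a homothety that
  maps the relevant simplices into themselves.
\<close>

lemma support_open:
  assumes T: "T \<in> \<T>" and v: "v \<in> T" "v \<in> \<Omega>" and y: "y \<in> T"
    and supp: "\<And>u. u \<in> verts T \<Longrightarrow> lam T u v > 0 \<Longrightarrow> lam T u y > 0"
  shows "y \<in> \<Omega>"
proof -
  define S where "S = {u \<in> verts T. lam T u y > 0}"
  \<comment> \<open>At most every positive coordinate of \<open>y\<close>, so that subtracting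
    \<tau> times a coordinate of \<open>w\<close> cannot make one negative; the entry 1 / 2 keeps it
    below one.\<close>
  define \<tau> where "\<tau> = Min (insert (1 / 2) ((\<lambda>u. lam T u y) ` S))"
  have finS: "finite S" using finite_verts[OF T] by (simp add: S_def)
  then have "\<tau> > 0" unfolding \<tau>_def by (subst Min_gr_iff) (auto simp: S_def)
  moreover have "\<tau> \<le> 1 / 2" unfolding \<tau>_def using finS by (intro Min_le) auto
  ultimately have \<tau>: "0 < \<tau>" "\<tau> < 1" by auto
  have \<tau>le: "\<tau> \<le> lam T u y" if "u \<in> S" for u unfolding \<tau>_def using finS that by (intro Min_le) auto
  obtain \<epsilon> where \<epsilon>: "\<epsilon> > 0" "ball v \<epsilon> \<subseteq> \<Omega>" using \<Omega>(1) v(2) open_contains_ball by blast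
  obtain s where s: "0 < s" "s < 1" and "(1 - s) *\<^sub>R v + s *\<^sub>R y \<in> ball v \<epsilon>"
    using segment_near[OF \<epsilon>(1)] by blast
  \<comment> \<open>\<open>w\<close> has the same positive coordinates as \<open>y\<close>, yet lies
    in \<Omega> because it is close to \<open>v\<close>.\<close>
  define w where "w = (1 - s) *\<^sub>R v + s *\<^sub>R y"
  have "w \<in> \<Omega>" using \<open>_ \<in> ball v \<epsilon>\<close> \<epsilon>(2) by (auto simp: w_def)
  then obtain \<delta>1 where \<delta>1: "\<delta>1 > 0" "ball w \<delta>1 \<subseteq> \<Omega>" using \<Omega>(1) open_contains_ball by blast
  obtain \<delta>2 where \<delta>2: "\<delta>2 > 0" "\<And>T. T \<in> \<T> \<Longrightarrow> T \<inter> ball w \<delta>2 \<noteq> {} \<Longrightarrow> w \<in> T" using local_elts by blast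
  define \<delta> where "\<delta> = min \<delta>1 \<delta>2"
  have \<delta>: "\<delta> > 0" using \<delta>1 \<delta>2 by (simp add: \<delta>_def)
  \<comment> \<open>The centre of the homothety with factor \<open>\<tau>\<close> that takes
    \<open>w\<close> to \<open>y\<close>.\<close>
  define y' where "y' = (1 / (1 - \<tau>)) *\<^sub>R (y - \<tau> *\<^sub>R w)"
  have yy: "y = (1 - \<tau>) *\<^sub>R y' + \<tau> *\<^sub>R w" using \<tau> by (simp add: y'_def)
  have wT: "w \<in> T" unfolding w_def using convexD_alt[OF convex_elt[OF T] v(1) y, of s] s by simp
  have lw: "lam T u w = (1 - s) * lam T u v + s * lam T u y" if "u \<in> verts T" for u
    unfolding w_def by (rule bary_line[OF frame[OF T] that])
  have ly': "(1 - \<tau>) * lam T u y' = lam T u y - \<tau> * lam T u w" if "u \<in> verts T" for u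
    using bary_line[OF frame[OF T] that, of \<tau> y' w] yy by simp
  have ynn: "lam T u y \<ge> 0" if "u \<in> verts T" for u using in_elt[OF T] y that by blast
  have vnn: "lam T u v \<ge> 0" if "u \<in> verts T" for u using in_elt[OF T] v(1) that by blast
  have "y' \<in> T''" if T'': "T'' \<in> \<T>" "w \<in> T''" for T''
  proof -
    let ?W = "verts T \<inter> verts T''"
    have "w \<in> convex hull ?W" using elt_inter[OF T T''(1)] wT T''(2) by blast
    then have w0: "lam T u w = 0" if "u \<in> verts T - ?W" for u
      using in_convex_hull_bary[OF frame[OF T], of ?W w] that by blast
    have "y' \<in> convex hull ?W"
      unfolding in_convex_hull_bary[OF frame[OF T] Int_lower1]
    proof (intro conjI ballI)
      fix u assume u: "u \<in> verts T"
      have "lam T u y - \<tau> * lam T u w \<ge> 0"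
      proof (cases "u \<in> S")
        case True
        have "lam T u w \<le> 1" using bary_le_1[OF frame[OF T] _ u] wT hull_verts[OF T] by simp
        then have "\<tau> * lam T u w \<le> \<tau>" using \<tau> by simp
        then show ?thesis using \<tau>le[OF True] by linarith
      next
        case False
        then have "lam T u y = 0" using ynn[OF u] u by (auto simp: S_def)
        moreover from this have "lam T u v = 0" using supp[OF u] vnn[OF u] by force
        ultimately show ?thesis using lw[OF u] by simp
      qed
      then have "(1 - \<tau>) * lam T u y' \<ge> 0" using ly'[OF u] by simp
      then show "lam T u y' \<ge> 0" using \<tau> by (simp add: zero_le_mult_iff)
    next
      fix u assume u: "u \<in> verts T - ?W"
      then have u': "u \<in> verts T" by blast
      have "lam T u w = 0" by (rule w0[OF u])
      moreover have "(1 - s) * lam T u v \<ge> 0" "s * lam T u y \<ge> 0" using s vnn[OF u'] ynn[OF u'] by auto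
      ultimately have "s * lam T u y = 0" using lw[OF u'] by linarith
      then have "(1 - \<tau>) * lam T u y' = 0" using ly'[OF u'] \<open>lam T u w = 0\<close> s by auto
      then show "lam T u y' = 0" using \<tau> by simp
    qed
    then show "y' \<in> T''" using elt_inter[OF T T''(1)] by blast
  qed
  note y' = this
  have "ball y (\<tau> * \<delta>) \<subseteq> closure \<Omega>"
  proof
    fix q assume q: "q \<in> ball y (\<tau> * \<delta>)"
    define p where "p = w + (1 / \<tau>) *\<^sub>R (q - y)"
    have "norm (p - w) = norm (q - y) / \<tau>" using \<tau> by (simp add: p_def)
    also have "\<dots> < \<delta>" using q \<tau> by (simp add: dist_norm norm_minus_commute pos_divide_less_eq mult.commute)
    finally have p: "p \<in> ball w \<delta>" by (simp add: dist_norm norm_minus_commute)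
    then have "p \<in> \<Omega>" using \<delta>1(2) by (auto simp: \<delta>_def)
    then have "p \<in> closure \<Omega>" using closure_subset by blast
    then obtain T'' where T'': "T'' \<in> \<T>" "p \<in> T''" using mesh_cover by blast
    moreover have "p \<in> ball w \<delta>2" using p by (simp add: \<delta>_def)
    ultimately have "w \<in> T''" using \<delta>2(2)[of T''] by blast
    then have "y' \<in> T''" using y' T'' by blast
    then have "(1 - \<tau>) *\<^sub>R y' + \<tau> *\<^sub>R p \<in> T''"
      using convexD_alt[OF convex_elt[OF T''(1)], of y' p \<tau>] T'' \<tau> by auto
    moreover have "(1 - \<tau>) *\<^sub>R y' + \<tau> *\<^sub>R p = q"
    proof -
      have "(1 - \<tau>) *\<^sub>R y' + \<tau> *\<^sub>R p = ((1 - \<tau>) *\<^sub>R y' + \<tau> *\<^sub>R w) + (q - y)"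
        using \<tau> by (simp add: p_def scaleR_add_right)
      then show ?thesis using yy by simp
    qed
    ultimately show "q \<in> closure \<Omega>" using T''(1) mesh_cover by blast
  qed
  then have "y \<in> interior (closure \<Omega>)"
    using \<tau> \<delta> by (intro interiorI[of "ball y (\<tau> * \<delta>)"]) auto
  then show ?thesis using \<Omega>(3) by simp
qed

text \<open>The only positive coordinate of a vertex is its own, so \<open>support_open\<close>
  applies.\<close>

lemma star_open:
  assumes T: "T \<in> \<T>" and v: "v \<in> verts T" "v \<in> \<Omega>" and y: "y \<in> T" "lam T v y > 0"
  shows "y \<in> \<Omega>"
proof (rule support_open[OF T _ v(2) y(1)])
  show "v \<in> T" using v(1) verts_subset[OF T] by blast
  show "lam T u y > 0" if "u \<in> verts T" "lam T u v > 0" for u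
    using bary_vertex[OF frame[OF T] that(1) v(1)] that(2) y(2) by (auto split: if_splits)
qed

section \<open>Elements sharing a facet\<close>

text \<open>Overlapping interiors make the intersection full-dimensional, and a proper face has
  smaller dimension.\<close>

lemma interior_elts_eq:
  assumes "T \<in> \<T>" "T' \<in> \<T>" "interior T \<inter> interior T' \<noteq> {}"
  shows "T = T'"
proof -
  have full: "aff_dim (T \<inter> T') = DIM('a)"
    using assms(3) by (intro aff_dim_nonempty_interior) (simp add: interior_Int)
  have "T \<inter> T' = T" if "T \<in> \<T>" "T' \<in> \<T>" "aff_dim (T \<inter> T') = DIM('a)" for T T'
    using face_of_aff_dim_lt[OF convex_elt[OF that(1)] inter_faces[OF that(1,2)]] that(3)
      aff_dim_le_DIM[of T] by auto
  then show ?thesis using assms(1,2) full by (metis Int_commute)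
qed

text \<open>Both coordinates are affine and vanish on the facet spanned by \<open>W\<close>, so they
  are proportional; the factor is the value at \<open>v1\<close>.\<close>

lemma lam_affine_change:
  assumes T: "T \<in> \<T>" "v \<in> verts T" and T1: "T1 \<in> \<T>" "verts T1 = insert v1 W" "v1 \<notin> W" and W: "W \<subseteq> verts T" "v \<notin> W"
  shows "lam T v x = lam T1 v1 x * lam T v v1"
proof -
  have fin: "finite W" using finite_verts[OF T1(1)] T1(2) by simp
  have "lam T v x = lam T v (\<Sum>u\<in>verts T1. lam T1 u x *\<^sub>R u)" using bary_comb[OF frame[OF T1(1)], of x] by simp
  also have "\<dots> = (\<Sum>u\<in>verts T1. lam T1 u x * lam T v u)"
    by (rule bary_combine[OF frame[OF T(1)] T(2) bary_sum[OF frame[OF T1(1)]]])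
  also have "\<dots> = lam T1 v1 x * lam T v v1 + (\<Sum>u\<in>W. lam T1 u x * lam T v u)"
    unfolding T1(2) using fin T1(3) by simp
  also have "(\<Sum>u\<in>W. lam T1 u x * lam T v u) = 0"
  proof (intro sum.neutral ballI)
    fix u assume "u \<in> W"
    then have "lam T v u = 0" using W bary_vertex[OF frame[OF T(1)] T(2), of u] by auto
    then show "lam T1 u x * lam T v u = 0" by simp
  qed
  finally show ?thesis by simp
qed

text \<open>From the barycentre \<open>p\<close> of the facet a small step towards \<open>v\<close>
  keeps all facet coordinates positive and makes the two opposite coordinates positive. It therefore
  enters the interior of both elements.\<close>

lemma same_side_eq:
  assumes T: "T \<in> \<T>" "verts T = insert v W" "v \<notin> W" and T1: "T1 \<in> \<T>" "verts T1 = insert v1 W" "v1 \<notin> W"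
    and W: "W \<noteq> {}" and pos: "lam T v v1 > 0"
  shows "T = T1"
proof -
  have fin: "finite W" using finite_verts[OF T1(1)] T1(2) by simp
  define p where "p = (\<Sum>w\<in>W. (1 / card W) *\<^sub>R w)"
  have lp: "lam S u p = (if u \<in> W then 1 / card W else 0)" if S: "S \<in> \<T>" "W \<subseteq> verts S" "u \<in> verts S" for S u
  proof -
    have "lam S u p = (\<Sum>w\<in>W. 1 / card W * lam S u w)"
      unfolding p_def using W fin by (intro bary_combine[OF frame[OF S(1)] S(3)]) simp
    also have "\<dots> = (\<Sum>w\<in>W. if u = w then 1 / card W else 0)"
      using S by (intro sum.cong refl) (auto simp: bary_vertex[OF frame[OF S(1)] S(3)])
    finally show ?thesis using fin by simp
  qed
  define N where "N = {x. \<forall>w\<in>W. lam T w x > 0} \<inter> {x. \<forall>w\<in>W. lam T1 w x > 0}"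
  have "open N" unfolding N_def using T T1 by (intro open_Int open_bary_pos frame) auto
  moreover have "p \<in> N"
  proof -
    have "card W > 0" using W fin by (simp add: card_gt_0_iff)
    moreover have "W \<subseteq> verts T" "W \<subseteq> verts T1" using T(2) T1(2) by auto
    ultimately have "lam T w p > 0 \<and> lam T1 w p > 0" if "w \<in> W" for w
      using lp[OF T(1), of w] lp[OF T1(1), of w] that by auto
    then show ?thesis by (simp add: N_def)
  qed
  ultimately obtain e where e: "e > 0" "ball p e \<subseteq> N" using open_contains_ball by blast
  obtain s where s: "0 < s" "s < 1" and near: "(1 - s) *\<^sub>R p + s *\<^sub>R v \<in> ball p e"
    using segment_near[OF e(1)] by blast
  define x where "x = (1 - s) *\<^sub>R p + s *\<^sub>R v"
  have "x \<in> N" using near e(2) by (auto simp: x_def)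
  have "lam T v x = s"
    unfolding x_def using bary_line[OF frame[OF T(1)], of v s p v] lp[OF T(1), of v] T
      bary_vertex[OF frame[OF T(1)], of v v] by auto
  moreover have "lam T v x = lam T1 v1 x * lam T v v1"
    using T T1 by (intro lam_affine_change) auto
  ultimately have "lam T v x > 0" "lam T1 v1 x > 0" using s pos by (auto simp: zero_less_mult_iff)
  then have x: "x \<in> {x. \<forall>u\<in>verts T. lam T u x > 0}" "x \<in> {x. \<forall>u\<in>verts T1. lam T1 u x > 0}"
    using \<open>x \<in> N\<close> T(2) T1(2) by (auto simp: N_def)
  have "{x. \<forall>u\<in>verts S. lam S u x > 0} \<subseteq> interior S" if "S \<in> \<T>" for S
    using open_bary_pos[OF frame[OF that] order_refl] in_elt[OF that]
    by (intro interior_maximal) (auto intro: less_imp_le)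
  then show ?thesis using x T(1) T1(1) by (intro interior_elts_eq) blast+
qed

text \<open>With three elements at one facet each opposite vertex would have nonpositive coordinate
  with respect to the others. The coordinate of \<open>v1\<close> is a product of two such numbers,
  hence zero, although some multiple of it is one. This makes the arbitrary choice in
  \<open>face_sides\<close> harmless.\<close>

lemma facet_two_sided:
  assumes T: "T \<in> \<T>" "T' \<in> \<T>" "T \<noteq> T'" and F: "F = T \<inter> T'" "F facet_of T" and T1: "T1 \<in> \<T>" "F \<subseteq> T1"
  shows "T1 = T \<or> T1 = T'"
proof (rule ccontr)
  assume ne: "\<not> ?thesis"
  define W where "W = verts T \<inter> verts T'"
  have FW: "F = convex hull W" unfolding F W_def by (rule elt_inter[OF T(1,2)])
  have fin: "finite W" using finite_verts[OF T(1)] by (simp add: W_def)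
  have "\<not> affine_dependent W"
    using frame[OF T(1)] affine_independent_subset[of "verts T" W] by (auto simp: affine_frame_def W_def)
  then have "aff_dim F = int (card W) - 1"
    unfolding FW aff_dim_convex_hull using aff_dim_affine_independent[of W] by simp
  moreover have "aff_dim T = DIM('a)" using interior_elt_nonempty[OF T(1)] by (rule aff_dim_nonempty_interior)
  ultimately have cW: "card W = DIM('a)" using F(2) by (simp add: facet_of_def)
  have ext: "\<exists>v. verts S = insert v W \<and> v \<notin> W" if "S \<in> \<T>" "W \<subseteq> verts S" for S
  proof -
    have "card (verts S - W) = 1"
      using card_Diff_subset[OF fin that(2)] frame[OF that(1)] cW by (simp add: affine_frame_def)
    then obtain v where "verts S - W = {v}" by (auto simp: card_1_singleton_iff)
    then show ?thesis using that(2) by blast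
  qed
  have "W \<subseteq> verts T1"
  proof
    fix w assume w: "w \<in> W"
    then have "w \<in> T1" using FW T1(2) hull_subset[of W convex] by blast
    then show "w \<in> verts T1" using vertex_of_elt[OF T(1) _ T1(1)] w by (auto simp: W_def)
  qed
  then obtain v1 where v1: "verts T1 = insert v1 W" "v1 \<notin> W" using ext[OF T1(1)] by blast
  obtain v where v: "verts T = insert v W" "v \<notin> W" using ext[OF T(1)] by (auto simp: W_def)
  obtain v' where v': "verts T' = insert v' W" "v' \<notin> W" using ext[OF T(2)] by (auto simp: W_def)
  have W: "W \<noteq> {}" using cW by auto
  have "lam T v v' \<le> 0" using same_side_eq[OF T(1) v T(2) v' W] T(3) by force
  moreover have n1: "lam T v v1 \<le> 0" using same_side_eq[OF T(1) v T1(1) v1 W] ne by force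
  moreover have "lam T' v' v1 \<le> 0" using same_side_eq[OF T(2) v' T1(1) v1 W] ne by force
  moreover have "lam T v v1 = lam T' v' v1 * lam T v v'"
    using v v' T by (intro lam_affine_change) auto
  ultimately have "lam T v v1 = 0" using mult_nonpos_nonpos[of "lam T' v' v1" "lam T v v'"] by linarith
  moreover have "lam T v v = lam T1 v1 v * lam T v v1"
    using v v1 T T1 by (intro lam_affine_change) auto
  ultimately show False using bary_vertex[OF frame[OF T(1)], of v v] v by auto
qed

end

section \<open>Vertex stars and hat functions\<close>

text \<open>A factor K / 2 for each step of a chain of elements joined by edges; a star has at most
  K ^ d elements.\<close>

definition star_ratio :: "nat \<Rightarrow> real \<Rightarrow> real" where
  "star_ratio d K = (K / 2) ^ nat \<lceil>K ^ d\<rceil>"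

text \<open>Some barycentric coordinate is at least 1 / (d + 1); divided by the Lipschitz constant
  in \<open>hat_lipschitz\<close> this is the distance, in units of the diameter, over which the hat
  function stays positive.\<close>

definition near_ratio :: "nat \<Rightarrow> real \<Rightarrow> real" where
  "near_ratio d K = 2 / (K * star_ratio d K * (real d + 1))"

context mesh
begin

lemma elt_inball:
  assumes T: "T \<in> \<T>"
  obtains z r where "0 < r" "cball z r \<subseteq> T" "T \<subseteq> cball z (K * r)" "2 * r \<le> diameter T" "diameter T \<le> K * r"
proof -
  obtain z r where r: "0 < r" "cball z r \<subseteq> T" "diameter T \<le> K * r" using inball[OF T] by blast
  have bd: "bounded T" using compact_elt[OF T] compact_imp_bounded by blast
  have "diameter (cball z r) \<le> diameter T" using r bd by (intro diameter_subset)
  then have "2 * r \<le> diameter T" using r by (simp add: diameter_cball)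
  moreover have "T \<subseteq> cball z (K * r)"
  proof
    fix x assume "x \<in> T"
    moreover have "z \<in> T" using r by auto
    ultimately have "dist z x \<le> diameter T" using diameter_bounded_bound[OF bd] by blast
    then show "x \<in> cball z (K * r)" using r by simp
  qed
  ultimately show thesis using that[of r z] r by blast
qed

lemma diameter_pos: "T \<in> \<T> \<Longrightarrow> diameter T > 0"
  by (rule elt_inball[of T]) auto

lemma K_ge_2: assumes T: "T \<in> \<T>" shows "K \<ge> 2"
proof -
  obtain z r where r: "0 < r" "2 * r \<le> diameter T" "diameter T \<le> K * r" using elt_inball[OF T] by metis
  then have "2 * r \<le> K * r" by linarith
  then show ?thesis using r(1) by simp
qed

lemma lam_lipschitz:
  assumes T: "T \<in> \<T>" and v: "v \<in> verts T"
  shows "\<bar>lam T v x - lam T v y\<bar> \<le> K / (2 * diameter T) * norm (x - y)"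
proof -
  obtain z r where r: "0 < r" "cball z r \<subseteq> T" "diameter T \<le> K * r" using inball[OF T] by blast
  have "\<bar>lam T v x - lam T v y\<bar> \<le> norm (x - y) / (2 * r)"
    using bary_lipschitz[OF frame[OF T] v r(1), of z x y] r(2) hull_verts[OF T] by simp
  also have "\<dots> \<le> K / (2 * diameter T) * norm (x - y)"
  proof -
    have "1 / (2 * r) \<le> K / (2 * diameter T)"
      using r diameter_pos[OF T] by (simp add: field_simps)
    then have "1 / (2 * r) * norm (x - y) \<le> K / (2 * diameter T) * norm (x - y)"
      by (intro mult_right_mono) auto
    then show ?thesis by simp
  qed
  finally show ?thesis .
qed

text \<open>The coordinate of \<open>u\<close> in \<open>T\<close> drops from one to zero along the
  common edge, so the edge has length at least 2 / K times the diameter of \<open>T\<close>; and it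
  lies in \<open>T'\<close>.\<close>

lemma shared_edge:
  assumes T: "T \<in> \<T>" "T' \<in> \<T>" and e: "u \<in> verts T \<inter> verts T'" "v \<in> verts T \<inter> verts T'" "u \<noteq> v"
  shows "diameter T \<le> K / 2 * diameter T'"
proof -
  have "1 \<le> K / (2 * diameter T) * norm (u - v)"
    using lam_lipschitz[OF T(1), of u u v] e bary_vertex[OF frame[OF T(1)], of u] by auto
  then have "2 * diameter T \<le> K * norm (u - v)"
    using diameter_pos[OF T(1)] by (simp add: field_simps)
  also have "norm (u - v) \<le> diameter T'"
  proof -
    have "bounded T'" using compact_elt[OF T(2)] compact_imp_bounded by blast
    moreover have "u \<in> T'" "v \<in> T'" using e verts_subset[OF T(2)] by auto
    ultimately show ?thesis using diameter_bounded_bound[of T' u v] by (simp add: dist_norm)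
  qed
  then have "K * norm (u - v) \<le> K * diameter T'" using K_ge_2[OF T(1)] by (intro mult_left_mono) auto
  finally show ?thesis by simp
qed

definition star :: "'a \<Rightarrow> 'a set set" where
  "star v = {T \<in> \<T>. v \<in> verts T}"

lemma finite_star: "finite (star v)"
  using finite_mesh by (simp add: star_def)

text \<open>Packing: shrunk towards \<open>v\<close> to the smallest diameter \<open>\<rho>\<close>
  in the star, each element still contains a ball of radius \<rho> / K. These balls are disjoint and
  lie in the ball of radius \<open>\<rho>\<close> around \<open>v\<close>. The shrinking avoids
  comparability of sizes, whose proof relies on this bound.\<close>

lemma card_star_le:
  assumes "star v \<noteq> {}" shows "real (card (star v)) \<le> K ^ DIM('a)"
proof -
  define \<rho> where "\<rho> = Min (diameter ` star v)"
  have \<rho>: "\<rho> > 0" "\<And>T. T \<in> star v \<Longrightarrow> \<rho> \<le> diameter T"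
    using assms finite_star diameter_pos by (auto simp: \<rho>_def star_def)
  obtain T0 where "T0 \<in> star v" using assms by blast
  then have K: "K \<ge> 2" using K_ge_2 by (auto simp: star_def)
  have "\<exists>z. ball z (\<rho> / K) \<subseteq> T \<inter> cball v \<rho>" if T: "T \<in> star v" for T
  proof -
    have TT: "T \<in> \<T>" "v \<in> T" using T verts_subset by (auto simp: star_def)
    obtain z r where r: "0 < r" "cball z r \<subseteq> T" "diameter T \<le> K * r" using inball[OF TT(1)] by blast
    define s where "s = \<rho> / diameter T"
    have s: "0 < s" "s \<le> 1" using \<rho>(1) \<rho>(2)[OF T] diameter_pos[OF TT(1)] by (auto simp: s_def)
    have "ball ((1 - s) *\<^sub>R v + s *\<^sub>R z) (\<rho> / K) \<subseteq> T \<inter> cball v \<rho>"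
    proof
      fix x assume x: "x \<in> ball ((1 - s) *\<^sub>R v + s *\<^sub>R z) (\<rho> / K)"
      define y where "y = v + (1 / s) *\<^sub>R (x - v)"
      have xy: "x = (1 - s) *\<^sub>R v + s *\<^sub>R y" using s by (simp add: y_def algebra_simps)
      have "x - ((1 - s) *\<^sub>R v + s *\<^sub>R z) = s *\<^sub>R (y - z)" by (simp add: xy scaleR_diff_right)
      then have "s * norm (y - z) < \<rho> / K" using x s by (simp add: dist_norm norm_minus_commute)
      also have "\<rho> / K = s * (diameter T / K)" using diameter_pos[OF TT(1)] by (simp add: s_def)
      also have "\<dots> \<le> s * r" using r(3) K s by (intro mult_left_mono) (auto simp: pos_divide_le_eq mult.commute)
      finally have "norm (y - z) < r" using s by simp
      then have yT: "y \<in> T" using r(2) by (auto simp: dist_norm norm_minus_commute)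
      have "x \<in> T" unfolding xy using convexD_alt[OF convex_elt[OF TT(1)] TT(2) yT] s by simp
      moreover have "norm (x - v) = s * norm (y - v)" using s by (simp add: y_def)
      moreover have "norm (y - v) \<le> diameter T"
        using diameter_bounded_bound[OF compact_imp_bounded[OF compact_elt[OF TT(1)]] yT TT(2)] by (simp add: dist_norm)
      then have "s * norm (y - v) \<le> s * diameter T" using s by (intro mult_left_mono) auto
      moreover have "s * diameter T = \<rho>" using diameter_pos[OF TT(1)] by (simp add: s_def)
      ultimately show "x \<in> T \<inter> cball v \<rho>" by (simp add: dist_norm norm_minus_commute)
    qed
    then show ?thesis by blast
  qed
  then have "\<forall>T\<in>star v. \<exists>z. ball z (\<rho> / K) \<subseteq> T \<inter> cball v \<rho>" by blast
  then obtain z where z: "\<forall>T\<in>star v. ball (z T) (\<rho> / K) \<subseteq> T \<inter> cball v \<rho>" by (rule bchoice[THEN exE])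
  have disj: "disjoint_family_on (\<lambda>T. ball (z T) (\<rho> / K)) (star v)"
    unfolding disjoint_family_on_def
  proof (intro ballI impI)
    fix T T' assume T: "T \<in> star v" "T' \<in> star v" "T \<noteq> T'"
    have "ball (z T) (\<rho> / K) \<subseteq> T" "ball (z T') (\<rho> / K) \<subseteq> T'" using z T by blast+
    then have "ball (z T) (\<rho> / K) \<subseteq> interior T" "ball (z T') (\<rho> / K) \<subseteq> interior T'"
      by (simp_all add: interior_maximal)
    then show "ball (z T) (\<rho> / K) \<inter> ball (z T') (\<rho> / K) = {}"
      using interior_elts_eq[of T T'] T by (auto simp: star_def)
  qed
  have V: "unit_ball_vol (real DIM('a)) > 0" by (simp add: unit_ball_vol_pos)
  have "(\<Sum>T\<in>star v. measure lborel (ball (z T) (\<rho> / K))) = measure lborel (\<Union>T\<in>star v. ball (z T) (\<rho> / K))"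
  proof (rule measure_finite_Union[symmetric, OF finite_star _ disj])
    show "emeasure lborel (ball (z T) (\<rho> / K)) \<noteq> \<infinity>" for T
      using emeasure_bounded_finite[OF bounded_ball[of "z T" "\<rho> / K"]] by simp
  qed auto
  also have "\<dots> \<le> measure lborel (cball v \<rho>)"
  proof (rule measure_mono_fmeasurable)
    show "cball v \<rho> \<in> fmeasurable lborel"
      using emeasure_bounded_finite[OF bounded_cball[of v \<rho>]] by (intro fmeasurableI) auto
    show "(\<Union>T\<in>star v. ball (z T) (\<rho> / K)) \<in> sets lborel" by (simp add: borel_open open_UN)
  qed (use z in blast)
  also have "\<dots> = unit_ball_vol (real DIM('a)) * \<rho> ^ DIM('a)"
    using \<rho> content_cball[of \<rho> v] by (simp add: measure_completion)
  also have "(\<Sum>T\<in>star v. measure lborel (ball (z T) (\<rho> / K))) =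
      (\<Sum>T\<in>star v. unit_ball_vol (real DIM('a)) * (\<rho> / K) ^ DIM('a))"
    using \<rho> K content_ball[of "\<rho> / K"] by (intro sum.cong) (auto simp: measure_completion)
  finally have "real (card (star v)) * (\<rho> / K) ^ DIM('a) \<le> \<rho> ^ DIM('a)"
    using V by (simp add: mult.left_commute)
  then show ?thesis using \<rho> K by (simp add: power_divide field_simps)
qed

text \<open>If the elements of \<open>A\<close> met the others only in \<open>v\<close>, a small
  punctured ball around the interior point \<open>v\<close> would be covered by two closed sets
  disjoint in it; but it is connected, since d >= 2.\<close>

lemma star_connected:
  assumes v: "v \<in> \<Omega>" and A: "A \<subseteq> star v" "A \<noteq> {}" "A \<noteq> star v"
  shows "\<exists>T1\<in>A. \<exists>T2\<in>star v - A. \<exists>u. u \<noteq> v \<and> u \<in> verts T1 \<inter> verts T2"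
proof (rule ccontr)
  assume no: "\<not> ?thesis"
  have sep: "T1 \<inter> T2 = {v}" if T: "T1 \<in> A" "T2 \<in> star v - A" for T1 T2
  proof -
    have "verts T1 \<inter> verts T2 = {v}" using no T A(1) by (auto simp: star_def)
    moreover have "T1 \<in> \<T>" "T2 \<in> \<T>" using T A(1) by (auto simp: star_def)
    ultimately show ?thesis using elt_inter by simp
  qed
  obtain e1 where e1: "e1 > 0" "ball v e1 \<subseteq> \<Omega>" using \<Omega>(1) v open_contains_ball by blast
  obtain e2 where e2: "e2 > 0" "\<And>T. T \<in> \<T> \<Longrightarrow> T \<inter> ball v e2 \<noteq> {} \<Longrightarrow> v \<in> T" using local_elts by blast
  define e where "e = min e1 e2"
  have e: "e > 0" using e1 e2 by (simp add: e_def)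
  obtain T0 where T0: "T0 \<in> A" using A(2) by blast
  have T0': "T0 \<in> \<T>" "v \<in> verts T0" using T0 A(1) by (auto simp: star_def)
  have cover: "ball v e - {v} \<subseteq> \<Union>A \<union> \<Union>(star v - A)"
  proof
    fix x assume x: "x \<in> ball v e - {v}"
    then have "x \<in> \<Omega>" using e1(2) by (auto simp: e_def)
    then have "x \<in> closure \<Omega>" using closure_subset by blast
    then obtain T where T: "T \<in> \<T>" "x \<in> T" using mesh_cover by blast
    moreover have "x \<in> ball v e2" using x by (simp add: e_def)
    ultimately have "v \<in> T" using e2(2)[of T] by blast
    then have "T \<in> star v" using vertex_of_elt[OF T0' T(1)] T(1) by (simp add: star_def)
    then show "x \<in> \<Union>A \<union> \<Union>(star v - A)" using T(2) by blast
  qed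
  have meet: "\<exists>x\<in>T. x \<in> ball v e - {v}" if "T \<in> star v" for T
  proof -
    have T: "T \<in> \<T>" "v \<in> T" using that verts_subset by (auto simp: star_def)
    have "\<exists>u\<in>verts T. u \<noteq> v"
    proof (rule ccontr)
      assume "\<not> ?thesis"
      then have "verts T \<subseteq> {v}" by blast
      then have "card (verts T) \<le> 1" using card_mono[of "{v}" "verts T"] by simp
      then show False using frame[OF T(1)] by (simp add: affine_frame_def)
    qed
    then obtain u where u: "u \<in> verts T" "u \<noteq> v" by blast
    obtain s where s: "0 < s" "s < 1" "(1 - s) *\<^sub>R v + s *\<^sub>R u \<in> ball v e"
      using segment_near[OF e] by blast
    have "(1 - s) *\<^sub>R v + s *\<^sub>R u \<in> T"
      using convexD_alt[OF convex_elt[OF T(1)] T(2), of u s] u s verts_subset[OF T(1)] by auto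
    moreover have "(1 - s) *\<^sub>R v + s *\<^sub>R u \<noteq> v"
    proof
      assume "(1 - s) *\<^sub>R v + s *\<^sub>R u = v"
      then have "s *\<^sub>R (u - v) = 0" by (simp add: algebra_simps)
      then show False using s u by simp
    qed
    ultimately show ?thesis using s by blast
  qed
  have "connected (ball v e - {v})" using dim by (intro connected_punctured_ball) simp
  moreover have "closed (\<Union>A)" "closed (\<Union>(star v - A))"
    using A(1) finite_star closed_elt by (auto intro!: closed_Union intro: finite_subset simp: star_def)
  moreover have "\<Union>A \<inter> \<Union>(star v - A) \<inter> (ball v e - {v}) = {}" using sep by blast
  moreover have "\<Union>A \<inter> (ball v e - {v}) \<noteq> {}" using meet[of T0] T0 A(1) by blast
  moreover obtain T2 where "T2 \<in> star v - A" using A by blast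
  then have "\<Union>(star v - A) \<inter> (ball v e - {v}) \<noteq> {}" using meet[of T2] by blast
  ultimately show False using cover unfolding connected_closed by blast
qed

text \<open>A set of elements is grown from \<open>T'\<close>; each new element shares an edge at
  \<open>v\<close> with an earlier one and costs a factor K / 2, until the star is
  exhausted.\<close>

lemma star_quasi_uniform:
  assumes v: "v \<in> \<Omega>" and T: "T \<in> star v" "T' \<in> star v"
  shows "diameter T \<le> star_ratio DIM('a) K * diameter T'"
proof -
  have TT: "T \<in> \<T>" "T' \<in> \<T>" using T by (auto simp: star_def)
  have K2: "K / 2 \<ge> 1" using K_ge_2[OF TT(1)] by simp
  have "\<exists>A\<subseteq>star v. T' \<in> A \<and> card A = Suc j \<and> (\<forall>S\<in>A. diameter S \<le> (K / 2) ^ j * diameter T')"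
    if "j < card (star v)" for j
    using that
  proof (induction j)
    case 0
    then show ?case using T(2) by (intro exI[of _ "{T'}"]) auto
  next
    case (Suc j)
    then obtain A where A: "A \<subseteq> star v" "T' \<in> A" "card A = Suc j"
      "\<And>S. S \<in> A \<Longrightarrow> diameter S \<le> (K / 2) ^ j * diameter T'" by auto
    have "A \<noteq> star v" using A(3) Suc.prems by auto
    then obtain T1 T2 u where u: "T1 \<in> A" "T2 \<in> star v - A" "u \<noteq> v" "u \<in> verts T1 \<inter> verts T2"
      using star_connected[OF v A(1)] A(2) by blast
    have "T1 \<in> \<T>" "T2 \<in> \<T>" "v \<in> verts T1" "v \<in> verts T2" using u A(1) by (auto simp: star_def)
    then have "diameter T2 \<le> K / 2 * diameter T1" using u by (intro shared_edge[of _ _ u v]) auto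
    also have "\<dots> \<le> K / 2 * ((K / 2) ^ j * diameter T')" using A(4)[OF u(1)] K2 by (intro mult_left_mono) auto
    finally have new: "diameter T2 \<le> (K / 2) ^ Suc j * diameter T'" by (simp add: mult.assoc)
    have old: "diameter S \<le> (K / 2) ^ Suc j * diameter T'" if "S \<in> A" for S
    proof -
      have "(K / 2) ^ j * diameter T' \<le> (K / 2) ^ Suc j * diameter T'"
        using K2 diameter_pos[OF TT(2)] by (intro mult_right_mono power_increasing) auto
      then show ?thesis using A(4)[OF that] by linarith
    qed
    have "finite A" using A(1) finite_star finite_subset by blast
    then show ?case
      using A u new old by (intro exI[of _ "insert T2 A"]) auto
  qed
  moreover have c: "card (star v) > 0" using T finite_star by (auto simp: card_gt_0_iff)
  ultimately obtain A where A: "A \<subseteq> star v" "card A = card (star v)"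
    "\<And>S. S \<in> A \<Longrightarrow> diameter S \<le> (K / 2) ^ (card (star v) - 1) * diameter T'"
    by (metis Suc_diff_1 diff_less zero_less_one)
  then have "A = star v" using finite_star card_subset_eq by blast
  then have "diameter T \<le> (K / 2) ^ (card (star v) - 1) * diameter T'" using A T by blast
  also have "\<dots> \<le> star_ratio DIM('a) K * diameter T'"
  proof -
    have ne: "star v \<noteq> {}" using T by blast
    have "real (card (star v)) \<le> real_of_int \<lceil>K ^ DIM('a)\<rceil>" using card_star_le[of v] ne by linarith
    then have "card (star v) - 1 \<le> nat \<lceil>K ^ DIM('a)\<rceil>" by linarith
    then show ?thesis unfolding star_ratio_def
      using K2 diameter_pos[OF TT(2)] by (intro mult_right_mono power_increasing) auto
  qed
  finally show ?thesis .
qed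

text \<open>The piecewise linear nodal function of \<open>v\<close>, extended by zero. The choice of
  the element is immaterial by \<open>lam_share\<close>.\<close>

definition hat :: "'a \<Rightarrow> 'a \<Rightarrow> real" where
  "hat v x = (if \<exists>T\<in>star v. x \<in> T then lam (SOME T. T \<in> star v \<and> x \<in> T) v x else 0)"

lemma hat_eq:
  assumes "T \<in> \<T>" "x \<in> T"
  shows "hat v x = (if v \<in> verts T then lam T v x else 0)"
proof (cases "\<exists>T\<in>star v. x \<in> T")
  case True
  define S where "S = (SOME T. T \<in> star v \<and> x \<in> T)"
  have S: "S \<in> star v" "x \<in> S" using someI_ex[of "\<lambda>T. T \<in> star v \<and> x \<in> T"] True by (auto simp: S_def)
  then have "S \<in> \<T>" "v \<in> verts S" by (auto simp: star_def)
  then show ?thesis using True lam_share[of S T x v] assms S by (simp add: hat_def S_def[symmetric])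
next
  case False
  then have "v \<notin> verts T" using assms by (auto simp: star_def)
  then show ?thesis using False by (simp add: hat_def)
qed

text \<open>By \<open>star_open\<close> a positive coordinate at an interior vertex forces the point
  into \<Omega>; this makes the extension by zero consistent on the boundary.\<close>

lemma hat_outside:
  assumes v: "v \<in> \<Omega>" and x: "x \<notin> \<Omega>" shows "hat v x = 0"
proof (cases "\<exists>T\<in>\<T>. x \<in> T")
  case True
  then obtain T where T: "T \<in> \<T>" "x \<in> T" by blast
  have "\<not> lam T v x > 0" if "v \<in> verts T" using star_open[OF T(1) that v T(2)] x by blast
  moreover have "lam T v x \<ge> 0" if "v \<in> verts T" using in_elt[OF T(1)] T(2) that by blast
  ultimately show ?thesis using hat_eq[OF T] by force
qed (auto simp: hat_def star_def)

text \<open>The domain need not be convex, so the segment may leave it. Its parameter interval is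
  covered by finitely many closed pieces, the preimages of the elements and of the complement of
  \<Omega>; the bound holds on each and hence on the whole. Quasi-uniformity of the star expresses
  it by the one element \<open>T\<close>.\<close>

lemma hat_lipschitz:
  assumes v: "v \<in> \<Omega>" and T: "T \<in> star v"
  shows "\<bar>hat v x - hat v y\<bar> \<le> K * star_ratio DIM('a) K / (2 * diameter T) * norm (x - y)"
proof -
  have TT: "T \<in> \<T>" using T by (simp add: star_def)
  have K: "K \<ge> 2" by (rule K_ge_2[OF TT])
  have q: "star_ratio DIM('a) K > 0" using K by (simp add: star_ratio_def)
  define L where "L = K * star_ratio DIM('a) K / (2 * diameter T)"
  have L: "L \<ge> 0" using K q diameter_pos[OF TT] by (simp add: L_def)
  have elt: "\<bar>hat v a - hat v b\<bar> \<le> L * norm (a - b)" if S: "S \<in> \<T>" "a \<in> S" "b \<in> S" for S a b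
  proof (cases "v \<in> verts S")
    case True
    then have "diameter T \<le> star_ratio DIM('a) K * diameter S" using S T v by (intro star_quasi_uniform) (auto simp: star_def)
    then have "K / (2 * diameter S) \<le> L"
      using K diameter_pos[OF TT] diameter_pos[OF S(1)] by (simp add: L_def field_simps)
    then have "K / (2 * diameter S) * norm (a - b) \<le> L * norm (a - b)" by (intro mult_right_mono) auto
    then show ?thesis using True lam_lipschitz[OF S(1) True, of a b] hat_eq[OF S(1,2)] hat_eq[OF S(1,3)] by simp
  qed (use L hat_eq[OF S(1,2)] hat_eq[OF S(1,3)] in simp)
  define P where "P t = x + t *\<^sub>R (y - x)" for t :: real
  have PP: "norm (P t - P s) = \<bar>t - s\<bar> * norm (x - y)" for s t
  proof -
    have "P t - P s = (t - s) *\<^sub>R (y - x)" by (simp add: P_def algebra_simps)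
    then show ?thesis by (simp add: norm_minus_commute)
  qed
  have contP: "continuous_on UNIV P" unfolding P_def by (intro continuous_intros)
  have "(L * norm (x - y))-lipschitz_on {0..1} (\<lambda>t. hat v (P t))"
  proof (rule lipschitz_on_closed_Union[where U="\<lambda>U. U" and I="insert (P -` (- \<Omega>)) ((\<lambda>S. P -` S) ` \<T>)"])
    fix U assume U: "U \<in> insert (P -` (- \<Omega>)) ((\<lambda>S. P -` S) ` \<T>)"
    show "closed U"
      using U closed_elt \<Omega>(1) contP by (auto intro!: closed_vimage simp: closed_Compl continuous_on_eq_continuous_at)
    show "(L * norm (x - y))-lipschitz_on U (\<lambda>t. hat v (P t))"
    proof (rule lipschitz_onI)
      fix s t assume st: "s \<in> U" "t \<in> U"
      show "dist (hat v (P s)) (hat v (P t)) \<le> L * norm (x - y) * dist s t"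
      proof (cases "U = P -` (- \<Omega>)")
        case True
        then show ?thesis using hat_outside[OF v] st L by (simp add: mult_nonneg_nonneg)
      next
        case False
        then obtain S where "S \<in> \<T>" "P s \<in> S" "P t \<in> S" using U st by auto
        from elt[OF this] show ?thesis by (simp add: PP dist_real_def mult_ac)
      qed
    qed (use L in simp)
  next
    show "finite (insert (P -` (- \<Omega>)) ((\<lambda>S. P -` S) ` \<T>))" using finite_mesh by simp
    show "{0..1} \<subseteq> (\<Union>U\<in>insert (P -` (- \<Omega>)) ((\<lambda>S. P -` S) ` \<T>). U)"
    proof
      fix t
      show "t \<in> (\<Union>U\<in>insert (P -` (- \<Omega>)) ((\<lambda>S. P -` S) ` \<T>). U)"
      proof (cases "P t \<in> \<Omega>")
        case True
        then have "P t \<in> \<Union>\<T>" using mesh_cover closure_subset by blast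
        then show ?thesis by auto
      qed auto
    qed
  qed (use L in simp)
  from lipschitz_onD[OF this, of 0 1] show ?thesis by (simp add: P_def dist_real_def L_def)
qed

text \<open>The coordinates of \<open>x\<close> sum to one, so some vertex has a coordinate of at
  least 1 / (d + 1). Its hat function stays positive within the radius, and positivity at a point
  yields both claims.\<close>

lemma near_vertex:
  assumes T: "T \<in> \<T>" "verts T \<subseteq> \<Omega>" and x: "x \<in> T"
  obtains v where "v \<in> verts T"
    "\<And>y. y \<in> ball x (near_ratio DIM('a) K * diameter T) \<Longrightarrow> y \<in> \<Omega> \<and> (\<forall>S\<in>\<T>. y \<in> S \<longrightarrow> v \<in> verts S)"
proof -
  have K: "K \<ge> 2" by (rule K_ge_2[OF T(1)])
  then have q: "star_ratio DIM('a) K > 0" by (simp add: star_ratio_def)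
  have h: "diameter T > 0" by (rule diameter_pos[OF T(1)])
  have card: "card (verts T) = Suc DIM('a)" using frame[OF T(1)] by (simp add: affine_frame_def)
  have "\<exists>v\<in>verts T. lam T v x \<ge> 1 / (real DIM('a) + 1)"
  proof (rule ccontr)
    assume "\<not> ?thesis"
    then have "(\<Sum>v\<in>verts T. lam T v x) < (\<Sum>v\<in>verts T. 1 / (real DIM('a) + 1))"
      using finite_verts[OF T(1)] card by (intro sum_strict_mono) force+
    then show False using bary_sum[OF frame[OF T(1)], of x] card by simp
  qed
  then obtain v where v: "v \<in> verts T" "lam T v x \<ge> 1 / (real DIM('a) + 1)" by blast
  have v\<Omega>: "v \<in> \<Omega>" using v(1) T(2) by blast
  have Tv: "T \<in> star v" using T(1) v(1) by (simp add: star_def)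
  show thesis
  proof (rule that[OF v(1)])
    fix y assume y: "y \<in> ball x (near_ratio DIM('a) K * diameter T)"
    have "hat v x - hat v y \<le> K * star_ratio DIM('a) K / (2 * diameter T) * norm (x - y)"
      using hat_lipschitz[OF v\<Omega> Tv, of x y] by linarith
    also have "\<dots> < K * star_ratio DIM('a) K / (2 * diameter T) * (near_ratio DIM('a) K * diameter T)"
      using y K q h by (intro mult_strict_left_mono) (auto simp: dist_norm)
    also have "\<dots> = 1 / (real DIM('a) + 1)"
    proof -
      have "K * star_ratio DIM('a) K / (2 * diameter T) * (2 / (K * star_ratio DIM('a) K * D) * diameter T) = 1 / D" if "D > 0" for D
        using K q h that by simp
      from this[of "real DIM('a) + 1"] show ?thesis by (simp add: near_ratio_def add_nonneg_pos)
    qed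
    finally have pos: "hat v y > 0" using v hat_eq[OF T(1) x, of v] by simp
    then have y\<Omega>: "y \<in> \<Omega>" using hat_outside[OF v\<Omega>] by force
    have "v \<in> verts S" if "S \<in> \<T>" "y \<in> S" for S
      using hat_eq[OF that, of v] pos by (auto split: if_splits)
    then show "y \<in> \<Omega> \<and> (\<forall>S\<in>\<T>. y \<in> S \<longrightarrow> v \<in> verts S)" using y\<Omega> by blast
  qed
qed

end

section \<open>Nodal basis\<close>

locale fe_mesh = mesh +
  fixes k :: nat
  assumes k: "k \<ge> 1"
begin

text \<open>Element-wise interpolation of arbitrary values; \<open>interp_restrict\<close> makes the
  choice of the element immaterial.\<close>

definition glue :: "('a \<Rightarrow> real) \<Rightarrow> 'a \<Rightarrow> real" where
  "glue g x = (if x \<in> closure \<Omega> then interp (verts (SOME T. T \<in> \<T> \<and> x \<in> T)) k g x else 0)"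

lemma glue_eq:
  assumes T: "T \<in> \<T>" "x \<in> T"
  shows "glue g x = interp (verts T) k g x"
proof -
  define S where "S = (SOME T. T \<in> \<T> \<and> x \<in> T)"
  have S: "S \<in> \<T>" "x \<in> S" using someI[of "\<lambda>T. T \<in> \<T> \<and> x \<in> T" T] T by (auto simp: S_def)
  have "x \<in> convex hull (verts S \<inter> verts T)" using elt_inter[OF S(1) T(1)] S T by blast
  then have "interp (verts S) k g x = interp (verts T) k g x"
    by (intro interp_restrict[OF frame[OF S(1)] frame[OF T(1)] _ _ k]) auto
  moreover have "x \<in> closure \<Omega>" using mesh_cover T by blast
  ultimately show ?thesis by (simp add: glue_def S_def)
qed

lemma nodes_subset: "nodes \<Omega> k \<T> \<subseteq> \<Omega>"
  by (auto simp: nodes_def)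

lemma lagrange_in_elt:
  assumes T: "T \<in> \<T>" and l: "l \<in> lagrange_points k T" shows "l \<in> T"
  using lagrange_points_subset[OF frame[OF T] k] l unfolding hull_verts[OF T] by (rule subsetD)

lemma lagrange_eq:
  assumes T: "T \<in> \<T>" shows "lagrange_points k T = lag_pt (verts T) k ` lag_idx (verts T) k"
  using lagrange_points_simplex[OF frame[OF T], of k] unfolding hull_verts[OF T] .

lemma finite_lagrange: "T \<in> \<T> \<Longrightarrow> finite (lagrange_points k T)"
  using lagrange_eq finite_lag_idx[OF finite_verts] by simp

lemma finite_nodes: "finite (nodes \<Omega> k \<T>)"
  using finite_mesh finite_lagrange by (auto simp: nodes_def)

lemma inj_lag_pt:
  assumes T: "T \<in> \<T>"
  shows "inj_on (lag_pt (verts T) k) (lag_idx (verts T) k)"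
proof (rule inj_onI)
  fix m m' assume m: "m \<in> lag_idx (verts T) k" "m' \<in> lag_idx (verts T) k"
    and eq: "lag_pt (verts T) k m = lag_pt (verts T) k m'"
  show "m = m'"
  proof
    fix v
    show "m v = m' v"
    proof (cases "v \<in> verts T")
      case True
      then show ?thesis
        using bary_lag_pt[OF frame[OF T] m(1) k True] bary_lag_pt[OF frame[OF T] m(2) k True] eq k by simp
    qed (use m in \<open>auto simp: lag_idx_def\<close>)
  qed
qed

lemma interp_on_elt:
  assumes T: "T \<in> \<T>" and x: "x \<in> T"
  shows "\<bar>interp (verts T) k g x\<bar> \<le> real k ^ k * (\<Sum>l\<in>lagrange_points k T. \<bar>g l\<bar>)"
proof -
  have x': "x \<in> convex hull (verts T)" using x hull_verts[OF T] by simp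
  have "\<bar>interp (verts T) k g x\<bar> \<le> (\<Sum>m\<in>lag_idx (verts T) k. \<bar>g (lag_pt (verts T) k m)\<bar> * \<bar>lagb (verts T) k m x\<bar>)"
    unfolding interp_def by (rule order_trans[OF sum_abs]) (simp add: abs_mult)
  also have "\<dots> \<le> (\<Sum>m\<in>lag_idx (verts T) k. \<bar>g (lag_pt (verts T) k m)\<bar> * real k ^ k)"
    by (intro sum_mono mult_left_mono abs_lagb_le[OF frame[OF T] _ k x']) auto
  also have "\<dots> = real k ^ k * (\<Sum>l\<in>lagrange_points k T. \<bar>g l\<bar>)"
    unfolding lagrange_eq[OF T] sum.reindex[OF inj_lag_pt[OF T]] o_def by (simp add: sum_distrib_left mult.commute)
  finally show ?thesis .
qed

lemma glue_at_node:
  assumes "T \<in> \<T>" "l \<in> lagrange_points k T"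
  shows "glue g l = g l"
proof -
  obtain m where "m \<in> lag_idx (verts T) k" "l = lag_pt (verts T) k m" using assms lagrange_eq by blast
  then show ?thesis
    using glue_eq[OF assms(1) lagrange_in_elt[OF assms]] interp_at_pt[OF frame[OF assms(1)] _ k] by simp
qed

lemma glue_zero:
  assumes T: "T \<in> \<T>" "x \<in> T" and "\<And>l. l \<in> lagrange_points k T \<Longrightarrow> g l = 0"
  shows "glue g x = 0"
  unfolding glue_eq[OF T] interp_def using assms(3) lagrange_eq[OF T(1)] by (intro sum.neutral) auto

text \<open>Vanishing on the boundary rests on \<open>support_open\<close>: for a lattice point
  inside \<Omega> some coordinate is positive there and zero at the boundary point, and then its
  basis polynomial vanishes at the boundary point.\<close>

lemma glue_fe_space:
  assumes g: "\<And>l. l \<notin> \<Omega> \<Longrightarrow> g l = 0"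
  shows "glue g \<in> fe_space \<Omega> k \<T>"
proof -
  have cont: "continuous_on (closure \<Omega>) (glue g)"
    unfolding mesh_cover[symmetric]
  proof (rule continuous_on_closed_Union[where U="\<lambda>T. T" and I=\<T>, simplified])
    show "finite \<T>" by (rule finite_mesh)
    show "closed T" if "T \<in> \<T>" for T using closed_elt that .
    fix T assume T: "T \<in> \<T>"
    have "continuous_on T (interp (verts T) k g)" by (rule continuous_polys[OF interp_polys[OF frame[OF T]]])
    then show "continuous_on T (glue g)" by (rule continuous_on_eq) (simp add: glue_eq[OF T])
  qed
  have fr: "glue g x = 0" if x: "x \<in> frontier \<Omega>" for x
  proof -
    have "x \<in> closure \<Omega>" "x \<notin> \<Omega>" using x \<Omega>(1) by (auto simp: frontier_def interior_open)
    then obtain T where T: "T \<in> \<T>" "x \<in> T" using mesh_cover by blast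
    have "g (lag_pt (verts T) k m) * lagb (verts T) k m x = 0" if m: "m \<in> lag_idx (verts T) k" for m
    proof (cases "lag_pt (verts T) k m \<in> \<Omega>")
      case True
      have "\<exists>u\<in>verts T. lam T u (lag_pt (verts T) k m) > 0 \<and> \<not> lam T u x > 0"
        using support_open[OF T(1) lagrange_in_elt[OF T(1)] True T(2)] \<open>x \<notin> \<Omega>\<close> m lagrange_eq[OF T(1)] by blast
      then obtain u where u: "u \<in> verts T" "lam T u (lag_pt (verts T) k m) > 0" "\<not> lam T u x > 0" by blast
      have "m u > 0" using u bary_lag_pt[OF frame[OF T(1)] m k u(1)] by (simp add: zero_less_divide_iff)
      moreover have "lam T u x = 0" using u in_elt[OF T(1), of x] T(2) by force
      ultimately have "(\<Prod>i<m u. real k * lam T u x - real i) = 0" by (intro prod_zero bexI[of _ 0]) auto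
      then have "newton (verts T) k m x = 0"
        unfolding newton_def using u(1) finite_verts[OF T(1)] by (intro prod_zero bexI[of _ u]) auto
      then show ?thesis by (simp add: lagb_def)
    qed (simp add: g)
    then show ?thesis unfolding glue_eq[OF T] interp_def by (intro sum.neutral) auto
  qed
  have "\<exists>p\<in>polys k. \<forall>x\<in>T. glue g x = p x" if T: "T \<in> \<T>" for T
    using interp_polys[OF frame[OF T], of k g] glue_eq[OF T] by blast
  then show ?thesis using cont fr by (auto simp: fe_space_def glue_def)
qed

text \<open>Unisolvence on each element; a lattice point that is not in \<Omega> lies on the
  boundary, where both functions vanish.\<close>

lemma fe_eqI:
  assumes u: "u \<in> fe_space \<Omega> k \<T>" and v: "v \<in> fe_space \<Omega> k \<T>"
    and eq: "\<And>l. l \<in> nodes \<Omega> k \<T> \<Longrightarrow> u l = v l"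
  shows "u = v"
proof
  fix x
  show "u x = v x"
  proof (cases "x \<in> closure \<Omega>")
    case True
    then obtain T where T: "T \<in> \<T>" "x \<in> T" using mesh_cover by blast
    obtain p where p: "p \<in> polys k" "\<And>x. x \<in> T \<Longrightarrow> u x = p x" using u T unfolding fe_space_def by blast
    obtain q where q: "q \<in> polys k" "\<And>x. x \<in> T \<Longrightarrow> v x = q x" using v T unfolding fe_space_def by blast
    have "p = q"
    proof (rule polys_eqI[OF frame[OF T(1)] k p(1) q(1)])
      fix l assume "l \<in> lagrange_points k (convex hull (verts T))"
      then have l: "l \<in> lagrange_points k T" using hull_verts[OF T(1)] by simp
      have lT: "l \<in> T" by (rule lagrange_in_elt[OF T(1) l])
      have "u l = v l"
      proof (cases "l \<in> \<Omega>")
        case True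
        then show ?thesis using eq l T(1) by (auto simp: nodes_def)
      next
        case False
        then have "l \<in> frontier \<Omega>" using lT T(1) mesh_cover \<Omega>(1) by (auto simp: frontier_def interior_open)
        then show ?thesis using u v by (simp add: fe_space_def)
      qed
      then show "p l = q l" using p(2) q(2) lT by simp
    qed
    then show ?thesis using p(2) q(2) T(2) by simp
  qed (use u v in \<open>simp add: fe_space_def\<close>)
qed

lemma nodal_basis_eq:
  assumes j: "j \<in> nodes \<Omega> k \<T>"
  shows "nodal_basis \<Omega> k \<T> j = glue (\<lambda>l. if l = j then 1 else 0)"
  unfolding nodal_basis_def
proof (rule the_equality)
  let ?g = "\<lambda>l. if l = j then 1 else 0 :: real"
  have G: "glue ?g \<in> fe_space \<Omega> k \<T>" using j nodes_subset by (intro glue_fe_space) auto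
  have at: "glue ?g l = ?g l" if "l \<in> nodes \<Omega> k \<T>" for l
    using that glue_at_node by (auto simp: nodes_def)
  show "glue ?g \<in> fe_space \<Omega> k \<T> \<and> (\<forall>l\<in>nodes \<Omega> k \<T>. glue ?g l = ?g l)" using G at by blast
  fix v assume "v \<in> fe_space \<Omega> k \<T> \<and> (\<forall>l\<in>nodes \<Omega> k \<T>. v l = ?g l)"
  then show "v = glue ?g" using G at by (intro fe_eqI) auto
qed

lemma glue_sum:
  assumes "finite J"
  shows "glue (\<lambda>l. \<Sum>j\<in>J. c j * g j l) x = (\<Sum>j\<in>J. c j * glue (g j) x)"
proof -
  have "interp C k (\<lambda>l. \<Sum>j\<in>J. c j * g j l) x = (\<Sum>j\<in>J. c j * interp C k (g j) x)" for C
    unfolding interp_def by (simp add: sum_distrib_left sum_distrib_right mult.assoc sum.swap[of _ _ J])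
  then show ?thesis by (simp add: glue_def)
qed

lemma nodal_sum:
  assumes J: "J \<subseteq> nodes \<Omega> k \<T>"
  shows "(\<Sum>j\<in>J. c j * nodal_basis \<Omega> k \<T> j x) = glue (\<lambda>l. if l \<in> J then c l else 0) x"
proof -
  have fin: "finite J" using J finite_nodes finite_subset by blast
  have "(\<lambda>l. if l \<in> J then c l else 0) = (\<lambda>l. \<Sum>j\<in>J. c j * (if l = j then 1 else 0))"
    using fin by (auto simp: if_distrib[of "\<lambda>a. _ * a"] cong: if_cong)
  then have "glue (\<lambda>l. if l \<in> J then c l else 0) x = (\<Sum>j\<in>J. c j * glue (\<lambda>l. if l = j then 1 else 0) x)"
    using glue_sum[OF fin, of c "\<lambda>j l. if l = j then 1 else 0" x] by simp
  then show ?thesis using J by (auto simp: nodal_basis_eq intro!: sum.cong)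
qed

lemma elt_polyI:
  assumes T: "T \<in> \<T>" and p: "p \<in> polys k" "\<And>x. x \<in> T \<Longrightarrow> p x = u x"
  shows "elt_poly k T u = p"
  unfolding elt_poly_def
proof (rule the_equality)
  show "p \<in> polys k \<and> (\<forall>x\<in>T. p x = u x)" using p by blast
  fix q assume q: "q \<in> polys k \<and> (\<forall>x\<in>T. q x = u x)"
  show "q = p"
    by (rule polys_eq_on_simplex[OF frame[OF T] k]) (use p q hull_verts[OF T] in auto)
qed

end

section \<open>Cut elements and bilinear forms\<close>

lemma set_integral_comb:
  fixes f g :: "'a \<Rightarrow> real"
  assumes "set_integrable M S f" "set_integrable M S g"
  shows "set_lebesgue_integral M S (\<lambda>x. a * f x + b * g x) =
    a * set_lebesgue_integral M S f + b * set_lebesgue_integral M S g"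
proof -
  have "set_integrable M S (\<lambda>x. a * f x)" "set_integrable M S (\<lambda>x. b * g x)"
    using assms by (auto intro: set_integrable_mult_right)
  then show ?thesis by (simp add: set_integral_add)
qed

locale cut_mesh = fe_mesh +
  fixes Om :: "nat \<Rightarrow> 'a set" and n :: "'a \<Rightarrow> 'a" and \<alpha> :: "nat \<Rightarrow> real" and \<gamma> \<beta> :: real
    and \<kappa> :: "'a set \<Rightarrow> real" and \<alpha>bar :: real and \<F> :: "nat \<Rightarrow> 'a set set"
  assumes part: "partitioned \<Omega> Om" and sm: "smooth_iface \<Omega> Om n"
    and nodes_off: "nodes \<Omega> k \<T> \<inter> iface Om = {}"
    and faces: "\<F> 1 \<subseteq> ghost_faces Om \<T> 1" "\<F> 2 \<subseteq> ghost_faces Om \<T> 2"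
begin

abbreviation cut where "cut \<equiv> cut_simplices Om \<T>"
abbreviation ex where "ex \<equiv> ex_simplices Om \<T>"
abbreviation I where "I \<equiv> cut_nodes \<Omega> Om k \<T>"
abbreviation Ii where "Ii \<equiv> cut_nodes_of \<Omega> Om k \<T>"
abbreviation cutfem where "cutfem \<equiv> cutfem_form Om n k \<T> \<alpha> \<gamma> \<beta> \<kappa> \<alpha>bar \<F>"

section \<open>Cut, uncut and extended elements\<close>

lemma cut_subset: "cut \<subseteq> \<T>" and ex_subset: "ex i \<subseteq> \<T>"
  by (auto simp: cut_simplices_def ex_simplices_def)

lemma finite_cut: "finite cut" and finite_ex: "finite (ex i)"
  using finite_mesh cut_subset ex_subset finite_subset by blast+

lemma open_Om: "i \<in> {1, 2} \<Longrightarrow> open (Om i)" and Om_disjoint: "Om 1 \<inter> Om 2 = {}"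
  and Om_cover: "Om 1 \<union> Om 2 = \<Omega> - iface Om"
  using part unfolding partitioned_def by blast+

lemma closed_iface: "closed (iface Om)" by (simp add: iface_def closed_Int)

lemma cut_ex: assumes "T \<in> cut" "i \<in> {1, 2}" shows "T \<in> ex i"
proof -
  obtain x where x: "x \<in> interior T" "x \<in> iface Om" using assms(1) by (auto simp: cut_simplices_def)
  then have "x \<in> closure (Om i)" using assms(2) by (auto simp: iface_def)
  then have "interior T \<inter> Om i \<noteq> {}" using x open_Int_closure_eq_empty[of "interior T" "Om i"] by blast
  then show ?thesis using assms(1) interior_subset by (auto simp: cut_simplices_def ex_simplices_def)
qed

text \<open>The interior of an uncut element is connected and avoids the interface, so it lies in a
  single subdomain.\<close>

lemma uncut_in_closure:
  assumes i: "i \<in> {1, 2}" and T: "T \<in> ex i" "T \<notin> cut"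
  shows "T \<subseteq> closure (Om i)"
proof -
  have TT: "T \<in> \<T>" "T \<inter> Om i \<noteq> {}" using T(1) by (auto simp: ex_simplices_def)
  have no: "interior T \<inter> iface Om = {}" using T(2) TT by (auto simp: cut_simplices_def)
  have "T \<subseteq> closure \<Omega>" using mesh_cover TT by blast
  from interior_mono[OF this] have "interior T \<subseteq> \<Omega>" using \<Omega>(3) by simp
  then have cov: "interior T \<subseteq> Om 1 \<union> Om 2" using no Om_cover by blast
  have "Om i \<inter> closure (interior T) \<noteq> {}" using closure_interior_elt[OF TT(1)] TT(2) by auto
  then have meet: "Om i \<inter> interior T \<noteq> {}"
    using open_Int_closure_eq_empty[OF open_Om[OF i], of "interior T"] by blast
  have "connected (interior T)" using convex_elt[OF TT(1)] by (intro convex_connected convex_interior)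
  then have "Om 1 \<inter> interior T = {} \<or> Om 2 \<inter> interior T = {}"
    using connectedD[of "interior T" "Om 1" "Om 2"] open_Om Om_disjoint cov by auto
  then have "interior T \<subseteq> Om i" using cov meet i by auto
  then have "closure (interior T) \<subseteq> closure (Om i)" by (rule closure_mono)
  then show ?thesis using closure_interior_elt[OF TT(1)] by simp
qed

lemma closure_Om_point:
  assumes i: "i \<in> {1, 2}" and x: "x \<in> closure (Om i)" "x \<in> \<Omega>" "x \<notin> iface Om"
  shows "x \<in> Om i"
proof (rule ccontr)
  assume no: "x \<notin> Om i"
  obtain j where j: "j \<in> {1, 2}" "x \<in> Om j" using Om_cover x by blast
  then have "j \<noteq> i" using no by blast
  then have "Om j \<inter> Om i = {}" using i j Om_disjoint by auto
  then have "Om j \<inter> closure (Om i) = {}" using open_Int_closure_eq_empty[OF open_Om[OF j(1)]] by blast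
  then show False using j x by blast
qed

lemma node_props:
  assumes "l \<in> nodes \<Omega> k \<T>"
  shows "l \<in> \<Omega>" "l \<notin> iface Om" "l \<in> Om 1 \<union> Om 2" "\<not> (l \<in> Om 1 \<and> l \<in> Om 2)"
  using assms nodes_subset nodes_off Om_cover Om_disjoint by blast+

lemma I_nodes: "I \<subseteq> nodes \<Omega> k \<T>" and Ii_I: "Ii i \<subseteq> I"
  by (auto simp: cut_nodes_def cut_nodes_of_def)

lemma finite_I: "finite I"
  by (rule finite_subset[OF I_nodes finite_nodes])

lemma finite_Ii: "finite (Ii i)"
  by (rule finite_subset[OF Ii_I finite_I])

lemma Ii_partition: "Ii 1 \<union> Ii 2 = I" "Ii 1 \<inter> Ii 2 = {}"
proof -
  have "l \<in> Om 1 \<union> Om 2 \<and> \<not> (l \<in> Om 1 \<and> l \<in> Om 2)" if "l \<in> I" for l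
    using node_props(3,4)[of l] subsetD[OF I_nodes that] by blast
  then show "Ii 1 \<union> Ii 2 = I" "Ii 1 \<inter> Ii 2 = {}" by (auto simp: cut_nodes_of_def)
qed

section \<open>Coefficient vectors and their images under L\<close>

definition gi :: "('a \<Rightarrow> real) \<Rightarrow> nat \<Rightarrow> 'a \<Rightarrow> real" where
  "gi x i l = (if l \<in> Ii i then x l else 0)"

text \<open>The image under L of the pair whose first entry is zero and whose second has the
  coefficients \<open>x\<close> (\<open>split_map_sum\<close>).\<close>

definition U :: "('a \<Rightarrow> real) \<Rightarrow> nat \<Rightarrow> 'a \<Rightarrow> real" where
  "U x i = restr (cut_region Om \<T>) (glue (gi x i))"

lemma cut_basis_at:
  assumes "j \<in> I" "l \<in> I" shows "cut_basis \<Omega> Om k \<T> j l = (if l = j then 1 else 0)"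
proof -
  have "l \<in> cut_region Om \<T>" using assms by (simp add: cut_nodes_def)
  moreover have "j \<in> nodes \<Omega> k \<T>" "l \<in> nodes \<Omega> k \<T>" using assms I_nodes by blast+
  ultimately show ?thesis
    using glue_at_node by (auto simp: cut_basis_def restr_def nodal_basis_eq nodes_def)
qed

lemma cut_basis_sum:
  assumes "J \<subseteq> I"
  shows "(\<lambda>y. \<Sum>j\<in>J. c j * cut_basis \<Omega> Om k \<T> j y) =
    restr (cut_region Om \<T>) (glue (\<lambda>l. if l \<in> J then c l else 0))"
proof
  fix y
  have "J \<subseteq> nodes \<Omega> k \<T>" using assms I_nodes by blast
  from nodal_sum[OF this, of c y]
  show "(\<Sum>j\<in>J. c j * cut_basis \<Omega> Om k \<T> j y) =
      restr (cut_region Om \<T>) (glue (\<lambda>l. if l \<in> J then c l else 0)) y"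
    by (simp add: cut_basis_def restr_def)
qed

text \<open>The description in \<open>cut_proj\<close> is unique because evaluation at the nodes in
  \<open>I\<close> recovers the coefficients.\<close>

lemma cut_proj_sum:
  "cut_proj \<Omega> Om k \<T> i (\<lambda>y. \<Sum>j\<in>I. c j * cut_basis \<Omega> Om k \<T> j y) =
   (\<lambda>y. \<Sum>j\<in>Ii i. c j * cut_basis \<Omega> Om k \<T> j y)"
  unfolding cut_proj_def
proof (rule the_equality)
  fix w
  assume "\<exists>c'. (\<lambda>y. \<Sum>j\<in>I. c j * cut_basis \<Omega> Om k \<T> j y) = (\<lambda>y. \<Sum>j\<in>I. c' j * cut_basis \<Omega> Om k \<T> j y) \<and>
      w = (\<lambda>y. \<Sum>j\<in>Ii i. c' j * cut_basis \<Omega> Om k \<T> j y)"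
  then obtain c' where c': "(\<lambda>y. \<Sum>j\<in>I. c j * cut_basis \<Omega> Om k \<T> j y) = (\<lambda>y. \<Sum>j\<in>I. c' j * cut_basis \<Omega> Om k \<T> j y)"
    and w: "w = (\<lambda>y. \<Sum>j\<in>Ii i. c' j * cut_basis \<Omega> Om k \<T> j y)" by blast
  have val: "(\<Sum>j\<in>I. d j * cut_basis \<Omega> Om k \<T> j l) = d l" if l: "l \<in> I" for d :: "'a \<Rightarrow> real" and l
  proof -
    have "(\<Sum>j\<in>I. d j * cut_basis \<Omega> Om k \<T> j l) = (\<Sum>j\<in>I. if j = l then d l else 0)"
      using l by (intro sum.cong refl) (auto simp: cut_basis_at)
    then show ?thesis using l finite_I by simp
  qed
  have "c l = c' l" if "l \<in> I" for l
    using val[OF that, of c] val[OF that, of c'] fun_cong[OF c', of l] by simp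
  then show "w = (\<lambda>y. \<Sum>j\<in>Ii i. c j * cut_basis \<Omega> Om k \<T> j y)"
    unfolding w using Ii_I[of i] by (intro ext sum.cong refl) auto
qed blast

lemma split_map_sum:
  "split_map \<Omega> Om k \<T> (\<lambda>_. 0, \<lambda>y. \<Sum>j\<in>I. x j * cut_basis \<Omega> Om k \<T> j y) = U x"
proof (intro ext)
  fix i y
  show "split_map \<Omega> Om k \<T> (\<lambda>_. 0, \<lambda>y. \<Sum>j\<in>I. x j * cut_basis \<Omega> Om k \<T> j y) i y = U x i y"
    using fun_cong[OF cut_basis_sum[OF Ii_I[of i], where c=x], of y]
    by (simp add: split_map_def cut_proj_sum U_def gi_def[abs_def] restr_def)
qed

definition unit :: "'a \<Rightarrow> 'a \<Rightarrow> real" where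
  "unit j l = (if l = j then 1 else 0)"

lemma split_map_basis:
  assumes j: "j \<in> I"
  shows "split_map \<Omega> Om k \<T> (\<lambda>_. 0, cut_basis \<Omega> Om k \<T> j) = U (unit j)"
proof -
  have "(\<Sum>l\<in>I. unit j l * cut_basis \<Omega> Om k \<T> l y) = cut_basis \<Omega> Om k \<T> j y" for y
  proof -
    have "(\<Sum>l\<in>I. unit j l * cut_basis \<Omega> Om k \<T> l y) = (\<Sum>l\<in>I. if l = j then cut_basis \<Omega> Om k \<T> j y else 0)"
      by (intro sum.cong refl) (auto simp: unit_def)
    then show ?thesis using j finite_I by simp
  qed
  then show ?thesis using split_map_sum[of "unit j"] by simp
qed

lemma U_sum: "U x = (\<lambda>i y. \<Sum>j\<in>I. x j * U (unit j) i y)"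
proof (intro ext)
  fix i y
  have "gi x i = (\<lambda>l. \<Sum>j\<in>I. x j * gi (unit j) i l)"
  proof
    fix l
    have "(\<Sum>j\<in>I. x j * gi (unit j) i l) = (\<Sum>j\<in>I. if j = l then gi x i l else 0)"
      by (intro sum.cong refl) (auto simp: gi_def unit_def)
    also have "\<dots> = gi x i l" using finite_I Ii_I[of i] by (auto simp: gi_def)
    finally show "gi x i l = (\<Sum>j\<in>I. x j * gi (unit j) i l)" by simp
  qed
  then show "U x i y = (\<Sum>j\<in>I. x j * U (unit j) i y)"
    using glue_sum[OF finite_I, of x "\<lambda>j. gi (unit j) i" y] by (simp add: U_def restr_def)
qed

text \<open>Such an element lies in the closure of \<open>Om i\<close>, and no node lies on the
  interface; its nodes in \<Omega> therefore belong to \<open>Om i\<close> and carry no coefficient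
  of component \<open>i\<close>. Extension by zero beyond the cut region thus agrees with the glued
  function.\<close>

lemma uncut_glue_zero:
  assumes i: "i \<in> {1, 2}" and T: "T \<in> ex i" "T \<notin> cut" and y: "y \<in> T"
  shows "glue (gi x i) y = 0"
proof (rule glue_zero[of T])
  show TT: "T \<in> \<T>" using T ex_subset by blast
  fix l assume l: "l \<in> lagrange_points k T"
  show "gi x i l = 0"
  proof (cases "l \<in> Ii i")
    case True
    then have "l \<in> nodes \<Omega> k \<T>" using Ii_I I_nodes by blast
    moreover have "l \<in> closure (Om i)" using uncut_in_closure[OF i T] lagrange_in_elt[OF TT l] by blast
    ultimately have "l \<in> Om i" using closure_Om_point[OF i] node_props by blast
    then show ?thesis using True by (simp add: cut_nodes_of_def)
  qed (simp add: gi_def)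
qed (rule y)

lemma U_on_elt:
  assumes i: "i \<in> {1, 2}" and T: "T \<in> ex i" and y: "y \<in> T"
  shows "U x i y = glue (gi x i) y"
proof (cases "T \<in> cut")
  case True
  then show ?thesis using y by (auto simp: U_def restr_def cut_region_def)
next
  case False
  then show ?thesis using uncut_glue_zero[OF i T False y] by (simp add: U_def restr_def)
qed

section \<open>Bilinearity of the forms on piecewise polynomials\<close>

text \<open>The class on which bilinearity is shown: \<open>elt_poly\<close> is a genuine polynomial
  there, and all integrands are bounded and continuous on sets of finite measure, so that the
  integrals are additive.\<close>

definition pw :: "(nat \<Rightarrow> 'a \<Rightarrow> real) set" where
  "pw = {u. \<forall>i\<in>{1, 2}. \<forall>T\<in>ex i. \<exists>p\<in>polys k. \<forall>y\<in>T. u i y = p y}"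

definition pol :: "('a \<Rightarrow> real) \<Rightarrow> nat \<Rightarrow> 'a set \<Rightarrow> 'a \<Rightarrow> real" where
  "pol x i T = interp (verts T) k (gi x i)"

lemma pol_polys: "T \<in> \<T> \<Longrightarrow> pol x i T \<in> polys k"
  unfolding pol_def by (intro interp_polys frame)

lemma U_pol:
  assumes i: "i \<in> {1, 2}" and T: "T \<in> ex i" and y: "y \<in> T"
  shows "U x i y = pol x i T y"
  using U_on_elt[OF i T y] glue_eq[of T y] T ex_subset y by (auto simp: pol_def)

lemma U_pw: "U x \<in> pw"
  unfolding pw_def using U_pol pol_polys ex_subset by blast

lemma elt_poly_U:
  assumes i: "i \<in> {1, 2}" and T: "T \<in> ex i"
  shows "elt_poly k T (U x i) = pol x i T"
  using T ex_subset U_pol[OF i T] by (intro elt_polyI pol_polys) auto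

lemma elt_poly_pw:
  assumes u: "u \<in> pw" and i: "i \<in> {1, 2}" and T: "T \<in> ex i"
  shows "elt_poly k T (u i) \<in> polys k" "\<And>y. y \<in> T \<Longrightarrow> u i y = elt_poly k T (u i) y"
proof -
  obtain p where p: "p \<in> polys k" "\<And>y. y \<in> T \<Longrightarrow> u i y = p y" using u i T unfolding pw_def by blast
  then have "elt_poly k T (u i) = p" using T ex_subset by (intro elt_polyI) auto
  then show "elt_poly k T (u i) \<in> polys k" "\<And>y. y \<in> T \<Longrightarrow> u i y = elt_poly k T (u i) y" using p by auto
qed

lemma elt_poly_comb:
  assumes u: "u \<in> pw" "w \<in> pw" and i: "i \<in> {1, 2}" and T: "T \<in> ex i"
  shows "elt_poly k T (\<lambda>y. a * u i y + b * w i y) = (\<lambda>y. a * elt_poly k T (u i) y + b * elt_poly k T (w i) y)"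
proof (rule elt_polyI)
  show "T \<in> \<T>" using T ex_subset by blast
  show "(\<lambda>y. a * elt_poly k T (u i) y + b * elt_poly k T (w i) y) \<in> polys k"
    by (intro polys_add polys_scale elt_poly_pw(1)[OF _ i T] u)
  fix y assume "y \<in> T"
  then show "a * elt_poly k T (u i) y + b * elt_poly k T (w i) y = a * u i y + b * w i y"
    using elt_poly_pw(2)[OF u(1) i T] elt_poly_pw(2)[OF u(2) i T] by simp
qed

lemma elt_grad_comb:
  assumes u: "u \<in> pw" "w \<in> pw" and i: "i \<in> {1, 2}" and T: "T \<in> ex i"
  shows "elt_grad k T (\<lambda>y. a * u i y + b * w i y) y = a *\<^sub>R elt_grad k T (u i) y + b *\<^sub>R elt_grad k T (w i) y"
  unfolding elt_grad_def elt_poly_comb[OF assms]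
  using elt_poly_pw(1)[OF u(1) i T] elt_poly_pw(1)[OF u(2) i T]
  by (simp add: grad_add[of _ k] grad_scale[of _ k] polys_scale)

lemma continuous_elt_grad:
  assumes "u \<in> pw" "i \<in> {1, 2}" "T \<in> ex i" shows "continuous_on S (elt_grad k T (u i))"
  unfolding elt_grad_def using continuous_on_subset[OF continuous_grad[OF elt_poly_pw(1)[OF assms]]] by simp

lemma pw_comb: "u \<in> pw \<Longrightarrow> w \<in> pw \<Longrightarrow> (\<lambda>i y. a * u i y + b * w i y) \<in> pw"
  unfolding pw_def
proof (intro CollectI ballI)
  fix i T assume u: "u \<in> {u. \<forall>i\<in>{1, 2}. \<forall>T\<in>ex i. \<exists>p\<in>polys k. \<forall>y\<in>T. u i y = p y}"
    and w: "w \<in> {u. \<forall>i\<in>{1, 2}. \<forall>T\<in>ex i. \<exists>p\<in>polys k. \<forall>y\<in>T. u i y = p y}"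
    and i: "i \<in> {1, 2}" and T: "T \<in> ex i"
  obtain p q where "p \<in> polys k" "\<forall>y\<in>T. u i y = p y" "q \<in> polys k" "\<forall>y\<in>T. w i y = q y"
    using u w i T by blast
  then show "\<exists>p\<in>polys k. \<forall>y\<in>T. a * u i y + b * w i y = p y"
    by (intro bexI[of _ "\<lambda>y. a * p y + b * q y"] polys_add polys_scale) auto
qed

lemma continuous_jump:
  assumes u: "u \<in> pw" and T: "T \<in> cut" shows "continuous_on (T \<inter> iface Om) (jump u)"
proof -
  have e: "T \<in> ex 1" "T \<in> ex 2" using cut_ex[OF T] by auto
  have "continuous_on (T \<inter> iface Om) (\<lambda>y. elt_poly k T (u 1) y - elt_poly k T (u 2) y)"
    by (intro continuous_on_diff continuous_polys[OF elt_poly_pw(1)[OF u _ e(1)]]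
        continuous_polys[OF elt_poly_pw(1)[OF u _ e(2)]]) auto
  then show ?thesis
    by (rule continuous_on_eq)
      (use e elt_poly_pw(2)[OF u, of 1 T] elt_poly_pw(2)[OF u, of 2 T] in \<open>simp add: jump_def\<close>)
qed

lemma jump_comb: "jump (\<lambda>i y. a * u i y + b * w i y) y = a * jump u y + b * jump w y"
  by (simp add: jump_def algebra_simps)

lemma iface_finite: "emeasure surface_measure (iface Om) < \<infinity>"
proof -
  obtain C c r0 :: real where "\<And>x a. a > 0 \<Longrightarrow>
      emeasure surface_measure (iface Om \<inter> cball x a) \<le> ennreal (C * a ^ (DIM('a) - 1))"
    using iface_measure_bounds[OF dim \<Omega>(1,2) part sm] by metis
  moreover obtain a where a: "a > 0" "\<forall>x\<in>iface Om. norm x \<le> a"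
    using compact_imp_bounded[OF compact_iface[OF \<Omega>(2) part]] unfolding bounded_pos by blast
  ultimately have "emeasure surface_measure (iface Om \<inter> cball 0 a) \<le> ennreal (C * a ^ (DIM('a) - 1))"
    by blast
  moreover have "iface Om \<inter> cball 0 a = iface Om" using a(2) by auto
  ultimately show ?thesis by (simp add: order_le_less_trans)
qed

lemma compact_cut_iface: "T \<in> \<T> \<Longrightarrow> compact (T \<inter> iface Om)"
  using compact_elt closed_iface by (rule compact_Int_closed)

lemma cut_iface_finite: "T \<in> \<T> \<Longrightarrow> emeasure surface_measure (T \<inter> iface Om) < \<infinity>"
proof -
  have "emeasure surface_measure (T \<inter> iface Om) \<le> emeasure surface_measure (iface Om)"
    using closed_iface by (intro emeasure_mono) (auto simp: borel_closed)
  then show ?thesis using iface_finite by (rule order_le_less_trans)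
qed

lemma set_integrable_iface:
  assumes "T \<in> \<T>" "continuous_on (T \<inter> iface Om) f"
  shows "set_integrable surface_measure (T \<inter> iface Om) (f :: 'a \<Rightarrow> real)"
  using assms by (intro set_integrable_compact compact_cut_iface cut_iface_finite) simp_all

lemma set_integrable_elt:
  assumes "T \<in> \<T>" "continuous_on T f" "A \<in> sets borel"
  shows "set_integrable lborel (T \<inter> A) (f :: 'a \<Rightarrow> real)"
proof (rule set_integrable_bounded)
  have T: "compact T" using compact_elt[OF assms(1)] .
  show "T \<inter> A \<in> sets borel" using T assms(3) by (simp add: borel_compact sets.Int)
  show "emeasure lborel (T \<inter> A) < \<infinity>"
    using T by (intro emeasure_bounded_finite bounded_subset[OF compact_imp_bounded[OF T]]) auto
  show "continuous_on (T \<inter> A) f" using assms(2) by (rule continuous_on_subset) auto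
  show "bounded (f ` (T \<inter> A))"
    by (rule bounded_subset[OF compact_imp_bounded[OF compact_continuous_image[OF assms(2) T]]]) auto
qed simp

lemma diffusion_comb:
  assumes u: "u \<in> pw" "w \<in> pw" "v \<in> pw"
  shows "diffusion_form Om k \<T> \<alpha> (\<lambda>i y. a * u i y + b * w i y) v =
    a * diffusion_form Om k \<T> \<alpha> u v + b * diffusion_form Om k \<T> \<alpha> w v"
proof -
  have "set_lebesgue_integral lborel (T \<inter> Om i)
      (\<lambda>y. \<alpha> i * (elt_grad k T (\<lambda>y. a * u i y + b * w i y) y \<bullet> elt_grad k T (v i) y)) =
    a * set_lebesgue_integral lborel (T \<inter> Om i) (\<lambda>y. \<alpha> i * (elt_grad k T (u i) y \<bullet> elt_grad k T (v i) y)) +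
    b * set_lebesgue_integral lborel (T \<inter> Om i) (\<lambda>y. \<alpha> i * (elt_grad k T (w i) y \<bullet> elt_grad k T (v i) y))"
    if i: "i \<in> {1, 2}" and T: "T \<in> ex i" for i T
  proof -
    have TT: "T \<in> \<T>" using T ex_subset by blast
    have int: "set_integrable lborel (T \<inter> Om i) (\<lambda>y. \<alpha> i * (elt_grad k T (u i) y \<bullet> elt_grad k T (v i) y))"
      if "u \<in> pw" for u
      by (intro set_integrable_elt[OF TT] borel_open open_Om[OF i] continuous_on_mult continuous_on_const
          continuous_on_inner continuous_elt_grad[OF _ i T] that u(3))
    show ?thesis
      unfolding set_integral_comb[OF int[OF u(1)] int[OF u(2)], symmetric] elt_grad_comb[OF u(1,2) i T]
      by (simp add: inner_add_left algebra_simps)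
  qed
  then show ?thesis
    unfolding diffusion_form_def sum_distrib_left sum.distrib[symmetric] by (intro sum.cong refl)
qed

lemma scaled_jump_comb:
  assumes u: "u \<in> pw" "w \<in> pw" "v \<in> pw"
  shows "scaled_jump_form Om \<T> (\<lambda>i y. a * u i y + b * w i y) v =
    a * scaled_jump_form Om \<T> u v + b * scaled_jump_form Om \<T> w v"
proof -
  have "set_lebesgue_integral surface_measure (T \<inter> iface Om)
      (\<lambda>y. jump (\<lambda>i y. a * u i y + b * w i y) y * jump v y) =
    a * set_lebesgue_integral surface_measure (T \<inter> iface Om) (\<lambda>y. jump u y * jump v y) +
    b * set_lebesgue_integral surface_measure (T \<inter> iface Om) (\<lambda>y. jump w y * jump v y)"
    if T: "T \<in> cut" for T
  proof -
    have TT: "T \<in> \<T>" using T cut_subset by blast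
    have int: "set_integrable surface_measure (T \<inter> iface Om) (\<lambda>y. jump u y * jump v y)" if "u \<in> pw" for u
      by (intro set_integrable_iface[OF TT] continuous_on_mult continuous_jump[OF _ T] that u(3))
    show ?thesis
      unfolding set_integral_comb[OF int[OF u(1)] int[OF u(2)], symmetric] jump_comb
      by (simp add: algebra_simps)
  qed
  then show ?thesis
    unfolding scaled_jump_form_def by (simp add: sum.distrib sum_distrib_left algebra_simps)
qed

lemma continuous_flux:
  assumes v: "v \<in> pw" and T: "T \<in> cut"
  shows "continuous_on (T \<inter> iface Om) (\<lambda>y. average (\<kappa> T) (\<lambda>i. - \<alpha> i *\<^sub>R elt_grad k T (v i) y) \<bullet> n y)"
proof -
  have e: "T \<in> ex 1" "T \<in> ex 2" using cut_ex[OF T] by auto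
  have c: "continuous_on S (elt_grad k T (v 1))" "continuous_on S (elt_grad k T (v 2))" for S
    using continuous_elt_grad[OF v] e by auto
  have "continuous_on (T \<inter> iface Om) n" using continuous_normal[OF sm] by (rule continuous_on_subset) auto
  then show ?thesis unfolding average_def
    by (intro continuous_on_inner continuous_on_add continuous_on_scaleR continuous_on_const c)
qed

lemma consistency_comb1:
  assumes u: "u \<in> pw" "w \<in> pw" "v \<in> pw"
  shows "consistency_form Om n k \<T> \<alpha> \<kappa> (\<lambda>i y. a * u i y + b * w i y) v =
    a * consistency_form Om n k \<T> \<alpha> \<kappa> u v + b * consistency_form Om n k \<T> \<alpha> \<kappa> w v"
proof -
  let ?f = "\<lambda>T y. average (\<kappa> T) (\<lambda>i. - \<alpha> i *\<^sub>R elt_grad k T (v i) y) \<bullet> n y"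
  have "set_lebesgue_integral surface_measure (T \<inter> iface Om)
      (\<lambda>y. ?f T y * jump (\<lambda>i y. a * u i y + b * w i y) y) =
    a * set_lebesgue_integral surface_measure (T \<inter> iface Om) (\<lambda>y. ?f T y * jump u y) +
    b * set_lebesgue_integral surface_measure (T \<inter> iface Om) (\<lambda>y. ?f T y * jump w y)"
    if T: "T \<in> cut" for T
  proof -
    have TT: "T \<in> \<T>" using T cut_subset by blast
    have int: "set_integrable surface_measure (T \<inter> iface Om) (\<lambda>y. ?f T y * jump u y)" if "u \<in> pw" for u
      by (intro set_integrable_iface[OF TT] continuous_on_mult continuous_jump[OF _ T] continuous_flux[OF _ T] that u(3))
    show ?thesis
      unfolding set_integral_comb[OF int[OF u(1)] int[OF u(2)], symmetric] jump_comb
      by (simp add: algebra_simps)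
  qed
  then show ?thesis
    unfolding consistency_form_def by (simp add: sum.distrib sum_distrib_left)
qed

lemma consistency_comb2:
  assumes u: "u \<in> pw" "w \<in> pw" "v \<in> pw"
  shows "consistency_form Om n k \<T> \<alpha> \<kappa> v (\<lambda>i y. a * u i y + b * w i y) =
    a * consistency_form Om n k \<T> \<alpha> \<kappa> v u + b * consistency_form Om n k \<T> \<alpha> \<kappa> v w"
proof -
  let ?f = "\<lambda>u T y. average (\<kappa> T) (\<lambda>i. - \<alpha> i *\<^sub>R elt_grad k T (u i) y) \<bullet> n y"
  have "set_lebesgue_integral surface_measure (T \<inter> iface Om)
      (\<lambda>y. ?f (\<lambda>i y. a * u i y + b * w i y) T y * jump v y) =
    a * set_lebesgue_integral surface_measure (T \<inter> iface Om) (\<lambda>y. ?f u T y * jump v y) +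
    b * set_lebesgue_integral surface_measure (T \<inter> iface Om) (\<lambda>y. ?f w T y * jump v y)"
    if T: "T \<in> cut" for T
  proof -
    have TT: "T \<in> \<T>" using T cut_subset by blast
    have e: "T \<in> ex 1" "T \<in> ex 2" using cut_ex[OF T] by auto
    have g1: "elt_grad k T (\<lambda>y. a * u 1 y + b * w 1 y) y = a *\<^sub>R elt_grad k T (u 1) y + b *\<^sub>R elt_grad k T (w 1) y" for y
      by (rule elt_grad_comb[OF u(1,2) _ e(1)]) simp
    have g2: "elt_grad k T (\<lambda>y. a * u 2 y + b * w 2 y) y = a *\<^sub>R elt_grad k T (u 2) y + b *\<^sub>R elt_grad k T (w 2) y" for y
      by (rule elt_grad_comb[OF u(1,2) _ e(2)]) simp
    have int: "set_integrable surface_measure (T \<inter> iface Om) (\<lambda>y. ?f u T y * jump v y)" if "u \<in> pw" for u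
      by (intro set_integrable_iface[OF TT] continuous_on_mult continuous_jump[OF _ T] continuous_flux[OF _ T] that u(3))
    have "?f (\<lambda>i y. a * u i y + b * w i y) T y = a * ?f u T y + b * ?f w T y" for y
      unfolding average_def g1 g2 by (simp add: inner_add_left inner_diff_left algebra_simps)
    then show ?thesis
      unfolding set_integral_comb[OF int[OF u(1)] int[OF u(2)], symmetric]
      by (simp add: algebra_simps)
  qed
  then show ?thesis
    unfolding consistency_form_def by (simp add: sum.distrib sum_distrib_left)
qed

text \<open>
  A ghost face determines its two neighbours, so both simplices chosen by \<^const>\<open>face_sides\<close> carry
  a polynomial.
\<close>

lemma ghost_face_props:
  assumes F: "F \<in> ghost_faces Om \<T> i"
  shows "fst (face_sides \<T> F) \<in> ex i" "snd (face_sides \<T> F) \<in> ex i" "compact F"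
    "emeasure surface_measure F < \<infinity>"
proof -
  obtain T T' where T: "T \<in> ex i" "T' \<in> ex i" "T \<noteq> T'" "F = T \<inter> T'" "F facet_of T"
    using F unfolding ghost_faces_def by blast
  have TT: "T \<in> \<T>" "T' \<in> \<T>" using T ex_subset by blast+
  obtain T1 T2 where sides: "face_sides \<T> F = (T1, T2)" by (meson surj_pair)
  have "case face_sides \<T> F of (T1, T2) \<Rightarrow> T1 \<in> \<T> \<and> T2 \<in> \<T> \<and> T1 \<noteq> T2 \<and> F = T1 \<inter> T2"
    unfolding face_sides_def by (rule someI[where x="(T, T')"]) (use T TT in simp)
  then have "T1 \<in> \<T>" "T2 \<in> \<T>" "F \<subseteq> T1" "F \<subseteq> T2" using sides by auto
  then show "fst (face_sides \<T> F) \<in> ex i" "snd (face_sides \<T> F) \<in> ex i"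
    using facet_two_sided[OF TT T(3,4,5)] T(1,2) sides by auto
  show cF: "compact F" unfolding T(4) using TT compact_elt by (intro compact_Int)
  have "aff_dim F < DIM('a)" using T(5) aff_dim_le_DIM[of T] by (simp add: facet_of_def)
  then obtain g c where "g \<noteq> 0" "F \<subseteq> {x. g \<bullet> x = c}" using aff_lowdim_subset_hyperplane by blast
  then show "emeasure surface_measure F < \<infinity>" using hausdorff_hyperplane_finite[OF dim _ _ cF] by blast
qed

lemma face_jump_comb:
  assumes u: "u \<in> pw" "w \<in> pw" and i: "i \<in> {1, 2}" and F: "F \<in> ghost_faces Om \<T> i"
  shows "face_jump k \<T> l F (\<lambda>y. a * u i y + b * w i y) y =
    a * face_jump k \<T> l F (u i) y + b * face_jump k \<T> l F (w i) y"
    and "continuous_on F (face_jump k \<T> l F (u i))"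
proof -
  obtain T1 T2 where sides: "face_sides \<T> F = (T1, T2)" by (meson surj_pair)
  have T: "T1 \<in> ex i" "T2 \<in> ex i" using ghost_face_props(1,2)[OF F] sides by auto
  define \<nu> where "\<nu> = face_normal F"
  have J: "face_jump k \<T> l F f y = dir_deriv l \<nu> (elt_poly k T1 f) y - dir_deriv l \<nu> (elt_poly k T2 f) y" for f y
    unfolding face_jump_def sides \<nu>_def by (simp add: Let_def)
  have D: "dir_deriv l \<nu> (\<lambda>y. a * elt_poly k S (u i) y + b * elt_poly k S (w i) y) y =
      a * dir_deriv l \<nu> (elt_poly k S (u i)) y + b * dir_deriv l \<nu> (elt_poly k S (w i)) y" if "S \<in> ex i" for S
    using elt_poly_pw(1)[OF u(1) i that] elt_poly_pw(1)[OF u(2) i that]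
    by (simp add: dir_deriv_add[of _ k] dir_deriv_scale[of _ k] polys_scale)
  show "face_jump k \<T> l F (\<lambda>y. a * u i y + b * w i y) y =
    a * face_jump k \<T> l F (u i) y + b * face_jump k \<T> l F (w i) y"
    unfolding J elt_poly_comb[OF u i T(1)] elt_poly_comb[OF u i T(2)] D[OF T(1)] D[OF T(2)]
    by (simp add: algebra_simps)
  have "continuous_on F (\<lambda>y. dir_deriv l \<nu> (elt_poly k T1 (u i)) y - dir_deriv l \<nu> (elt_poly k T2 (u i)) y)"
    by (intro continuous_on_diff continuous_dir_deriv[OF elt_poly_pw(1)[OF u(1) i T(1)]]
        continuous_dir_deriv[OF elt_poly_pw(1)[OF u(1) i T(2)]])
  then show "continuous_on F (face_jump k \<T> l F (u i))" by (rule continuous_on_eq) (simp add: J)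
qed

lemma ghost_comb:
  assumes u: "u \<in> pw" "w \<in> pw" "v \<in> pw"
  shows "ghost_form k \<T> \<beta> \<F> (\<lambda>i y. a * u i y + b * w i y) v =
    a * ghost_form k \<T> \<beta> \<F> u v + b * ghost_form k \<T> \<beta> \<F> w v"
proof -
  have "set_lebesgue_integral surface_measure F
      (\<lambda>y. face_jump k \<T> l F (\<lambda>y. a * u i y + b * w i y) y * face_jump k \<T> l F (v i) y) =
    a * set_lebesgue_integral surface_measure F (\<lambda>y. face_jump k \<T> l F (u i) y * face_jump k \<T> l F (v i) y) +
    b * set_lebesgue_integral surface_measure F (\<lambda>y. face_jump k \<T> l F (w i) y * face_jump k \<T> l F (v i) y)"
    if i: "i \<in> {1, 2}" and "F \<in> \<F> i" for i l F
  proof -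
    have F: "F \<in> ghost_faces Om \<T> i" using faces that by auto
    note P = ghost_face_props[OF F]
    have int: "set_integrable surface_measure F (\<lambda>y. face_jump k \<T> l F (u i) y * face_jump k \<T> l F (v i) y)"
      if "u \<in> pw" for u
      by (intro set_integrable_compact P continuous_on_mult face_jump_comb(2)[OF _ u(3) i F] that u(3)) simp
    show ?thesis
      unfolding set_integral_comb[OF int[OF u(1)] int[OF u(2)], symmetric] face_jump_comb(1)[OF u(1,2) i F]
      by (simp add: algebra_simps)
  qed
  note eq = this
  have "(\<Sum>i\<in>{1, 2}. \<Sum>l\<in>{1..k}. \<Sum>F\<in>\<F> i. diameter F ^ (2 * l - 1) * set_lebesgue_integral surface_measure F
      (\<lambda>y. face_jump k \<T> l F (\<lambda>y. a * u i y + b * w i y) y * face_jump k \<T> l F (v i) y)) =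
    a * (\<Sum>i\<in>{1, 2}. \<Sum>l\<in>{1..k}. \<Sum>F\<in>\<F> i. diameter F ^ (2 * l - 1) * set_lebesgue_integral surface_measure F
      (\<lambda>y. face_jump k \<T> l F (u i) y * face_jump k \<T> l F (v i) y)) +
    b * (\<Sum>i\<in>{1, 2}. \<Sum>l\<in>{1..k}. \<Sum>F\<in>\<F> i. diameter F ^ (2 * l - 1) * set_lebesgue_integral surface_measure F
      (\<lambda>y. face_jump k \<T> l F (w i) y * face_jump k \<T> l F (v i) y))"
    unfolding sum_distrib_left sum.distrib[symmetric]
    by (intro sum.cong refl, subst eq) (assumption | simp only: distrib_left mult.left_commute)+
  then show ?thesis unfolding ghost_form_def by (simp only: distrib_left mult.left_commute)
qed

lemma cutfem_comb:
  assumes u: "u \<in> pw" "w \<in> pw" "v \<in> pw"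
  shows "cutfem (\<lambda>i y. a * u i y + b * w i y) v = a * cutfem u v + b * cutfem w v"
  unfolding cutfem_form_def diffusion_comb[OF u] scaled_jump_comb[OF u] ghost_comb[OF u]
    consistency_comb1[OF u] consistency_comb2[OF u]
  by (simp add: algebra_simps)

lemma cutfem_commute: "cutfem u v = cutfem v u"
proof -
  have "diffusion_form Om k \<T> \<alpha> u v = diffusion_form Om k \<T> \<alpha> v u"
    unfolding diffusion_form_def by (simp only: inner_commute)
  moreover have "scaled_jump_form Om \<T> u v = scaled_jump_form Om \<T> v u"
    unfolding scaled_jump_form_def by (simp only: mult.commute)
  moreover have "ghost_form k \<T> \<beta> \<F> u v = ghost_form k \<T> \<beta> \<F> v u"
    unfolding ghost_form_def by (simp only: mult.commute)
  ultimately show ?thesis unfolding cutfem_form_def by simp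
qed

text \<open>Membership of the partial sums in \<open>pw\<close> is part of the induction, since
  \<open>cutfem_comb\<close> asks for it.\<close>

lemma cutfem_sum:
  assumes "finite J" "\<And>j. j \<in> J \<Longrightarrow> \<Phi> j \<in> pw" "v \<in> pw"
  shows "(\<lambda>i y. \<Sum>j\<in>J. c j * \<Phi> j i y) \<in> pw \<and> cutfem (\<lambda>i y. \<Sum>j\<in>J. c j * \<Phi> j i y) v = (\<Sum>j\<in>J. c j * cutfem (\<Phi> j) v)"
  using assms
proof (induction J rule: finite_induct)
  case empty
  then show ?case using cutfem_comb[of v v v 0 0] pw_comb[of v v 0 0] by simp
next
  case (insert j J)
  then have IH: "(\<lambda>i y. \<Sum>j\<in>J. c j * \<Phi> j i y) \<in> pw"
    "cutfem (\<lambda>i y. \<Sum>j\<in>J. c j * \<Phi> j i y) v = (\<Sum>j\<in>J. c j * cutfem (\<Phi> j) v)" by auto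
  have "\<Phi> j \<in> pw" using insert.prems by simp
  from cutfem_comb[OF this IH(1) insert.prems(2), of "c j" 1] pw_comb[OF this IH(1), of "c j" 1]
  show ?case using insert.hyps IH(2) by simp
qed

section \<open>Matrix, diagonal and energy in terms of coefficients\<close>

text \<open>Linearity is available in the first argument; symmetry of the form supplies the second
  expansion.\<close>

lemma quad_form_cutfem:
  "quad_form I (cut_matrix \<Omega> Om n k \<T> \<alpha> \<gamma> \<beta> \<kappa> \<alpha>bar \<F>) x = cutfem (U x) (U x)"
proof -
  have "cutfem (U x) (U x) = (\<Sum>l\<in>I. x l * cutfem (U (unit l)) (U x))"
    using cutfem_sum[OF finite_I, of "\<lambda>l. U (unit l)" "U x" x] U_pw U_sum[of x, symmetric] by simp
  also have "\<dots> = (\<Sum>l\<in>I. x l * (\<Sum>m\<in>I. x m * cutfem (U (unit l)) (U (unit m))))"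
  proof (intro sum.cong refl arg_cong2[where f="(*)"])
    fix l
    have "cutfem (U (unit l)) (U x) = cutfem (U x) (U (unit l))" by (rule cutfem_commute)
    also have "\<dots> = (\<Sum>m\<in>I. x m * cutfem (U (unit m)) (U (unit l)))"
      using cutfem_sum[OF finite_I, of "\<lambda>l. U (unit l)" "U (unit l)" x] U_pw U_sum[of x, symmetric] by simp
    also have "\<dots> = (\<Sum>m\<in>I. x m * cutfem (U (unit l)) (U (unit m)))"
      by (intro sum.cong refl arg_cong2[where f="(*)"]) (rule cutfem_commute)
    finally show "cutfem (U (unit l)) (U x) = (\<Sum>m\<in>I. x m * cutfem (U (unit l)) (U (unit m)))" .
  qed
  also have "\<dots> = (\<Sum>l\<in>I. \<Sum>m\<in>I. x m * cutfem (U (unit l)) (U (unit m)) * x l)"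
    by (simp add: sum_distrib_left ac_simps)
  also have "\<dots> = (\<Sum>m\<in>I. \<Sum>l\<in>I. x m * cutfem (U (unit l)) (U (unit m)) * x l)" by (rule sum.swap)
  also have "\<dots> = quad_form I (cut_matrix \<Omega> Om n k \<T> \<alpha> \<gamma> \<beta> \<kappa> \<alpha>bar \<F>) x"
    unfolding quad_form_def cut_matrix_def split_form_def
    by (intro sum.cong refl) (simp add: split_map_basis)
  finally show ?thesis by simp
qed

lemma quad_form_diag:
  "quad_form I (diag_part (cut_matrix \<Omega> Om n k \<T> \<alpha> \<gamma> \<beta> \<kappa> \<alpha>bar \<F>)) x =
    (\<Sum>j\<in>I. (x j)\<^sup>2 * cutfem (U (unit j)) (U (unit j)))"
proof -
  let ?A = "cut_matrix \<Omega> Om n k \<T> \<alpha> \<gamma> \<beta> \<kappa> \<alpha>bar \<F>"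
  have "quad_form I (diag_part ?A) x = (\<Sum>m\<in>I. \<Sum>l\<in>I. if l = m then x m * ?A m m * x m else 0)"
    unfolding quad_form_def diag_part_def by (intro sum.cong refl) auto
  also have "\<dots> = (\<Sum>m\<in>I. x m * ?A m m * x m)" using finite_I by simp
  also have "\<dots> = (\<Sum>j\<in>I. (x j)\<^sup>2 * cutfem (U (unit j)) (U (unit j)))"
    unfolding cut_matrix_def split_form_def
    by (intro sum.cong refl) (simp add: split_map_basis power2_eq_square)
  finally show ?thesis .
qed

lemma norm_equivalence_U:
  assumes "norm_equivalence c1 c2 \<Omega> Om n k \<T> \<alpha> \<gamma> \<beta> \<kappa> \<alpha>bar \<F>"
  shows "c1 * energy Om k \<T> (U x) \<le> cutfem (U x) (U x)" "cutfem (U x) (U x) \<le> c2 * energy Om k \<T> (U x)"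
proof -
  let ?u = "\<lambda>y. \<Sum>j\<in>I. x j * cut_basis \<Omega> Om k \<T> j y"
  let ?v = "\<lambda>i y. \<Sum>j\<in>Ii i. x j * cut_basis \<Omega> Om k \<T> j y"
  have "?u = (\<lambda>y. ?v 1 y + ?v 2 y)"
    unfolding Ii_partition(1)[symmetric] using finite_Ii Ii_partition(2) by (simp add: sum.union_disjoint)
  moreover have v: "?v i \<in> cut_space_of \<Omega> Om k \<T> i" for i unfolding cut_space_of_def by blast
  have "(\<lambda>y. ?v 1 y + ?v 2 y) \<in> cut_space \<Omega> Om k \<T>"
    unfolding cut_space_def by (intro CollectI exI[of _ "?v 1"] exI[of _ "?v 2"] conjI refl v)
  ultimately have "?u \<in> cut_space \<Omega> Om k \<T>" by simp
  moreover have "(\<lambda>_. 0) \<in> fe_space \<Omega> k \<T>" by (auto simp: fe_space_def intro: polys_zero)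
  ultimately have "(\<lambda>_. 0, ?u) \<in> fe_space \<Omega> k \<T> \<times> cut_space \<Omega> Om k \<T>" by blast
  from bspec[OF assms[unfolded norm_equivalence_def] this]
  show "c1 * energy Om k \<T> (U x) \<le> cutfem (U x) (U x)" "cutfem (U x) (U x) \<le> c2 * energy Om k \<T> (U x)"
    by (simp_all add: Let_def split_form_def split_map_sum)
qed

definition grad_energy :: "('a \<Rightarrow> real) \<Rightarrow> nat \<Rightarrow> 'a set \<Rightarrow> real" where
  "grad_energy x i T = set_lebesgue_integral lborel T (\<lambda>y. (norm (grad (pol x i T) y))\<^sup>2)"

definition jump_energy :: "('a \<Rightarrow> real) \<Rightarrow> 'a set \<Rightarrow> real" where
  "jump_energy x T = 1 / diameter T *
     set_lebesgue_integral surface_measure (T \<inter> iface Om) (\<lambda>y. (pol x 1 T y - pol x 2 T y)\<^sup>2)"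

definition local_energy :: "('a \<Rightarrow> real) \<Rightarrow> 'a set \<Rightarrow> real" where
  "local_energy x T = grad_energy x 1 T + grad_energy x 2 T + jump_energy x T"

text \<open>Only cut elements contribute, because on every other extended element the component is
  the zero polynomial.\<close>

lemma energy_local: "energy Om k \<T> (U x) = (\<Sum>T\<in>cut. local_energy x T)"
proof -
  have G: "(\<Sum>T\<in>ex i. set_lebesgue_integral lborel T (\<lambda>y. (norm (elt_grad k T (U x i) y))\<^sup>2)) =
      (\<Sum>T\<in>cut. grad_energy x i T)" if i: "i \<in> {1, 2}" for i
  proof -
    have "(\<Sum>T\<in>ex i. set_lebesgue_integral lborel T (\<lambda>y. (norm (elt_grad k T (U x i) y))\<^sup>2)) =
        (\<Sum>T\<in>ex i. grad_energy x i T)"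
      unfolding grad_energy_def elt_grad_def by (intro sum.cong refl) (simp only: elt_poly_U[OF i])
    also have "\<dots> = (\<Sum>T\<in>cut. grad_energy x i T)"
    proof (rule sum.mono_neutral_right[OF finite_ex])
      show "cut \<subseteq> ex i" using cut_ex[OF _ i] by blast
      show "\<forall>T\<in>ex i - cut. grad_energy x i T = 0"
      proof
        fix T assume T: "T \<in> ex i - cut"
        then have TT: "T \<in> \<T>" using ex_subset by blast
        have "pol x i T = (\<lambda>y. 0)"
        proof (rule polys_eq_on_simplex[OF frame[OF TT] k pol_polys[OF TT] polys_zero])
          fix y assume "y \<in> convex hull (verts T)"
          then have "y \<in> T" using hull_verts[OF TT] by simp
          then show "pol x i T y = 0"
            using uncut_glue_zero[OF i, of T y x] T glue_eq[OF TT, of y] by (simp add: pol_def)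
        qed
        moreover have "grad (\<lambda>y::'a. 0) y = 0" for y by (rule grad_eqI) simp
        ultimately show "grad_energy x i T = 0" by (simp add: grad_energy_def set_lebesgue_integral_def)
      qed
    qed
    finally show ?thesis .
  qed
  have J: "scaled_jump_form Om \<T> (U x) (U x) = (\<Sum>T\<in>cut. jump_energy x T)"
    unfolding scaled_jump_form_def jump_energy_def
  proof (intro sum.cong refl arg_cong2[where f="(*)"])
    fix T assume T: "T \<in> cut"
    then have TT: "T \<in> \<T>" using cut_subset by blast
    show "set_lebesgue_integral surface_measure (T \<inter> iface Om) (\<lambda>y. jump (U x) y * jump (U x) y) =
        set_lebesgue_integral surface_measure (T \<inter> iface Om) (\<lambda>y. (pol x 1 T y - pol x 2 T y)\<^sup>2)"
    proof (rule set_lebesgue_integral_cong)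
      show "T \<inter> iface Om \<in> sets surface_measure"
        using compact_cut_iface[OF TT] by (simp add: borel_compact)
      show "\<forall>y. y \<in> T \<inter> iface Om \<longrightarrow> jump (U x) y * jump (U x) y = (pol x 1 T y - pol x 2 T y)\<^sup>2"
        using U_pol[of 1 T _ x] U_pol[of 2 T _ x] cut_ex[OF T] by (simp add: jump_def power2_eq_square)
    qed
  qed
  show ?thesis unfolding energy_def J local_energy_def sum.distrib using G[of 1] G[of 2] by simp
qed

end

section \<open>Local energy estimates\<close>

text \<open>
  The constants are defined outside the mesh locales, which makes their independence of the mesh and of
  its position relative to the interface explicit.
\<close>

definition node_bound :: "nat \<Rightarrow> nat \<Rightarrow> real" where
  "node_bound d k = real (Suc k) ^ Suc d"

text \<open>Two gradient terms, each a squared inverse estimate times the volume of a ball; the 4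
  comes from a jump of two polynomials of equal sup bound; the last factor bounds a squared
  polynomial by nodal values.\<close>

definition grow_const :: "nat \<Rightarrow> nat \<Rightarrow> real \<Rightarrow> real \<Rightarrow> real \<Rightarrow> real" where
  "grow_const d k K Cg CH =
     (2 * (Cg\<^sup>2 * K\<^sup>2 * unit_ball_vol (real d)) + 4 * CH) * ((real k ^ k)\<^sup>2 * node_bound d k)"

definition osc_const :: "nat \<Rightarrow> real \<Rightarrow> real \<Rightarrow> real" where
  "osc_const d K Co = K ^ (d - 2) * Co"

text \<open>The first summand is the reciprocal of the relative interface area demanded in
  \<open>good_elt\<close>, the second bounds the oscillation; the factors 2 come from splitting a
  square.\<close>

definition good_const :: "nat \<Rightarrow> real \<Rightarrow> real \<Rightarrow> real \<Rightarrow> real \<Rightarrow> real" where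
  "good_const d K Co cH \<rho> = 2 * ((star_ratio d K / \<rho>) ^ (d - 1) * K ^ d / cH) + 2 * osc_const d K Co"

text \<open>Transport from the good neighbour through the common vertex: \<open>star_ratio\<close>
  converts the diameters, and the second summand pays for the way from the vertex to an arbitrary
  point.\<close>

definition patch_const :: "nat \<Rightarrow> real \<Rightarrow> real \<Rightarrow> real \<Rightarrow> real \<Rightarrow> real" where
  "patch_const d K Co cH \<rho> = 2 * (star_ratio d K ^ (d - 2) * good_const d K Co cH \<rho>) + 2 * osc_const d K Co"

text \<open>Nodes per element, times the patch bound, times the number of elements that can share a
  vertex with a given one.\<close>

definition coercivity_const :: "nat \<Rightarrow> nat \<Rightarrow> real \<Rightarrow> real \<Rightarrow> real \<Rightarrow> real \<Rightarrow> real" where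
  "coercivity_const d k K Co cH \<rho> = node_bound d k * (2 * patch_const d K Co cH \<rho>) * (real (Suc d) * K ^ d)"

lemma card_lag_idx_le:
  assumes "finite C"
  shows "real (card (lag_idx C k)) \<le> real (Suc k) ^ card C"
proof -
  have "inj_on (\<lambda>m. restrict m C) (lag_idx C k)"
  proof (rule inj_onI, rule ext)
    fix m m' v assume m: "m \<in> lag_idx C k" "m' \<in> lag_idx C k" and eq: "restrict m C = restrict m' C"
    show "m v = m' v"
      using fun_cong[OF eq, of v] m by (cases "v \<in> C") (auto simp: lag_idx_def)
  qed
  moreover have "(\<lambda>m. restrict m C) ` lag_idx C k \<subseteq> C \<rightarrow>\<^sub>E {..k}"
  proof
    fix f assume "f \<in> (\<lambda>m. restrict m C) ` lag_idx C k"
    then obtain m where m: "m \<in> lag_idx C k" "f = restrict m C" by blast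
    have "m v \<le> k" if "v \<in> C" for v
      using m(1) member_le_sum[OF that, of m] assms by (auto simp: lag_idx_def)
    then show "f \<in> C \<rightarrow>\<^sub>E {..k}" using m(2) by auto
  qed
  ultimately have "card (lag_idx C k) \<le> card (C \<rightarrow>\<^sub>E {..k})"
    using assms by (intro card_inj_on_le[of "\<lambda>m. restrict m C"]) (auto intro: finite_PiE)
  also have "\<dots> = Suc k ^ card C" using assms by (simp add: card_PiE)
  finally show ?thesis by (metis of_nat_le_iff of_nat_power)
qed

text \<open>The estimates for polynomials and for the interface enter with their constants as
  parameters. \<open>\<rho>\<close> times the diameter is the radius of the interface ball around a
  point of an element: small enough for \<open>near_vertex\<close> and for the area bound up to
  \<open>r0\<close>.\<close>

locale cut_mesh_est = cut_mesh +
  fixes d :: nat and Co Cg CH cH r0 \<rho> :: real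
  assumes d: "d = DIM('a)"
    and Co: "Co > 0" "\<And>z r S p x y. r > 0 \<Longrightarrow> cball z r \<subseteq> S \<Longrightarrow> S \<subseteq> cball z (K * r) \<Longrightarrow> compact S \<Longrightarrow>
      p \<in> polys k \<Longrightarrow> x \<in> S \<Longrightarrow> y \<in> S \<Longrightarrow> r ^ (DIM('a) - 2) * (p x - p y)\<^sup>2 \<le>
        Co * set_lebesgue_integral lborel S (\<lambda>x::'a. (norm (grad p x))\<^sup>2)"
    and Cg: "Cg > 0" "\<And>z r S p M x. r > 0 \<Longrightarrow> cball z r \<subseteq> S \<Longrightarrow> S \<subseteq> cball z (K * r) \<Longrightarrow>
      p \<in> polys k \<Longrightarrow> (\<And>x. x \<in> S \<Longrightarrow> \<bar>p x\<bar> \<le> M) \<Longrightarrow> x \<in> S \<Longrightarrow> norm (grad p (x::'a)) \<le> Cg * M / r"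
    and CH: "CH > 0" "\<And>x a. a > 0 \<Longrightarrow> emeasure surface_measure (iface Om \<inter> cball x a) \<le> ennreal (CH * a ^ (DIM('a) - 1))"
    and cH: "cH > 0" "\<And>x r. x \<in> iface Om \<Longrightarrow> 0 < r \<Longrightarrow> r \<le> r0 \<Longrightarrow> ball x r \<subseteq> \<Omega> \<Longrightarrow>
      ennreal (cH * r ^ (DIM('a) - 1)) \<le> emeasure surface_measure (iface Om \<inter> ball x r)"
    and \<rho>: "\<rho> > 0" "\<rho> \<le> near_ratio DIM('a) K" "\<And>T. T \<in> \<T> \<Longrightarrow> \<rho> * diameter T \<le> r0"
begin

abbreviation C1 where "C1 \<equiv> osc_const d K Co"

lemma d2: "d \<ge> 2" using d dim by simp

lemma elt_facts:
  assumes "T \<in> \<T>"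
  shows "diameter T > 0" "K \<ge> 2" "star_ratio d K \<ge> 1" "C1 > 0"
proof -
  show "diameter T > 0" "K \<ge> 2" using diameter_pos[OF assms] K_ge_2[OF assms] by auto
  then show "star_ratio d K \<ge> 1" "C1 > 0"
    using Co(1) by (auto simp: star_ratio_def osc_const_def intro!: one_le_power)
qed

lemma grad_energy_nonneg: "grad_energy x i T \<ge> 0"
  unfolding grad_energy_def set_lebesgue_integral_def by (intro Bochner_Integration.integral_nonneg) simp

lemma jump_energy_nonneg: "T \<in> \<T> \<Longrightarrow> jump_energy x T \<ge> 0"
  unfolding jump_energy_def set_lebesgue_integral_def
  using diameter_pos[of T] by (intro mult_nonneg_nonneg Bochner_Integration.integral_nonneg) auto

lemma local_energy_ge:
  assumes T: "T \<in> \<T>" and i: "i \<in> {1, 2}"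
  shows "grad_energy x i T \<le> local_energy x T" "jump_energy x T \<le> local_energy x T" "0 \<le> local_energy x T"
  using i grad_energy_nonneg[of x 1 T] grad_energy_nonneg[of x 2 T] jump_energy_nonneg[OF T, of x]
  by (auto simp: local_energy_def)

lemma osc_elt:
  assumes T: "T \<in> \<T>" and p: "y \<in> T" "z \<in> T"
  shows "diameter T ^ (d - 2) * (pol x i T y - pol x i T z)\<^sup>2 \<le> C1 * grad_energy x i T"
proof -
  obtain c r where r: "0 < r" "cball c r \<subseteq> T" "T \<subseteq> cball c (K * r)" "diameter T \<le> K * r"
    using elt_inball[OF T] by metis
  have "diameter T ^ (d - 2) * (pol x i T y - pol x i T z)\<^sup>2 \<le> (K * r) ^ (d - 2) * (pol x i T y - pol x i T z)\<^sup>2"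
    using r elt_facts(1)[OF T] by (intro mult_right_mono power_mono) auto
  also have "\<dots> = K ^ (d - 2) * (r ^ (d - 2) * (pol x i T y - pol x i T z)\<^sup>2)" by (simp add: power_mult_distrib)
  also have "\<dots> \<le> K ^ (d - 2) * (Co * grad_energy x i T)"
    using Co(2)[OF r(1-3) compact_elt[OF T] pol_polys[OF T] p] elt_facts(2)[OF T]
    unfolding grad_energy_def d by (intro mult_left_mono) auto
  finally show ?thesis by (simp add: osc_const_def mult.assoc)
qed

lemma pol_at_node:
  assumes "T \<in> \<T>" "l \<in> lagrange_points k T" shows "pol x i T l = gi x i l"
  using glue_at_node[OF assms] glue_eq[OF assms(1) lagrange_in_elt[OF assms]] by (simp add: pol_def)

lemma osc_zero:
  assumes T: "T \<in> \<T>" and i: "i \<in> {1, 2}" and l: "l \<in> lagrange_points k T" "gi x i l = 0" and y: "y \<in> T"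
  shows "diameter T ^ (d - 2) * (pol x i T y)\<^sup>2 \<le> C1 * local_energy x T"
proof -
  have "diameter T ^ (d - 2) * (pol x i T y - pol x i T l)\<^sup>2 \<le> C1 * grad_energy x i T"
    by (rule osc_elt[OF T y lagrange_in_elt[OF T l(1)]])
  also have "\<dots> \<le> C1 * local_energy x T"
    using local_energy_ge(1)[OF T i, of x] elt_facts(4)[OF T] by (intro mult_left_mono) auto
  finally show ?thesis using pol_at_node[OF T l(1)] l(2) by simp
qed

lemma card_lagrange: "T \<in> \<T> \<Longrightarrow> real (card (lagrange_points k T)) \<le> node_bound d k"
  using card_lag_idx_le[OF finite_verts, of T k] frame[of T] lagrange_eq[of T]
    card_image[OF inj_lag_pt, of T] by (simp add: node_bound_def affine_frame_def d)

definition nodal_sum_sq :: "('a \<Rightarrow> real) \<Rightarrow> 'a set \<Rightarrow> real" where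
  "nodal_sum_sq x T = (\<Sum>l\<in>lagrange_points k T \<inter> I. (x l)\<^sup>2)"

lemma pol_bound:
  assumes T: "T \<in> \<T>" and y: "y \<in> T"
  shows "\<bar>pol x i T y\<bar> \<le> sqrt ((real k ^ k)\<^sup>2 * node_bound d k * nodal_sum_sq x T)"
proof -
  let ?L = "lagrange_points k T"
  have fin: "finite ?L" by (rule finite_lagrange[OF T])
  have "\<bar>pol x i T y\<bar> \<le> real k ^ k * (\<Sum>l\<in>?L. \<bar>gi x i l\<bar>)"
    unfolding pol_def by (rule interp_on_elt[OF T y])
  then have "(pol x i T y)\<^sup>2 \<le> (real k ^ k * (\<Sum>l\<in>?L. \<bar>gi x i l\<bar>))\<^sup>2"
    by (metis abs_ge_zero power2_abs power_mono)
  also have "\<dots> = (real k ^ k)\<^sup>2 * (\<Sum>l\<in>?L. 1 * \<bar>gi x i l\<bar>)\<^sup>2" by (simp add: power_mult_distrib)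
  also have "\<dots> \<le> (real k ^ k)\<^sup>2 * ((\<Sum>l\<in>?L. 1\<^sup>2) * (\<Sum>l\<in>?L. \<bar>gi x i l\<bar>\<^sup>2))"
    by (intro mult_left_mono Cauchy_Schwarz_ineq_sum) auto
  also have "\<dots> \<le> (real k ^ k)\<^sup>2 * (node_bound d k * nodal_sum_sq x T)"
  proof (intro mult_left_mono mult_mono)
    show "(\<Sum>l\<in>?L. 1\<^sup>2) \<le> node_bound d k" using card_lagrange[OF T] by simp
    have "(\<Sum>l\<in>?L. \<bar>gi x i l\<bar>\<^sup>2) = (\<Sum>l\<in>?L \<inter> I. (gi x i l)\<^sup>2)"
      using fin Ii_I[of i] by (intro sum.mono_neutral_cong_right) (auto simp: gi_def)
    also have "\<dots> \<le> nodal_sum_sq x T"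
      unfolding nodal_sum_sq_def by (intro sum_mono) (auto simp: gi_def)
    finally show "(\<Sum>l\<in>?L. \<bar>gi x i l\<bar>\<^sup>2) \<le> nodal_sum_sq x T" .
  qed (auto simp: node_bound_def intro: sum_nonneg)
  finally have "(pol x i T y)\<^sup>2 \<le> (real k ^ k)\<^sup>2 * node_bound d k * nodal_sum_sq x T" by (simp add: mult.assoc)
  from real_sqrt_le_mono[OF this] show ?thesis by simp
qed

text \<open>Power counting: the inverse estimate gives h^-2 against a volume of order h^d, and the
  weight h^-1 meets an area of order h^(d-1); both leave h^(d-2).\<close>

lemma local_energy_upper:
  assumes T: "T \<in> cut"
  shows "local_energy x T \<le> grow_const d k K Cg CH * (diameter T ^ (d - 2) * nodal_sum_sq x T)"
proof -
  have TT: "T \<in> \<T>" using T cut_subset by blast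
  define h where "h = diameter T"
  have h: "h > 0" and K: "K \<ge> 2" using elt_facts[OF TT] by (auto simp: h_def)
  define B where "B = (real k ^ k)\<^sup>2 * node_bound d k * nodal_sum_sq x T"
  have B: "B \<ge> 0" by (simp add: B_def nodal_sum_sq_def node_bound_def sum_nonneg)
  have pb: "\<bar>pol x i T y\<bar> \<le> sqrt B" if "y \<in> T" for i y
    unfolding B_def by (rule pol_bound[OF TT that])
  obtain c r where r: "0 < r" "cball c r \<subseteq> T" "T \<subseteq> cball c (K * r)" "h \<le> K * r"
    using elt_inball[OF TT] unfolding h_def by metis
  have cT: "c \<in> T" using r by auto
  have bT: "bounded T" using compact_imp_bounded[OF compact_elt[OF TT]] .
  have Th: "T \<subseteq> cball c h"
    using diameter_bounded_bound[OF bT cT] by (auto simp: h_def)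
  have hd: "h ^ d = h ^ (d - 2) * h\<^sup>2" "h ^ (d - 1) = h ^ (d - 2) * h"
    using d2 by (metis le_add_diff_inverse2 power_add)
      (metis Suc_diff_le diff_Suc_Suc numeral_2_eq_2 One_nat_def power_Suc2 d2)
  have grad: "grad_energy x i T \<le> Cg\<^sup>2 * K\<^sup>2 * unit_ball_vol (real d) * (h ^ (d - 2) * B)" for i
  proof -
    define G where "G = (Cg * sqrt B * K / h)\<^sup>2"
    have gb: "(norm (grad (pol x i T) y))\<^sup>2 \<le> G" if y: "y \<in> T" for y
    proof -
      have "norm (grad (pol x i T) y) \<le> Cg * sqrt B / r"
        by (rule Cg(2)[OF r(1-3) pol_polys[OF TT] pb y])
      also have "\<dots> \<le> Cg * sqrt B * K / h"
      proof -
        have "1 / r \<le> K / h" using r h by (simp add: field_simps)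
        then have "Cg * sqrt B * (1 / r) \<le> Cg * sqrt B * (K / h)"
          using Cg(1) B by (intro mult_left_mono) auto
        then show ?thesis by simp
      qed
      finally show ?thesis unfolding G_def by (intro power_mono) auto
    qed
    have "measure lborel T \<le> measure lborel (cball c h)"
    proof (rule measure_mono_fmeasurable[OF Th])
      show "T \<in> sets lborel" using compact_elt[OF TT] by (simp add: borel_compact)
      show "cball c h \<in> fmeasurable lborel"
        using emeasure_bounded_finite[OF bounded_cball[of c h]] by (intro fmeasurableI) auto
    qed
    also have "\<dots> = unit_ball_vol (real d) * h ^ d" using content_cball[of h c] h by (simp add: d)
    finally have meas: "measure lborel T \<le> unit_ball_vol (real d) * h ^ d" .
    have fT: "emeasure lborel T < \<infinity>" using emeasure_bounded_finite[OF bT] by simp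
    have "set_integrable lborel T (\<lambda>y. G)"
      by (rule set_integrable_compact[OF _ compact_elt[OF TT] fT]) (auto intro: continuous_on_const)
    moreover have "set_integrable lborel T (\<lambda>y. (norm (grad (pol x i T) y))\<^sup>2)"
      using continuous_on_subset[OF continuous_grad[OF pol_polys[OF TT]], of T x i]
      by (intro set_integrable_compact[OF _ compact_elt[OF TT] fT] continuous_on_power continuous_on_norm) auto
    ultimately have "grad_energy x i T \<le> set_lebesgue_integral lborel T (\<lambda>y. G)"
      unfolding grad_energy_def using gb by (intro set_integral_mono) auto
    also have "\<dots> = measure lborel T * G"
      using compact_elt[OF TT] by (simp add: set_lebesgue_integral_def borel_compact)
    also have "\<dots> \<le> unit_ball_vol (real d) * h ^ d * G" using meas by (intro mult_right_mono) (auto simp: G_def)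
    also have "\<dots> = Cg\<^sup>2 * K\<^sup>2 * unit_ball_vol (real d) * (h ^ (d - 2) * B)"
      using h B by (simp add: G_def hd(1) power_mult_distrib power_divide)
    finally show ?thesis .
  qed
  have jump: "jump_energy x T \<le> 4 * CH * (h ^ (d - 2) * B)"
  proof -
    let ?S = "T \<inter> iface Om"
    have fS: "emeasure surface_measure ?S < \<infinity>" by (rule cut_iface_finite[OF TT])
    have "set_lebesgue_integral surface_measure ?S (\<lambda>y. (pol x 1 T y - pol x 2 T y)\<^sup>2) \<le>
        set_lebesgue_integral surface_measure ?S (\<lambda>y. 4 * B)"
    proof (rule set_integral_mono)
      show "set_integrable surface_measure ?S (\<lambda>y. (pol x 1 T y - pol x 2 T y)\<^sup>2)"
        by (intro set_integrable_iface[OF TT] continuous_on_power continuous_on_diff continuous_polys[OF pol_polys[OF TT]])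
      show "set_integrable surface_measure ?S (\<lambda>y. 4 * B)"
        by (intro set_integrable_iface[OF TT] continuous_on_const)
      fix y assume y: "y \<in> ?S"
      have "\<bar>pol x 1 T y - pol x 2 T y\<bar> \<le> 2 * sqrt B" using pb[of y 1] pb[of y 2] y by auto
      then have "\<bar>pol x 1 T y - pol x 2 T y\<bar>\<^sup>2 \<le> (2 * sqrt B)\<^sup>2" by (intro power_mono) auto
      then show "(pol x 1 T y - pol x 2 T y)\<^sup>2 \<le> 4 * B" using B by (simp add: power_mult_distrib)
    qed
    also have "\<dots> = measure surface_measure ?S * (4 * B)"
      using compact_cut_iface[OF TT] by (simp add: set_lebesgue_integral_def borel_compact)
    also have "\<dots> \<le> (CH * h ^ (d - 1)) * (4 * B)"
    proof (intro mult_right_mono)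
      have "emeasure surface_measure ?S \<le> emeasure surface_measure (iface Om \<inter> cball c h)"
        using Th closed_iface by (intro emeasure_mono) (auto simp: borel_closed closed_Int)
      also have "\<dots> \<le> ennreal (CH * h ^ (d - 1))" unfolding d by (rule CH(2)[OF h])
      finally have "enn2real (emeasure surface_measure ?S) \<le> CH * h ^ (d - 1)"
        using CH(1) h by (intro enn2real_leI) auto
      then show "measure surface_measure ?S \<le> CH * h ^ (d - 1)" by (simp add: measure_def)
    qed (use B in auto)
    finally have "jump_energy x T \<le> 1 / h * ((CH * h ^ (d - 1)) * (4 * B))"
      unfolding jump_energy_def h_def[symmetric] using h by (intro mult_left_mono) auto
    also have "\<dots> = 4 * CH * (h ^ (d - 2) * B)" unfolding hd(2) using h by simp
    finally show ?thesis .
  qed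
  have "local_energy x T \<le> (2 * (Cg\<^sup>2 * K\<^sup>2 * unit_ball_vol (real d)) + 4 * CH) * (h ^ (d - 2) * B)"
    using grad[of 1] grad[of 2] jump by (simp add: local_energy_def algebra_simps)
  also have "\<dots> = grow_const d k K Cg CH * (diameter T ^ (d - 2) * nodal_sum_sq x T)"
    by (simp add: grow_const_def B_def h_def ac_simps)
  finally show ?thesis .
qed

text \<open>
  On a cut simplex whose intersection with the interface is not too small, both components are
  controlled: a component without a zero node is alone in the jump term.
\<close>

lemma good_elt:
  assumes T: "T \<in> cut" and i: "i \<in> {1, 2}" and y: "y \<in> T"
    and \<mu>: "measure surface_measure (T \<inter> iface Om) \<ge> cH * (\<rho> * diameter T / star_ratio d K) ^ (d - 1) / K ^ d"
  shows "diameter T ^ (d - 2) * (pol x i T y)\<^sup>2 \<le> good_const d K Co cH \<rho> * local_energy x T"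
proof -
  have TT: "T \<in> \<T>" using T cut_subset by blast
  note F = elt_facts[OF TT]
  \<comment> \<open>The reciprocal of the relative area in the hypothesis, so that h ^ (d - 1) is at
    most \<open>R\<close> times the measure of the cut.\<close>
  define R where "R = (star_ratio d K / \<rho>) ^ (d - 1) * K ^ d / cH"
  have R: "R > 0" using F \<rho>(1) cH(1) by (simp add: R_def)
  have E: "local_energy x T \<ge> 0" by (rule local_energy_ge(3)[OF TT i])
  have gc: "good_const d K Co cH \<rho> = 2 * R + 2 * C1" by (simp add: good_const_def R_def)
  show ?thesis
  proof (cases "\<exists>l\<in>lagrange_points k T. gi x i l = 0")
    case True
    then have "diameter T ^ (d - 2) * (pol x i T y)\<^sup>2 \<le> C1 * local_energy x T" using osc_zero[OF TT i _ _ y] by blast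
    also have "\<dots> \<le> good_const d K Co cH \<rho> * local_energy x T"
      unfolding gc using R F(4) E by (intro mult_right_mono) auto
    finally show ?thesis .
  next
    case False
    define j where "j = 3 - i"
    have j: "j \<in> {1, 2}" "j \<noteq> i" using i by (auto simp: j_def)
    have "Ii i \<inter> Ii j = {}" using Ii_partition(2) i j by auto
    have other: "gi x j l = 0" if "l \<in> lagrange_points k T" for l
    proof -
      have "gi x i l \<noteq> 0" using False that by blast
      then have "l \<in> Ii i" by (simp add: gi_def split: if_splits)
      then have "l \<notin> Ii j" using \<open>Ii i \<inter> Ii j = {}\<close> by blast
      then show ?thesis by (simp add: gi_def)
    qed
    have zero: "pol x j T z = 0" if "z \<in> T" for z
      using glue_zero[OF TT that other] glue_eq[OF TT that] by (simp add: pol_def)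
    let ?S = "T \<inter> iface Om" and ?p = "pol x i T"
    define h where "h = diameter T"
    have h: "h > 0" using F by (simp add: h_def)
    define \<mu> where "\<mu> = measure surface_measure ?S"
    define J where "J = set_lebesgue_integral surface_measure ?S (\<lambda>z. (?p z)\<^sup>2)"
    have sq: "(pol x 1 T z - pol x 2 T z)\<^sup>2 = (?p z)\<^sup>2" if "z \<in> T" for z
      using i zero[OF that] by (auto simp: j_def)
    have "jump_energy x T = 1 / h * J"
      unfolding jump_energy_def J_def h_def using compact_cut_iface[OF TT] sq
      by (intro arg_cong2[where f="(*)"] set_lebesgue_integral_cong refl) (auto simp: borel_compact)
    then have J: "J = h * jump_energy x T" using h by simp
    \<comment> \<open>Bounds twice the squared oscillation on \<open>T\<close>. With it the
      pointwise inequality for fixed \<open>y\<close> is integrated over \<open>z\<close> in the cut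
      and divided by its measure.\<close>
    define Q where "Q = 2 * C1 * grad_energy x i T / h ^ (d - 2)"
    have pt: "(?p y)\<^sup>2 \<le> 2 * (?p z)\<^sup>2 + Q" if z: "z \<in> T" for z
    proof -
      have "h ^ (d - 2) * (?p y - ?p z)\<^sup>2 \<le> C1 * grad_energy x i T"
        unfolding h_def by (rule osc_elt[OF TT y z])
      then have "2 * (?p y - ?p z)\<^sup>2 \<le> Q" using h by (simp add: Q_def field_simps)
      moreover have "(?p y)\<^sup>2 \<le> 2 * (?p z)\<^sup>2 + 2 * (?p y - ?p z)\<^sup>2"
        using zero_le_power2[of "?p y - 2 * ?p z"] by (simp add: power2_eq_square algebra_simps)
      ultimately show ?thesis by linarith
    qed
    have int: "set_integrable surface_measure ?S (\<lambda>z. 2 * (?p z)\<^sup>2 + Q)" "set_integrable surface_measure ?S (\<lambda>z. (?p y)\<^sup>2)"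
      "set_integrable surface_measure ?S (\<lambda>z. (?p z)\<^sup>2)" "set_integrable surface_measure ?S (\<lambda>z. 1::real)"
      by (intro set_integrable_iface[OF TT] continuous_on_add continuous_on_mult continuous_on_power continuous_on_const
          continuous_polys[OF pol_polys[OF TT]])+
    have const: "set_lebesgue_integral surface_measure ?S (\<lambda>z. a) = \<mu> * a" for a :: real
      using compact_cut_iface[OF TT] by (simp add: set_lebesgue_integral_def borel_compact \<mu>_def)
    have "\<mu> * (?p y)\<^sup>2 = set_lebesgue_integral surface_measure ?S (\<lambda>z. (?p y)\<^sup>2)" by (rule const[symmetric])
    also have "\<dots> \<le> set_lebesgue_integral surface_measure ?S (\<lambda>z. 2 * (?p z)\<^sup>2 + Q)"
      using pt by (intro set_integral_mono int) auto
    also have "\<dots> = 2 * J + \<mu> * Q"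
      using set_integral_comb[OF int(3,4), of 2 Q] unfolding J_def const mult_1_right
      by (simp only: mult.commute[of Q])
    finally have main: "\<mu> * (?p y)\<^sup>2 \<le> 2 * (h * jump_energy x T) + \<mu> * Q" unfolding J .
    have hd: "h ^ (d - 1) = h ^ (d - 2) * h"
      using d2 by (metis Suc_diff_le diff_Suc_Suc numeral_2_eq_2 One_nat_def power_Suc2)
    have \<mu>R: "h ^ (d - 1) \<le> R * \<mu>"
    proof -
      have "R * (cH * (\<rho> * h / star_ratio d K) ^ (d - 1) / K ^ d) = ((star_ratio d K / \<rho>) * (\<rho> * h / star_ratio d K)) ^ (d - 1)"
        unfolding R_def power_mult_distrib using F cH(1) by simp
      also have "(star_ratio d K / \<rho>) * (\<rho> * h / star_ratio d K) = h" using F \<rho>(1) by simp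
      finally have "h ^ (d - 1) = R * (cH * (\<rho> * h / star_ratio d K) ^ (d - 1) / K ^ d)" by simp
      also have "\<dots> \<le> R * \<mu>" using R assms(4) unfolding h_def \<mu>_def by (intro mult_left_mono) auto
      finally show ?thesis .
    qed
    have "\<mu> > 0" using \<mu>R R h zero_less_power[OF h, of "d - 1"] by (metis less_le_trans zero_less_mult_pos)
    have "\<mu> * (h ^ (d - 2) * (?p y)\<^sup>2) = h ^ (d - 2) * (\<mu> * (?p y)\<^sup>2)" by simp
    also have "\<dots> \<le> h ^ (d - 2) * (2 * (h * jump_energy x T) + \<mu> * Q)"
      using h by (intro mult_left_mono main) auto
    also have "\<dots> = 2 * h ^ (d - 1) * jump_energy x T + \<mu> * (2 * C1 * grad_energy x i T)"
      unfolding hd using h by (simp add: Q_def distrib_left)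
    also have "\<dots> \<le> 2 * (R * \<mu>) * jump_energy x T + \<mu> * (2 * C1 * grad_energy x i T)"
      using \<mu>R jump_energy_nonneg[OF TT, of x] by (intro add_right_mono mult_right_mono) auto
    also have "\<dots> = \<mu> * (2 * R * jump_energy x T + 2 * C1 * grad_energy x i T)" by (simp add: algebra_simps)
    finally have "h ^ (d - 2) * (?p y)\<^sup>2 \<le> 2 * R * jump_energy x T + 2 * C1 * grad_energy x i T"
      using \<open>\<mu> > 0\<close> by simp
    also have "\<dots> \<le> 2 * R * local_energy x T + 2 * C1 * local_energy x T"
      using R F(4) local_energy_ge[OF TT i, of x] by (intro add_mono mult_left_mono) auto
    finally show ?thesis unfolding gc h_def by (simp add: algebra_simps)
  qed
qed

section \<open>Interface area in the star of a vertex\<close>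

lemma verts_lagrange:
  assumes T: "T \<in> \<T>" and v: "v \<in> verts T" shows "v \<in> lagrange_points k T"
proof -
  let ?m = "\<lambda>u. if u = v then k else 0"
  have fin: "finite (verts T)" by (rule finite_verts[OF T])
  have "?m \<in> lag_idx (verts T) k" using v fin by (auto simp: lag_idx_def)
  moreover have "lag_pt (verts T) k ?m = (\<Sum>u\<in>verts T. if u = v then v else 0)"
    unfolding lag_pt_def using k by (intro sum.cong) auto
  then have "lag_pt (verts T) k ?m = v" using v fin by simp
  ultimately show ?thesis unfolding lagrange_eq[OF T] by (metis imageI)
qed

text \<open>Otherwise all elements around \<open>y\<close> are uncut and contain \<open>v\<close>, a
  point of \<open>Om j\<close>; a neighbourhood of \<open>y\<close> then lies in the closure of
  \<open>Om j\<close>, although \<open>Om i\<close> accumulates at \<open>y\<close>.\<close>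

lemma iface_in_cut_star:
  assumes v: "v \<in> Om j" "i \<in> {1, 2}" "j \<in> {1, 2}" "i \<noteq> j" and y: "y \<in> iface Om" "y \<in> \<Omega>"
    and star: "\<And>S. S \<in> \<T> \<Longrightarrow> y \<in> S \<Longrightarrow> v \<in> verts S"
  shows "\<exists>S\<in>star v \<inter> cut. y \<in> S"
proof (rule ccontr)
  assume no: "\<not> ?thesis"
  have sub: "S \<subseteq> closure (Om j)" if S: "S \<in> \<T>" "y \<in> S" for S
  proof (rule uncut_in_closure[OF v(3)])
    have "v \<in> S" using star[OF S] verts_subset[OF S(1)] by blast
    then show "S \<in> ex j" using v(1) S(1) by (auto simp: ex_simplices_def)
    show "S \<notin> cut" using no S star[OF S] by (auto simp: star_def)
  qed
  obtain e1 where e1: "e1 > 0" "ball y e1 \<subseteq> \<Omega>" using \<Omega>(1) y(2) open_contains_ball by blast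
  obtain e2 where e2: "e2 > 0" "\<And>T. T \<in> \<T> \<Longrightarrow> T \<inter> ball y e2 \<noteq> {} \<Longrightarrow> y \<in> T" using local_elts by blast
  have "ball y (min e1 e2) \<subseteq> closure (Om j)"
  proof
    fix z assume z: "z \<in> ball y (min e1 e2)"
    then have "z \<in> \<Omega>" using e1(2) by auto
    then obtain S where S: "S \<in> \<T>" "z \<in> S" using mesh_cover closure_subset by blast
    have "z \<in> ball y e2" using z by simp
    then have "y \<in> S" using e2(2)[OF S(1)] S(2) by blast
    then show "z \<in> closure (Om j)" using sub[OF S(1)] S(2) by blast
  qed
  moreover have "ball y (min e1 e2) \<inter> Om i \<noteq> {}"
  proof -
    have "y \<in> closure (Om i)" using y(1) v(2) by (auto simp: iface_def)
    moreover have "y \<in> ball y (min e1 e2)" using e1(1) e2(1) by simp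
    ultimately show ?thesis using open_Int_closure_eq_empty[OF open_ball, of y "min e1 e2" "Om i"] by blast
  qed
  moreover have "Om i \<inter> closure (Om j) = {}"
    using open_Int_closure_eq_empty[OF open_Om[OF v(2)], of "Om j"] Om_disjoint v(2-4) by auto
  ultimately show False by blast
qed

text \<open>Since all nodes carry component \<open>i\<close>, every vertex of \<open>T\<close> lies
  in \<Omega> and in the other subdomain, so the interface in a small ball is covered by the cut
  elements of one star. These are at most K ^ d in number, and the pigeonhole principle selects
  one.\<close>

lemma good_neighbour:
  assumes T: "T \<in> cut" and i: "i \<in> {1, 2}" and all: "\<And>l. l \<in> lagrange_points k T \<Longrightarrow> l \<in> Ii i"
  obtains v S where "v \<in> verts T" "S \<in> star v \<inter> cut" "v \<in> \<Omega>"
    "measure surface_measure (S \<inter> iface Om) \<ge> cH * (\<rho> * diameter S / star_ratio d K) ^ (d - 1) / K ^ d"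
proof -
  have TT: "T \<in> \<T>" using T cut_subset by blast
  note F = elt_facts[OF TT]
  have nodesT: "l \<in> nodes \<Omega> k \<T> \<and> l \<notin> Om i" if "l \<in> verts T" for l
    using all[OF verts_lagrange[OF TT that]] I_nodes by (auto simp: cut_nodes_of_def)
  then have vO: "verts T \<subseteq> \<Omega>" using nodes_subset by blast
  obtain x0 where x0: "x0 \<in> interior T" "x0 \<in> iface Om" using T by (auto simp: cut_simplices_def)
  have x0T: "x0 \<in> T" using x0(1) interior_subset by blast
  obtain v where v: "v \<in> verts T" and near: "\<And>y. y \<in> ball x0 (near_ratio DIM('a) K * diameter T) \<Longrightarrow>
      y \<in> \<Omega> \<and> (\<forall>S\<in>\<T>. y \<in> S \<longrightarrow> v \<in> verts S)"
    using near_vertex[OF TT vO x0T] by blast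
  define r where "r = \<rho> * diameter T"
  have r: "0 < r" "r \<le> r0" using \<rho>(1) \<rho>(3)[OF TT] F(1) by (auto simp: r_def)
  have "r \<le> near_ratio DIM('a) K * diameter T" unfolding r_def using \<rho>(2) F(1) by (intro mult_right_mono) auto
  then have near: "y \<in> \<Omega> \<and> (\<forall>S\<in>\<T>. y \<in> S \<longrightarrow> v \<in> verts S)" if "y \<in> ball x0 r" for y
    using near[of y] that by auto
  define j where "j = 3 - i"
  have j: "j \<in> {1, 2}" "i \<noteq> j" using i by (auto simp: j_def)
  have vj: "v \<in> Om j" using nodesT[OF v] node_props(3)[of v] i by (auto simp: j_def)
  have v\<Omega>: "v \<in> \<Omega>" using v vO by blast
  have cover: "iface Om \<inter> ball x0 r \<subseteq> (\<Union>S\<in>star v \<inter> cut. S \<inter> iface Om)"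
  proof
    fix y assume y: "y \<in> iface Om \<inter> ball x0 r"
    then have "\<exists>S\<in>star v \<inter> cut. y \<in> S"
      using near[of y] by (intro iface_in_cut_star[OF vj i j]) auto
    then show "y \<in> (\<Union>S\<in>star v \<inter> cut. S \<inter> iface Om)" using y by blast
  qed
  define \<mu> where "\<mu> S = measure surface_measure (S \<inter> iface Om)" for S
  have em: "emeasure surface_measure (S \<inter> iface Om) = ennreal (\<mu> S)" if "S \<in> star v \<inter> cut" for S
    using cut_iface_finite[of S] that unfolding \<mu>_def
    by (intro emeasure_eq_ennreal_measure) (auto simp: star_def)
  have "ennreal (cH * r ^ (d - 1)) \<le> emeasure surface_measure (iface Om \<inter> ball x0 r)"
    unfolding d using near by (intro cH(2)[OF x0(2) r]) blast
  also have "\<dots> \<le> emeasure surface_measure (\<Union>S\<in>star v \<inter> cut. S \<inter> iface Om)"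
  proof (rule emeasure_mono[OF cover])
    show "(\<Union>S\<in>star v \<inter> cut. S \<inter> iface Om) \<in> sets surface_measure"
      using finite_star compact_cut_iface by (intro sets.finite_UN) (auto simp: borel_compact star_def)
  qed
  also have "\<dots> \<le> (\<Sum>S\<in>star v \<inter> cut. emeasure surface_measure (S \<inter> iface Om))"
    using finite_star compact_cut_iface by (intro emeasure_subadditive_finite) (auto simp: borel_compact star_def)
  also have "\<dots> = (\<Sum>S\<in>star v \<inter> cut. ennreal (\<mu> S))" using em by (intro sum.cong) auto
  also have "\<dots> = ennreal (\<Sum>S\<in>star v \<inter> cut. \<mu> S)" by (intro sum_ennreal) (simp add: \<mu>_def)
  finally have total: "cH * r ^ (d - 1) \<le> (\<Sum>S\<in>star v \<inter> cut. \<mu> S)"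
    by (subst (asm) ennreal_le_iff) (auto simp: \<mu>_def intro: sum_nonneg)
  \<comment> \<open>The pigeonhole share of the area guaranteed in the ball.\<close>
  define q where "q = cH * r ^ (d - 1) / K ^ d"
  have q: "q > 0" using cH(1) r F by (simp add: q_def)
  have ne: "star v \<inter> cut \<noteq> {}" using T v TT by (auto simp: star_def)
  have "\<exists>S\<in>star v \<inter> cut. \<mu> S \<ge> q"
  proof (rule ccontr)
    assume "\<not> ?thesis"
    then have "(\<Sum>S\<in>star v \<inter> cut. \<mu> S) < (\<Sum>S\<in>star v \<inter> cut. q)"
      using finite_star ne by (intro sum_strict_mono) (auto simp: not_le)
    also have "\<dots> = real (card (star v \<inter> cut)) * q" by simp
    also have "\<dots> \<le> K ^ d * q"
    proof (intro mult_right_mono)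
      have "card (star v \<inter> cut) \<le> card (star v)" using finite_star by (intro card_mono) auto
      then show "real (card (star v \<inter> cut)) \<le> K ^ d" using card_star_le[of v] ne unfolding d by force
    qed (use q in simp)
    also have "\<dots> = cH * r ^ (d - 1)" using F by (simp add: q_def)
    finally show False using total by simp
  qed
  then obtain S where S: "S \<in> star v \<inter> cut" "\<mu> S \<ge> q" by blast
  \<comment> \<open>Expresses the share by the diameter of \<open>S\<close>, which may exceed that
    of \<open>T\<close> by the factor \<open>star_ratio\<close>.\<close>
  have "cH * (\<rho> * diameter S / star_ratio d K) ^ (d - 1) / K ^ d \<le> q"
  proof -
    have SS: "S \<in> \<T>" "S \<in> star v" "T \<in> star v" using S v TT by (auto simp: star_def)
    have "diameter S \<le> star_ratio d K * diameter T" unfolding d by (rule star_quasi_uniform[OF v\<Omega> SS(2,3)])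
    then have "\<rho> * diameter S \<le> \<rho> * (star_ratio d K * diameter T)" using \<rho>(1) by (intro mult_left_mono) auto
    then have "\<rho> * diameter S / star_ratio d K \<le> r" using F by (simp add: r_def pos_divide_le_eq mult_ac)
    then have "(\<rho> * diameter S / star_ratio d K) ^ (d - 1) \<le> r ^ (d - 1)"
      using F \<rho>(1) elt_facts(1)[OF SS(1)] by (intro power_mono) auto
    then show ?thesis unfolding q_def using cH(1) F by (intro divide_right_mono mult_left_mono) auto
  qed
  then show thesis using that[OF v S(1) v\<Omega>] S(2) by (simp add: \<mu>_def)
qed

definition nbrs :: "'a set \<Rightarrow> 'a set set" where
  "nbrs T = {S \<in> cut. verts S \<inter> verts T \<noteq> {}}"

lemma pol_lower:
  assumes T: "T \<in> cut" and i: "i \<in> {1, 2}" and y: "y \<in> T"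
  shows "diameter T ^ (d - 2) * (pol x i T y)\<^sup>2 \<le> patch_const d K Co cH \<rho> * (2 * (\<Sum>S\<in>nbrs T. local_energy x S))"
proof -
  have TT: "T \<in> \<T>" using T cut_subset by blast
  note F = elt_facts[OF TT]
  have nonneg: "local_energy x S \<ge> 0" if "S \<in> nbrs T" for S
    using that cut_subset local_energy_ge(3)[of S 1] by (auto simp: nbrs_def)
  have finN: "finite (nbrs T)" using finite_cut by (simp add: nbrs_def)
  have mem: "local_energy x S \<le> (\<Sum>S\<in>nbrs T. local_energy x S)" if "S \<in> nbrs T" for S
    using member_le_sum[OF that, of "local_energy x"] nonneg finN by auto
  have "verts T \<noteq> {}" using frame[OF TT] by (auto simp: affine_frame_def)
  then have TN: "T \<in> nbrs T" using T by (auto simp: nbrs_def)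
  define \<Sigma> where "\<Sigma> = (\<Sum>S\<in>nbrs T. local_energy x S)"
  have \<Sigma>: "\<Sigma> \<ge> 0" unfolding \<Sigma>_def using nonneg by (rule sum_nonneg)
  have G: "good_const d K Co cH \<rho> \<ge> 0"
    using F \<rho>(1) cH(1) by (simp add: good_const_def)
  have s: "star_ratio d K ^ (d - 2) \<ge> 0" using F by simp
  have pc: "patch_const d K Co cH \<rho> = 2 * (star_ratio d K ^ (d - 2) * good_const d K Co cH \<rho>) + 2 * C1"
    by (simp add: patch_const_def)
  have P: "patch_const d K Co cH \<rho> \<ge> C1" using G s F(4) by (simp add: pc)
  show ?thesis
  proof (cases "\<exists>l\<in>lagrange_points k T. gi x i l = 0")
    case True
    then have "diameter T ^ (d - 2) * (pol x i T y)\<^sup>2 \<le> C1 * local_energy x T" using osc_zero[OF TT i _ _ y] by blast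
    also have "\<dots> \<le> patch_const d K Co cH \<rho> * (2 * \<Sigma>)"
      using P F(4) mem[OF TN] \<Sigma> nonneg[OF TN] unfolding \<Sigma>_def[symmetric] by (intro mult_mono) auto
    finally show ?thesis unfolding \<Sigma>_def .
  next
    case False
    have "l \<in> Ii i" if "l \<in> lagrange_points k T" for l
    proof -
      have "gi x i l \<noteq> 0" using False that by blast
      then show ?thesis by (simp add: gi_def split: if_splits)
    qed
    then obtain v S where v: "v \<in> verts T" and S: "S \<in> star v \<inter> cut" and v\<Omega>: "v \<in> \<Omega>"
      and \<mu>: "measure surface_measure (S \<inter> iface Om) \<ge> cH * (\<rho> * diameter S / star_ratio d K) ^ (d - 1) / K ^ d"
      using good_neighbour[OF T i] by blast
    have SS: "S \<in> \<T>" "v \<in> verts S" "S \<in> cut" "T \<in> star v" using S v TT by (auto simp: star_def)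
    have vS: "v \<in> S" "v \<in> T" using SS v TT verts_subset by blast+
    have SN: "S \<in> nbrs T" using SS v by (auto simp: nbrs_def)
    have eq: "pol x i T v = pol x i S v"
      using glue_eq[OF TT vS(2)] glue_eq[OF SS(1) vS(1)] by (simp add: pol_def)
    have "diameter T ^ (d - 2) \<le> (star_ratio d K * diameter S) ^ (d - 2)"
      using star_quasi_uniform[OF v\<Omega> SS(4), of S] S F(1) unfolding d by (intro power_mono) auto
    then have "diameter T ^ (d - 2) * (pol x i T v)\<^sup>2 \<le> (star_ratio d K * diameter S) ^ (d - 2) * (pol x i S v)\<^sup>2"
      unfolding eq by (intro mult_right_mono) auto
    also have "\<dots> = star_ratio d K ^ (d - 2) * (diameter S ^ (d - 2) * (pol x i S v)\<^sup>2)" by (simp add: power_mult_distrib)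
    also have "\<dots> \<le> star_ratio d K ^ (d - 2) * (good_const d K Co cH \<rho> * local_energy x S)"
      using s by (intro mult_left_mono good_elt[OF SS(3) i vS(1) \<mu>]) auto
    finally have 1: "diameter T ^ (d - 2) * (pol x i T v)\<^sup>2 \<le> star_ratio d K ^ (d - 2) * good_const d K Co cH \<rho> * local_energy x S"
      by (simp add: mult.assoc)
    also have "\<dots> \<le> star_ratio d K ^ (d - 2) * good_const d K Co cH \<rho> * \<Sigma>"
      using mem[OF SN] s G unfolding \<Sigma>_def by (intro mult_left_mono) auto
    finally have 1: "diameter T ^ (d - 2) * (pol x i T v)\<^sup>2 \<le> star_ratio d K ^ (d - 2) * good_const d K Co cH \<rho> * \<Sigma>" .
    have "diameter T ^ (d - 2) * (pol x i T y - pol x i T v)\<^sup>2 \<le> C1 * grad_energy x i T" by (rule osc_elt[OF TT y vS(2)])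
    also have "\<dots> \<le> C1 * \<Sigma>"
      using local_energy_ge(1)[OF TT i, of x] mem[OF TN] F(4) unfolding \<Sigma>_def by (intro mult_left_mono) auto
    finally have 2: "diameter T ^ (d - 2) * (pol x i T y - pol x i T v)\<^sup>2 \<le> C1 * \<Sigma>" .
    have "(pol x i T y)\<^sup>2 \<le> 2 * (pol x i T v)\<^sup>2 + 2 * (pol x i T y - pol x i T v)\<^sup>2"
      using zero_le_power2[of "pol x i T y - 2 * pol x i T v"] by (simp add: power2_eq_square algebra_simps)
    then have "diameter T ^ (d - 2) * (pol x i T y)\<^sup>2 \<le>
        diameter T ^ (d - 2) * (2 * (pol x i T v)\<^sup>2 + 2 * (pol x i T y - pol x i T v)\<^sup>2)"
      using F(1) by (intro mult_left_mono) auto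
    also have "\<dots> \<le> patch_const d K Co cH \<rho> * \<Sigma>"
      using 1 2 unfolding pc by (simp add: algebra_simps)
    also have "\<dots> \<le> patch_const d K Co cH \<rho> * (2 * \<Sigma>)"
      using P F(4) \<Sigma> by (intro mult_left_mono) auto
    finally show ?thesis unfolding \<Sigma>_def .
  qed
qed

section \<open>The diagonal comparison form\<close>

definition mass :: "('a \<Rightarrow> real) \<Rightarrow> real" where
  "mass x = (\<Sum>T\<in>cut. diameter T ^ (d - 2) * nodal_sum_sq x T)"

lemma energy_le_mass: "energy Om k \<T> (U x) \<le> grow_const d k K Cg CH * mass x"
  unfolding energy_local mass_def sum_distrib_left by (intro sum_mono local_energy_upper)

text \<open>Summation of the element bounds counts each local energy once for every cut element that
  shares a vertex with it, at most (d + 1) K ^ d times; exchanging the sums makes this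
  visible.\<close>

lemma mass_le_energy: "mass x \<le> coercivity_const d k K Co cH \<rho> * energy Om k \<T> (U x)"
proof (cases "cut = {}")
  case True
  then show ?thesis by (simp add: mass_def energy_local)
next
  case False
  then obtain T0 where "T0 \<in> \<T>" using cut_subset by blast
  note F0 = elt_facts[OF this]
  define P where "P = patch_const d K Co cH \<rho>"
  have P: "P \<ge> 0" using F0 \<rho>(1) cH(1) by (simp add: P_def patch_const_def good_const_def)
  have N: "node_bound d k \<ge> 0" by (simp add: node_bound_def)
  have nonneg: "local_energy x S \<ge> 0" if "S \<in> cut" for S
    using that cut_subset local_energy_ge(3)[of S 1] by auto
  have T: "diameter T ^ (d - 2) * nodal_sum_sq x T \<le> node_bound d k * (P * (2 * (\<Sum>S\<in>nbrs T. local_energy x S)))"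
    if T: "T \<in> cut" for T
  proof -
    have TT: "T \<in> \<T>" using T cut_subset by blast
    let ?\<Sigma> = "\<Sum>S\<in>nbrs T. local_energy x S"
    have \<Sigma>: "?\<Sigma> \<ge> 0" using nonneg by (intro sum_nonneg) (auto simp: nbrs_def)
    have node: "diameter T ^ (d - 2) * (x l)\<^sup>2 \<le> P * (2 * ?\<Sigma>)" if l: "l \<in> lagrange_points k T \<inter> I" for l
    proof -
      obtain i where i: "i \<in> {1, 2}" "l \<in> Ii i" using l Ii_partition(1) by blast
      have "pol x i T l = x l" using pol_at_node[OF TT, of l x i] l i by (simp add: gi_def)
      then show ?thesis using pol_lower[OF T i(1) lagrange_in_elt[OF TT], of l x] l by (simp add: P_def)
    qed
    have "diameter T ^ (d - 2) * nodal_sum_sq x T = (\<Sum>l\<in>lagrange_points k T \<inter> I. diameter T ^ (d - 2) * (x l)\<^sup>2)"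
      by (simp add: nodal_sum_sq_def sum_distrib_left)
    also have "\<dots> \<le> (\<Sum>l\<in>lagrange_points k T \<inter> I. P * (2 * ?\<Sigma>))" by (intro sum_mono node)
    also have "\<dots> = real (card (lagrange_points k T \<inter> I)) * (P * (2 * ?\<Sigma>))" by simp
    also have "\<dots> \<le> node_bound d k * (P * (2 * ?\<Sigma>))"
    proof (intro mult_right_mono)
      have "card (lagrange_points k T \<inter> I) \<le> card (lagrange_points k T)"
        using finite_lagrange[OF TT] by (intro card_mono) auto
      then show "real (card (lagrange_points k T \<inter> I)) \<le> node_bound d k" using card_lagrange[OF TT] by linarith
    qed (use P \<Sigma> in simp)
    finally show ?thesis .
  qed
  have nb: "real (card {T \<in> cut. S \<in> nbrs T}) \<le> real (Suc d) * K ^ d" if S: "S \<in> cut" for S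
  proof -
    have SS: "S \<in> \<T>" using S cut_subset by blast
    have "card {T \<in> cut. S \<in> nbrs T} \<le> card (\<Union>v\<in>verts S. star v)"
      using finite_star finite_verts[OF SS] cut_subset by (intro card_mono) (auto simp: nbrs_def star_def)
    also have "\<dots> \<le> (\<Sum>v\<in>verts S. card (star v))" by (rule card_UN_le[OF finite_verts[OF SS]])
    finally have "real (card {T \<in> cut. S \<in> nbrs T}) \<le> (\<Sum>v\<in>verts S. real (card (star v)))"
      by (metis of_nat_le_iff of_nat_sum)
    also have "\<dots> \<le> (\<Sum>v\<in>verts S. K ^ d)"
      using SS unfolding d by (intro sum_mono card_star_le) (auto simp: star_def)
    also have "\<dots> = real (Suc d) * K ^ d" using frame[OF SS] by (simp add: affine_frame_def d)
    finally show ?thesis .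
  qed
  have "mass x \<le> (\<Sum>T\<in>cut. node_bound d k * (P * (2 * (\<Sum>S\<in>nbrs T. local_energy x S))))"
    unfolding mass_def by (intro sum_mono T)
  also have "\<dots> = node_bound d k * (2 * P) * (\<Sum>T\<in>cut. \<Sum>S\<in>nbrs T. local_energy x S)"
    by (simp add: sum_distrib_left ac_simps)
  also have "(\<Sum>T\<in>cut. \<Sum>S\<in>nbrs T. local_energy x S) = (\<Sum>S\<in>cut. \<Sum>T\<in>{T \<in> cut. S \<in> nbrs T}. local_energy x S)"
  proof -
    have "(\<Sum>T\<in>cut. \<Sum>S\<in>nbrs T. local_energy x S) = (\<Sum>T\<in>cut. \<Sum>S\<in>{S \<in> cut. S \<in> nbrs T}. local_energy x S)"
      by (intro sum.cong refl) (auto simp: nbrs_def)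
    also have "\<dots> = (\<Sum>S\<in>cut. \<Sum>T\<in>{T \<in> cut. S \<in> nbrs T}. local_energy x S)"
      by (rule sum.swap_restrict[OF finite_cut finite_cut])
    finally show ?thesis .
  qed
  also have "\<dots> = (\<Sum>S\<in>cut. real (card {T \<in> cut. S \<in> nbrs T}) * local_energy x S)" by simp
  also have "node_bound d k * (2 * P) * \<dots> \<le> node_bound d k * (2 * P) * (\<Sum>S\<in>cut. real (Suc d) * K ^ d * local_energy x S)"
    using P N by (intro mult_left_mono sum_mono mult_right_mono nb nonneg) auto
  also have "\<dots> = coercivity_const d k K Co cH \<rho> * energy Om k \<T> (U x)"
    by (simp add: coercivity_const_def P_def energy_local sum_distrib_left ac_simps)
  finally show ?thesis .
qed

text \<open>This diagonality lets bounds at unit vectors, which give the diagonal entries of the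
  matrix, act on an arbitrary vector.\<close>

lemma mass_unit: "mass x = (\<Sum>j\<in>I. (x j)\<^sup>2 * mass (unit j))"
proof -
  have "nodal_sum_sq x T = (\<Sum>j\<in>I. (x j)\<^sup>2 * nodal_sum_sq (unit j) T)" for T
  proof -
    have "nodal_sum_sq (unit j) T = (if j \<in> lagrange_points k T then 1 else 0)" if "j \<in> I" for j
    proof -
      have "nodal_sum_sq (unit j) T = (\<Sum>l\<in>lagrange_points k T \<inter> I. if l = j then 1 else 0)"
        unfolding nodal_sum_sq_def by (intro sum.cong) (auto simp: unit_def)
      then show ?thesis using finite_I that by simp
    qed
    then have "(\<Sum>j\<in>I. (x j)\<^sup>2 * nodal_sum_sq (unit j) T) = (\<Sum>j\<in>I. if j \<in> lagrange_points k T then (x j)\<^sup>2 else 0)"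
      by (intro sum.cong) auto
    also have "\<dots> = nodal_sum_sq x T"
      unfolding nodal_sum_sq_def using finite_I by (simp add: sum.If_cases Int_commute)
    finally show ?thesis by simp
  qed
  then have "mass x = (\<Sum>T\<in>cut. \<Sum>j\<in>I. (x j)\<^sup>2 * (diameter T ^ (d - 2) * nodal_sum_sq (unit j) T))"
    unfolding mass_def by (simp add: sum_distrib_left ac_simps)
  also have "\<dots> = (\<Sum>j\<in>I. (x j)\<^sup>2 * mass (unit j))"
    unfolding mass_def by (subst sum.swap) (simp add: sum_distrib_left)
  finally show ?thesis .
qed

lemma energy_nonneg: "energy Om k \<T> (U x) \<ge> 0"
  unfolding energy_local using cut_subset local_energy_ge(3)[of _ 1] by (intro sum_nonneg) auto

text \<open>The two-sided comparison with \<open>mass\<close> is used at \<open>x\<close> and at the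
  unit vectors. Both directions chain the same two inequalities with the roles exchanged, hence the
  common constant.\<close>

lemma quad_form_bounds:
  fixes c1 c2 :: real
  assumes c: "c1 > 0" "c2 > 0"
    and eq: "norm_equivalence c1 c2 \<Omega> Om n k \<T> \<alpha> \<gamma> \<beta> \<kappa> \<alpha>bar \<F>"
    and G: "G \<ge> grow_const d k K Cg CH" "G \<ge> 0" and H: "H \<ge> coercivity_const d k K Co cH \<rho>" "H \<ge> 0"
  shows "quad_form I (cut_matrix \<Omega> Om n k \<T> \<alpha> \<gamma> \<beta> \<kappa> \<alpha>bar \<F>) x \<le>
      c2 * G * H / c1 * quad_form I (diag_part (cut_matrix \<Omega> Om n k \<T> \<alpha> \<gamma> \<beta> \<kappa> \<alpha>bar \<F>)) x"
    and "quad_form I (diag_part (cut_matrix \<Omega> Om n k \<T> \<alpha> \<gamma> \<beta> \<kappa> \<alpha>bar \<F>)) x \<le>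
      c2 * G * H / c1 * quad_form I (cut_matrix \<Omega> Om n k \<T> \<alpha> \<gamma> \<beta> \<kappa> \<alpha>bar \<F>) x"
proof -
  let ?E = "\<lambda>x. energy Om k \<T> (U x)" and ?A = "\<lambda>x. cutfem (U x) (U x)"
  have mass0: "mass x \<ge> 0" for x
  proof -
    have "nodal_sum_sq x T \<ge> 0" for T unfolding nodal_sum_sq_def by (simp add: sum_nonneg)
    then show ?thesis
      unfolding mass_def using cut_subset diameter_pos
      by (intro sum_nonneg mult_nonneg_nonneg zero_le_power) (auto intro: less_imp_le)
  qed
  have E: "?E x \<le> G * mass x" for x
    using energy_le_mass[of x] mult_right_mono[OF G(1) mass0[of x]] by linarith
  have M: "mass x \<le> H * ?E x" for x
    using mass_le_energy[of x] mult_right_mono[OF H(1) energy_nonneg[of x]] by linarith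
  have lo: "?E x \<le> ?A x / c1" and up: "?A x \<le> c2 * ?E x" for x
    using norm_equivalence_U[OF eq, of x] c by (auto simp: field_simps)
  have A_M: "?A x \<le> c2 * G * mass x" for x
    using order_trans[OF up[of x] mult_left_mono[OF E[of x], of c2]] c by (simp add: mult.assoc)
  have M_A: "mass x \<le> H / c1 * ?A x" for x
    using order_trans[OF M[of x] mult_left_mono[OF lo[of x] H(2)]] by simp
  have D: "quad_form I (diag_part (cut_matrix \<Omega> Om n k \<T> \<alpha> \<gamma> \<beta> \<kappa> \<alpha>bar \<F>)) x = (\<Sum>j\<in>I. (x j)\<^sup>2 * ?A (unit j))"
    by (rule quad_form_diag)
  have cG: "c2 * G \<ge> 0" using c G by simp
  have "?A x \<le> c2 * G * (\<Sum>j\<in>I. (x j)\<^sup>2 * mass (unit j))" using A_M[of x] mass_unit[of x] by simp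
  also have "\<dots> \<le> c2 * G * (\<Sum>j\<in>I. (x j)\<^sup>2 * (H / c1 * ?A (unit j)))"
    by (intro mult_left_mono sum_mono M_A cG) auto
  also have "\<dots> = c2 * G * H / c1 * (\<Sum>j\<in>I. (x j)\<^sup>2 * ?A (unit j))"
    by (simp add: sum_distrib_left ac_simps)
  finally show "quad_form I (cut_matrix \<Omega> Om n k \<T> \<alpha> \<gamma> \<beta> \<kappa> \<alpha>bar \<F>) x \<le>
      c2 * G * H / c1 * quad_form I (diag_part (cut_matrix \<Omega> Om n k \<T> \<alpha> \<gamma> \<beta> \<kappa> \<alpha>bar \<F>)) x"
    unfolding D quad_form_cutfem .
  have "(\<Sum>j\<in>I. (x j)\<^sup>2 * ?A (unit j)) \<le> (\<Sum>j\<in>I. (x j)\<^sup>2 * (c2 * G * mass (unit j)))"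
    by (intro sum_mono mult_left_mono A_M) auto
  also have "\<dots> = c2 * G * mass x" unfolding mass_unit[of x] by (simp add: sum_distrib_left ac_simps)
  also have "\<dots> \<le> c2 * G * (H / c1 * ?A x)" by (intro mult_left_mono M_A cG)
  finally show "quad_form I (diag_part (cut_matrix \<Omega> Om n k \<T> \<alpha> \<gamma> \<beta> \<kappa> \<alpha>bar \<F>)) x \<le>
      c2 * G * H / c1 * quad_form I (cut_matrix \<Omega> Om n k \<T> \<alpha> \<gamma> \<beta> \<kappa> \<alpha>bar \<F>) x"
    unfolding D quad_form_cutfem by (simp add: mult.assoc)
qed

end

section \<open>Constants independent of the mesh\<close>

text \<open>Instead of showing that the supremum is attained, a ball with more than half the
  extremal diameter is taken; with the passage from diameter to radius this gives the factor
  4.\<close>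

lemma inball_shape_regular:
  fixes T :: "'a::euclidean_space set"
  assumes T: "int DIM('a) simplex T" and \<sigma>: "diameter T \<le> \<sigma> * inball_diameter T"
  shows "\<exists>z r. 0 < r \<and> cball z r \<subseteq> T \<and> diameter T \<le> 4 * \<sigma> * r" and "\<sigma> > 0"
proof -
  obtain C where C: "\<not> affine_dependent C" "int (card C) = int DIM('a) + 1" "T = convex hull C"
    using T unfolding simplex_def by blast
  then have frame: "affine_frame C" by (simp add: affine_frame_def)
  have bd: "bounded T"
    using C affine_frame_finite[OF frame] by (simp add: bounded_convex_hull finite_imp_bounded)
  obtain z where "z \<in> interior T" using interior_simplex_nonempty[OF frame] C(3) by blast
  then obtain e where e: "e > 0" "cball z e \<subseteq> T" by (auto simp: mem_interior_cball)
  define S where "S = {2 * r | r. 0 \<le> r \<and> (\<exists>x. cball x r \<subseteq> T)}"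
  have up: "s \<le> diameter T" if s: "s \<in> S" for s
  proof -
    obtain r x where r: "s = 2 * r" "0 \<le> r" "cball x r \<subseteq> T" using s by (auto simp: S_def)
    have "diameter (cball x r) \<le> diameter T" by (rule diameter_subset[OF r(3) bd])
    then show ?thesis using r by (simp add: diameter_cball)
  qed
  then have bdd: "bdd_above S" by (rule bdd_aboveI)
  have eS: "2 * e \<in> S" using e by (auto simp: S_def intro!: exI[of _ e])
  then have "2 * e \<le> Sup S" using bdd by (intro cSup_upper)
  then have pos: "Sup S > 0" using e(1) by simp
  have \<sigma>S: "diameter T \<le> \<sigma> * Sup S" using \<sigma> by (simp add: inball_diameter_def S_def)
  have "0 < diameter T" using up[OF eS] e(1) by simp
  then have "0 < \<sigma> * Sup S" using \<sigma>S by simp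
  then show \<sigma>pos: "\<sigma> > 0" using pos by (simp add: zero_less_mult_iff)
  have "Sup S / 2 < Sup S" using pos by simp
  then obtain s where s: "s \<in> S" "Sup S / 2 < s" using less_cSupD[of S "Sup S / 2"] eS by blast
  then obtain r x where r: "s = 2 * r" "cball x r \<subseteq> T" by (auto simp: S_def)
  have "\<sigma> * Sup S \<le> \<sigma> * (4 * r)" using s(2) r(1) \<sigma>pos by (intro mult_left_mono) auto
  then have "diameter T \<le> 4 * \<sigma> * r" using \<sigma>S by simp
  moreover have "r > 0" using s(2) r(1) pos by simp
  ultimately show "\<exists>z r. 0 < r \<and> cball z r \<subseteq> T \<and> diameter T \<le> 4 * \<sigma> * r" using r(2) by blast
qed

theorem lemma6p1:
  fixes \<Omega> :: "'a::euclidean_space set"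
    and Om :: "nat \<Rightarrow> 'a set"
    and n :: "'a \<Rightarrow> 'a"
    and k :: nat
    and \<alpha> :: "nat \<Rightarrow> real"
    and \<gamma> \<beta> \<sigma> c1 c2 :: real
  assumes "DIM('a) \<in> {2, 3}"
    and "k \<ge> 1"
    and "polygonal_domain \<Omega>"
    and "partitioned \<Omega> Om"
    and "smooth_iface \<Omega> Om n"
    and "\<alpha> 1 > 0" "\<alpha> 2 > 0" "\<gamma> > 0" "\<beta> > 0"
    and "c1 > 0" "c2 > 0"
  shows "\<exists>C1>0. \<exists>C2>0. \<forall>(\<T> :: 'a set set) (\<kappa> :: 'a set \<Rightarrow> real) (\<alpha>bar :: real) (\<F> :: nat \<Rightarrow> 'a set set).
    simplicial_mesh \<Omega> \<T> \<and>
    shape_regular \<sigma> \<T> \<and>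
    nodes \<Omega> k \<T> \<inter> iface Om = {} \<and>
    (\<forall>T. \<kappa> T \<in> {0..1}) \<and>
    \<alpha>bar \<in> {min (\<alpha> 1) (\<alpha> 2)..max (\<alpha> 1) (\<alpha> 2)} \<and>
    \<F> 1 \<subseteq> ghost_faces Om \<T> 1 \<and> \<F> 2 \<subseteq> ghost_faces Om \<T> 2 \<and>
    norm_equivalence c1 c2 \<Omega> Om n k \<T> \<alpha> \<gamma> \<beta> \<kappa> \<alpha>bar \<F>
    \<longrightarrow>
    (let I = cut_nodes \<Omega> Om k \<T>;
         A1 = cut_matrix \<Omega> Om n k \<T> \<alpha> \<gamma> \<beta> \<kappa> \<alpha>bar \<F>;
         D1 = diag_part A1
     in \<forall>x :: 'a \<Rightarrow> real.
          C1 * quad_form I A1 x \<le> quad_form I D1 x \<and> quad_form I D1 x \<le> C2 * quad_form I A1 x)"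
proof -
  define K where "K = 4 * \<sigma>"
  have d2: "DIM('a) \<ge> 2" using assms(1) by auto
  have dom: "open \<Omega>" "bounded \<Omega>" "interior (closure \<Omega>) = \<Omega>" "\<Omega> \<noteq> {}"
    using assms(3) unfolding polygonal_domain_def by blast+
  obtain Co where Co: "Co > 0" "\<forall>(z::'a) r S p. r > 0 \<longrightarrow> cball z r \<subseteq> S \<longrightarrow> S \<subseteq> cball z (K * r) \<longrightarrow> compact S \<longrightarrow>
    p \<in> polys k \<longrightarrow> (\<forall>x\<in>S. \<forall>y\<in>S. r ^ (DIM('a) - 2) * (p x - p y)\<^sup>2 \<le>
      Co * set_lebesgue_integral lborel S (\<lambda>x. (norm (grad p x))\<^sup>2))"
    using polys_oscillation[OF assms(2) d2, of K] by (elim exE conjE)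
  obtain Cg where Cg: "Cg > 0" "\<forall>(z::'a) r S p M. r > 0 \<longrightarrow> cball z r \<subseteq> S \<longrightarrow> S \<subseteq> cball z (K * r) \<longrightarrow>
    p \<in> polys k \<longrightarrow> (\<forall>x\<in>S. \<bar>p x\<bar> \<le> M) \<longrightarrow> (\<forall>x\<in>S. norm (grad p x) \<le> Cg * M / r)"
    using polys_gradient_bound[OF assms(2), of K, where 'a='a] by (elim exE conjE)
  obtain CH cH r0 :: real where CH: "CH > 0" "cH > 0" "r0 > 0"
    and CHu: "\<And>x a. a > 0 \<Longrightarrow> emeasure surface_measure (iface Om \<inter> cball x a) \<le> ennreal (CH * a ^ (DIM('a) - 1))"
    and cHl: "\<And>x r. x \<in> iface Om \<Longrightarrow> 0 < r \<Longrightarrow> r \<le> r0 \<Longrightarrow> ball x r \<subseteq> \<Omega> \<Longrightarrow>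
      ennreal (cH * r ^ (DIM('a) - 1)) \<le> emeasure surface_measure (iface Om \<inter> ball x r)"
    using iface_measure_bounds[OF d2 dom(1,2) assms(4,5)] by metis
  define D where "D = diameter (closure \<Omega>)"
  have bdO: "bounded (closure \<Omega>)" using dom(2) by (rule bounded_closure)
  have D: "D \<ge> 0" unfolding D_def by (rule diameter_ge_0[OF bdO])
  \<comment> \<open>No element has diameter above \<open>D\<close>, so the second entry makes \<rho>
    times any element diameter at most \<open>r0\<close>, on coarse meshes too; \<open>D + 1\<close>
    avoids division by zero.\<close>
  define \<rho> where "\<rho> = min (near_ratio DIM('a) K) (r0 / (D + 1))"
  \<comment> \<open>The maximum with one keeps the constants positive even if
    \<open>\<sigma>\<close> admits no mesh, since they must be given before any mesh is
    known.\<close>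
  define G where "G = max 1 (grow_const DIM('a) k K Cg CH)"
  define H where "H = max 1 (coercivity_const DIM('a) k K Co cH \<rho>)"
  define C where "C = c2 * G * H / c1"
  have C: "C > 0" using assms(10,11) by (auto simp: C_def G_def H_def intro!: mult_pos_pos divide_pos_pos)
  have main: "quad_form (cut_nodes \<Omega> Om k \<T>) (cut_matrix \<Omega> Om n k \<T> \<alpha> \<gamma> \<beta> \<kappa> \<alpha>bar \<F>) x \<le>
      C * quad_form (cut_nodes \<Omega> Om k \<T>) (diag_part (cut_matrix \<Omega> Om n k \<T> \<alpha> \<gamma> \<beta> \<kappa> \<alpha>bar \<F>)) x \<and>
      quad_form (cut_nodes \<Omega> Om k \<T>) (diag_part (cut_matrix \<Omega> Om n k \<T> \<alpha> \<gamma> \<beta> \<kappa> \<alpha>bar \<F>)) x \<le>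
      C * quad_form (cut_nodes \<Omega> Om k \<T>) (cut_matrix \<Omega> Om n k \<T> \<alpha> \<gamma> \<beta> \<kappa> \<alpha>bar \<F>) x"
    if h: "simplicial_mesh \<Omega> \<T>" "shape_regular \<sigma> \<T>" "nodes \<Omega> k \<T> \<inter> iface Om = {}"
      "\<F> 1 \<subseteq> ghost_faces Om \<T> 1" "\<F> 2 \<subseteq> ghost_faces Om \<T> 2"
      "norm_equivalence c1 c2 \<Omega> Om n k \<T> \<alpha> \<gamma> \<beta> \<kappa> \<alpha>bar \<F>"
    for \<T> :: "'a set set" and \<kappa> \<alpha>bar \<F> x
  proof -
    have elt: "int DIM('a) simplex T \<and> diameter T \<le> \<sigma> * inball_diameter T" if "T \<in> \<T>" for T
      using h(1,2) that unfolding simplicial_mesh_def shape_regular_def by blast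
    have cover: "\<Union>\<T> = closure \<Omega>" using h(1) by (simp add: simplicial_mesh_def)
    \<comment> \<open>The domain is not empty, so there is an element, and its shape regularity
      forces \<open>\<sigma>\<close> and hence \<open>K\<close> to be positive.\<close>
    then obtain T0 where "T0 \<in> \<T>" using dom(4) closure_subset[of \<Omega>] by auto
    then have K: "K > 0" using inball_shape_regular(2)[of T0 \<sigma>] elt by (simp add: K_def)
    have near: "near_ratio DIM('a) K > 0" using K by (simp add: near_ratio_def star_ratio_def add_nonneg_pos)
    have \<rho>: "\<rho> > 0" "\<rho> \<le> r0 / (D + 1)" using near CH(3) D by (auto simp: \<rho>_def)
    have "\<rho> * D \<le> r0"
    proof -
      have "\<rho> * (D + 1) \<le> r0" using \<rho>(2) D by (simp add: pos_le_divide_eq)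
      then show ?thesis using \<rho>(1) by (simp add: distrib_left)
    qed
    then have \<rho>T: "\<rho> * diameter T \<le> r0" if "T \<in> \<T>" for T
    proof -
      have "T \<subseteq> closure \<Omega>" using cover that by blast
      then have "diameter T \<le> D" unfolding D_def by (rule diameter_subset[OF _ bdO])
      then have "\<rho> * diameter T \<le> \<rho> * D" using \<rho>(1) by (intro mult_left_mono) auto
      then show ?thesis using \<open>\<rho> * D \<le> r0\<close> by linarith
    qed
    interpret cut_mesh_est \<Omega> \<T> K k Om n \<alpha> \<gamma> \<beta> \<kappa> \<alpha>bar \<F> "DIM('a)" Co Cg CH cH r0 \<rho>
    proof unfold_locales
      show "\<exists>z r. 0 < r \<and> cball z r \<subseteq> T \<and> diameter T \<le> K * r" if "T \<in> \<T>" for T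
        using inball_shape_regular(1)[of T \<sigma>] elt[OF that] unfolding K_def by blast
      show "r ^ (DIM('a) - 2) * (p x - p y)\<^sup>2 \<le> Co * set_lebesgue_integral lborel S (\<lambda>x::'a. (norm (grad p x))\<^sup>2)"
        if "r > 0" "cball z r \<subseteq> S" "S \<subseteq> cball z (K * r)" "compact S" "p \<in> polys k" "x \<in> S" "y \<in> S" for z r S p x y
        using Co(2) that by blast
      show "norm (grad p x) \<le> Cg * M / r"
        if "r > 0" "cball z r \<subseteq> S" "S \<subseteq> cball z (K * r)" "p \<in> polys k" "\<And>x. x \<in> S \<Longrightarrow> \<bar>p x\<bar> \<le> M" "x \<in> S"
        for z r S p M and x :: 'a
        using Cg(2) that by blast
      show "\<rho> \<le> near_ratio DIM('a) K" by (simp add: \<rho>_def)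
    qed (use d2 dom h assms(2,4,5) Co(1) Cg(1) CH CHu cHl \<rho>(1) \<rho>T in blast)+
    show ?thesis
      unfolding C_def
      using quad_form_bounds[OF assms(10,11) h(6), of G H x] by (simp add: G_def H_def)
  qed
  show ?thesis
  proof (intro exI conjI allI impI)
    \<comment> \<open>Both one-sided bounds hold with the constant \<open>C\<close>; the bound of
      the matrix by its diagonal is divided by it.\<close>
    show "1 / C > 0" "C > 0" using C by auto
    fix \<T> :: "'a set set" and \<kappa> :: "'a set \<Rightarrow> real" and \<alpha>bar :: real and \<F> :: "nat \<Rightarrow> 'a set set"
    assume h: "simplicial_mesh \<Omega> \<T> \<and> shape_regular \<sigma> \<T> \<and> nodes \<Omega> k \<T> \<inter> iface Om = {} \<and>
      (\<forall>T. \<kappa> T \<in> {0..1}) \<and> \<alpha>bar \<in> {min (\<alpha> 1) (\<alpha> 2)..max (\<alpha> 1) (\<alpha> 2)} \<and>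
      \<F> 1 \<subseteq> ghost_faces Om \<T> 1 \<and> \<F> 2 \<subseteq> ghost_faces Om \<T> 2 \<and>
      norm_equivalence c1 c2 \<Omega> Om n k \<T> \<alpha> \<gamma> \<beta> \<kappa> \<alpha>bar \<F>"
    have "1 / C * quad_form (cut_nodes \<Omega> Om k \<T>) (cut_matrix \<Omega> Om n k \<T> \<alpha> \<gamma> \<beta> \<kappa> \<alpha>bar \<F>) x \<le>
        quad_form (cut_nodes \<Omega> Om k \<T>) (diag_part (cut_matrix \<Omega> Om n k \<T> \<alpha> \<gamma> \<beta> \<kappa> \<alpha>bar \<F>)) x \<and>
      quad_form (cut_nodes \<Omega> Om k \<T>) (diag_part (cut_matrix \<Omega> Om n k \<T> \<alpha> \<gamma> \<beta> \<kappa> \<alpha>bar \<F>)) x \<le>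
      C * quad_form (cut_nodes \<Omega> Om k \<T>) (cut_matrix \<Omega> Om n k \<T> \<alpha> \<gamma> \<beta> \<kappa> \<alpha>bar \<F>) x" for x
      using main[of \<T> \<F> \<kappa> \<alpha>bar x] h C by (simp add: pos_divide_le_eq mult.commute)
    then show "let I = cut_nodes \<Omega> Om k \<T>;
         A1 = cut_matrix \<Omega> Om n k \<T> \<alpha> \<gamma> \<beta> \<kappa> \<alpha>bar \<F>;
         D1 = diag_part A1
     in \<forall>x :: 'a \<Rightarrow> real.
          1 / C * quad_form I A1 x \<le> quad_form I D1 x \<and> quad_form I D1 x \<le> C * quad_form I A1 x"
      unfolding Let_def by blast
  qed
qed

end
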